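(* Let $(G,\sigma,K)$ be a Riemannian symmetric triple and let $P=\exp(\mathfrak{p})$. For each coset $gK$, $g\in G$, we have $gK\cap P\neq\emptyset$.
   Context: A Riemannian symmetric triple $(G,\sigma,K)$ consists of a connected Lie group $G$, an involution $\sigma$ of $G$ (a Lie group automorphism with $\sigma^2=\mathrm{id}$), and the closed subgroup $K=\{g\in G\mid\sigma(g)=g\}$, such that there exists a $G$-invariant Riemannian structure on $G/K$. Let $\mathfrak{g}$ be the Lie algebra of $G$ and $d\sigma$ the differential of $\sigma$ on $\mathfrak{g}$; $\mathfrak{p}$ is the eigenspace of $d\sigma$ with eigenvalue $-1$. *)

theory Defs
  imports "HOL-Analysis.Analysis" "HOL-Algebra.Left_Coset"
begin

section \<open>Smooth functions on open subsets of a linear subspace\<close>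

text \<open>
  Manifolds are modelled on a linear subspace \<open>V\<close> of a Euclidean space, so that the dimension
  \<open>dim V\<close> is a number rather than a type; in particular it may be \<open>0\<close>, and manifolds of different
  dimensions share one type. A function is \<open>C\<^sup>k\<close> on a relatively open subset \<open>S\<close> of \<open>V\<close> if it has
  iterated Frechet derivatives along \<open>V\<close> that are continuous up to order \<open>k\<close>. The values of \<open>f' x\<close>
  on \<open>V\<close> are determined by \<open>f\<close>; its values outside \<open>V\<close> are irrelevant.
\<close>

fun Ck_on :: "nat \<Rightarrow> 'e::euclidean_space set \<Rightarrow> 'e set \<Rightarrow> ('e \<Rightarrow> 'f::real_normed_vector) \<Rightarrow> bool"
where
  "Ck_on 0 V S f \<longleftrightarrow> continuous_on S f"
| "Ck_on (Suc k) V S f \<longleftrightarrow>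
     (\<exists>f'. (\<forall>x\<in>S. (f has_derivative f' x) (at x within S)) \<and>
           (\<forall>v\<in>V. Ck_on k V S (\<lambda>x. f' x v)))"

definition smooth_on ::
  "'e::euclidean_space set \<Rightarrow> 'e set \<Rightarrow> ('e \<Rightarrow> 'f::real_normed_vector) \<Rightarrow> bool"
where "smooth_on V S f \<longleftrightarrow> (\<forall>k. Ck_on k V S f)"


section \<open>Smooth manifolds and smooth maps\<close>

type_synonym ('a, 'e) chart = "'a set \<times> ('a \<Rightarrow> 'e)"

record ('a, 'e) manifold =
  mtop :: "'a topology"
  model :: "'e set"
  atlas :: "('a, 'e) chart set"

abbreviation points :: "('a, 'e) manifold \<Rightarrow> 'a set"
where "points M \<equiv> topspace (mtop M)"

definition is_chart :: "('a, 'e::euclidean_space) manifold \<Rightarrow> ('a, 'e) chart \<Rightarrow> bool"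
where
  "is_chart M c \<longleftrightarrow>
     (case c of (U, \<phi>) \<Rightarrow>
        openin (mtop M) U \<and>
        openin (top_of_set (model M)) (\<phi> ` U) \<and>
        homeomorphic_map (subtopology (mtop M) U) (top_of_set (\<phi> ` U)) \<phi>)"

locale smooth_manifold =
  fixes M :: "('a, 'e::euclidean_space) manifold"
  assumes Hausdorff: "Hausdorff_space (mtop M)"
    and second_countable: "second_countable (mtop M)"
    and subspace_model: "subspace (model M)"
    and charts: "\<And>c. c \<in> atlas M \<Longrightarrow> is_chart M c"
    and atlas_covers: "(\<Union>(U, \<phi>)\<in>atlas M. U) = points M"
    and transition_smooth:
      "\<And>U \<phi> W \<psi>. (U, \<phi>) \<in> atlas M \<Longrightarrow> (W, \<psi>) \<in> atlas M \<Longrightarrow>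
         smooth_on (model M) (\<phi> ` (U \<inter> W)) (\<lambda>y. \<psi> (inv_into U \<phi> y))"

definition smooth_map ::
  "('a, 'e::euclidean_space) manifold \<Rightarrow> ('b, 'f::euclidean_space) manifold \<Rightarrow> ('a \<Rightarrow> 'b) \<Rightarrow> bool"
where
  "smooth_map M N F \<longleftrightarrow>
     continuous_map (mtop M) (mtop N) F \<and>
     (\<forall>(U, \<phi>)\<in>atlas M. \<forall>(W, \<psi>)\<in>atlas N.
        smooth_on (model M) (\<phi> ` (U \<inter> F -` W)) (\<lambda>y. \<psi> (F (inv_into U \<phi> y))))"

definition prod_manifold ::
  "('a, 'e::euclidean_space) manifold \<Rightarrow> ('b, 'f::euclidean_space) manifold \<Rightarrow>
   ('a \<times> 'b, 'e \<times> 'f) manifold"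
where
  "prod_manifold M N =
     \<lparr>mtop = prod_topology (mtop M) (mtop N),
      model = model M \<times> model N,
      atlas = {(U \<times> W, map_prod \<phi> \<psi>) | U \<phi> W \<psi>. (U, \<phi>) \<in> atlas M \<and> (W, \<psi>) \<in> atlas N}\<rparr>"

definition real_line :: "(real, real) manifold"
where "real_line = \<lparr>mtop = euclideanreal, model = UNIV, atlas = {(UNIV, \<lambda>x. x)}\<rparr>"


section \<open>Tangent vectors and differentials\<close>

definition smooth_near :: "('a, 'e::euclidean_space) manifold \<Rightarrow> 'a \<Rightarrow> ('a \<Rightarrow> real) \<Rightarrow> bool"
where
  "smooth_near M p f \<longleftrightarrow>
     (\<exists>A. openin (mtop M) A \<and> p \<in> A \<and>
        (\<forall>(U, \<phi>)\<in>atlas M. smooth_on (model M) (\<phi> ` (U \<inter> A)) (\<lambda>y. f (inv_into U \<phi> y))))"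

text \<open>
  A tangent vector at \<open>p\<close> is a derivation at \<open>p\<close> of the functions that are smooth near \<open>p\<close>,
  extended by \<open>0\<close> to all other functions. It depends only on the germ of its argument: if \<open>u\<close>
  vanishes on an open neighbourhood \<open>A\<close> of \<open>p\<close>, then \<open>u\<close> is the product of \<open>u\<close> with the indicator
  function of the complement of \<open>A\<close>, which is smooth near \<open>p\<close>, and both factors vanish at \<open>p\<close>.
\<close>

type_synonym 'a tvector = "('a \<Rightarrow> real) \<Rightarrow> real"

definition tangent_space :: "('a, 'e::euclidean_space) manifold \<Rightarrow> 'a \<Rightarrow> 'a tvector set"
where
  "tangent_space M p =
     {X. (\<forall>f g. smooth_near M p f \<longrightarrow> smooth_near M p g \<longrightarrow>
            X (\<lambda>x. f x + g x) = X f + X g \<and>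
            X (\<lambda>x. f x * g x) = f p * X g + X f * g p) \<and>
         (\<forall>a f. smooth_near M p f \<longrightarrow> X (\<lambda>x. a * f x) = a * X f) \<and>
         (\<forall>f. \<not> smooth_near M p f \<longrightarrow> X f = 0)}"

definition differential ::
  "('b, 'f::euclidean_space) manifold \<Rightarrow> ('a \<Rightarrow> 'b) \<Rightarrow> 'a \<Rightarrow> 'a tvector \<Rightarrow> 'b tvector"
where
  "differential N F p X = (\<lambda>f. if smooth_near N (F p) f then X (\<lambda>x. f (F x)) else 0)"

definition velocity ::
  "('a, 'e::euclidean_space) manifold \<Rightarrow> (real \<Rightarrow> 'a) \<Rightarrow> real \<Rightarrow> 'a tvector"
where
  "velocity M \<gamma> t = (\<lambda>f. if smooth_near M (\<gamma> t) f then deriv (\<lambda>s. f (\<gamma> s)) t else 0)"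

text \<open>The coordinate vector at \<open>p\<close> with constant components \<open>v\<close> in a chart \<open>(U, \<phi>)\<close> around \<open>p\<close>.\<close>

definition coord_vector ::
  "('a, 'e::euclidean_space) manifold \<Rightarrow> ('a, 'e) chart \<Rightarrow> 'e \<Rightarrow> 'a \<Rightarrow> 'a tvector"
where
  "coord_vector M c v p =
     (case c of (U, \<phi>) \<Rightarrow>
        (\<lambda>f. if smooth_near M p f
             then deriv (\<lambda>t. f (inv_into U \<phi> (\<phi> p + t *\<^sub>R v))) 0 else 0))"

definition submersion ::
  "('a, 'e::euclidean_space) manifold \<Rightarrow> ('b, 'f::euclidean_space) manifold \<Rightarrow> ('a \<Rightarrow> 'b) \<Rightarrow> bool"
where
  "submersion M N F \<longleftrightarrow>
     smooth_map M N F \<and>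
     (\<forall>p\<in>points M. differential N F p ` tangent_space M p = tangent_space N (F p))"


section \<open>Riemannian structures\<close>

locale riemannian_structure = smooth_manifold N
  for N :: "('a, 'e::euclidean_space) manifold" +
  fixes h :: "'a \<Rightarrow> 'a tvector \<Rightarrow> 'a tvector \<Rightarrow> real"
  assumes sym:
      "\<And>p X Y. p \<in> points N \<Longrightarrow> X \<in> tangent_space N p \<Longrightarrow> Y \<in> tangent_space N p \<Longrightarrow>
         h p X Y = h p Y X"
    and linear:
      "\<And>p X Y Z a b. p \<in> points N \<Longrightarrow> X \<in> tangent_space N p \<Longrightarrow> Y \<in> tangent_space N p \<Longrightarrow>
         Z \<in> tangent_space N p \<Longrightarrow>
         h p (\<lambda>f. a * X f + b * Y f) Z = a * h p X Z + b * h p Y Z"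
    and pos_def:
      "\<And>p X. p \<in> points N \<Longrightarrow> X \<in> tangent_space N p \<Longrightarrow> X \<noteq> (\<lambda>f. 0) \<Longrightarrow> h p X X > 0"
    and smooth:
      "\<And>U \<phi> v w. (U, \<phi>) \<in> atlas N \<Longrightarrow> v \<in> model N \<Longrightarrow> w \<in> model N \<Longrightarrow>
         smooth_on (model N) (\<phi> ` U)
           (\<lambda>y. h (inv_into U \<phi> y) (coord_vector N (U, \<phi>) v (inv_into U \<phi> y))
                                    (coord_vector N (U, \<phi>) w (inv_into U \<phi> y)))"


section \<open>Lie groups and the exponential map\<close>

locale lie_group = group G + smooth_manifold M
  for G :: "('g, 'r) monoid_scheme" (structure)
    and M :: "('g, 'e::euclidean_space) manifold" +
  assumes points_eq: "points M = carrier G"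
    and mult_smooth: "smooth_map (prod_manifold M M) M (\<lambda>(x, y). x \<otimes> y)"
    and inv_smooth: "smooth_map M M (\<lambda>x. inv x)"

text \<open>The Lie algebra of \<open>G\<close>, as the tangent space at the identity (its bracket is not needed).\<close>

definition lie_algebra ::
  "('g, 'r) monoid_scheme \<Rightarrow> ('g, 'e::euclidean_space) manifold \<Rightarrow> 'g tvector set"
where "lie_algebra G M = tangent_space M \<one>\<^bsub>G\<^esub>"

definition one_parameter_subgroup ::
  "('g, 'r) monoid_scheme \<Rightarrow> ('g, 'e::euclidean_space) manifold \<Rightarrow> (real \<Rightarrow> 'g) \<Rightarrow> bool"
where
  "one_parameter_subgroup G M \<gamma> \<longleftrightarrow>
     smooth_map real_line M \<gamma> \<and> (\<forall>s t. \<gamma> (s + t) = \<gamma> s \<otimes>\<^bsub>G\<^esub> \<gamma> t)"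

definition lie_exp ::
  "('g, 'r) monoid_scheme \<Rightarrow> ('g, 'e::euclidean_space) manifold \<Rightarrow> 'g tvector \<Rightarrow> 'g"
where
  "lie_exp G M X = (THE \<gamma>. one_parameter_subgroup G M \<gamma> \<and> velocity M \<gamma> 0 = X) 1"


section \<open>Riemannian symmetric triples\<close>

text \<open>
  The smooth structure of \<open>G/K\<close> is the one for which the projection \<open>G \<rightarrow> G/K\<close> is a
  submersion. There is at most one, and its topology is the quotient topology, because the
  projection is surjective; for closed \<open>K\<close> it exists.
\<close>

definition homogeneous_space_structure ::
  "('g, 'r) monoid_scheme \<Rightarrow> ('g, 'e::euclidean_space) manifold \<Rightarrow> 'g set \<Rightarrow>
   ('g set, 'e) manifold \<Rightarrow> bool"
where
  "homogeneous_space_structure G M K N \<longleftrightarrow>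
     smooth_manifold N \<and>
     points N = lcosets\<^bsub>G\<^esub> K \<and>
     submersion M N (\<lambda>x. x <#\<^bsub>G\<^esub> K)"

definition invariant_structure ::
  "('g, 'r) monoid_scheme \<Rightarrow> ('g set, 'e::euclidean_space) manifold \<Rightarrow>
   ('g set \<Rightarrow> 'g set tvector \<Rightarrow> 'g set tvector \<Rightarrow> real) \<Rightarrow> bool"
where
  "invariant_structure G N h \<longleftrightarrow>
     (\<forall>a\<in>carrier G. \<forall>p\<in>points N. \<forall>X\<in>tangent_space N p. \<forall>Y\<in>tangent_space N p.
        h (a <#\<^bsub>G\<^esub> p) (differential N (\<lambda>q. a <#\<^bsub>G\<^esub> q) p X)
                        (differential N (\<lambda>q. a <#\<^bsub>G\<^esub> q) p Y) = h p X Y)"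

text \<open>
  Since \<open>dim (G/K) \<le> dim G\<close>, it is no restriction that \<open>G/K\<close> is modelled on a subspace of the
  same Euclidean space as \<open>G\<close>. The subgroup \<open>K\<close> is closed, being the fixed point set of the
  continuous map \<open>\<sigma>\<close> on a Hausdorff space.
\<close>

locale riemannian_symmetric_triple = lie_group G M
  for G :: "('g, 'r) monoid_scheme" (structure)
    and M :: "('g, 'e::euclidean_space) manifold" +
  fixes \<sigma> :: "'g \<Rightarrow> 'g" and K :: "'g set"
  assumes connected: "connected_space (mtop M)"
    and automorphism: "\<sigma> \<in> iso G G"
    and smooth_automorphism: "smooth_map M M \<sigma>"
    and involution: "\<And>x. x \<in> carrier G \<Longrightarrow> \<sigma> (\<sigma> x) = x"
    and K_eq: "K = {x \<in> carrier G. \<sigma> x = x}"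
    and invariant_riemannian:
      "\<exists>N h. homogeneous_space_structure G M K N \<and> riemannian_structure N h \<and>
             invariant_structure G N h"

definition minus_eigenspace ::
  "('g, 'r) monoid_scheme \<Rightarrow> ('g, 'e::euclidean_space) manifold \<Rightarrow> ('g \<Rightarrow> 'g) \<Rightarrow> 'g tvector set"
where
  "minus_eigenspace G M \<sigma> =
     {X \<in> lie_algebra G M. differential M \<sigma> \<one>\<^bsub>G\<^esub> X = (\<lambda>f. - X f)}"

end

theory Submission
  imports Defs
begin

text \<open>
  The exponential map is obtained without ODE theory, as the linearization of the squaring map
  \<open>q\<close> at the identity, that is, as the limit of the \<open>n\<close>-th iterate of \<open>q\<close> at
  \<open>x / 2^n\<close>. An element \<open>a\<close> near the identity is \<open>Exp Z k\<close> with \<open>k\<close> in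
  \<open>K\<close> and \<open>Z\<close> in \<open>\<pp>\<close> determined by \<open>Exp (2 Z) = a \<sigma>(a)\<^sup>-\<^sup>1\<close>, so by
  connectedness every \<open>g\<close> lies in some \<open>Exp X\<^sub>1 \<dots> Exp X\<^sub>n K\<close>. Instead of
  Hopf--Rinow, a discrete geodesic argument reduces \<open>n\<close> to 1: fix a large \<open>n\<close> and minimise
  the energy, the sum of the \<open>|X\<^sub>i|\<^sup>2\<close>, over the \<open>n\<close>-tuples in \<open>\<pp>\<close> reaching
  \<open>g K\<close>, where \<open>|.|\<close> is the \<open>Ad K\<close>-invariant norm on \<open>\<pp>\<close> given by the
  Riemannian structure. All \<open>X\<^sub>i\<close> are then small. For consecutive \<open>X \<noteq> Y\<close>, with
  \<open>Exp X Exp Y = Exp Z k\<close>, one has \<open>|Z|\<^sup>2 < 2 (|X|\<^sup>2 + |Y|\<^sup>2)\<close>, and replacing both by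
  \<open>Z/2\<close> (and moving \<open>k\<close> to the right) would lower the energy. So all \<open>X\<^sub>i\<close> agree and
  \<open>g\<close> lies in \<open>Exp (n X\<^sub>1) K\<close>.
\<close>

section \<open>Calculus on open subsets of a subspace\<close>

text \<open>Two competing rates govern \<open>Exp\<close>. Near the identity, squaring expands chart
  distances by a factor below 3, while an error made at \<open>x / 2^n\<close> is of order
  \<open>4^-n\<close>. Carried back to scale 1 it has weight \<open>(3/4)^n\<close>, which gives
  convergence of the iterates and, in \<open>Exp_unique\<close>, a uniqueness statement that yields
  the power law, the behaviour under homomorphisms and the classification of one-parameter
  subgroups.

  The obstacle is the inequality for a corner. First-order information gives only
  \<open>Z = X + Y\<close> up to an error quadratic in the size \<open>r\<close> of \<open>X\<close>
  and \<open>Y\<close>, but the margin to be beaten is \<open>|X - Y|^2\<close>, which can be far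
  smaller. Symmetry of \<open>|Z|\<close> under exchange of \<open>X\<close> and \<open>Y\<close>,
  combined with a bound on second differences, replaces that error by one of size
  \<open>r |X - Y|^2\<close>. For this reason second differences are followed through composition,
  inversion and the limit.

  Keeping the number of factors fixed makes the minimisation a finite-dimensional problem;
  subdivision beforehand makes the energy as small as desired, so that the minimiser lies where the
  local estimate holds.\<close>

lemma subspace_orthonormal_expansion:
  fixes V :: "'e::euclidean_space set"
  assumes "subspace V"
  obtains B where "finite B" "B \<subseteq> V" "\<And>x. x \<in> V \<Longrightarrow> (\<Sum>b\<in>B. (x \<bullet> b) *\<^sub>R b) = x"
    "\<And>b. b \<in> B \<Longrightarrow> norm b = 1"
proof -
  obtain B where B: "B \<subseteq> V" "pairwise orthogonal B" "\<And>x. x \<in> B \<Longrightarrow> norm x = 1"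
      "independent B" "card B = dim V" "span B = V"
    using orthonormal_basis_subspace[OF assms] by blast
  have fin: "finite B" using B(4) independent_imp_finite by blast
  have "(\<Sum>b\<in>B. (x \<bullet> b) *\<^sub>R b) = x" if "x \<in> V" for x
  proof -
    have "x \<in> span B" using that B(6) by simp
    then obtain u where u: "x = (\<Sum>b\<in>B. u b *\<^sub>R b)"
      using span_finite[OF fin] by auto
    have "x \<bullet> c = u c" if "c \<in> B" for c
    proof -
      have "x \<bullet> c = (\<Sum>b\<in>B. u b * (b \<bullet> c))"
        unfolding u by (simp add: inner_sum_left)
      also have "\<dots> = (\<Sum>b\<in>B. if b = c then u b else 0)"
      proof (rule sum.cong[OF refl])
        fix b assume "b \<in> B"
        show "u b * (b \<bullet> c) = (if b = c then u b else 0)"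
        proof (cases "b = c")
          case True
          then show ?thesis using B(3)[OF that] by (simp add: norm_eq_1)
        next
          case False
          then have "b \<bullet> c = 0" using B(2) \<open>b \<in> B\<close> that by (auto simp: pairwise_def orthogonal_def)
          then show ?thesis using False by simp
        qed
      qed
      also have "\<dots> = u c" using fin that by simp
      finally show ?thesis .
    qed
    then show ?thesis using u by simp
  qed
  then show ?thesis using that[OF fin B(1) _ B(3)] by blast
qed

text \<open>Defined along a line so that the derivative depends on \<open>f\<close> alone. A witness
  \<open>f'\<close> in \<open>Ck_on\<close> depends on the set and is arbitrary off
  \<open>V\<close>, so local witnesses could not simply be glued.\<close>

definition dirD :: "('e::real_normed_vector \<Rightarrow> 'f::real_normed_vector) \<Rightarrow> 'e \<Rightarrow> 'e \<Rightarrow> 'f"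
  where "dirD f v x = vector_derivative (\<lambda>t. f (x + t *\<^sub>R v)) (at 0)"

lemma openin_subspace_line:
  fixes V :: "'e::euclidean_space set"
  assumes "subspace V" "openin (top_of_set V) S" "x \<in> S" "v \<in> V"
  obtains T where "open T" "(0::real) \<in> T" "\<And>t. t \<in> T \<Longrightarrow> x + t *\<^sub>R v \<in> S"
proof -
  obtain Op where Op: "open Op" "S = V \<inter> Op"
    using assms(2) by (auto simp: openin_open)
  have "open ((\<lambda>t. x + t *\<^sub>R v) -` Op)"
    by (intro open_vimage Op continuous_intros)
  moreover have "x + t *\<^sub>R v \<in> V" for t
    using assms Op by (auto intro!: subspace_add subspace_scale)
  ultimately show ?thesis using that[of "(\<lambda>t. x + t *\<^sub>R v) -` Op"] Op assms(3) by auto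
qed

lemma has_derivative_line:
  fixes V :: "'e::euclidean_space set"
  assumes V: "subspace V" "openin (top_of_set V) S" and "x \<in> S" "v \<in> V"
    and f: "(f has_derivative f') (at x within S)"
  shows "((\<lambda>t. f (x + t *\<^sub>R v)) has_vector_derivative f' v) (at 0)"
proof -
  obtain T where T: "open T" "(0::real) \<in> T" "\<And>t. t \<in> T \<Longrightarrow> x + t *\<^sub>R v \<in> S"
    using openin_subspace_line[OF V assms(3,4)] by blast
  have "((\<lambda>t. x + t *\<^sub>R v) has_derivative (\<lambda>t. t *\<^sub>R v)) (at 0 within T)"
    by (rule derivative_eq_intros refl | simp)+
  moreover have "(f has_derivative f') (at (x + 0 *\<^sub>R v) within ((\<lambda>t. x + t *\<^sub>R v) ` T))"
  proof -
    have "(\<lambda>t. x + t *\<^sub>R v) ` T \<subseteq> S" using T(3) by blast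
    from has_derivative_subset[OF f this] show ?thesis by simp
  qed
  ultimately have "((\<lambda>t. f (x + t *\<^sub>R v)) has_derivative (\<lambda>t. f' (t *\<^sub>R v))) (at 0 within T)"
    by (rule has_derivative_in_compose)
  then show ?thesis
    unfolding has_vector_derivative_def at_within_open[OF T(2,1)]
      linear_cmul[OF has_derivative_linear[OF f]] .
qed

lemma dirD_eq:
  fixes V :: "'e::euclidean_space set"
  assumes V: "subspace V" "openin (top_of_set V) S" and "x \<in> S" "v \<in> V"
    and f: "(f has_derivative f') (at x within S)"
  shows "dirD f v x = f' v"
  using has_derivative_line[OF assms] by (simp add: dirD_def vector_derivative_at)

text \<open>Increments within \<open>S\<close> lie in \<open>V\<close>, so only the values of
  \<open>f'\<close> on \<open>V\<close> enter the limit. The expansion in an orthonormal basis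
  builds a derivative from the finitely many vectors \<open>f' b\<close>, and these are the ones
  about which \<open>Ck_on\<close> gives information.\<close>

lemma has_derivative_expansion:
  fixes V :: "'e::euclidean_space set"
  assumes B: "finite B" "\<And>x. x \<in> V \<Longrightarrow> (\<Sum>b\<in>B. (x \<bullet> b) *\<^sub>R b) = x"
    and V: "subspace V" "S \<subseteq> V" "x \<in> S" and f: "(f has_derivative f') (at x within S)"
  shows "(f has_derivative (\<lambda>v. \<Sum>b\<in>B. (v \<bullet> b) *\<^sub>R f' b)) (at x within S)"
proof -
  have lin: "linear f'" using has_derivative_linear[OF f] .
  have eq: "(\<Sum>b\<in>B. (v \<bullet> b) *\<^sub>R f' b) = f' v" if "v \<in> V" for v
  proof -
    have "f' v = f' (\<Sum>b\<in>B. (v \<bullet> b) *\<^sub>R b)" using B(2)[OF that] by simp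
    also have "\<dots> = (\<Sum>b\<in>B. (v \<bullet> b) *\<^sub>R f' b)"
      by (simp add: linear_sum[OF lin] linear_cmul[OF lin])
    finally show ?thesis by simp
  qed
  have bl: "bounded_linear (\<lambda>v. \<Sum>b\<in>B. (v \<bullet> b) *\<^sub>R f' b)"
    by (intro bounded_linear_sum bounded_linear_compose[OF bounded_linear_scaleR_left]
        bounded_linear_inner_left)
  have lim: "((\<lambda>y. (f y - f x - f' (y - x)) /\<^sub>R norm (y - x)) \<longlongrightarrow> 0) (at x within S)"
    using f by (simp add: has_derivative_at_within)
  have "eventually (\<lambda>y. (f y - f x - f' (y - x)) /\<^sub>R norm (y - x) =
      (f y - f x - (\<Sum>b\<in>B. ((y - x) \<bullet> b) *\<^sub>R f' b)) /\<^sub>R norm (y - x)) (at x within S)"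
    using V by (auto simp: eventually_at_filter subspace_diff subset_iff eq intro!: always_eventually)
  from Lim_transform_eventually[OF lim this] bl show ?thesis
    by (simp add: has_derivative_at_within)
qed

section \<open>Finite differentiability along a subspace: closure properties, chain rule,
  locality\<close>

lemma Ck_on_cong:
  assumes "\<And>x. x \<in> S \<Longrightarrow> f x = g x"
  shows "Ck_on k V S f \<longleftrightarrow> Ck_on k V S g"
proof (cases k)
  case 0
  then show ?thesis using assms by (simp cong: continuous_on_cong)
next
  case (Suc n)
  have "(f has_derivative D) (at x within S) \<longleftrightarrow> (g has_derivative D) (at x within S)"
    if "x \<in> S" for x D
    using assms that
    by (auto intro: has_derivative_transform[of x S g f D] has_derivative_transform[of x S f g D])
  then show ?thesis unfolding Suc Ck_on.simps(2) by (simp cong: ball_cong)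
qed

declare Ck_on.simps(2) [simp del]

lemma Ck_on_SucE:
  assumes "Ck_on (Suc k) V S f"
  obtains f' where "\<forall>x\<in>S. (f has_derivative f' x) (at x within S)" "\<forall>v\<in>V. Ck_on k V S (\<lambda>x. f' x v)"
  using assms unfolding Ck_on.simps(2) by blast

lemma Ck_on_subset:
  assumes "Ck_on k V S f" "T \<subseteq> S"
  shows "Ck_on k V T f"
  using assms
proof (induction k arbitrary: f)
  case 0
  then show ?case by (auto intro: continuous_on_subset)
next
  case (Suc k)
  from Suc.prems(1) obtain f' where f': "\<forall>x\<in>S. (f has_derivative f' x) (at x within S)"
    "\<forall>v\<in>V. Ck_on k V S (\<lambda>x. f' x v)" by (rule Ck_on_SucE)
  show ?case unfolding Ck_on.simps(2)
    using f' Suc.IH Suc.prems(2) has_derivative_subset[OF bspec[OF f'(1)], of _ T]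
    by (intro exI[of _ f']) blast
qed

lemma Ck_on_Suc_continuous: "Ck_on (Suc k) V S f \<Longrightarrow> continuous_on S f"
  by (erule Ck_on_SucE) (blast intro: has_derivative_continuous_on)

lemma Ck_on_SucD: "Ck_on (Suc k) V S f \<Longrightarrow> Ck_on k V S f"
proof (induction k arbitrary: f)
  case 0
  then show ?case unfolding Ck_on.simps(1) by (rule Ck_on_Suc_continuous)
next
  case (Suc k)
  from Suc.prems obtain f' where "\<forall>x\<in>S. (f has_derivative f' x) (at x within S)"
    "\<forall>v\<in>V. Ck_on (Suc k) V S (\<lambda>x. f' x v)" by (rule Ck_on_SucE)
  with Suc.IH show ?case unfolding Ck_on.simps(2) by blast
qed

lemma Ck_on_continuous: "Ck_on k V S f \<Longrightarrow> continuous_on S f"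
  by (cases k) (auto intro: Ck_on_Suc_continuous)

text \<open>On an open set the existential witness is replaced by the canonical \<open>dirD\<close>.
  In this form regularity can be checked locally, which is how \<open>Ck_on_local\<close>
  proceeds.\<close>

lemma Ck_on_Suc_iff:
  assumes V: "subspace V" "openin (top_of_set V) S"
  shows "Ck_on (Suc k) V S f \<longleftrightarrow>
    (\<forall>x\<in>S. \<exists>D. (f has_derivative D) (at x within S)) \<and> (\<forall>v\<in>V. Ck_on k V S (dirD f v))"
proof
  assume "Ck_on (Suc k) V S f"
  then obtain f' where f': "\<forall>x\<in>S. (f has_derivative f' x) (at x within S)"
    "\<forall>v\<in>V. Ck_on k V S (\<lambda>x. f' x v)" by (elim Ck_on_SucE)
  have "Ck_on k V S (dirD f v)" if "v \<in> V" for v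
  proof -
    have "dirD f v x = f' x v" if "x \<in> S" for x
      using dirD_eq[OF V that \<open>v \<in> V\<close> bspec[OF f'(1) that]] .
    then show ?thesis using f'(2) that Ck_on_cong[of S "dirD f v" "\<lambda>x. f' x v" k V] by simp
  qed
  then show "(\<forall>x\<in>S. \<exists>D. (f has_derivative D) (at x within S)) \<and> (\<forall>v\<in>V. Ck_on k V S (dirD f v))"
    using f' by blast
next
  assume *: "(\<forall>x\<in>S. \<exists>D. (f has_derivative D) (at x within S)) \<and> (\<forall>v\<in>V. Ck_on k V S (dirD f v))"
  then obtain f' where f': "\<forall>x\<in>S. (f has_derivative f' x) (at x within S)" by metis
  have "Ck_on k V S (\<lambda>x. f' x v)" if "v \<in> V" for v
  proof -
    have "dirD f v x = f' x v" if "x \<in> S" for x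
      using dirD_eq[OF V that \<open>v \<in> V\<close> bspec[OF f' that]] .
    then show ?thesis using * that Ck_on_cong[of S "dirD f v" "\<lambda>x. f' x v" k V] by simp
  qed
  with f' show "Ck_on (Suc k) V S f" unfolding Ck_on.simps(2) by blast
qed

lemma Ck_on_const: "Ck_on k V S (\<lambda>x. c)"
proof (induction k arbitrary: c)
  case (Suc k)
  then show ?case unfolding Ck_on.simps(2)
    by (intro exI[of _ "\<lambda>x v. 0"] conjI ballI has_derivative_const) auto
qed simp

lemma Ck_on_bounded_linear_compose:
  assumes "bounded_linear L" "Ck_on k V S f"
  shows "Ck_on k V S (\<lambda>x. L (f x))"
  using assms(2)
proof (induction k arbitrary: f)
  case 0
  then show ?case
    using assms(1) by (auto intro: bounded_linear.continuous_on)
next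
  case (Suc k)
  then obtain f' where f': "\<forall>x\<in>S. (f has_derivative f' x) (at x within S)"
    "\<forall>v\<in>V. Ck_on k V S (\<lambda>x. f' x v)" by (elim Ck_on_SucE)
  then show ?case unfolding Ck_on.simps(2)
    by (intro exI[of _ "\<lambda>x v. L (f' x v)"] conjI ballI bounded_linear.has_derivative[OF assms(1)] Suc.IH) auto
qed

lemma Ck_on_id: "Ck_on k V S (\<lambda>x. x)"
proof (cases k)
  case (Suc n)
  show ?thesis unfolding Suc Ck_on.simps(2)
    by (intro exI[of _ "\<lambda>x v. v"] conjI ballI Ck_on_const has_derivative_ident)
qed (simp add: continuous_on_id)

lemma Ck_on_bounded_linear: "bounded_linear L \<Longrightarrow> Ck_on k V S L"
  using Ck_on_bounded_linear_compose[OF _ Ck_on_id] .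

lemma Ck_on_add:
  assumes "Ck_on k V S f" "Ck_on k V S g"
  shows "Ck_on k V S (\<lambda>x. f x + g x)"
  using assms
proof (induction k arbitrary: f g)
  case 0
  then show ?case by (auto intro: continuous_intros)
next
  case (Suc k)
  then obtain f' g' where "\<forall>x\<in>S. (f has_derivative f' x) (at x within S)"
    "\<forall>v\<in>V. Ck_on k V S (\<lambda>x. f' x v)" "\<forall>x\<in>S. (g has_derivative g' x) (at x within S)"
    "\<forall>v\<in>V. Ck_on k V S (\<lambda>x. g' x v)" unfolding Ck_on.simps(2) by blast
  then show ?case unfolding Ck_on.simps(2)
    by (intro exI[of _ "\<lambda>x v. f' x v + g' x v"] conjI ballI has_derivative_add Suc.IH) auto
qed

lemma Ck_on_sum:
  assumes "\<And>i. i \<in> I \<Longrightarrow> Ck_on k V S (f i)"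
  shows "Ck_on k V S (\<lambda>x. \<Sum>i\<in>I. f i x)"
  using assms by (induction I rule: infinite_finite_induct) (auto intro: Ck_on_const Ck_on_add)

lemma Ck_on_bilinear:
  assumes "bounded_bilinear h" "Ck_on k V S f" "Ck_on k V S g"
  shows "Ck_on k V S (\<lambda>x. h (f x) (g x))"
  using assms(2,3)
proof (induction k arbitrary: f g)
  case 0
  then show ?case using bounded_bilinear.continuous_on[OF assms(1)] by auto
next
  case (Suc k)
  then obtain f' g' where *: "\<forall>x\<in>S. (f has_derivative f' x) (at x within S)"
    "\<forall>v\<in>V. Ck_on k V S (\<lambda>x. f' x v)" "\<forall>x\<in>S. (g has_derivative g' x) (at x within S)"
    "\<forall>v\<in>V. Ck_on k V S (\<lambda>x. g' x v)" unfolding Ck_on.simps(2) by blast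
  have "Ck_on k V S f" "Ck_on k V S g" using Suc.prems Ck_on_SucD by auto
  with * show ?case unfolding Ck_on.simps(2)
    by (intro exI[of _ "\<lambda>x v. h (f x) (g' x v) + h (f' x v) (g x)"])
      (intro conjI ballI bounded_bilinear.FDERIV[OF assms(1)] Ck_on_add Suc.IH; simp)
qed

text \<open>The derivative of the composite applies \<open>g' (f x)\<close> to the varying vector
  \<open>f' x v\<close>, so the induction hypothesis does not apply to it directly. Expanding that
  vector in a basis of \<open>W\<close> turns it into a finite sum of products of scalars with
  \<open>g' (f x) b\<close> for fixed \<open>b\<close>.\<close>

lemma Ck_on_compose:
  fixes W :: "'f::euclidean_space set"
  assumes "subspace W" "T \<subseteq> W" "f ` S \<subseteq> T" "Ck_on k V S f" "Ck_on k W T g"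
  shows "Ck_on k V S (\<lambda>x. g (f x))"
  using assms(4,5)
proof (induction k arbitrary: g)
  case 0
  then show ?case using assms(3) by (auto intro: continuous_on_compose2)
next
  case (Suc k)
  then obtain f' g' where *: "\<forall>x\<in>S. (f has_derivative f' x) (at x within S)"
    "\<forall>v\<in>V. Ck_on k V S (\<lambda>x. f' x v)" "\<forall>x\<in>T. (g has_derivative g' x) (at x within T)"
    "\<forall>v\<in>W. Ck_on k W T (\<lambda>x. g' x v)" unfolding Ck_on.simps(2) by blast
  obtain B where B: "finite B" "B \<subseteq> W" "\<And>x. x \<in> W \<Longrightarrow> (\<Sum>b\<in>B. (x \<bullet> b) *\<^sub>R b) = x"
    using subspace_orthonormal_expansion[OF assms(1)] by metis
  have f: "Ck_on k V S f" using Suc.prems Ck_on_SucD by auto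
  show ?case unfolding Ck_on.simps(2)
  proof (intro exI[of _ "\<lambda>x v. \<Sum>b\<in>B. (f' x v \<bullet> b) *\<^sub>R g' (f x) b"] conjI ballI)
    fix x assume x: "x \<in> S"
    have "(g has_derivative (\<lambda>v. \<Sum>b\<in>B. (v \<bullet> b) *\<^sub>R g' (f x) b)) (at (f x) within T)"
      using has_derivative_expansion[OF B(1,3) assms(1,2)] * x assms(3) by blast
    then have "(g has_derivative (\<lambda>v. \<Sum>b\<in>B. (v \<bullet> b) *\<^sub>R g' (f x) b)) (at (f x) within f ` S)"
      using assms(3) has_derivative_subset by blast
    with * x show "((\<lambda>x. g (f x)) has_derivative (\<lambda>v. \<Sum>b\<in>B. (f' x v \<bullet> b) *\<^sub>R g' (f x) b)) (at x within S)"
      using has_derivative_in_compose by blast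
  next
    fix v assume v: "v \<in> V"
    show "Ck_on k V S (\<lambda>x. \<Sum>b\<in>B. (f' x v \<bullet> b) *\<^sub>R g' (f x) b)"
    proof (rule Ck_on_sum)
      fix b assume "b \<in> B"
      then have "Ck_on k V S (\<lambda>x. g' (f x) b)"
        using Suc.IH[OF f] * B(2) by blast
      moreover have "Ck_on k V S (\<lambda>x. f' x v \<bullet> b)"
        using * v Ck_on_bounded_linear_compose[OF bounded_linear_inner_left] by blast
      ultimately show "Ck_on k V S (\<lambda>x. (f' x v \<bullet> b) *\<^sub>R g' (f x) b)"
        by (intro Ck_on_bilinear[OF bounded_bilinear_scaleR])
    qed
  qed
qed

lemma Ck_on_Pair:
  assumes "Ck_on k V S f" "Ck_on k V S g"
  shows "Ck_on k V S (\<lambda>x. (f x, g x))"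
proof -
  have "bounded_linear (\<lambda>x. (x, 0))" "bounded_linear (\<lambda>x. (0, x))"
    by (auto intro!: bounded_linear_Pair bounded_linear_ident bounded_linear_zero)
  then have "Ck_on k V S (\<lambda>x. (f x, 0) + (0, g x))"
    by (intro Ck_on_add Ck_on_bounded_linear_compose[OF _ assms(1)]
        Ck_on_bounded_linear_compose[OF _ assms(2)])
  then show ?thesis by simp
qed

lemma at_within_openin_subset:
  assumes "openin (top_of_set V) T" "x \<in> T" "T \<subseteq> S" "S \<subseteq> V"
  shows "at x within T = at x within S"
proof -
  obtain Op where "open Op" "T = V \<inter> Op" using assms(1) by (auto simp: openin_open)
  then show ?thesis using assms by (intro at_within_nhd[of x Op]) auto
qed

lemma Ck_on_local:
  assumes V: "subspace V"
    and "\<And>x. x \<in> S \<Longrightarrow> \<exists>T. openin (top_of_set V) T \<and> x \<in> T \<and> T \<subseteq> S \<and> Ck_on k V T f"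
  shows "Ck_on k V S f"
  using assms(2)
proof (induction k arbitrary: f)
  case 0
  have S: "openin (top_of_set V) S" using 0 by (subst openin_subopen) blast
  have "continuous (at x within S) f" if "x \<in> S" for x
  proof -
    from 0[OF that] obtain T where T: "openin (top_of_set V) T" "x \<in> T" "T \<subseteq> S" "continuous_on T f"
      by auto
    have "at x within T = at x within S"
      using at_within_openin_subset[OF T(1-3)] S openin_imp_subset by blast
    then show ?thesis using T by (metis continuous_on_eq_continuous_within)
  qed
  then show ?case by (simp add: continuous_on_eq_continuous_within)
next
  case (Suc k)
  have S: "openin (top_of_set V) S" using Suc.prems by (subst openin_subopen) blast
  show ?case unfolding Ck_on_Suc_iff[OF V S]
  proof (intro conjI ballI)
    fix x assume "x \<in> S"
    from Suc.prems[OF this] obtain T where T: "openin (top_of_set V) T" "x \<in> T" "T \<subseteq> S" "Ck_on (Suc k) V T f"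
      by blast
    then obtain D where "(f has_derivative D) (at x within T)"
      unfolding Ck_on_Suc_iff[OF V T(1)] by blast
    moreover have "at x within T = at x within S"
      using at_within_openin_subset[OF T(1-3)] S openin_imp_subset by blast
    ultimately show "\<exists>D. (f has_derivative D) (at x within S)" by metis
  next
    fix v assume v: "v \<in> V"
    show "Ck_on k V S (dirD f v)"
    proof (rule Suc.IH)
      fix x assume "x \<in> S"
      from Suc.prems[OF this] obtain T where T: "openin (top_of_set V) T" "x \<in> T" "T \<subseteq> S" "Ck_on (Suc k) V T f"
        by blast
      then have "Ck_on k V T (dirD f v)"
        unfolding Ck_on_Suc_iff[OF V T(1)] using v by blast
      with T show "\<exists>T. openin (top_of_set V) T \<and> x \<in> T \<and> T \<subseteq> S \<and> Ck_on k V T (dirD f v)" by blast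
    qed
  qed
qed

section \<open>The same closure properties for smooth functions\<close>

lemma smooth_on_Ck: "smooth_on V S f \<Longrightarrow> Ck_on k V S f"
  by (simp add: smooth_on_def)

lemma smooth_on_subset: "smooth_on V S f \<Longrightarrow> T \<subseteq> S \<Longrightarrow> smooth_on V T f"
  by (simp add: smooth_on_def Ck_on_subset[of _ V S f T])

lemma smooth_on_cong:
  assumes "\<And>x. x \<in> S \<Longrightarrow> f x = g x"
  shows "smooth_on V S f \<longleftrightarrow> smooth_on V S g"
proof -
  have "Ck_on k V S f \<longleftrightarrow> Ck_on k V S g" for k using assms by (rule Ck_on_cong)
  then show ?thesis unfolding smooth_on_def by blast
qed

lemma smooth_on_compose:
  fixes W :: "'f::euclidean_space set"
  assumes "subspace W" "T \<subseteq> W" "f ` S \<subseteq> T" "smooth_on V S f" "smooth_on W T g"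
  shows "smooth_on V S (\<lambda>x. g (f x))"
  unfolding smooth_on_def
  by (intro allI, rule Ck_on_compose[OF assms(1-3)]) (use assms(4,5) in \<open>simp_all add: smooth_on_def\<close>)

lemma smooth_on_Pair: "smooth_on V S f \<Longrightarrow> smooth_on V S g \<Longrightarrow> smooth_on V S (\<lambda>x. (f x, g x))"
  unfolding smooth_on_def by (simp add: Ck_on_Pair)

lemma smooth_on_add: "smooth_on V S f \<Longrightarrow> smooth_on V S g \<Longrightarrow> smooth_on V S (\<lambda>x. f x + g x)"
  unfolding smooth_on_def by (simp add: Ck_on_add)

lemma smooth_on_mult:
  fixes f g :: "'e::euclidean_space \<Rightarrow> real"
  shows "smooth_on V S f \<Longrightarrow> smooth_on V S g \<Longrightarrow> smooth_on V S (\<lambda>x. f x * g x)"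
  unfolding smooth_on_def by (simp add: Ck_on_bilinear[OF bounded_bilinear_mult])

lemma smooth_on_const: "smooth_on V S (\<lambda>x. c)"
  unfolding smooth_on_def by (simp add: Ck_on_const)

lemma smooth_on_id: "smooth_on V S (\<lambda>x. x)"
  unfolding smooth_on_def by (simp add: Ck_on_id)

lemma smooth_on_bounded_linear: "bounded_linear L \<Longrightarrow> smooth_on V S L"
  unfolding smooth_on_def by (simp add: Ck_on_bounded_linear)

lemma smooth_on_bounded_linear_compose:
  "bounded_linear L \<Longrightarrow> smooth_on V S f \<Longrightarrow> smooth_on V S (\<lambda>x. L (f x))"
  unfolding smooth_on_def by (simp add: Ck_on_bounded_linear_compose)

lemma smooth_on_local:
  assumes V: "subspace V"
    and "\<And>x. x \<in> S \<Longrightarrow> \<exists>T. openin (top_of_set V) T \<and> x \<in> T \<and> T \<subseteq> S \<and> smooth_on V T f"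
  shows "smooth_on V S f"
  unfolding smooth_on_def
proof
  fix k
  show "Ck_on k V S f"
    using assms(2) by (intro Ck_on_local[OF V]) (metis smooth_on_def)
qed

lemma smooth_on_continuous: "smooth_on V S f \<Longrightarrow> continuous_on S f"
  using Ck_on_continuous smooth_on_def by metis

lemma smooth_on_dirD:
  assumes "subspace V" "openin (top_of_set V) S" "smooth_on V S f" "v \<in> V"
  shows "smooth_on V S (dirD f v)"
  unfolding smooth_on_def
proof
  fix k
  have "Ck_on (Suc k) V S f" using assms(3) by (rule smooth_on_Ck)
  then show "Ck_on k V S (dirD f v)"
    unfolding Ck_on_Suc_iff[OF assms(1,2)] using assms(4) by blast
qed

lemma smooth_on_differentiable:
  assumes "smooth_on V S f" "x \<in> S"
  obtains D where "(f has_derivative D) (at x within S)"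
proof -
  have "Ck_on (Suc 0) V S f" using assms(1) by (rule smooth_on_Ck)
  then show ?thesis using that assms(2) by (elim Ck_on_SucE) blast
qed

text \<open>Bootstrapping for integral curves: if \<open>b\<close> is \<open>C^k\<close>, so is its
  derivative \<open>F (b t)\<close>, hence \<open>b\<close> is \<open>C^(k+1)\<close>.\<close>

lemma smooth_on_curveI:
  fixes b :: "real \<Rightarrow> 'e::euclidean_space"
  assumes V: "subspace V" and S: "open S" and T: "T \<subseteq> V" "b ` S \<subseteq> T" and F: "smooth_on V T F"
    and b: "\<And>t. t \<in> S \<Longrightarrow> (b has_vector_derivative F (b t)) (at t)"
  shows "smooth_on UNIV S b"
  unfolding smooth_on_def
proof
  fix k show "Ck_on k UNIV S b"
  proof (induction k)
    case 0
    have "isCont b t" if "t \<in> S" for t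
      using b[OF that] has_vector_derivative_continuous by blast
    then show ?case by (simp add: continuous_at_imp_continuous_on)
  next
    case (Suc k)
    show ?case unfolding Ck_on.simps(2)
    proof (intro exI[of _ "\<lambda>t h. h *\<^sub>R F (b t)"] conjI ballI)
      fix t assume "t \<in> S"
      then show "(b has_derivative (\<lambda>h. h *\<^sub>R F (b t))) (at t within S)"
        using b has_derivative_at_withinI unfolding has_vector_derivative_def by blast
    next
      fix v :: real
      have "Ck_on k UNIV S (\<lambda>t. F (b t))"
        by (rule Ck_on_compose[OF V T Suc smooth_on_Ck[OF F]])
      then show "Ck_on k UNIV S (\<lambda>t. v *\<^sub>R F (b t))"
        by (rule Ck_on_bounded_linear_compose[OF bounded_linear_scaleR_right])
    qed
  qed
qed

section \<open>Mean value estimates\<close>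

lemma linearization_bound:
  fixes f :: "'e::euclidean_space \<Rightarrow> 'f::real_normed_vector"
  assumes "convex X" "x \<in> X" "y \<in> X" "linear A"
    and f: "\<And>z. z \<in> X \<Longrightarrow> (f has_derivative F z) (at z within X)"
    and M: "\<And>z v. z \<in> closed_segment x y \<Longrightarrow> norm (F z v - A v) \<le> M * norm v"
  shows "norm (f y - f x - A (y - x)) \<le> M * norm (y - x)"
proof -
  let ?I = "closed_segment x y"
  have sub: "?I \<subseteq> X" using assms(1-3) by (simp add: closed_segment_subset)
  have A: "(A has_derivative A) (at z within ?I)" for z
    using assms(4) by (simp add: bounded_linear_imp_has_derivative linear_conv_bounded_linear)
  \<comment> \<open>The mean value inequality for \<open>f - A\<close>. Taking \<open>A = 0\<close>
    gives Lipschitz bounds, and taking for \<open>A\<close> the derivative at \<open>x\<close> or at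
    0 gives the two estimates that make up tameness.\<close>
  have "norm ((f y - A y) - (f x - A x)) \<le> M * norm (y - x)"
  proof (rule differentiable_bound[of ?I "\<lambda>z. f z - A z" "\<lambda>z v. F z v - A v"])
    fix z assume z: "z \<in> ?I"
    have "(f has_derivative F z) (at z within ?I)"
      using has_derivative_subset[OF f sub] z sub by blast
    then show "((\<lambda>z. f z - A z) has_derivative (\<lambda>v. F z v - A v)) (at z within ?I)"
      using A by (rule has_derivative_diff)
    show "onorm (\<lambda>v. F z v - A v) \<le> M" using M[OF z] by (rule onorm_le)
  qed auto
  then show ?thesis using assms(4) by (simp add: linear_diff algebra_simps)
qed

lemma norm_expansion_le:
  fixes f :: "'e::euclidean_space \<Rightarrow> 'f::real_normed_vector"
  assumes "finite B" "\<And>b. b \<in> B \<Longrightarrow> norm b = 1" "\<And>b. b \<in> B \<Longrightarrow> norm (f b) \<le> M" "0 \<le> M"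
  shows "norm (\<Sum>b\<in>B. (v \<bullet> b) *\<^sub>R f b) \<le> real (card B) * M * norm v"
proof -
  have "norm ((v \<bullet> b) *\<^sub>R f b) \<le> M * norm v" if "b \<in> B" for b
  proof -
    have "\<bar>v \<bullet> b\<bar> \<le> norm v * norm b" by (rule Cauchy_Schwarz_ineq2)
    also have "\<dots> \<le> norm v * 1" using assms(2)[OF that] by simp
    finally have "\<bar>v \<bullet> b\<bar> * norm (f b) \<le> norm v * M"
      using assms(3)[OF that] assms(4) by (intro mult_mono) auto
    then show ?thesis by (simp add: mult.commute)
  qed
  then have "norm (\<Sum>b\<in>B. (v \<bullet> b) *\<^sub>R f b) \<le> (\<Sum>b\<in>B. M * norm v)" by (rule sum_norm_le)
  then show ?thesis by simp
qed

lemma C1_lipschitz_on_compact: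
  fixes f :: "'e::euclidean_space \<Rightarrow> 'f::real_normed_vector"
  assumes V: "subspace V" and f: "Ck_on 1 V X f" and X: "X \<subseteq> V" "convex X" "compact X"
  obtains K where "K \<ge> 0" "\<And>x y. x \<in> X \<Longrightarrow> y \<in> X \<Longrightarrow> norm (f y - f x) \<le> K * norm (y - x)"
proof -
  obtain f' where f': "\<forall>x\<in>X. (f has_derivative f' x) (at x within X)"
    "\<forall>v\<in>V. Ck_on 0 V X (\<lambda>x. f' x v)" using f by (simp only: One_nat_def) (elim Ck_on_SucE)
  obtain B where B: "finite B" "B \<subseteq> V" "\<And>x. x \<in> V \<Longrightarrow> (\<Sum>b\<in>B. (x \<bullet> b) *\<^sub>R b) = x"
     "\<And>b. b \<in> B \<Longrightarrow> norm b = 1"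
    using subspace_orthonormal_expansion[OF V] by metis
  have "\<exists>M. \<forall>x\<in>X. norm (f' x b) \<le> M" if "b \<in> B" for b
  proof -
    have "continuous_on X (\<lambda>x. norm (f' x b))" using f'(2) B(2) that by (auto intro!: continuous_intros)
    then have "bounded ((\<lambda>x. norm (f' x b)) ` X)"
      using X(3) compact_continuous_image compact_imp_bounded by blast
    then show ?thesis unfolding bounded_iff by auto
  qed
  then obtain M where M: "\<And>b x. b \<in> B \<Longrightarrow> x \<in> X \<Longrightarrow> norm (f' x b) \<le> M b" by metis
  define M' where "M' = (\<Sum>b\<in>B. \<bar>M b\<bar>)"
  have M'0: "M' \<ge> 0" unfolding M'_def by (simp add: sum_nonneg)
  have M': "norm (f' x b) \<le> M'" if "b \<in> B" "x \<in> X" for b x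
  proof -
    have "\<bar>M b\<bar> \<le> M'" unfolding M'_def using that(1) B(1) by (intro member_le_sum) auto
    then show ?thesis using M[OF that] by linarith
  qed
  show ?thesis
  proof (rule that)
    show "0 \<le> real (card B) * M'" using M'0 by simp
    fix x y assume xy: "x \<in> X" "y \<in> X"
    have "norm (f y - f x - (\<lambda>_. 0) (y - x)) \<le> real (card B) * M' * norm (y - x)"
    proof (rule linearization_bound[OF X(2) xy, where F = "\<lambda>z v. \<Sum>b\<in>B. (v \<bullet> b) *\<^sub>R f' z b"])
      fix z assume "z \<in> X"
      then show "(f has_derivative (\<lambda>v. \<Sum>b\<in>B. (v \<bullet> b) *\<^sub>R f' z b)) (at z within X)"
        using has_derivative_expansion[OF B(1,3) V X(1) _ bspec[OF f'(1)]] by simp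
    next
      fix z v assume "z \<in> closed_segment x y"
      then have "z \<in> X" using X(2) xy closed_segment_subset by blast
      then show "norm ((\<Sum>b\<in>B. (v \<bullet> b) *\<^sub>R f' z b) - 0) \<le> real (card B) * M' * norm v"
        using norm_expansion_le[OF B(1,4) M' M'0] by simp
    qed (simp add: linear_zero)
    then show "norm (f y - f x) \<le> real (card B) * M' * norm (y - x)" by simp
  qed
qed

section \<open>Tame maps\<close>

text \<open>
  The regularity needed at 0: strict differentiability with a Lipschitz rate, and quadratically bounded
  second differences at all nearby points. Unlike being \<open>C\<^sup>2\<close>, both conditions pass directly to
  the limit that defines the exponential map.
\<close>

definition tame_within ::
  "'e::real_normed_vector set \<Rightarrow> ('e \<Rightarrow> 'f::real_normed_vector) \<Rightarrow> ('e \<Rightarrow> 'f) \<Rightarrow> real \<Rightarrow> real \<Rightarrow> bool"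
where
  "tame_within V L f C r \<longleftrightarrow> r > 0 \<and> C \<ge> 0 \<and> f 0 = 0 \<and>
     (\<forall>x\<in>V. \<forall>y\<in>V. norm x < r \<longrightarrow> norm y < r \<longrightarrow>
        norm (f x - f y - L (x - y)) \<le> C * (norm x + norm y) * norm (x - y)) \<and>
     (\<forall>x\<in>V. \<forall>w\<in>V. norm x < r \<longrightarrow> norm (x + w) < r \<longrightarrow> norm (x - w) < r \<longrightarrow>
        norm (f (x + w) + f (x - w) - 2 *\<^sub>R f x) \<le> C * (norm w)\<^sup>2)"

definition tame ::
  "'e::real_normed_vector set \<Rightarrow> ('e \<Rightarrow> 'f::real_normed_vector) \<Rightarrow> ('e \<Rightarrow> 'f) \<Rightarrow> bool"
where "tame V L f \<longleftrightarrow> (\<exists>C r. tame_within V L f C r)"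

lemma tame_withinD:
  assumes "tame_within V L f C r"
  shows "r > 0" "C \<ge> 0" "f 0 = 0"
    "\<And>x y. x \<in> V \<Longrightarrow> y \<in> V \<Longrightarrow> norm x < r \<Longrightarrow> norm y < r \<Longrightarrow>
        norm (f x - f y - L (x - y)) \<le> C * (norm x + norm y) * norm (x - y)"
    "\<And>x w. x \<in> V \<Longrightarrow> w \<in> V \<Longrightarrow> norm x < r \<Longrightarrow> norm (x + w) < r \<Longrightarrow> norm (x - w) < r \<Longrightarrow>
        norm (f (x + w) + f (x - w) - 2 *\<^sub>R f x) \<le> C * (norm w)\<^sup>2"
  using assms unfolding tame_within_def by simp_all

lemma tame_within_mono:
  assumes "tame_within V L f C r" "C \<le> C'" "0 < r'" "r' \<le> r"
  shows "tame_within V L f C' r'"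
proof -
  note T = tame_withinD[OF assms(1)]
  show ?thesis unfolding tame_within_def
  proof (intro conjI ballI impI)
    fix x y assume *: "x \<in> V" "y \<in> V" "norm x < r'" "norm y < r'"
    have "norm (f x - f y - L (x - y)) \<le> C * (norm x + norm y) * norm (x - y)"
      using * assms by (intro T(4)) auto
    also have "\<dots> \<le> C' * (norm x + norm y) * norm (x - y)"
      using assms(2) by (intro mult_right_mono) auto
    finally show "norm (f x - f y - L (x - y)) \<le> C' * (norm x + norm y) * norm (x - y)" .
  next
    fix x w assume *: "x \<in> V" "w \<in> V" "norm x < r'" "norm (x + w) < r'" "norm (x - w) < r'"
    have "norm (f (x + w) + f (x - w) - 2 *\<^sub>R f x) \<le> C * (norm w)\<^sup>2"
      using * assms by (intro T(5)) auto
    also have "\<dots> \<le> C' * (norm w)\<^sup>2" using assms(2) by (intro mult_right_mono) auto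
    finally show "norm (f (x + w) + f (x - w) - 2 *\<^sub>R f x) \<le> C' * (norm w)\<^sup>2" .
  qed (use T assms in auto)
qed

lemma tame_cong:
  assumes "tame V L f" "r > 0" "subspace V"
    and "\<And>x. x \<in> V \<Longrightarrow> norm x < r \<Longrightarrow> g x = f x" "\<And>x. x \<in> V \<Longrightarrow> M x = L x"
  shows "tame V M g"
proof -
  obtain C r0 where "tame_within V L f C r0" using assms(1) tame_def by metis
  then have "tame_within V L f C (min r r0)"
    using tame_within_mono[of V L f C r0 C "min r r0"] assms(2) tame_withinD(1)[of V L f C r0] by simp
  then have "tame_within V M g C (min r r0)"
    using assms(3-) unfolding tame_within_def
    by (simp add: subspace_diff subspace_add subspace_0)
  then show ?thesis unfolding tame_def by blast
qed

lemma tame_linear: "linear L \<Longrightarrow> tame V L L"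
  unfolding tame_def tame_within_def
  by (intro exI[of _ 0] exI[of _ 1])
    (simp add: linear_0 linear_diff linear_add algebra_simps scaleR_2)

lemma tame_Pair:
  assumes "tame V L f" "tame V M g"
  shows "tame V (\<lambda>x. (L x, M x)) (\<lambda>x. (f x, g x))"
proof -
  obtain C1 r1 C2 r2 where *: "tame_within V L f C1 r1" "tame_within V M g C2 r2"
    using assms tame_def by metis
  define r where "r = min r1 r2"
  have r: "r > 0" "r \<le> r1" "r \<le> r2"
    using tame_withinD(1)[OF *(1)] tame_withinD(1)[OF *(2)] by (auto simp: r_def)
  note F = tame_withinD[OF tame_within_mono[OF *(1) order_refl r(1,2)]]
    and G = tame_withinD[OF tame_within_mono[OF *(2) order_refl r(1,3)]]
  have "tame_within V (\<lambda>x. (L x, M x)) (\<lambda>x. (f x, g x)) (C1 + C2) r"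
    unfolding tame_within_def
  proof (intro conjI ballI impI)
    fix x y assume xy: "x \<in> V" "y \<in> V" "norm x < r" "norm y < r"
    have "norm ((f x, g x) - (f y, g y) - (L (x - y), M (x - y)))
      \<le> norm (f x - f y - L (x - y)) + norm (g x - g y - M (x - y))"
      by (simp add: norm_Pair_le)
    also have "\<dots> \<le> C1 * (norm x + norm y) * norm (x - y) + C2 * (norm x + norm y) * norm (x - y)"
      by (intro add_mono F(4) G(4) xy)
    finally show "norm ((f x, g x) - (f y, g y) - (L (x - y), M (x - y)))
      \<le> (C1 + C2) * (norm x + norm y) * norm (x - y)" by (simp add: algebra_simps)
  next
    fix x w assume xw: "x \<in> V" "w \<in> V" "norm x < r" "norm (x + w) < r" "norm (x - w) < r"
    have "norm ((f (x + w), g (x + w)) + (f (x - w), g (x - w)) - 2 *\<^sub>R (f x, g x))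
      \<le> norm (f (x + w) + f (x - w) - 2 *\<^sub>R f x) + norm (g (x + w) + g (x - w) - 2 *\<^sub>R g x)"
      by (simp add: norm_Pair_le)
    also have "\<dots> \<le> C1 * (norm w)\<^sup>2 + C2 * (norm w)\<^sup>2"
      by (intro add_mono F(5) G(5) xw)
    finally show "norm ((f (x + w), g (x + w)) + (f (x - w), g (x - w)) - 2 *\<^sub>R (f x, g x))
      \<le> (C1 + C2) * (norm w)\<^sup>2" by (simp add: algebra_simps)
  qed (use r F G in \<open>auto simp: zero_prod_def\<close>)
  then show ?thesis unfolding tame_def by blast
qed

lemma tame_lipschitz:
  assumes "tame_within V L f C r" "linear L" "\<And>x. norm (L x) \<le> K * norm x"
    and "x \<in> V" "y \<in> V" "norm x < r" "norm y < r"
  shows "norm (f x - f y) \<le> (K + 2 * C * r) * norm (x - y)"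
proof -
  note T = tame_withinD[OF assms(1)]
  have "norm (f x - f y) \<le> norm (f x - f y - L (x - y)) + norm (L (x - y))"
    by (metis diff_add_cancel norm_triangle_ineq)
  also have "\<dots> \<le> C * (norm x + norm y) * norm (x - y) + K * norm (x - y)"
    using assms by (intro add_mono T(4)) auto
  also have "C * (norm x + norm y) * norm (x - y) \<le> C * (2 * r) * norm (x - y)"
    using assms T by (intro mult_right_mono mult_left_mono) auto
  finally show ?thesis by (simp add: algebra_simps)
qed

text \<open>For second differences, \<open>f (x + w)\<close> and \<open>f (x - w)\<close> are
  written as \<open>q + d\<close> and \<open>q - d\<close> about their midpoint \<open>q\<close>.
  The second difference of \<open>g\<close> at \<open>q\<close> with step \<open>d\<close> is
  controlled by tameness of \<open>g\<close>, and moving from \<open>q\<close> to \<open>f x\<close>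
  costs half a second difference of \<open>f\<close>.\<close>

lemma tame_compose:
  fixes V :: "'e::euclidean_space set" and W :: "'f::euclidean_space set"
  assumes V: "subspace V" and W: "subspace W" and f: "tame V L f" and g: "tame W M g"
    and L: "linear L" and M: "linear M"
    and fW: "\<rho> > 0" "\<And>x. x \<in> V \<Longrightarrow> norm x < \<rho> \<Longrightarrow> f x \<in> W"
  shows "tame V (\<lambda>x. M (L x)) (\<lambda>x. g (f x))"
proof -
  obtain C1 r1 C2 r2 where *: "tame_within V L f C1 r1" "tame_within W M g C2 r2"
    using f g tame_def by metis
  obtain KL where KL: "KL > 0" "\<And>x. norm (L x) \<le> KL * norm x" using linear_bounded_pos[OF L] by blast
  obtain KM where KM: "KM > 0" "\<And>x. norm (M x) \<le> KM * norm x" using linear_bounded_pos[OF M] by blast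
  have r1: "r1 > 0" "r2 > 0" "C1 \<ge> 0" "C2 \<ge> 0"
    using tame_withinD(1,2)[OF *(1)] tame_withinD(1,2)[OF *(2)] by simp_all
  define K where "K = KL + 2 * C1 * r1"
  define J where "J = KM + 2 * C2 * r2"
  have K: "K > 0" "J > 0" using r1 KL KM by (auto simp: K_def J_def add_pos_nonneg)
  \<comment> \<open>\<open>f\<close> is \<open>K\<close>-Lipschitz near 0, so the radius
    \<open>r2 / K\<close> keeps its values where \<open>g\<close> is controlled.\<close>
  define r where "r = min (min r1 \<rho>) (r2 / K)"
  have r: "r > 0" "r \<le> r1" "r \<le> \<rho>" "r \<le> r2 / K" using r1 K fW(1) by (auto simp: r_def)
  note F = tame_withinD[OF *(1)] and G = tame_withinD[OF *(2)]
  have fl: "norm (f x - f y) \<le> K * norm (x - y)" if "x \<in> V" "y \<in> V" "norm x < r" "norm y < r" for x y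
    unfolding K_def using that r by (intro tame_lipschitz[OF *(1) L KL(2)]) auto
  have f0: "norm (f x) \<le> K * norm x" if "x \<in> V" "norm x < r" for x
    using fl[OF that(1) subspace_0[OF V] that(2)] r F(3) by simp
  have f2: "norm (f x) < r2" "f x \<in> W" if "x \<in> V" "norm x < r" for x
  proof -
    have "K * norm x < K * (r2 / K)" using that r K by (intro mult_strict_left_mono) auto
    then show "norm (f x) < r2" using f0[OF that] K by simp
    show "f x \<in> W" using fW(2) that r by auto
  qed
  define C where "C = C2 * K * K + KM * C1 + J * C1"
  have "tame_within V (\<lambda>x. M (L x)) (\<lambda>x. g (f x)) C r"
    unfolding tame_within_def
  proof (intro conjI ballI impI)
    show "g (f 0) = 0" using F(3) G(3) by simp
    show "0 \<le> C" using r1 K KL KM by (simp add: C_def)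
    fix x y assume xy: "x \<in> V" "y \<in> V" "norm x < r" "norm y < r"
    have "norm (g (f x) - g (f y) - M (L (x - y)))
      = norm ((g (f x) - g (f y) - M (f x - f y)) + M (f x - f y - L (x - y)))"
      by (simp add: linear_diff[OF M])
    also have "\<dots> \<le> norm (g (f x) - g (f y) - M (f x - f y)) + norm (M (f x - f y - L (x - y)))"
      by (rule norm_triangle_ineq)
    also have "norm (g (f x) - g (f y) - M (f x - f y)) \<le> C2 * (norm (f x) + norm (f y)) * norm (f x - f y)"
      using f2 xy by (intro G(4)) auto
    also have "\<dots> \<le> C2 * (K * norm x + K * norm y) * (K * norm (x - y))"
      using xy r1 K by (intro mult_mono mult_left_mono add_mono f0 fl) auto
    also have "norm (M (f x - f y - L (x - y))) \<le> KM * norm (f x - f y - L (x - y))" by (rule KM(2))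
    also have "\<dots> \<le> KM * (C1 * (norm x + norm y) * norm (x - y))"
      using xy r KM by (intro mult_left_mono F(4)) auto
    finally have "norm (g (f x) - g (f y) - M (L (x - y)))
      \<le> (C2 * K * K + KM * C1) * ((norm x + norm y) * norm (x - y))"
      by (simp add: algebra_simps)
    also have "\<dots> \<le> C * ((norm x + norm y) * norm (x - y))"
      using K r1 by (intro mult_right_mono) (auto simp: C_def)
    finally show "norm (g (f x) - g (f y) - M (L (x - y))) \<le> C * (norm x + norm y) * norm (x - y)"
      by (simp add: mult.assoc)
  next
    fix x w assume xw: "x \<in> V" "w \<in> V" "norm x < r" "norm (x + w) < r" "norm (x - w) < r"
    have V': "x + w \<in> V" "x - w \<in> V" using xw V by (auto intro: subspace_add subspace_diff)
    define q where "q = (1/2) *\<^sub>R (f (x + w) + f (x - w))"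
    define d where "d = (1/2) *\<^sub>R (f (x + w) - f (x - w))"
    have qd: "q + d = f (x + w)" "q - d = f (x - w)"
      unfolding q_def d_def by (simp_all add: algebra_simps flip: scaleR_add_left)
    have qW: "q \<in> W" "d \<in> W"
      using f2 xw V' W by (auto simp: q_def d_def intro!: subspace_scale subspace_add subspace_diff)
    have "norm q \<le> (1/2) * (norm (f (x + w)) + norm (f (x - w)))"
      unfolding q_def by (simp add: norm_triangle_ineq)
    then have qr: "norm q < r2" using f2(1)[OF V'(1) xw(4)] f2(1)[OF V'(2) xw(5)] by simp
    have "norm d \<le> (1/2) * (K * norm (x + w - (x - w)))"
      unfolding d_def using fl[OF V' xw(4,5)] by simp
    also have "x + w - (x - w) = 2 *\<^sub>R w" by (simp add: scaleR_2)
    finally have d: "norm d \<le> K * norm w" by simp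
    have "norm (g (q + d) + g (q - d) - 2 *\<^sub>R g q) \<le> C2 * (norm d)\<^sup>2"
      using qW qr f2(1)[OF V'(1) xw(4)] f2(1)[OF V'(2) xw(5)] by (intro G(5)) (simp_all add: qd)
    also have "\<dots> \<le> C2 * (K * norm w)\<^sup>2" using d r1 by (intro mult_left_mono power_mono) auto
    finally have 1: "norm (g (f (x + w)) + g (f (x - w)) - 2 *\<^sub>R g q) \<le> C2 * (K * norm w)\<^sup>2"
      by (simp add: qd)
    have "norm (g q - g (f x)) \<le> J * norm (q - f x)"
      unfolding J_def using qW qr f2[OF xw(1,3)] by (intro tame_lipschitz[OF *(2) M KM(2)]) auto
    also have "q - f x = (1/2) *\<^sub>R (f (x + w) + f (x - w) - 2 *\<^sub>R f x)"
      unfolding q_def by (simp add: algebra_simps)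
    also have "norm \<dots> \<le> (1/2) * (C1 * (norm w)\<^sup>2)"
      using F(5)[of x w] xw r by simp
    finally have 2: "norm (2 *\<^sub>R (g q - g (f x))) \<le> J * C1 * (norm w)\<^sup>2"
      using K by (simp add: mult_left_mono)
    have "norm (g (f (x + w)) + g (f (x - w)) - 2 *\<^sub>R g (f x))
      = norm ((g (f (x + w)) + g (f (x - w)) - 2 *\<^sub>R g q) + 2 *\<^sub>R (g q - g (f x)))"
      by (simp add: algebra_simps)
    also have "\<dots> \<le> C2 * (K * norm w)\<^sup>2 + J * C1 * (norm w)\<^sup>2"
      using norm_triangle_ineq 1 2 by (rule order_trans[OF _ add_mono])
    also have "\<dots> = (C2 * K * K + J * C1) * (norm w)\<^sup>2" by (simp add: power2_eq_square algebra_simps)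
    also have "\<dots> \<le> C * (norm w)\<^sup>2"
      using KM r1 by (intro mult_right_mono) (auto simp: C_def)
    finally show "norm (g (f (x + w)) + g (f (x - w)) - 2 *\<^sub>R g (f x)) \<le> C * (norm w)\<^sup>2" .
  qed (rule r(1))
  then show ?thesis unfolding tame_def by blast
qed


text \<open>Two derivatives suffice: on a compact ball of \<open>V\<close> the coefficients of the
  derivative are Lipschitz, hence so is the derivative \<open>F\<close> as an operator. The first
  condition is the mean value inequality against \<open>F 0\<close>; the second adds the quadratic
  Taylor remainders at \<open>x + w\<close> and \<open>x - w\<close>, whose linear terms
  cancel.\<close>

lemma tame_smooth:
  fixes f :: "'e::euclidean_space \<Rightarrow> 'f::real_normed_vector"
  assumes V: "subspace V" and S: "openin (top_of_set V) S" "0 \<in> S" and f: "smooth_on V S f"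
    and f0: "f 0 = 0" and D: "(f has_derivative D) (at 0 within S)"
  shows "tame V D f"
proof -
  obtain Op where Op: "open Op" "S = V \<inter> Op" using S(1) by (auto simp: openin_open)
  then obtain r where r: "r > 0" "cball 0 r \<subseteq> Op" using S(2) open_contains_cball by blast
  define X where "X = V \<inter> cball 0 r"
  have X: "X \<subseteq> V" "convex X" "compact X" "X \<subseteq> S"
    using V Op r by (auto simp: X_def subspace_imp_convex convex_Int closed_subspace intro: closed_Int_compact)
  have "Ck_on (Suc 1) V X f" using smooth_on_subset[OF f X(4)] by (rule smooth_on_Ck)
  then obtain f' where f': "\<forall>x\<in>X. (f has_derivative f' x) (at x within X)"
    "\<forall>v\<in>V. Ck_on 1 V X (\<lambda>x. f' x v)" by (elim Ck_on_SucE)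
  obtain B where B: "finite B" "B \<subseteq> V" "\<And>x. x \<in> V \<Longrightarrow> (\<Sum>b\<in>B. (x \<bullet> b) *\<^sub>R b) = x"
     "\<And>b. b \<in> B \<Longrightarrow> norm b = 1"
    using subspace_orthonormal_expansion[OF V] by metis
  have "\<exists>K\<ge>0. \<forall>x\<in>X. \<forall>y\<in>X. norm (f' y b - f' x b) \<le> K * norm (y - x)" if "b \<in> B" for b
  proof -
    have "Ck_on 1 V X (\<lambda>x. f' x b)" using f'(2) B(2) that by blast
    then show ?thesis using C1_lipschitz_on_compact[OF V _ X(1-3)] by metis
  qed
  then obtain K0 where K0: "\<And>b. b \<in> B \<Longrightarrow> K0 b \<ge> 0"
    "\<And>b x y. b \<in> B \<Longrightarrow> x \<in> X \<Longrightarrow> y \<in> X \<Longrightarrow> norm (f' y b - f' x b) \<le> K0 b * norm (y - x)"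
    by metis
  define K1 where "K1 = (\<Sum>b\<in>B. K0 b)"
  have K1: "K1 \<ge> 0" using K0(1) by (simp add: K1_def sum_nonneg)
  have K01: "norm (f' y b - f' x b) \<le> K1 * norm (y - x)" if "b \<in> B" "x \<in> X" "y \<in> X" for b x y
  proof -
    have "K0 b \<le> K1" unfolding K1_def using K0(1) that B(1) by (intro member_le_sum) auto
    then show ?thesis using K0(2)[OF that] mult_right_mono[of "K0 b" K1 "norm (y - x)"] by simp
  qed
  define F where "F = (\<lambda>z v. \<Sum>b\<in>B. (v \<bullet> b) *\<^sub>R f' z b)"
  define K where "K = real (card B) * K1"
  have K: "K \<ge> 0" using K1 by (simp add: K_def)
  have Flin: "linear (F z)" for z
    unfolding F_def by (intro linear_compose_sum ballI linearI) (simp_all add: inner_add_left algebra_simps)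
  have Fder: "(f has_derivative F z) (at z within X)" if "z \<in> X" for z
    unfolding F_def using has_derivative_expansion[OF B(1,3) V X(1) that bspec[OF f'(1) that]] by simp
  have Flip: "norm (F z v - F x v) \<le> K * norm (z - x) * norm v" if "z \<in> X" "x \<in> X" for x z v
  proof -
    have "F z v - F x v = (\<Sum>b\<in>B. (v \<bullet> b) *\<^sub>R (f' z b - f' x b))"
      by (simp add: F_def sum_subtractf scaleR_diff_right)
    also have "norm \<dots> \<le> real (card B) * (K1 * norm (z - x)) * norm v"
      using K1 K01 that by (intro norm_expansion_le B) auto
    finally show ?thesis by (simp add: K_def mult.assoc)
  qed
  have seg: "z \<in> X \<and> norm (z - a) \<le> max (norm (x - a)) (norm (y - a))" if "z \<in> closed_segment x y" "x \<in> X" "y \<in> X"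
    for x y z a
  proof
    show "z \<in> X" using that X(2) closed_segment_subset by blast
    have "closed_segment x y \<subseteq> cball a (max (norm (x - a)) (norm (y - a)))"
      by (intro closed_segment_subset convex_cball) (auto simp: dist_norm norm_minus_commute)
    then show "norm (z - a) \<le> max (norm (x - a)) (norm (y - a))"
      using that(1) by (auto simp: dist_norm norm_minus_commute)
  qed
  have X0: "0 \<in> X" using r V by (simp add: X_def subspace_0)
  have quad: "norm (f y - f x - F x (y - x)) \<le> K * norm (y - x) * norm (y - x)" if "x \<in> X" "y \<in> X" for x y
  proof (rule linearization_bound[OF X(2) that Flin Fder])
    fix z v assume "z \<in> closed_segment x y"
    from seg[OF this that, of x] have z: "z \<in> X" "norm (z - x) \<le> norm (y - x)" by auto
    have "norm (F z v - F x v) \<le> K * norm (z - x) * norm v" using Flip z(1) that(1) .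
    also have "\<dots> \<le> K * norm (y - x) * norm v"
      using z(2) K by (intro mult_right_mono mult_left_mono) auto
    finally show "norm (F z v - F x v) \<le> K * norm (y - x) * norm v" .
  qed
  have "tame_within V (F 0) f (2 * K) r"
    unfolding tame_within_def
  proof (intro conjI ballI impI)
    fix x y assume xy: "x \<in> V" "y \<in> V" "norm x < r" "norm y < r"
    then have xyX: "x \<in> X" "y \<in> X" by (auto simp: X_def)
    have "norm (f x - f y - F 0 (x - y)) \<le> K * (norm x + norm y) * norm (x - y)"
    proof (rule linearization_bound[OF X(2) xyX(2,1) Flin Fder])
      fix z v assume "z \<in> closed_segment y x"
      from seg[OF this xyX(2,1), of 0] have z: "z \<in> X" "norm z \<le> max (norm y) (norm x)"
        by simp_all
      have "max (norm y) (norm x) \<le> norm x + norm y" by simp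
      with z(2) have z2: "norm z \<le> norm x + norm y" by (rule order_trans)
      have "norm (F z v - F 0 v) \<le> K * norm (z - 0) * norm v" using Flip z(1) X0 .
      also have "\<dots> \<le> K * (norm x + norm y) * norm v"
        using z2 K by (intro mult_right_mono mult_left_mono) auto
      finally show "norm (F z v - F 0 v) \<le> K * (norm x + norm y) * norm v" .
    qed
    also have "\<dots> \<le> 2 * K * (norm x + norm y) * norm (x - y)"
      using K by (intro mult_right_mono) auto
    finally show "norm (f x - f y - F 0 (x - y)) \<le> 2 * K * (norm x + norm y) * norm (x - y)" .
  next
    fix x w assume xw: "x \<in> V" "w \<in> V" "norm x < r" "norm (x + w) < r" "norm (x - w) < r"
    then have xX: "x \<in> X" "x + w \<in> X" "x - w \<in> X"
      using V by (auto simp: X_def subspace_add subspace_diff)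
    have "norm (f (x + w) + f (x - w) - 2 *\<^sub>R f x)
      = norm ((f (x + w) - f x - F x (x + w - x)) + (f (x - w) - f x - F x (x - w - x)))"
      by (simp add: scaleR_2 linear_neg[OF Flin] algebra_simps)
    also have "\<dots> \<le> K * norm w * norm w + K * norm w * norm w"
      using quad[OF xX(1,2)] quad[OF xX(1,3)] by (intro norm_triangle_le add_mono) auto
    finally show "norm (f (x + w) + f (x - w) - 2 *\<^sub>R f x) \<le> 2 * K * (norm w)\<^sup>2"
      by (simp add: power2_eq_square)
  qed (use r K f0 in auto)
  then have "tame V (F 0) f" unfolding tame_def by blast
  \<comment> \<open>The given \<open>D\<close> and the constructed \<open>F 0\<close> can differ off
    \<open>V\<close>; agreement on \<open>V\<close> is what \<open>tame_cong\<close> asks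
    for.\<close>
  moreover have "D v = F 0 v" if "v \<in> V" for v
  proof -
    have at: "at 0 within X = at 0 within S"
      by (rule at_within_nhd[of 0 "ball 0 r"]) (use r X Op in \<open>auto simp: X_def\<close>)
    have "(f has_derivative F 0) (at 0 within S)" using Fder[OF X0] at by simp
    then show ?thesis using dirD_eq[OF V S that] D by metis
  qed
  ultimately show ?thesis using tame_cong[OF _ r(1) V, of "F 0" f f D] by simp
qed

section \<open>Quantitative inversion of maps close to the identity\<close>

lemma perturbed_identity_surj:
  fixes f :: "'e::euclidean_space \<Rightarrow> 'e"
  assumes V: "subspace V" and "r > 0" and fV: "\<And>x. x \<in> V \<Longrightarrow> norm x \<le> r \<Longrightarrow> f x \<in> V"
    and f: "\<And>x y. x \<in> V \<Longrightarrow> y \<in> V \<Longrightarrow> norm x \<le> r \<Longrightarrow> norm y \<le> r \<Longrightarrow>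
      norm (f x - f y - (x - y)) \<le> (1/2) * norm (x - y)" and f0: "f 0 = 0"
    and y: "y \<in> V" "norm y \<le> r / 2"
  obtains x where "x \<in> V" "norm x \<le> 2 * norm y" "f x = y"
proof -
  define s where "s = V \<inter> cball 0 (2 * norm y)"
  have sr: "norm x \<le> r" "x \<in> V" if "x \<in> s" for x using that y by (auto simp: s_def)
  \<comment> \<open>A fixed point solves \<open>f x = y\<close>. The map contracts by 1/2, and it
    preserves the ball of radius \<open>2 |y|\<close> because
    \<open>|y| + |x| / 2 \<le> 2 |y|\<close> there.\<close>
  have "\<exists>!x\<in>s. x + (y - f x) = x"
  proof (rule Banach_fix[where c = "1/2"])
    show "complete s" unfolding s_def
      using closed_subspace[OF V] by (simp add: closed_Int complete_eq_closed)
    show "s \<noteq> {}" using subspace_0[OF V] by (auto simp: s_def)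
    show "(\<lambda>x. x + (y - f x)) ` s \<subseteq> s"
    proof
      fix z assume "z \<in> (\<lambda>x. x + (y - f x)) ` s"
      then obtain x where x: "x \<in> s" "z = y - (f x - f 0 - (x - 0))" by (auto simp: f0)
      have "norm (f x - f 0 - (x - 0)) \<le> (1/2) * norm (x - 0)"
        using sr[OF x(1)] subspace_0[OF V] assms(2) by (intro f) auto
      also have "\<dots> \<le> norm y" using x(1) by (simp add: s_def)
      finally have "norm z \<le> 2 * norm y" using x(2) norm_triangle_ineq4[of y "f x - f 0 - (x - 0)"] by simp
      moreover have "z \<in> V" using x sr[OF x(1)] fV[of x] y V f0 by (auto intro!: subspace_diff)
      ultimately show "z \<in> s" by (simp add: s_def)
    qed
    show "dist (x + (y - f x)) (x' + (y - f x')) \<le> 1/2 * dist x x'" if "x \<in> s" "x' \<in> s" for x x'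
    proof -
      have "x \<in> s" "x' \<in> s" using that by auto
      then have "norm (f x - f x' - (x - x')) \<le> (1/2) * norm (x - x')" using sr by (intro f) auto
      moreover have "x + (y - f x) - (x' + (y - f x')) = - (f x - f x' - (x - x'))" by simp
      ultimately show "dist (x + (y - f x)) (x' + (y - f x')) \<le> 1/2 * dist x x'"
        unfolding dist_norm by (metis norm_minus_cancel)
    qed
  qed auto
  then obtain x where x: "x \<in> s" and "x + (y - f x) = x" by (elim ex1E conjE)
  then have "f x = y" by (simp add: algebra_simps)
  with x show ?thesis using that[of x] by (simp add: s_def)
qed

lemma tame_near_identity:
  assumes "tame V (\<lambda>x. x) f"
  obtains C r where "tame_within V (\<lambda>x. x) f C r"
    "\<And>x y. x \<in> V \<Longrightarrow> y \<in> V \<Longrightarrow> norm x < r \<Longrightarrow> norm y < r \<Longrightarrow>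
      norm (f x - f y - (x - y)) \<le> (1/2) * norm (x - y)"
proof -
  obtain C r0 where T: "tame_within V (\<lambda>x. x) f C r0" using assms tame_def by metis
  note t = tame_withinD[OF T]
  \<comment> \<open>Makes \<open>C (|x| + |y|)\<close> at most \<open>2 C r \<le> 1/2\<close>; the
    summand 1 covers \<open>C = 0\<close>.\<close>
  define r where "r = min r0 (1 / (4 * (C + 1)))"
  have r: "r > 0" "r \<le> r0" "r \<le> 1 / (4 * (C + 1))" using t by (auto simp: r_def)
  have "C * (2 * r) \<le> C * (2 * (1 / (4 * (C + 1))))" using r t by (intro mult_left_mono) auto
  also have "\<dots> \<le> 1/2" using t by (simp add: field_simps)
  finally have Cr: "C * (2 * r) \<le> 1/2" .
  show ?thesis
  proof (rule that)
    show T': "tame_within V (\<lambda>x. x) f C r" using tame_within_mono[OF T order_refl r(1,2)] .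
    fix x y assume *: "x \<in> V" "y \<in> V" "norm x < r" "norm y < r"
    have "norm (f x - f y - (x - y)) \<le> C * (norm x + norm y) * norm (x - y)"
      by (rule tame_withinD(4)[OF T' *])
    also have "\<dots> \<le> C * (2 * r) * norm (x - y)"
      using * t by (intro mult_right_mono mult_left_mono) auto
    also have "\<dots> \<le> 1/2 * norm (x - y)" using Cr by (intro mult_right_mono) auto
    finally show "norm (f x - f y - (x - y)) \<le> (1/2) * norm (x - y)" .
  qed
qed

text \<open>Closeness to the identity gives \<open>|u - v| \<le> 2 |f u - f v|\<close>, which
  carries estimates for \<open>f\<close> back to \<open>g\<close>. For second differences, let
  \<open>q\<close> be the midpoint of \<open>g (x + w)\<close> and \<open>g (x - w)\<close>:
  tameness of \<open>f\<close> puts \<open>f q\<close> within order \<open>|w|^2\<close> of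
  \<open>x\<close>, hence \<open>q\<close> within order \<open>|w|^2\<close> of
  \<open>g x\<close>.\<close>

lemma tame_inverse:
  fixes f g :: "'e::euclidean_space \<Rightarrow> 'e"
  assumes V: "subspace V" and f: "tame V (\<lambda>x. x) f"
    and g: "\<rho> > 0" "\<And>y. y \<in> V \<Longrightarrow> norm y < \<rho> \<Longrightarrow> g y \<in> V \<and> norm (g y) \<le> 2 * norm y \<and> f (g y) = y"
  shows "tame V (\<lambda>x. x) g"
proof -
  obtain C r0 where T: "tame_within V (\<lambda>x. x) f C r0" and
    lip: "\<And>x y. x \<in> V \<Longrightarrow> y \<in> V \<Longrightarrow> norm x < r0 \<Longrightarrow> norm y < r0 \<Longrightarrow>
      norm (f x - f y - (x - y)) \<le> (1/2) * norm (x - y)"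
    using tame_near_identity[OF f] by metis
  note t = tame_withinD[OF T]
  define r where "r = min \<rho> (r0 / 2)"
  have r: "r > 0" "r \<le> \<rho>" "r \<le> r0 / 2" using t g by (auto simp: r_def)
  have bilip: "norm (u - v) \<le> 2 * norm (f u - f v)"
    if "u \<in> V" "v \<in> V" "norm u < r0" "norm v < r0" for u v
    using lip[OF that] norm_triangle_ineq2[of "u - v" "f u - f v"] by (simp add: norm_minus_commute)
  have G: "g y \<in> V" "norm (g y) \<le> 2 * norm y" "f (g y) = y" "norm (g y) < r0"
    if "y \<in> V" "norm y < r" for y
    using g(2)[of y] that r by auto
  have "tame_within V (\<lambda>x. x) g (8 * C) r"
    unfolding tame_within_def
  proof (intro conjI ballI impI)
    show "g 0 = 0" using G(2)[of 0] V r by (simp add: subspace_0)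
    fix x y assume xy: "x \<in> V" "y \<in> V" "norm x < r" "norm y < r"
    note Gx = G[OF xy(1,3)] and Gy = G[OF xy(2,4)]
    have d: "norm (g x - g y) \<le> 2 * norm (x - y)" using bilip[of "g x" "g y"] Gx Gy by simp
    have "norm (g x - g y - (x - y)) = norm (f (g x) - f (g y) - (g x - g y))"
      using Gx(3) Gy(3) by (simp add: norm_minus_commute)
    also have "\<dots> \<le> C * (norm (g x) + norm (g y)) * norm (g x - g y)" using Gx Gy by (intro t(4))
    also have "\<dots> \<le> C * (2 * norm x + 2 * norm y) * (2 * norm (x - y))"
      using Gx Gy d t by (intro mult_mono mult_left_mono add_mono) auto
    also have "\<dots> = 4 * C * (norm x + norm y) * norm (x - y)" by (simp add: algebra_simps)
    also have "\<dots> \<le> 8 * C * (norm x + norm y) * norm (x - y)" using t by (intro mult_right_mono) auto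
    finally show "norm (g x - g y - (x - y)) \<le> 8 * C * (norm x + norm y) * norm (x - y)" .
  next
    fix x w assume xw: "x \<in> V" "w \<in> V" "norm x < r" "norm (x + w) < r" "norm (x - w) < r"
    have V': "x + w \<in> V" "x - w \<in> V" using xw V by (auto intro: subspace_add subspace_diff)
    note G0 = G[OF xw(1,3)] and Gp = G[OF V'(1) xw(4)] and Gm = G[OF V'(2) xw(5)]
    define q where "q = (1/2) *\<^sub>R (g (x + w) + g (x - w))"
    define d where "d = (1/2) *\<^sub>R (g (x + w) - g (x - w))"
    have qd: "q + d = g (x + w)" "q - d = g (x - w)"
      unfolding q_def d_def by (simp_all add: algebra_simps flip: scaleR_add_left)
    have qV: "q \<in> V" "d \<in> V"
      using Gp Gm V by (auto simp: q_def d_def intro!: subspace_scale subspace_add subspace_diff)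
    have "norm q \<le> (1/2) * (norm (g (x + w)) + norm (g (x - w)))"
      unfolding q_def by (simp add: norm_triangle_ineq)
    then have qr: "norm q < r0" using Gp Gm by simp
    have "norm (g (x + w) - g (x - w)) \<le> 2 * norm (x + w - (x - w))"
      using bilip[of "g (x + w)" "g (x - w)"] Gp Gm by simp
    also have "x + w - (x - w) = 2 *\<^sub>R w" by (simp add: scaleR_2)
    finally have d: "norm d \<le> 2 * norm w" unfolding d_def by simp
    have "norm (f (q + d) + f (q - d) - 2 *\<^sub>R f q) \<le> C * (norm d)\<^sup>2"
      using qV qr Gp Gm by (intro t(5)) (simp_all add: qd)
    also have "f (q + d) + f (q - d) - 2 *\<^sub>R f q = 2 *\<^sub>R (x - f q)"
      unfolding qd using Gp(3) Gm(3) by (simp add: algebra_simps scaleR_2)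
    finally have "2 * norm (x - f q) \<le> C * (2 * norm w)\<^sup>2"
      using d t mult_left_mono[OF power_mono[OF d norm_ge_zero, of 2], of C] by simp
    then have 1: "norm (x - f q) \<le> 2 * C * (norm w)\<^sup>2" by (simp add: power_mult_distrib)
    have "norm (q - g x) \<le> 2 * norm (x - f q)"
      using bilip[of q "g x"] qV qr G0 by (simp add: norm_minus_commute)
    moreover have "g (x + w) + g (x - w) - 2 *\<^sub>R g x = 2 *\<^sub>R (q - g x)"
      unfolding q_def by (simp add: algebra_simps)
    ultimately show "norm (g (x + w) + g (x - w) - 2 *\<^sub>R g x) \<le> 8 * C * (norm w)\<^sup>2"
      using 1 by simp
  qed (use r t in auto)
  then show ?thesis unfolding tame_def by blast
qed

section \<open>Differentiation under an integral along rays\<close>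

lemma segment_in_subspace_ball:
  fixes V :: "'e::real_normed_vector set"
  assumes "subspace V" "x \<in> V \<inter> ball 0 r" "0 \<le> t" "t \<le> (1::real)"
  shows "t *\<^sub>R x \<in> V \<inter> ball 0 r"
proof -
  have "t * norm x \<le> 1 * norm x" using assms by (intro mult_right_mono) auto
  then show ?thesis using assms by (auto simp: subspace_scale)
qed

text \<open>Differentiating \<open>t^j F(t x)\<close> in direction \<open>b\<close> gives
  \<open>t^(j+1)\<close> times \<open>dirD F b\<close> at \<open>t x\<close>, an integrand of the
  same form. Carrying the power \<open>j\<close> along closes the induction.\<close>

lemma Ck_on_integral_scaled:
  fixes F :: "'e::euclidean_space \<Rightarrow> real"
  assumes V: "subspace V" and S: "S = V \<inter> ball 0 r" and F: "smooth_on V S F"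
  shows "Ck_on k V S (\<lambda>x. integral {0..1} (\<lambda>t. t ^ j * F (t *\<^sub>R x)))"
  using F
proof (induction k arbitrary: F j)
  have So: "openin (top_of_set V) S" unfolding S by (auto simp: openin_open)
  have SV: "S \<subseteq> V" unfolding S by blast
  have Sc: "convex S" unfolding S using V by (intro convex_Int subspace_imp_convex convex_ball)
  obtain B where B: "finite B" "B \<subseteq> V" "\<And>x. x \<in> V \<Longrightarrow> (\<Sum>b\<in>B. (x \<bullet> b) *\<^sub>R b) = x"
     "\<And>b. b \<in> B \<Longrightarrow> norm b = 1"
    using subspace_orthonormal_expansion[OF V] by metis
  have tS: "t *\<^sub>R x \<in> S" if "x \<in> S" "t \<in> {0..1}" for x t
    using segment_in_subspace_ball[OF V, of x r t] that S by auto
  have cont: "continuous_on (S \<times> cbox 0 1) (\<lambda>(x, t::real). t ^ j * H (t *\<^sub>R x))" if "smooth_on V S H" for H :: "'e \<Rightarrow> real" and j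
  proof -
    have H: "continuous_on S H" using that by (rule smooth_on_continuous)
    show ?thesis unfolding split_def
      by (intro continuous_intros continuous_on_compose2[OF H]) (auto intro: tS)
  qed
  have int: "(\<lambda>t. t ^ j * H (t *\<^sub>R x)) integrable_on cbox 0 1" if "smooth_on V S H" "x \<in> S" for H :: "'e \<Rightarrow> real" and j x
  proof (rule integrable_continuous)
    have "continuous_on (cbox 0 1) (\<lambda>t. (\<lambda>(x, t::real). t ^ j * H (t *\<^sub>R x)) (x, t))"
      by (rule continuous_on_compose2[OF cont[OF that(1)]]) (use that(2) in \<open>auto intro!: continuous_intros\<close>)
    then show "continuous_on (cbox 0 1) (\<lambda>t. t ^ j * H (t *\<^sub>R x))" by simp
  qed
  have der: "((\<lambda>x. integral {0..1} (\<lambda>t. t ^ j * F (t *\<^sub>R x))) has_derivative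
      (\<lambda>v. \<Sum>b\<in>B. (v \<bullet> b) * integral {0..1} (\<lambda>t. t ^ Suc j * dirD F b (t *\<^sub>R x)))) (at x within S)"
    if F: "smooth_on V S F" and x: "x \<in> S" for F :: "'e \<Rightarrow> real" and j x
  proof -
    have DF: "smooth_on V S (dirD F b)" if "b \<in> B" for b
      using smooth_on_dirD[OF V So F] B(2) that by blast
    \<comment> \<open>\<open>leibniz_rule\<close> expects the derivative as a bounded linear
      function depending continuously on \<open>(x, t)\<close>. The basis expansion supplies it as a
      finite sum of fixed functionals with continuous coefficients.\<close>
    define fx where "fx = (\<lambda>x t. \<Sum>b\<in>B. (t ^ Suc j * dirD F b (t *\<^sub>R x)) *\<^sub>R blinfun_inner_left b)"
    have "((\<lambda>x. integral (cbox 0 1) (\<lambda>t. t ^ j * F (t *\<^sub>R x))) has_derivative integral (cbox 0 1) (fx x)) (at x within S)"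
    proof (rule leibniz_rule[OF _ _ _ x Sc])
      fix x t assume x: "x \<in> S" and t: "t \<in> cbox 0 (1::real)"
      obtain D where D: "(F has_derivative D) (at (t *\<^sub>R x) within S)"
        using smooth_on_differentiable[OF F tS[OF x]] t by auto
      have tx: "t *\<^sub>R x \<in> S" using tS x t by simp
      have D': "(F has_derivative (\<lambda>v. \<Sum>b\<in>B. (v \<bullet> b) *\<^sub>R D b)) (at (t *\<^sub>R x) within S)"
        by (rule has_derivative_expansion[OF B(1,3) V SV tx D])
      have Db: "D b = dirD F b (t *\<^sub>R x)" if "b \<in> B" for b
        using dirD_eq[OF V So tx _ D] B(2) that by (simp add: subset_iff)
      have "((\<lambda>x. t *\<^sub>R x) has_derivative (\<lambda>v. t *\<^sub>R v)) (at x within S)"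
        by (intro derivative_intros)
      moreover have "(F has_derivative (\<lambda>v. \<Sum>b\<in>B. (v \<bullet> b) *\<^sub>R D b)) (at (t *\<^sub>R x) within (\<lambda>x. t *\<^sub>R x) ` S)"
        by (rule has_derivative_subset[OF D']) (use tS t in auto)
      ultimately have "((\<lambda>x. F (t *\<^sub>R x)) has_derivative (\<lambda>v. \<Sum>b\<in>B. ((t *\<^sub>R v) \<bullet> b) *\<^sub>R D b)) (at x within S)"
        by (rule has_derivative_in_compose)
      then have "((\<lambda>x. t ^ j * F (t *\<^sub>R x)) has_derivative (\<lambda>v. t ^ j * (\<Sum>b\<in>B. ((t *\<^sub>R v) \<bullet> b) *\<^sub>R D b))) (at x within S)"
        by (rule has_derivative_mult_right)
      moreover have "(\<lambda>v. t ^ j * (\<Sum>b\<in>B. ((t *\<^sub>R v) \<bullet> b) *\<^sub>R D b)) = blinfun_apply (fx x t)"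
      proof
        fix v
        show "t ^ j * (\<Sum>b\<in>B. ((t *\<^sub>R v) \<bullet> b) *\<^sub>R D b) = blinfun_apply (fx x t) v"
          unfolding fx_def blinfun.sum_left sum_distrib_left
          by (rule sum.cong) (simp_all add: blinfun.scaleR_left Db)
      qed
      ultimately show "((\<lambda>x. t ^ j * F (t *\<^sub>R x)) has_derivative blinfun_apply (fx x t)) (at x within S)"
        by simp
    next
      show "(\<lambda>t. t ^ j * F (t *\<^sub>R x)) integrable_on cbox 0 1" if "x \<in> S" for x
        using int F that .
      show "continuous_on (S \<times> cbox 0 1) (\<lambda>(x, t). fx x t)"
        unfolding fx_def split_def
        by (intro continuous_on_sum continuous_on_scaleR continuous_on_const
            cont[OF DF, unfolded split_def])
    qed
    moreover have "blinfun_apply (integral (cbox 0 1) (fx x)) v =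
       (\<Sum>b\<in>B. (v \<bullet> b) * integral {0..1} (\<lambda>t. t ^ Suc j * dirD F b (t *\<^sub>R x)))" for v
    proof -
      have "fx x integrable_on cbox 0 1" unfolding fx_def
        by (intro integrable_sum B integrable_on_scaleR_left int DF x)
      then have "blinfun_apply (integral (cbox 0 1) (fx x)) v = integral (cbox 0 1) (\<lambda>t. blinfun_apply (fx x t) v)"
        using integral_linear[of "fx x" "cbox 0 1" "\<lambda>A. blinfun_apply A v"]
        by (simp add: o_def blinfun.bounded_linear_left)
      also have "\<dots> = integral (cbox 0 1) (\<lambda>t. \<Sum>b\<in>B. (v \<bullet> b) * (t ^ Suc j * dirD F b (t *\<^sub>R x)))"
        unfolding fx_def blinfun.sum_left by (simp add: blinfun.scaleR_left mult_ac)
      also have "\<dots> = (\<Sum>b\<in>B. integral (cbox 0 1) (\<lambda>t. (v \<bullet> b) * (t ^ Suc j * dirD F b (t *\<^sub>R x))))"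
        by (intro integral_sum B integrable_on_mult_right int DF x)
      finally show ?thesis by simp
    qed
    then have "blinfun_apply (integral (cbox 0 1) (fx x)) =
       (\<lambda>v. \<Sum>b\<in>B. (v \<bullet> b) * integral {0..1} (\<lambda>t. t ^ Suc j * dirD F b (t *\<^sub>R x)))" ..
    ultimately show ?thesis by simp
  qed
  {
    case 0
    show ?case unfolding Ck_on.simps(1) continuous_on_eq_continuous_within
      by (intro ballI has_derivative_continuous[OF der[OF 0]])
  next
    case (Suc k)
    show ?case unfolding Ck_on.simps(2)
    proof (intro exI[of _ "\<lambda>x v. \<Sum>b\<in>B. (v \<bullet> b) * integral {0..1} (\<lambda>t. t ^ Suc j * dirD F b (t *\<^sub>R x))"] conjI ballI)
      fix x assume "x \<in> S"
      then show "((\<lambda>x. integral {0..1} (\<lambda>t. t ^ j * F (t *\<^sub>R x))) has_derivative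
      (\<lambda>v. \<Sum>b\<in>B. (v \<bullet> b) * integral {0..1} (\<lambda>t. t ^ Suc j * dirD F b (t *\<^sub>R x)))) (at x within S)"
        by (rule der[OF Suc.prems])
    next
      fix v
      have "smooth_on V S (dirD F b)" if "b \<in> B" for b
        using smooth_on_dirD[OF V So Suc.prems] B(2) that by blast
      then show "Ck_on k V S (\<lambda>x. \<Sum>b\<in>B. (v \<bullet> b) * integral {0..1} (\<lambda>t. t ^ Suc j * dirD F b (t *\<^sub>R x)))"
        by (intro Ck_on_sum Ck_on_bounded_linear_compose[OF bounded_linear_mult_right] Suc.IH)
    qed
  }
qed

section \<open>Hadamard factorization and smooth inverses\<close>

text \<open>The fundamental theorem of calculus on the ray from 0 to \<open>x\<close>. The factors
  \<open>x \<bullet> b\<close> vanish at 0, so a derivation at the base point can be evaluated on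
  \<open>F\<close> by the product rule.\<close>

lemma hadamard:
  fixes F :: "'e::euclidean_space \<Rightarrow> real"
  assumes V: "subspace V" and S: "S = V \<inter> ball 0 r" and F: "smooth_on V S F"
    and B: "finite B" "B \<subseteq> V" "\<And>x. x \<in> V \<Longrightarrow> (\<Sum>b\<in>B. (x \<bullet> b) *\<^sub>R b) = x"
  obtains g where "\<And>b. b \<in> B \<Longrightarrow> smooth_on V S (g b)" "\<And>b. b \<in> B \<Longrightarrow> g b 0 = dirD F b 0"
    "\<And>x. x \<in> S \<Longrightarrow> F x = F 0 + (\<Sum>b\<in>B. (x \<bullet> b) * g b x)"
proof
  have So: "openin (top_of_set V) S" unfolding S by (auto simp: openin_open)
  have SV: "S \<subseteq> V" unfolding S by blast
  have DF: "smooth_on V S (dirD F b)" if "b \<in> B" for b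
    using smooth_on_dirD[OF V So F] B(2) that by blast
  let ?g = "\<lambda>b x. integral {0..1} (\<lambda>t. dirD F b (t *\<^sub>R x))"
  show "smooth_on V S (?g b)" if "b \<in> B" for b
    unfolding smooth_on_def
  proof
    fix k show "Ck_on k V S (?g b)"
      using Ck_on_integral_scaled[OF V S DF[OF that], of k 0] by simp
  qed
  show "?g b 0 = dirD F b 0" if "b \<in> B" for b by simp
  show "F x = F 0 + (\<Sum>b\<in>B. (x \<bullet> b) * ?g b x)" if x: "x \<in> S" for x
  proof -
    have tS: "t *\<^sub>R x \<in> S" if "t \<in> {0..1}" for t
      using segment_in_subspace_ball[OF V, of x r t] that x S by auto
    have int: "(\<lambda>t. dirD F b (t *\<^sub>R x)) integrable_on {0..1}" if "b \<in> B" for b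
    proof (rule integrable_continuous_real)
      show "continuous_on {0..1} (\<lambda>t. dirD F b (t *\<^sub>R x))"
        by (rule continuous_on_compose2[OF smooth_on_continuous[OF DF[OF that]]])
          (use tS in \<open>auto intro!: continuous_intros\<close>)
    qed
    have "((\<lambda>t. \<Sum>b\<in>B. (x \<bullet> b) * dirD F b (t *\<^sub>R x)) has_integral F (1 *\<^sub>R x) - F (0 *\<^sub>R x)) {0..1}"
    proof (rule fundamental_theorem_of_calculus)
      fix t :: real assume t: "t \<in> {0..1}"
      obtain D where D: "(F has_derivative D) (at (t *\<^sub>R x) within S)"
        using smooth_on_differentiable[OF F tS[OF t]] by auto
      have D': "(F has_derivative (\<lambda>v. \<Sum>b\<in>B. (v \<bullet> b) *\<^sub>R D b)) (at (t *\<^sub>R x) within S)"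
        by (rule has_derivative_expansion[OF B(1,3) V SV tS[OF t] D])
      have Db: "D b = dirD F b (t *\<^sub>R x)" if "b \<in> B" for b
        using dirD_eq[OF V So tS[OF t] _ D] B(2) that by (simp add: subset_iff)
      have "((\<lambda>t. t *\<^sub>R x) has_derivative (\<lambda>h. h *\<^sub>R x)) (at t within {0..1})"
        by (intro derivative_intros)
      moreover have "(F has_derivative (\<lambda>v. \<Sum>b\<in>B. (v \<bullet> b) *\<^sub>R D b)) (at (t *\<^sub>R x) within (\<lambda>t. t *\<^sub>R x) ` {0..1})"
        by (rule has_derivative_subset[OF D']) (use tS in auto)
      ultimately have "((\<lambda>t. F (t *\<^sub>R x)) has_derivative (\<lambda>h. \<Sum>b\<in>B. ((h *\<^sub>R x) \<bullet> b) *\<^sub>R D b)) (at t within {0..1})"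
        by (rule has_derivative_in_compose)
      moreover have "(\<lambda>h. \<Sum>b\<in>B. ((h *\<^sub>R x) \<bullet> b) *\<^sub>R D b) = (\<lambda>h. h *\<^sub>R (\<Sum>b\<in>B. (x \<bullet> b) * dirD F b (t *\<^sub>R x)))"
        by (simp add: Db sum_distrib_left mult.assoc)
      ultimately show "((\<lambda>t. F (t *\<^sub>R x)) has_vector_derivative (\<Sum>b\<in>B. (x \<bullet> b) * dirD F b (t *\<^sub>R x))) (at t within {0..1})"
        by (simp add: has_vector_derivative_def)
    qed simp
    then have "F x - F 0 = integral {0..1} (\<lambda>t. \<Sum>b\<in>B. (x \<bullet> b) * dirD F b (t *\<^sub>R x))"
      by (simp add: integral_unique)
    also have "\<dots> = (\<Sum>b\<in>B. (x \<bullet> b) * ?g b x)"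
      using int by (subst integral_sum) (auto intro: B integrable_on_mult_right)
    finally show ?thesis by simp
  qed
qed

text \<open>When one factor vanishes at the point, mere continuity of the other gives the product
  rule. In \<open>smooth_on_inverse\<close> this yields differentiability of the inverse derivative
  at a stage where only its continuity is known.\<close>

lemma has_derivative_scaleR_vanishing:
  fixes a :: "'e::real_normed_vector \<Rightarrow> real" and A :: "'e \<Rightarrow> 'f::real_normed_vector"
  assumes a: "(a has_derivative a') (at x within S)" "a x = 0" and A: "continuous (at x within S) A"
  shows "((\<lambda>y. a y *\<^sub>R A y) has_derivative (\<lambda>h. a' h *\<^sub>R A x)) (at x within S)"
  unfolding has_derivative_within_alt
proof (intro conjI allI impI)
  have bl: "bounded_linear a'" using a(1) has_derivative_bounded_linear by blast
  then show "bounded_linear (\<lambda>h. a' h *\<^sub>R A x)"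
    by (rule bounded_linear_compose[OF bounded_linear_scaleR_left])
  fix e :: real assume e: "e > 0"
  obtain K where K: "K > 0" "\<And>h. norm (a' h) \<le> K * norm h"
    using bounded_linear.pos_bounded[OF bl] by (metis mult.commute)
  \<comment> \<open>Chosen with \<open>e2\<close> so that \<open>(K + e1) e2\<close> and
    \<open>e1 |A x|\<close> are each at most \<open>e / 2\<close>.\<close>
  define e1 where "e1 = e / (2 * (norm (A x) + 1))"
  define e2 where "e2 = min 1 (e / (2 * (K + e1)))"
  have e1: "e1 > 0" unfolding e1_def using e by (simp add: add_nonneg_pos)
  have e2: "e2 > 0" unfolding e2_def using e e1 K by simp
  obtain d1 where d1: "d1 > 0" "\<forall>y\<in>S. norm (y - x) < d1 \<longrightarrow> norm (a y - a x - a' (y - x)) \<le> e1 * norm (y - x)"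
    using a(1) e1 unfolding has_derivative_within_alt by blast
  obtain d2 where d2: "d2 > 0" "\<forall>y\<in>S. dist y x < d2 \<longrightarrow> dist (A y) (A x) < e2"
    using A e2 unfolding continuous_within_eps_delta by blast
  show "\<exists>d>0. \<forall>y\<in>S. norm (y - x) < d \<longrightarrow>
          norm (a y *\<^sub>R A y - a x *\<^sub>R A x - a' (y - x) *\<^sub>R A x) \<le> e * norm (y - x)"
  proof (intro exI[of _ "min d1 d2"] conjI ballI impI)
    fix y assume y: "y \<in> S" "norm (y - x) < min d1 d2"
    have 1: "\<bar>a y - a' (y - x)\<bar> \<le> e1 * norm (y - x)" using d1 y a(2) by auto
    have "\<bar>a' (y - x)\<bar> \<le> K * norm (y - x)" using K(2) by simp
    with 1 have 2: "\<bar>a y\<bar> \<le> (K + e1) * norm (y - x)" by (simp add: algebra_simps)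
    have 3: "norm (A y - A x) \<le> e2" using d2 y by (simp add: dist_norm less_imp_le)
    have "norm (a y *\<^sub>R A y - a x *\<^sub>R A x - a' (y - x) *\<^sub>R A x)
      = norm (a y *\<^sub>R (A y - A x) + (a y - a' (y - x)) *\<^sub>R A x)"
      using a(2) by (simp add: algebra_simps)
    also have "\<dots> \<le> \<bar>a y\<bar> * norm (A y - A x) + \<bar>a y - a' (y - x)\<bar> * norm (A x)"
      by (metis norm_scaleR norm_triangle_ineq)
    also have "\<dots> \<le> ((K + e1) * norm (y - x)) * e2 + (e1 * norm (y - x)) * norm (A x)"
      using 1 2 3 by (intro add_mono mult_mono mult_right_mono) (auto intro: order_trans[OF abs_ge_zero])
    also have "\<dots> = ((K + e1) * e2 + e1 * norm (A x)) * norm (y - x)" by (simp add: algebra_simps)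
    also have "\<dots> \<le> e * norm (y - x)"
    proof (intro mult_right_mono)
      have "(K + e1) * e2 \<le> (K + e1) * (e / (2 * (K + e1)))"
        using K e1 by (intro mult_left_mono) (auto simp: e2_def)
      also have "\<dots> = e / 2" using K e1 by (simp add: field_simps)
      finally have "(K + e1) * e2 \<le> e / 2" .
      moreover have "e1 * norm (A x) \<le> e1 * (norm (A x) + 1)" using e1 by simp
      moreover have "e1 * (norm (A x) + 1) = e / 2"
        unfolding e1_def using norm_ge_zero[of "A x"] by (simp add: field_simps add_nonneg_eq_0_iff)
      ultimately show "(K + e1) * e2 + e1 * norm (A x) \<le> e" by linarith
    qed simp
    finally show "norm (a y *\<^sub>R A y - a x *\<^sub>R A x - a' (y - x) *\<^sub>R A x) \<le> e * norm (y - x)" .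
  qed (use d1 d2 in simp)
qed


text \<open>Transfers a bound on difference quotients to the derivative. It converts Lipschitz
  closeness of a map to the identity into closeness of its derivative to the identity.\<close>

lemma norm_limit_within_line_le:
  assumes g: "(g has_vector_derivative d) (at (0::real))" "g 0 = c" and e: "e > 0"
    and le: "\<And>t. \<bar>t\<bar> < e \<Longrightarrow> norm (g t - c - t *\<^sub>R v) \<le> M * \<bar>t\<bar>"
  shows "norm (d - v) \<le> M"
proof (rule field_le_epsilon)
  fix \<epsilon> :: real assume \<epsilon>: "\<epsilon> > 0"
  obtain \<delta> where \<delta>: "\<delta> > 0" "\<forall>t. norm (t - 0) < \<delta> \<longrightarrow> norm (g t - g 0 - (t - 0) *\<^sub>R d) \<le> \<epsilon> * norm (t - 0)"
    using g(1) \<epsilon> unfolding has_vector_derivative_def has_derivative_within_alt by auto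
  define t where "t = min \<delta> e / 2"
  have t: "t > 0" "\<bar>t\<bar> < \<delta>" "\<bar>t\<bar> < e" using \<delta> e by (auto simp: t_def)
  have 1: "norm (g t - c - t *\<^sub>R d) \<le> \<epsilon> * t" using \<delta>(2)[rule_format, of t] t g(2) by simp
  have 2: "norm (g t - c - t *\<^sub>R v) \<le> M * t" using le[OF t(3)] t by simp
  have "t * norm (d - v) = norm (t *\<^sub>R (d - v))" using t by simp
  also have "\<dots> = norm ((g t - c - t *\<^sub>R v) - (g t - c - t *\<^sub>R d))" by (simp add: algebra_simps)
  also have "\<dots> \<le> M * t + \<epsilon> * t" using 1 2 norm_triangle_ineq4[of "g t - c - t *\<^sub>R v" "g t - c - t *\<^sub>R d"] by linarith
  finally have "t * norm (d - v) \<le> t * (M + \<epsilon>)" by (simp add: algebra_simps)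
  then show "norm (d - v) \<le> M + \<epsilon>" using t by simp
qed

text \<open>The orthogonal projection onto \<open>W\<close> fixes every value of \<open>f\<close>,
  so it commutes with differentiation along the line and fixes \<open>D v\<close>.\<close>

lemma derivative_in_subspace:
  fixes V :: "'e::euclidean_space set" and f :: "'e \<Rightarrow> 'f::euclidean_space"
  assumes V: "subspace V" "openin (top_of_set V) S" and W: "subspace W" and f: "\<And>x. x \<in> S \<Longrightarrow> f x \<in> W"
    and "x \<in> S" "v \<in> V" "(f has_derivative D) (at x within S)"
  shows "D v \<in> W"
proof -
  have d: "((\<lambda>t. f (x + t *\<^sub>R v)) has_vector_derivative D v) (at 0)"
    using has_derivative_line[OF V assms(5-7)] .
  obtain T where T: "open T" "(0::real) \<in> T" "\<And>t. t \<in> T \<Longrightarrow> x + t *\<^sub>R v \<in> S"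
    using openin_subspace_line[OF V assms(5,6)] by blast
  obtain B where B: "finite B" "B \<subseteq> W" "\<And>x. x \<in> W \<Longrightarrow> (\<Sum>b\<in>B. (x \<bullet> b) *\<^sub>R b) = x"
    using subspace_orthonormal_expansion[OF W] by metis
  define P where "P = (\<lambda>y. \<Sum>b\<in>B. (y \<bullet> b) *\<^sub>R b)"
  have "((\<lambda>t. P (f (x + t *\<^sub>R v))) has_vector_derivative P (D v)) (at 0)"
    unfolding P_def using d
    by (intro has_vector_derivative_sum bounded_linear.has_vector_derivative[OF
        bounded_linear_compose[OF bounded_linear_scaleR_left bounded_linear_inner_left]])
  moreover have "P (f (x + t *\<^sub>R v)) = f (x + t *\<^sub>R v)" if "t \<in> T" for t
    unfolding P_def using f T(3)[OF that] B(3) by blast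
  ultimately have "((\<lambda>t. f (x + t *\<^sub>R v)) has_vector_derivative P (D v)) (at 0)"
    by (rule has_vector_derivative_transform_within_open[OF _ T(1,2)])
  with d have "P (D v) = D v" by (rule vector_derivative_unique_at[rotated])
  moreover have "P (D v) \<in> W" unfolding P_def using B(2) W by (intro subspace_sum subspace_scale) auto
  ultimately show ?thesis by simp
qed

text \<open>The derivative of \<open>f\<close> at each point is within 1/2 of the identity, so it
  can be solved on \<open>V\<close>; \<open>A y b\<close> is the solution for the right-hand side
  \<open>b\<close> at the point \<open>g y\<close>. Smoothness of \<open>g\<close> reduces to that
  of the vectors \<open>A y b\<close>, and both are obtained together.\<close>

lemma smooth_on_inverse:
  fixes f g :: "'e::euclidean_space \<Rightarrow> 'e"
  assumes V: "subspace V" and S: "openin (top_of_set V) S" and f: "smooth_on V S f" "\<And>x. x \<in> S \<Longrightarrow> f x \<in> V"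
    and lip: "\<And>x y. x \<in> S \<Longrightarrow> y \<in> S \<Longrightarrow> norm (f x - f y - (x - y)) \<le> (1/2) * norm (x - y)"
    and T: "openin (top_of_set V) T" and g: "\<And>y. y \<in> T \<Longrightarrow> g y \<in> S \<and> f (g y) = y"
  shows "smooth_on V T g"
proof -
  have SV: "S \<subseteq> V" and TV: "T \<subseteq> V" using S T openin_imp_subset by auto
  obtain B where B: "finite B" "B \<subseteq> V" "\<And>x. x \<in> V \<Longrightarrow> (\<Sum>b\<in>B. (x \<bullet> b) *\<^sub>R b) = x"
     "\<And>b. b \<in> B \<Longrightarrow> norm b = 1"
    using subspace_orthonormal_expansion[OF V] by metis
  define F where "F = (\<lambda>x v. \<Sum>b\<in>B. (v \<bullet> b) *\<^sub>R dirD f b x)"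
  have Flin: "linear (F x)" for x
    unfolding F_def by (intro linear_compose_sum ballI linearI) (simp_all add: inner_add_left algebra_simps)
  have Fder: "(f has_derivative F x) (at x within S)" if "x \<in> S" for x
  proof -
    obtain D where D: "(f has_derivative D) (at x within S)" using smooth_on_differentiable[OF f(1) \<open>x \<in> S\<close>] .
    have Db: "D b = dirD f b x" if "b \<in> B" for b
      using dirD_eq[OF V S \<open>x \<in> S\<close> _ D] B(2) that by (simp add: subset_iff)
    have "F x = (\<lambda>v. \<Sum>b\<in>B. (v \<bullet> b) *\<^sub>R D b)" unfolding F_def by (simp add: Db)
    then show ?thesis using has_derivative_expansion[OF B(1,3) V SV that D] by simp
  qed
  have FV: "F x v \<in> V" if "x \<in> S" "v \<in> V" for x v
    using derivative_in_subspace[OF V S V f(2) that Fder[OF that(1)]] by simp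
  have Fid: "norm (F x v - v) \<le> (1/2) * norm v" if xv: "x \<in> S" "v \<in> V" for x v
  proof -
    obtain T where T: "open T" "(0::real) \<in> T" "\<And>t. t \<in> T \<Longrightarrow> x + t *\<^sub>R v \<in> S"
      using openin_subspace_line[OF V S xv] by blast
    then obtain e where e: "e > 0" "ball 0 e \<subseteq> T" using open_contains_ball by blast
    show ?thesis
    proof (rule norm_limit_within_line_le[OF has_derivative_line[OF V S xv Fder[OF xv(1)]] _ e(1)])
      fix t :: real assume "\<bar>t\<bar> < e"
      then have "x + t *\<^sub>R v \<in> S" using T(3) e(2) by auto
      from lip[OF this xv(1)] show "norm (f (x + t *\<^sub>R v) - f x - t *\<^sub>R v) \<le> (1/2) * norm v * \<bar>t\<bar>"
        by (simp add: mult.commute)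
    qed simp
  qed
  have Fbd: "norm u \<le> 2 * norm (F x u)" if "x \<in> S" "u \<in> V" for x u
    using Fid[OF that] norm_triangle_ineq3[of "F x u" u] by linarith
  have Fsurj: "\<exists>u\<in>V. F x u = v" if "x \<in> S" "v \<in> V" for x v
  proof -
    obtain u where "u \<in> V" "F x u = v"
    proof (rule perturbed_identity_surj[OF V, of "2 * norm v + 1" "F x" v])
      show "norm (F x u - F x w - (u - w)) \<le> (1/2) * norm (u - w)" if "u \<in> V" "w \<in> V" for u w
        using Fid[OF \<open>x \<in> S\<close> subspace_diff[OF V that]] by (simp add: linear_diff[OF Flin])
    qed (use that \<open>x \<in> S\<close> \<open>v \<in> V\<close> FV in \<open>auto simp: linear_0[OF Flin] add_nonneg_pos\<close>)
    then show ?thesis by blast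
  qed
  define A where "A = (\<lambda>y b. SOME u. u \<in> V \<and> F (g y) u = b)"
  have A: "A y b \<in> V" "F (g y) (A y b) = b" if "y \<in> T" "b \<in> V" for y b
  proof -
    have "\<exists>u. u \<in> V \<and> F (g y) u = b" using Fsurj[of "g y" b] g[OF that(1)] that(2) by blast
    then have "A y b \<in> V \<and> F (g y) (A y b) = b" unfolding A_def by (rule someI_ex)
    then show "A y b \<in> V" "F (g y) (A y b) = b" by auto
  qed
  define G where "G = (\<lambda>y v. \<Sum>b\<in>B. (v \<bullet> b) *\<^sub>R A y b)"
  have Glin: "linear (G y)" for y
    unfolding G_def by (intro linear_compose_sum ballI linearI) (simp_all add: inner_add_left algebra_simps)
  have G: "G y v \<in> V" "F (g y) (G y v) = v" if "y \<in> T" "v \<in> V" for y v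
  proof -
    show "G y v \<in> V" unfolding G_def using A that(1) B(2) V by (intro subspace_sum subspace_scale) auto
    have "F (g y) (G y v) = (\<Sum>b\<in>B. (v \<bullet> b) *\<^sub>R F (g y) (A y b))"
      by (simp add: G_def linear_sum[OF Flin] linear_cmul[OF Flin])
    also have "\<dots> = (\<Sum>b\<in>B. (v \<bullet> b) *\<^sub>R b)" using A(2) that(1) B(2) by (intro sum.cong) auto
    finally show "F (g y) (G y v) = v" using B(3)[OF that(2)] by simp
  qed
  have Gbd: "norm (G y v) \<le> 2 * norm v" if "y \<in> T" "v \<in> V" for y v
    using Fbd[of "g y" "G y v"] G[OF that] g[OF that(1)] by simp
  have Finj: "u = w" if "x \<in> S" "u \<in> V" "w \<in> V" "F x u = F x w" for x u w
    using Fbd[OF that(1) subspace_diff[OF V that(2,3)]] that(4) by (simp add: linear_diff[OF Flin])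
  have glip: "norm (g y - g z) \<le> 2 * norm (y - z)" if "y \<in> T" "z \<in> T" for y z
    using lip[of "g y" "g z"] g[OF that(1)] g[OF that(2)] norm_triangle_ineq3[of "y - z" "g y - g z"]
    by simp
  have gder: "(g has_derivative G y) (at y within T)" if y: "y \<in> T" for y
    unfolding has_derivative_within_alt
  proof (intro conjI allI impI)
    show "bounded_linear (G y)" using Glin linear_conv_bounded_linear by blast
    fix e :: real assume "e > 0"
    then have "e / 4 > 0" by simp
    then obtain d where d: "d > 0" "\<forall>x\<in>S. norm (x - g y) < d \<longrightarrow>
        norm (f x - f (g y) - F (g y) (x - g y)) \<le> e / 4 * norm (x - g y)"
      using Fder[of "g y"] g[OF y] unfolding has_derivative_within_alt by blast
    show "\<exists>d>0. \<forall>z\<in>T. norm (z - y) < d \<longrightarrow> norm (g z - g y - G y (z - y)) \<le> e * norm (z - y)"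
    proof (intro exI[of _ "d / 2"] conjI ballI impI)
      fix z assume z: "z \<in> T" "norm (z - y) < d / 2"
      have V': "g z - g y \<in> V" "z - y \<in> V" using g[OF z(1)] g[OF y] SV TV z(1) y V by (auto intro!: subspace_diff)
      have "norm (g z - g y) < d" using glip[OF z(1) y] z(2) by simp
      then have "norm (z - y - F (g y) (g z - g y)) \<le> e / 4 * norm (g z - g y)"
        using d(2) g[OF z(1)] g[OF y] by auto
      also have "\<dots> \<le> e / 4 * (2 * norm (z - y))"
        using glip[OF z(1) y] \<open>e > 0\<close> by (intro mult_left_mono) auto
      finally have 1: "norm (z - y - F (g y) (g z - g y)) \<le> e / 2 * norm (z - y)" by simp
      have "norm (g z - g y - G y (z - y)) \<le> 2 * norm (F (g y) (g z - g y - G y (z - y)))"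
        using g[OF y] by (intro Fbd subspace_diff[OF V V'(1) G(1)[OF y V'(2)]]) auto
      also have "F (g y) (g z - g y - G y (z - y)) = - (z - y - F (g y) (g z - g y))"
        using G(2)[OF y V'(2)] by (simp add: linear_diff[OF Flin, of _ "g z - g y"])
      finally show "norm (g z - g y - G y (z - y)) \<le> e * norm (z - y)" using 1 by (simp add: norm_minus_commute)
    qed (use d in simp)
  qed
  have gcont: "continuous_on T g" using gder has_derivative_continuous_on by blast
  have phi_smooth: "smooth_on V S (dirD f e)" if "e \<in> B" for e
    using smooth_on_dirD[OF V S f(1)] B(2) that by blast
  have gS: "g ` T \<subseteq> S" using g by blast
  \<comment> \<open>A resolvent identity: \<open>A z b\<close> solves the equation at
    \<open>z\<close>, and its defect at \<open>y\<close>, fed through the inverse at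
    \<open>y\<close>, is the correction. The defect vanishes for \<open>y = z\<close>, so the
    formula can be differentiated at \<open>z\<close> knowing only that \<open>A\<close> is
    continuous.\<close>
  have A_eq: "A y b = A z b - (\<Sum>c\<in>B. (((\<Sum>e\<in>B. (A z b \<bullet> e) *\<^sub>R dirD f e (g y)) - b) \<bullet> c) *\<^sub>R A y c)"
    and A_near: "norm (A y b - A z b) \<le> 2 * norm ((\<Sum>e\<in>B. (A z b \<bullet> e) *\<^sub>R dirD f e (g y)) - b)"
    if "y \<in> T" "z \<in> T" "b \<in> V" for y z b
  proof -
    define w where "w = F (g y) (A z b) - b"
    have w: "w \<in> V" unfolding w_def
      using FV[OF conjunct1[OF g[OF that(1)]] A(1)[OF that(2,3)]] that(3) by (rule subspace_diff[OF V])
    have "F (g y) (A z b - G y w) = b"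
      using G(2)[OF that(1) w] by (simp add: linear_diff[OF Flin] w_def)
    with A(2)[OF that(1,3)] have "F (g y) (A y b) = F (g y) (A z b - G y w)" by simp
    moreover have "g y \<in> S" using g[OF that(1)] ..
    ultimately have "A y b = A z b - G y w"
      using Finj[OF _ A(1)[OF that(1,3)] subspace_diff[OF V A(1)[OF that(2,3)] G(1)[OF that(1) w]]] by blast
    then show "A y b = A z b - (\<Sum>c\<in>B. (((\<Sum>e\<in>B. (A z b \<bullet> e) *\<^sub>R dirD f e (g y)) - b) \<bullet> c) *\<^sub>R A y c)"
      by (simp add: G_def w_def F_def)
    have "norm (A y b - A z b) = norm (G y w)" using \<open>A y b = A z b - G y w\<close> by simp
    then show "norm (A y b - A z b) \<le> 2 * norm ((\<Sum>e\<in>B. (A z b \<bullet> e) *\<^sub>R dirD f e (g y)) - b)"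
      using Gbd[OF that(1) w] by (simp add: w_def F_def)
  qed
  have w0: "(\<Sum>e\<in>B. (A z b \<bullet> e) *\<^sub>R dirD f e (g z)) = b" if "z \<in> T" "b \<in> V" for z b
    using A(2)[OF that] by (simp add: F_def)
  have Acont: "continuous (at z within T) (\<lambda>y. A y b)" if z: "z \<in> T" "b \<in> V" for z b
  proof -
    have "continuous (at z within T) (\<lambda>y. dirD f e (g y))" if "e \<in> B" for e
    proof -
      have "continuous_on T (\<lambda>y. dirD f e (g y))"
        by (rule continuous_on_compose2[OF smooth_on_continuous[OF phi_smooth[OF that]] gcont gS])
      then show ?thesis using z(1) continuous_on_eq_continuous_within by blast
    qed
    then have "continuous (at z within T) (\<lambda>y. 2 * norm ((\<Sum>e\<in>B. (A z b \<bullet> e) *\<^sub>R dirD f e (g y)) - b))"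
      by (intro continuous_intros)
    then have "((\<lambda>y. 2 * norm ((\<Sum>e\<in>B. (A z b \<bullet> e) *\<^sub>R dirD f e (g y)) - b)) \<longlongrightarrow> 0) (at z within T)"
      unfolding continuous_within using w0[OF z] by simp
    then have "((\<lambda>y. A y b - A z b) \<longlongrightarrow> 0) (at z within T)"
      by (rule Lim_null_comparison[rotated]) (use A_near[OF _ z] in \<open>auto simp: eventually_at_filter\<close>)
    then show ?thesis unfolding continuous_within by (simp add: LIM_zero_iff)
  qed
  \<comment> \<open>Simultaneous induction: regularity of \<open>A\<close> raises that of
    \<open>g\<close>, because \<open>A\<close> gives the derivative of \<open>g\<close>, and then
    \<open>g\<close> and \<open>A\<close> together raise that of \<open>A\<close>.\<close>
  have "Ck_on k V T g \<and> (\<forall>b\<in>V. Ck_on k V T (\<lambda>y. A y b))" for k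
  proof (induction k)
    case 0
    then show ?case using gcont Acont by (auto simp: continuous_on_eq_continuous_within)
  next
    case (Suc k)
    have g': "Ck_on (Suc k) V T g" unfolding Ck_on.simps(2)
    proof (intro exI[of _ G] conjI ballI)
      show "Ck_on k V T (\<lambda>y. G y v)" for v
        unfolding G_def using Suc B(2)
        by (intro Ck_on_sum Ck_on_bounded_linear_compose[OF bounded_linear_scaleR_right]) auto
    qed (rule gder)
    have "\<exists>D. (\<forall>y\<in>T. ((\<lambda>y. dirD f e (g y)) has_derivative D y) (at y within T)) \<and>
       (\<forall>v\<in>V. Ck_on k V T (\<lambda>y. D y v))" if "e \<in> B" for e
    proof -
      have "Ck_on (Suc k) V T (\<lambda>y. dirD f e (g y))"
        by (rule Ck_on_compose[OF V SV gS g' smooth_on_Ck[OF phi_smooth[OF that]]])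
      then show ?thesis unfolding Ck_on.simps(2) .
    qed
    then obtain D where D: "\<And>e y. e \<in> B \<Longrightarrow> y \<in> T \<Longrightarrow> ((\<lambda>y. dirD f e (g y)) has_derivative D e y) (at y within T)"
      "\<And>e v. e \<in> B \<Longrightarrow> v \<in> V \<Longrightarrow> Ck_on k V T (\<lambda>y. D e y v)" by metis
    \<comment> \<open>The derivative below is the familiar minus inverse, times derivative of the
      operator, times inverse, written in coordinates.\<close>
    have "Ck_on (Suc k) V T (\<lambda>y. A y b)" if b: "b \<in> V" for b
      unfolding Ck_on.simps(2)
    proof (intro exI[of _ "\<lambda>y v. - (\<Sum>c\<in>B. ((\<Sum>e\<in>B. (A y b \<bullet> e) *\<^sub>R D e y v) \<bullet> c) *\<^sub>R A y c)"] conjI ballI)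
      fix z assume z: "z \<in> T"
      let ?w = "\<lambda>y. (\<Sum>e\<in>B. (A z b \<bullet> e) *\<^sub>R dirD f e (g y)) - b"
      have w: "(?w has_derivative (\<lambda>v. (\<Sum>e\<in>B. (A z b \<bullet> e) *\<^sub>R D e z v) - 0)) (at z within T)"
        by (intro has_derivative_diff has_derivative_sum has_derivative_scaleR_right has_derivative_const D(1) z)
      have "((\<lambda>y. A z b - (\<Sum>c\<in>B. (?w y \<bullet> c) *\<^sub>R A y c)) has_derivative
        (\<lambda>v. 0 - (\<Sum>c\<in>B. (((\<Sum>e\<in>B. (A z b \<bullet> e) *\<^sub>R D e z v) - 0) \<bullet> c) *\<^sub>R A z c))) (at z within T)"
        using B(2) z by (intro has_derivative_diff has_derivative_const has_derivative_sum
            has_derivative_scaleR_vanishing has_derivative_inner_left w Acont) (auto simp: w0[OF z b])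
      then have "((\<lambda>y. A z b - (\<Sum>c\<in>B. (?w y \<bullet> c) *\<^sub>R A y c)) has_derivative
        (\<lambda>v. - (\<Sum>c\<in>B. ((\<Sum>e\<in>B. (A z b \<bullet> e) *\<^sub>R D e z v) \<bullet> c) *\<^sub>R A z c))) (at z within T)"
        by simp
      then show "((\<lambda>y. A y b) has_derivative
        (\<lambda>v. - (\<Sum>c\<in>B. ((\<Sum>e\<in>B. (A z b \<bullet> e) *\<^sub>R D e z v) \<bullet> c) *\<^sub>R A z c))) (at z within T)"
        by (rule has_derivative_transform[OF z, rotated]) (rule A_eq[OF _ z b])
    next
      fix v assume v: "v \<in> V"
      have A': "Ck_on k V T (\<lambda>y. A y c)" if "c \<in> V" for c using Suc that by blast
      have "Ck_on k V T (\<lambda>y. (\<Sum>c\<in>B. ((\<Sum>e\<in>B. (A y b \<bullet> e) *\<^sub>R D e y v) \<bullet> c) *\<^sub>R A y c))"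
      proof (rule Ck_on_sum)
        fix c assume c: "c \<in> B"
        have "Ck_on k V T (\<lambda>y. (A y b \<bullet> e) *\<^sub>R D e y v)" if "e \<in> B" for e
          by (rule Ck_on_bilinear[OF bounded_bilinear_scaleR
              Ck_on_bounded_linear_compose[OF bounded_linear_inner_left A'[OF b]] D(2)[OF that v]])
        then have "Ck_on k V T (\<lambda>y. \<Sum>e\<in>B. (A y b \<bullet> e) *\<^sub>R D e y v)" by (rule Ck_on_sum)
        then have "Ck_on k V T (\<lambda>y. (\<Sum>e\<in>B. (A y b \<bullet> e) *\<^sub>R D e y v) \<bullet> c)"
          by (rule Ck_on_bounded_linear_compose[OF bounded_linear_inner_left])
        moreover have "Ck_on k V T (\<lambda>y. A y c)" using A' c B(2) by blast
        ultimately show "Ck_on k V T (\<lambda>y. ((\<Sum>e\<in>B. (A y b \<bullet> e) *\<^sub>R D e y v) \<bullet> c) *\<^sub>R A y c)"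
          by (rule Ck_on_bilinear[OF bounded_bilinear_scaleR])
      qed
      then show "Ck_on k V T (\<lambda>y. - (\<Sum>c\<in>B. ((\<Sum>e\<in>B. (A y b \<bullet> e) *\<^sub>R D e y v) \<bullet> c) *\<^sub>R A y c))"
        by (rule Ck_on_bounded_linear_compose[OF bounded_linear_minus[OF bounded_linear_ident]])
    qed
    with g' show ?case by blast
  qed
  then show ?thesis unfolding smooth_on_def by blast
qed

section \<open>Charts, tangent vectors and smooth maps\<close>

context smooth_manifold
begin

lemma chart_open: "(U, \<phi>) \<in> atlas M \<Longrightarrow> openin (mtop M) U"
  and chart_image_open: "(U, \<phi>) \<in> atlas M \<Longrightarrow> openin (top_of_set (model M)) (\<phi> ` U)"
  and chart_homeomorphic: "(U, \<phi>) \<in> atlas M \<Longrightarrow>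
    homeomorphic_map (subtopology (mtop M) U) (top_of_set (\<phi> ` U)) \<phi>"
  using charts[of "(U, \<phi>)"] by (auto simp: is_chart_def)

lemma chart_subset_points: "(U, \<phi>) \<in> atlas M \<Longrightarrow> U \<subseteq> points M"
  using chart_open openin_subset by blast

lemma chart_image_subset: "(U, \<phi>) \<in> atlas M \<Longrightarrow> \<phi> ` U \<subseteq> model M"
  using chart_image_open openin_imp_subset by blast

lemma chart_inj: "(U, \<phi>) \<in> atlas M \<Longrightarrow> inj_on \<phi> U"
  using chart_homeomorphic[of U \<phi>] chart_subset_points[of U \<phi>]
  by (auto simp: homeomorphic_eq_everything_map topspace_subtopology_subset Int_absorb1)

lemma chart_inv [simp]:
  "(U, \<phi>) \<in> atlas M \<Longrightarrow> x \<in> U \<Longrightarrow> inv_into U \<phi> (\<phi> x) = x"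
  using chart_inj inv_into_f_f by metis

lemma chart_image_openin:
  assumes "(U, \<phi>) \<in> atlas M" "openin (mtop M) A"
  shows "openin (top_of_set (model M)) (\<phi> ` (U \<inter> A))"
proof -
  have "open_map (subtopology (mtop M) U) (top_of_set (\<phi> ` U)) \<phi>"
    using chart_homeomorphic[OF assms(1)] homeomorphic_imp_open_map by blast
  moreover have "openin (subtopology (mtop M) U) (U \<inter> A)"
    using assms(2) openin_subtopology_Int2 by blast
  ultimately have "openin (top_of_set (\<phi> ` U)) (\<phi> ` (U \<inter> A))" unfolding open_map_def by blast
  then show ?thesis using chart_image_open[OF assms(1)] openin_trans by blast
qed

lemma chart_preimage_openin:
  assumes "(U, \<phi>) \<in> atlas M" "openin (top_of_set (model M)) S"
  shows "openin (mtop M) {x \<in> U. \<phi> x \<in> S}"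
proof -
  have "continuous_map (subtopology (mtop M) U) (top_of_set (\<phi> ` U)) \<phi>"
    using chart_homeomorphic[OF assms(1)] homeomorphic_imp_continuous_map by blast
  moreover have "openin (top_of_set (\<phi> ` U)) (\<phi> ` U \<inter> S)"
  proof -
    obtain Op where "open Op" "S = model M \<inter> Op" using assms(2) by (auto simp: openin_open)
    then have "\<phi> ` U \<inter> S = \<phi> ` U \<inter> Op" using chart_image_subset[OF assms(1)] by blast
    then show ?thesis using \<open>open Op\<close> by (auto simp: openin_open)
  qed
  ultimately have "openin (subtopology (mtop M) U)
      {x \<in> topspace (subtopology (mtop M) U). \<phi> x \<in> \<phi> ` U \<inter> S}"
    by (rule openin_continuous_map_preimage)
  moreover have "{x \<in> topspace (subtopology (mtop M) U). \<phi> x \<in> \<phi> ` U \<inter> S} = {x \<in> U. \<phi> x \<in> S}"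
    using chart_subset_points[OF assms(1)] by auto
  ultimately show ?thesis using openin_open_subtopology[OF chart_open[OF assms(1)]] by simp
qed

lemma chart_at:
  assumes "p \<in> points M"
  obtains U \<phi> where "(U, \<phi>) \<in> atlas M" "p \<in> U"
  using assms atlas_covers by blast

text \<open>A single chart decides: in any other chart the function is the given expression composed
  with a smooth transition map.\<close>

lemma smooth_nearI:
  assumes c: "(U, \<phi>) \<in> atlas M" and S: "openin (top_of_set (model M)) S" "\<phi> p \<in> S" and p: "p \<in> U"
    and f: "smooth_on (model M) (S \<inter> \<phi> ` U) (\<lambda>y. f (inv_into U \<phi> y))"
  shows "smooth_near M p f"
  unfolding smooth_near_def
proof (intro exI[of _ "{x \<in> U. \<phi> x \<in> S}"] conjI ballI)
  show "openin (mtop M) {x \<in> U. \<phi> x \<in> S}" by (rule chart_preimage_openin[OF c S(1)])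
  show "p \<in> {x \<in> U. \<phi> x \<in> S}" using p S by simp
  fix d assume "d \<in> atlas M"
  then obtain W \<psi> where d: "d = (W, \<psi>)" "(W, \<psi>) \<in> atlas M" by (cases d) auto
  let ?A = "\<psi> ` (W \<inter> {x \<in> U. \<phi> x \<in> S})"
  have tr: "smooth_on (model M) ?A (\<lambda>y. \<phi> (inv_into W \<psi> y))"
    by (rule smooth_on_subset[OF transition_smooth[OF d(2) c]]) auto
  have im: "(\<lambda>y. \<phi> (inv_into W \<psi> y)) ` ?A \<subseteq> S \<inter> \<phi> ` U"
    using d(2) by auto
  have sub: "S \<inter> \<phi> ` U \<subseteq> model M" using chart_image_subset[OF c] by blast
  have "smooth_on (model M) ?A (\<lambda>y. f (inv_into U \<phi> (\<phi> (inv_into W \<psi> y))))"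
    by (rule smooth_on_compose[OF subspace_model sub im tr f])
  moreover have "f (inv_into U \<phi> (\<phi> (inv_into W \<psi> y))) = f (inv_into W \<psi> y)" if "y \<in> ?A" for y
    using that d(2) c by auto
  ultimately have "smooth_on (model M) ?A (\<lambda>y. f (inv_into W \<psi> y))"
    using smooth_on_cong[of ?A "\<lambda>y. f (inv_into U \<phi> (\<phi> (inv_into W \<psi> y)))" "\<lambda>y. f (inv_into W \<psi> y)"] by blast
  then show "case d of (U', \<phi>') \<Rightarrow> smooth_on (model M) (\<phi>' ` (U' \<inter> {x \<in> U. \<phi> x \<in> S})) (\<lambda>y. f (inv_into U' \<phi>' y))"
    by (simp add: d(1))
qed

lemma smooth_nearE:
  assumes "smooth_near M p f" "(U, \<phi>) \<in> atlas M" "p \<in> U"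
  obtains S where "openin (top_of_set (model M)) S" "\<phi> p \<in> S" "S \<subseteq> \<phi> ` U"
    "smooth_on (model M) S (\<lambda>y. f (inv_into U \<phi> y))"
proof -
  obtain A where A: "openin (mtop M) A" "p \<in> A"
    "\<forall>(U, \<phi>)\<in>atlas M. smooth_on (model M) (\<phi> ` (U \<inter> A)) (\<lambda>y. f (inv_into U \<phi> y))"
    using assms(1) unfolding smooth_near_def by blast
  show ?thesis
    using that[of "\<phi> ` (U \<inter> A)"] chart_image_openin[OF assms(2) A(1)] A(2,3) assms(2,3) by blast
qed

lemma smooth_near_cong:
  assumes "smooth_near M p f" "openin (mtop M) A" "p \<in> A" "\<And>x. x \<in> A \<Longrightarrow> g x = f x"
  shows "smooth_near M p g"
proof -
  obtain A' where A': "openin (mtop M) A'" "p \<in> A'"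
    "\<forall>(U, \<phi>)\<in>atlas M. smooth_on (model M) (\<phi> ` (U \<inter> A')) (\<lambda>y. f (inv_into U \<phi> y))"
    using assms(1) unfolding smooth_near_def by blast
  show ?thesis unfolding smooth_near_def
  proof (intro exI[of _ "A \<inter> A'"] conjI ballI)
    fix d assume "d \<in> atlas M"
    then obtain W \<psi> where d: "d = (W, \<psi>)" "(W, \<psi>) \<in> atlas M" by (cases d) auto
    have "smooth_on (model M) (\<psi> ` (W \<inter> A')) (\<lambda>y. f (inv_into W \<psi> y))" using A'(3) d(2) by blast
    then have "smooth_on (model M) (\<psi> ` (W \<inter> (A \<inter> A'))) (\<lambda>y. f (inv_into W \<psi> y))"
      by (rule smooth_on_subset) blast
    moreover have "f (inv_into W \<psi> y) = g (inv_into W \<psi> y)" if "y \<in> \<psi> ` (W \<inter> (A \<inter> A'))" for y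
      using that d(2) assms(4) by auto
    ultimately have "smooth_on (model M) (\<psi> ` (W \<inter> (A \<inter> A'))) (\<lambda>y. g (inv_into W \<psi> y))"
      using smooth_on_cong[of "\<psi> ` (W \<inter> (A \<inter> A'))" "\<lambda>y. f (inv_into W \<psi> y)" "\<lambda>y. g (inv_into W \<psi> y)"] by blast
    then show "case d of (U', \<phi>') \<Rightarrow> smooth_on (model M) (\<phi>' ` (U' \<inter> (A \<inter> A'))) (\<lambda>y. g (inv_into U' \<phi>' y))"
      by (simp add: d(1))
  qed (use assms A' in auto)
qed

lemma smooth_near_const: "p \<in> points M \<Longrightarrow> smooth_near M p (\<lambda>x. c)"
  unfolding smooth_near_def by (rule exI[of _ "points M"]) (auto simp: smooth_on_const)

lemma smooth_near_binop:
  assumes "smooth_near M p f" "smooth_near M p g"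
    and h: "\<And>S u v. smooth_on (model M) S u \<Longrightarrow> smooth_on (model M) S v \<Longrightarrow>
      smooth_on (model M) S (\<lambda>y. h (u y) (v y))"
  shows "smooth_near M p (\<lambda>x. h (f x) (g x))"
proof -
  obtain A where A: "openin (mtop M) A" "p \<in> A"
    "\<forall>(U, \<phi>)\<in>atlas M. smooth_on (model M) (\<phi> ` (U \<inter> A)) (\<lambda>y. f (inv_into U \<phi> y))"
    using assms(1) unfolding smooth_near_def by blast
  obtain A' where A': "openin (mtop M) A'" "p \<in> A'"
    "\<forall>(U, \<phi>)\<in>atlas M. smooth_on (model M) (\<phi> ` (U \<inter> A')) (\<lambda>y. g (inv_into U \<phi> y))"
    using assms(2) unfolding smooth_near_def by blast
  show ?thesis unfolding smooth_near_def
  proof (intro exI[of _ "A \<inter> A'"] conjI ballI)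
    fix d assume "d \<in> atlas M"
    then obtain W \<psi> where d: "d = (W, \<psi>)" "(W, \<psi>) \<in> atlas M" by (cases d) auto
    have "smooth_on (model M) (\<psi> ` (W \<inter> A)) (\<lambda>y. f (inv_into W \<psi> y))"
      "smooth_on (model M) (\<psi> ` (W \<inter> A')) (\<lambda>y. g (inv_into W \<psi> y))" using A(3) A'(3) d(2) by blast+
    then have "smooth_on (model M) (\<psi> ` (W \<inter> (A \<inter> A'))) (\<lambda>y. f (inv_into W \<psi> y))"
      "smooth_on (model M) (\<psi> ` (W \<inter> (A \<inter> A'))) (\<lambda>y. g (inv_into W \<psi> y))"
      by (auto elim!: smooth_on_subset)
    then have "smooth_on (model M) (\<psi> ` (W \<inter> (A \<inter> A'))) (\<lambda>y. h (f (inv_into W \<psi> y)) (g (inv_into W \<psi> y)))"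
      by (rule h)
    then show "case d of (U', \<phi>') \<Rightarrow> smooth_on (model M) (\<phi>' ` (U' \<inter> (A \<inter> A')))
        (\<lambda>y. h (f (inv_into U' \<phi>' y)) (g (inv_into U' \<phi>' y)))"
      by (simp add: d(1))
  qed (use A A' in auto)
qed

lemma smooth_near_add: "smooth_near M p f \<Longrightarrow> smooth_near M p g \<Longrightarrow> smooth_near M p (\<lambda>x. f x + g x)"
  by (rule smooth_near_binop[where h = "(+)"]) (auto intro: smooth_on_add)

lemma smooth_near_mult: "smooth_near M p f \<Longrightarrow> smooth_near M p g \<Longrightarrow> smooth_near M p (\<lambda>x. f x * g x)"
  by (rule smooth_near_binop[where h = "(*)"]) (auto intro: smooth_on_mult)

lemma smooth_near_sum:
  assumes "\<And>i. i \<in> I \<Longrightarrow> smooth_near M p (f i)" "p \<in> points M"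
  shows "smooth_near M p (\<lambda>x. \<Sum>i\<in>I. f i x)"
  using assms(1)
  by (induction I rule: infinite_finite_induct) (simp_all add: smooth_near_const assms(2) smooth_near_add)

lemma smooth_near_chart:
  assumes c: "(U, \<phi>) \<in> atlas M" and p: "p \<in> U"
    and S: "openin (top_of_set (model M)) S" "\<phi> p \<in> S" and f: "smooth_on (model M) S f"
  shows "smooth_near M p (\<lambda>x. f (\<phi> x))"
proof (rule smooth_nearI[OF c S p])
  have "smooth_on (model M) (S \<inter> \<phi> ` U) f" by (rule smooth_on_subset[OF f]) blast
  moreover have "f y = f (\<phi> (inv_into U \<phi> y))" if "y \<in> S \<inter> \<phi> ` U" for y
    using that by (simp add: f_inv_into_f)
  ultimately show "smooth_on (model M) (S \<inter> \<phi> ` U) (\<lambda>y. f (\<phi> (inv_into U \<phi> y)))"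
    using smooth_on_cong[of "S \<inter> \<phi> ` U" f "\<lambda>y. f (\<phi> (inv_into U \<phi> y))"] by blast
qed

lemma smooth_near_derivative:
  assumes c: "(U, \<phi>) \<in> atlas M" and p: "p \<in> U" and f: "smooth_near M p f"
  obtains D S where "openin (top_of_set (model M)) S" "\<phi> p \<in> S" "S \<subseteq> \<phi> ` U"
    "((\<lambda>y. f (inv_into U \<phi> y)) has_derivative D) (at (\<phi> p) within S)"
    "smooth_on (model M) S (\<lambda>y. f (inv_into U \<phi> y))"
  using smooth_nearE[OF f c p] smooth_on_differentiable by metis

lemma coord_vector_eq:
  assumes c: "(U, \<phi>) \<in> atlas M" and p: "p \<in> U" and f: "smooth_near M p f" and v: "v \<in> model M"
    and S: "openin (top_of_set (model M)) S" "\<phi> p \<in> S"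
    and D: "((\<lambda>y. f (inv_into U \<phi> y)) has_derivative D) (at (\<phi> p) within S)"
  shows "coord_vector M (U, \<phi>) v p f = D v"
proof -
  have "((\<lambda>t. f (inv_into U \<phi> (\<phi> p + t *\<^sub>R v))) has_vector_derivative D v) (at 0)"
    by (rule has_derivative_line[OF subspace_model S v D])
  then show ?thesis
    using f by (simp add: coord_vector_def DERIV_imp_deriv has_real_derivative_iff_has_vector_derivative)
qed

lemma coord_vector_not_smooth: "\<not> smooth_near M p f \<Longrightarrow> coord_vector M c v p f = 0"
  by (simp add: coord_vector_def split: prod.split)

lemma coord_vector_linear:
  assumes c: "(U, \<phi>) \<in> atlas M" and p: "p \<in> U" and v: "v \<in> model M" "w \<in> model M"
  shows "coord_vector M (U, \<phi>) (a *\<^sub>R v + b *\<^sub>R w) p =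
    (\<lambda>f. a * coord_vector M (U, \<phi>) v p f + b * coord_vector M (U, \<phi>) w p f)"
proof
  fix f
  show "coord_vector M (U, \<phi>) (a *\<^sub>R v + b *\<^sub>R w) p f =
    a * coord_vector M (U, \<phi>) v p f + b * coord_vector M (U, \<phi>) w p f"
  proof (cases "smooth_near M p f")
    case True
    obtain D S where D: "openin (top_of_set (model M)) S" "\<phi> p \<in> S" "S \<subseteq> \<phi> ` U"
      "((\<lambda>y. f (inv_into U \<phi> y)) has_derivative D) (at (\<phi> p) within S)"
      using smooth_near_derivative[OF c p True] .
    have lin: "linear D" using D(4) has_derivative_linear by blast
    have vw: "a *\<^sub>R v + b *\<^sub>R w \<in> model M" using v subspace_model by (intro subspace_add subspace_scale)
    show ?thesis
      unfolding coord_vector_eq[OF c p True vw D(1,2,4)] coord_vector_eq[OF c p True v(1) D(1,2,4)]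
        coord_vector_eq[OF c p True v(2) D(1,2,4)]
      by (simp add: linear_add[OF lin] linear_cmul[OF lin])
  qed (simp add: coord_vector_not_smooth)
qed

lemma coord_vector_zero:
  assumes "(U, \<phi>) \<in> atlas M" "p \<in> U"
  shows "coord_vector M (U, \<phi>) 0 p = (\<lambda>f. 0)"
  using coord_vector_linear[OF assms subspace_0[OF subspace_model] subspace_0[OF subspace_model], of 0 0]
  by simp

lemma coord_vector_in_tangent_space:
  assumes c: "(U, \<phi>) \<in> atlas M" and p: "p \<in> U" and v: "v \<in> model M"
  shows "coord_vector M (U, \<phi>) v p \<in> tangent_space M p"
  unfolding tangent_space_def
proof (intro CollectI conjI allI impI)
  let ?X = "coord_vector M (U, \<phi>) v p"
  fix f g assume f: "smooth_near M p f" and g: "smooth_near M p g"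
  obtain D S where D: "openin (top_of_set (model M)) S" "\<phi> p \<in> S" "S \<subseteq> \<phi> ` U"
      "((\<lambda>y. f (inv_into U \<phi> y)) has_derivative D) (at (\<phi> p) within S)"
    using smooth_near_derivative[OF c p f] .
  obtain E T where E: "openin (top_of_set (model M)) T" "\<phi> p \<in> T" "T \<subseteq> \<phi> ` U"
      "((\<lambda>y. g (inv_into U \<phi> y)) has_derivative E) (at (\<phi> p) within T)"
    using smooth_near_derivative[OF c p g] .
  have ST: "openin (top_of_set (model M)) (S \<inter> T)" "\<phi> p \<in> S \<inter> T" using D E by auto
  have D': "((\<lambda>y. f (inv_into U \<phi> y)) has_derivative D) (at (\<phi> p) within S \<inter> T)"
    using D(4) by (rule has_derivative_subset) blast
  have E': "((\<lambda>y. g (inv_into U \<phi> y)) has_derivative E) (at (\<phi> p) within S \<inter> T)"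
    using E(4) by (rule has_derivative_subset) blast
  note X = coord_vector_eq[OF c p _ v ST]
  show "?X (\<lambda>x. f x + g x) = ?X f + ?X g"
    using X[OF f D'] X[OF g E'] X[OF smooth_near_add[OF f g] has_derivative_add[OF D' E']] by simp
  show "?X (\<lambda>x. f x * g x) = f p * ?X g + ?X f * g p"
    using X[OF f D'] X[OF g E'] X[OF smooth_near_mult[OF f g] has_derivative_mult[OF D' E']] c p
    by simp
next
  let ?X = "coord_vector M (U, \<phi>) v p"
  fix a f assume f: "smooth_near M p f"
  obtain D S where D: "openin (top_of_set (model M)) S" "\<phi> p \<in> S" "S \<subseteq> \<phi> ` U"
      "((\<lambda>y. f (inv_into U \<phi> y)) has_derivative D) (at (\<phi> p) within S)"
    using smooth_near_derivative[OF c p f] .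
  have "smooth_near M p (\<lambda>x. a * f x)"
    using smooth_near_mult[OF smooth_near_const f] p chart_subset_points[OF c] by blast
  from coord_vector_eq[OF c p this v D(1,2) has_derivative_mult_right[OF D(4)]]
  show "?X (\<lambda>x. a * f x) = a * ?X f"
    using coord_vector_eq[OF c p f v D(1,2,4)] by simp
qed (simp add: coord_vector_not_smooth)

lemma coord_vector_coordinate:
  assumes c: "(U, \<phi>) \<in> atlas M" and p: "p \<in> U" and v: "v \<in> model M"
  shows "smooth_near M p (\<lambda>x. \<phi> x \<bullet> u)" "coord_vector M (U, \<phi>) v p (\<lambda>x. \<phi> x \<bullet> u) = v \<bullet> u"
proof -
  have S: "openin (top_of_set (model M)) (\<phi> ` U)" "\<phi> p \<in> \<phi> ` U"
    using chart_image_open[OF c] p by auto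
  show sm: "smooth_near M p (\<lambda>x. \<phi> x \<bullet> u)"
    by (rule smooth_near_chart[OF c p S smooth_on_bounded_linear[OF bounded_linear_inner_left]])
  have "((\<lambda>y. y \<bullet> u) has_derivative (\<lambda>v. v \<bullet> u)) (at (\<phi> p) within \<phi> ` U)"
    by (intro derivative_intros)
  then have "((\<lambda>y. \<phi> (inv_into U \<phi> y) \<bullet> u) has_derivative (\<lambda>v. v \<bullet> u)) (at (\<phi> p) within \<phi> ` U)"
    by (rule has_derivative_transform[OF S(2), rotated]) (simp add: f_inv_into_f)
  then show "coord_vector M (U, \<phi>) v p (\<lambda>x. \<phi> x \<bullet> u) = v \<bullet> u"
    by (rule coord_vector_eq[OF c p sm v S])
qed

text \<open>Tested on the coordinate function in the direction \<open>v - w\<close>, the two vectors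
  give values that differ by \<open>|v - w|^2\<close>.\<close>

lemma coord_vector_inj:
  assumes c: "(U, \<phi>) \<in> atlas M" and p: "p \<in> U" and v: "v \<in> model M" "w \<in> model M"
    and eq: "coord_vector M (U, \<phi>) v p = coord_vector M (U, \<phi>) w p"
  shows "v = w"
proof -
  have "v \<bullet> (v - w) = w \<bullet> (v - w)"
    using coord_vector_coordinate(2)[OF c p v(1), of "v - w"]
      coord_vector_coordinate(2)[OF c p v(2), of "v - w"] eq by simp
  then have "(v - w) \<bullet> (v - w) = 0" by (simp add: inner_diff_left)
  then show ?thesis by simp
qed

lemma tangent_spaceD:
  assumes "X \<in> tangent_space M p"
  shows "smooth_near M p f \<Longrightarrow> smooth_near M p g \<Longrightarrow> X (\<lambda>x. f x + g x) = X f + X g"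
    "smooth_near M p f \<Longrightarrow> smooth_near M p g \<Longrightarrow> X (\<lambda>x. f x * g x) = f p * X g + X f * g p"
    "smooth_near M p f \<Longrightarrow> X (\<lambda>x. a * f x) = a * X f"
    "\<not> smooth_near M p f \<Longrightarrow> X f = 0"
  using assms unfolding tangent_space_def by simp_all

lemma tangent_vector_germ:
  assumes X: "X \<in> tangent_space M p" and A: "openin (mtop M) A" "p \<in> A"
    and fg: "\<And>x. x \<in> A \<Longrightarrow> f x = g x" and f: "smooth_near M p f"
  shows "X f = X g"
proof -
  note X = tangent_spaceD[OF X]
  have p: "p \<in> points M" using A openin_subset by blast
  have g: "smooth_near M p g" by (rule smooth_near_cong[OF f A]) (simp add: fg)
  let ?u = "\<lambda>x. f x + (-1) * g x"
  let ?i = "\<lambda>x. if x \<in> A then 0 else (1::real)"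
  have g': "smooth_near M p (\<lambda>x. (-1) * g x)" by (rule smooth_near_mult[OF smooth_near_const[OF p] g])
  have u: "smooth_near M p ?u" by (rule smooth_near_add[OF f g'])
  have i: "smooth_near M p ?i" by (rule smooth_near_cong[OF smooth_near_const[OF p, of 0] A]) simp
  have "X (\<lambda>x. ?u x * ?i x) = ?u p * X ?i + X ?u * ?i p" by (rule X(2)[OF u i])
  moreover have "(\<lambda>x. ?u x * ?i x) = ?u" by (rule ext) (simp add: fg)
  ultimately have "X ?u = 0" using A(2) fg by simp
  moreover have "X ?u = X f + (-1) * X g" using X(1)[OF f g'] X(3)[OF g, of "-1"] by simp
  ultimately show ?thesis by simp
qed

lemma tangent_vector_sum:
  assumes X: "X \<in> tangent_space M p" and p: "p \<in> points M" and f: "\<And>i. i \<in> I \<Longrightarrow> smooth_near M p (f i)"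
  shows "X (\<lambda>x. \<Sum>i\<in>I. f i x) = (\<Sum>i\<in>I. X (f i))"
  using f
proof (induction I rule: infinite_finite_induct)
  case (insert i I)
  then show ?case
    using tangent_spaceD(1)[OF X, of "f i" "\<lambda>x. \<Sum>i\<in>I. f i x"] smooth_near_sum[OF _ p, of I f] by simp
qed (use tangent_spaceD(3)[OF X smooth_near_const[OF p], of 0 0] in simp_all)

lemma tangent_vector_const:
  assumes X: "X \<in> tangent_space M p" and p: "p \<in> points M"
  shows "X (\<lambda>x. c) = 0"
proof -
  have "X (\<lambda>x. 1 * 1) = 1 * X (\<lambda>x. 1) + X (\<lambda>x. 1) * 1"
    by (rule tangent_spaceD(2)[OF X]) (rule smooth_near_const[OF p])+
  then have "X (\<lambda>x. 1) = 0" by simp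
  then show ?thesis using tangent_spaceD(3)[OF X smooth_near_const[OF p], of c 1] by simp
qed

text \<open>Near \<open>p\<close>, Hadamard's factorization writes \<open>f\<close> as
  \<open>f p\<close> plus products of the centred coordinates \<open>co b\<close> with smooth
  functions. Since \<open>co b\<close> vanishes at \<open>p\<close>, the product rule leaves the
  numbers \<open>X (co b)\<close> times the directional derivatives of \<open>f\<close>, so the
  \<open>X (co b)\<close> are the components. The expansion is only local, hence the appeal to
  germs.\<close>

lemma tangent_space_coord_vector:
  assumes c: "(U, \<phi>) \<in> atlas M" and p: "p \<in> U" and X: "X \<in> tangent_space M p"
  obtains v where "v \<in> model M" "X = coord_vector M (U, \<phi>) v p"
proof -
  have pM: "p \<in> points M" using p chart_subset_points[OF c] by blast
  have pV: "\<phi> p \<in> model M" using p chart_image_subset[OF c] by blast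
  obtain B where B: "finite B" "B \<subseteq> model M" "\<And>x. x \<in> model M \<Longrightarrow> (\<Sum>b\<in>B. (x \<bullet> b) *\<^sub>R b) = x"
     "\<And>b. b \<in> B \<Longrightarrow> norm b = 1"
    using subspace_orthonormal_expansion[OF subspace_model] by metis
  define co where "co = (\<lambda>b x. \<phi> x \<bullet> b + - (\<phi> p \<bullet> b))"
  have co: "smooth_near M p (co b)" for b
    unfolding co_def
    by (intro smooth_near_add smooth_near_const[OF pM] coord_vector_coordinate(1)[OF c p subspace_0[OF subspace_model]])
  define v where "v = (\<Sum>b\<in>B. X (co b) *\<^sub>R b)"
  have v: "v \<in> model M" unfolding v_def using B(2) subspace_model by (intro subspace_sum subspace_scale) auto
  have "X f = coord_vector M (U, \<phi>) v p f" for f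
  proof (cases "smooth_near M p f")
    case True
    obtain D S where D: "openin (top_of_set (model M)) S" "\<phi> p \<in> S" "S \<subseteq> \<phi> ` U"
      "((\<lambda>y. f (inv_into U \<phi> y)) has_derivative D) (at (\<phi> p) within S)"
      "smooth_on (model M) S (\<lambda>y. f (inv_into U \<phi> y))"
      using smooth_near_derivative[OF c p True] .
    obtain Op where Op: "open Op" "S = model M \<inter> Op" using D(1) by (auto simp: openin_open)
    then obtain r where r: "r > 0" "ball (\<phi> p) r \<subseteq> Op" using D(2) open_contains_ball by blast
    define S' where "S' = model M \<inter> ball 0 r"
    define F where "F = (\<lambda>x. f (inv_into U \<phi> (\<phi> p + x)))"
    have S': "(\<lambda>x. \<phi> p + x) ` S' \<subseteq> S"
      using pV subspace_model r(2) Op(2) by (auto simp: S'_def subspace_add dist_norm subset_iff)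
    have SV: "S \<subseteq> model M" using Op by blast
    have shift: "smooth_on (model M) S' (\<lambda>x. \<phi> p + x)" by (intro smooth_on_add smooth_on_const smooth_on_id)
    have F: "smooth_on (model M) S' F" unfolding F_def
      by (rule smooth_on_compose[OF subspace_model SV S' shift D(5)])
    obtain g where g: "\<And>b. b \<in> B \<Longrightarrow> smooth_on (model M) S' (g b)" "\<And>b. b \<in> B \<Longrightarrow> g b 0 = dirD F b 0"
      "\<And>x. x \<in> S' \<Longrightarrow> F x = F 0 + (\<Sum>b\<in>B. (x \<bullet> b) * g b x)"
      using hadamard[OF subspace_model S'_def F B(1-3)] by blast
    define A where "A = {x \<in> U. \<phi> x \<in> model M \<inter> ball (\<phi> p) r}"
    have bo: "openin (top_of_set (model M)) (model M \<inter> ball (\<phi> p) r)" by (auto simp: openin_open)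
    have A: "openin (mtop M) A" "p \<in> A"
      using chart_preimage_openin[OF c bo] p pV r by (auto simp: A_def)
    have AS: "\<phi> x - \<phi> p \<in> S'" if "x \<in> A" for x
      using that pV subspace_model by (auto simp: A_def S'_def subspace_diff dist_norm norm_minus_commute)
    have "f x = f p + (\<Sum>b\<in>B. co b x * g b (\<phi> x - \<phi> p))" if "x \<in> A" for x
      using g(3)[OF AS[OF that]] that c p by (simp add: F_def A_def co_def inner_diff_left)
    then have "X f = X (\<lambda>x. f p + (\<Sum>b\<in>B. co b x * g b (\<phi> x - \<phi> p)))"
      by (rule tangent_vector_germ[OF X A _ True])
    also have gs: "smooth_near M p (\<lambda>x. g b (\<phi> x - \<phi> p))" if "b \<in> B" for b
    proof (rule smooth_near_chart[OF c p bo])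
      have sh: "smooth_on (model M) (model M \<inter> ball (\<phi> p) r) (\<lambda>y. y + - \<phi> p)"
        by (intro smooth_on_add smooth_on_const smooth_on_id)
      have im: "(\<lambda>y. y + - \<phi> p) ` (model M \<inter> ball (\<phi> p) r) \<subseteq> S'"
        using pV subspace_model by (auto simp: S'_def subspace_diff dist_norm norm_minus_commute)
      have "S' \<subseteq> model M" by (auto simp: S'_def)
      from smooth_on_compose[OF subspace_model this im sh g(1)[OF that]]
      show "smooth_on (model M) (model M \<inter> ball (\<phi> p) r) (\<lambda>y. g b (y - \<phi> p))" by simp
    qed (use pV r in auto)
    then have ps: "smooth_near M p (\<lambda>x. co b x * g b (\<phi> x - \<phi> p))" if "b \<in> B" for b
      using smooth_near_mult[OF co gs] that by blast
    have "X (\<lambda>x. f p + (\<Sum>b\<in>B. co b x * g b (\<phi> x - \<phi> p))) =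
        X (\<lambda>x. f p) + X (\<lambda>x. \<Sum>b\<in>B. co b x * g b (\<phi> x - \<phi> p))"
      by (intro tangent_spaceD(1)[OF X] smooth_near_const[OF pM] smooth_near_sum pM ps)
    also have "\<dots> = (\<Sum>b\<in>B. X (\<lambda>x. co b x * g b (\<phi> x - \<phi> p)))"
      using tangent_vector_const[OF X pM] tangent_vector_sum[OF X pM ps] by simp
    also have "\<dots> = (\<Sum>b\<in>B. X (co b) * D b)"
    proof (rule sum.cong[OF refl])
      fix b assume b: "b \<in> B"
      have "((\<lambda>t. F (0 + t *\<^sub>R b)) has_vector_derivative D b) (at 0)"
        using has_derivative_line[OF subspace_model D(1,2) _ D(4), of b] b B(2) by (auto simp: F_def)
      then have "dirD F b 0 = D b" unfolding dirD_def by (rule vector_derivative_at)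
      moreover have "X (\<lambda>x. co b x * g b (\<phi> x - \<phi> p)) = co b p * X (\<lambda>x. g b (\<phi> x - \<phi> p)) + X (co b) * g b (\<phi> p - \<phi> p)"
        by (rule tangent_spaceD(2)[OF X co gs[OF b]])
      ultimately show "X (\<lambda>x. co b x * g b (\<phi> x - \<phi> p)) = X (co b) * D b"
        using g(2)[OF b] by (simp add: co_def)
    qed
    also have "\<dots> = D v"
    proof -
      have "linear D" using D(4) has_derivative_linear by blast
      then show ?thesis by (simp add: v_def linear_sum linear_cmul)
    qed
    also have "\<dots> = coord_vector M (U, \<phi>) v p f"
      using coord_vector_eq[OF c p True v D(1,2,4)] by simp
    finally show ?thesis .
  next
    case False
    then show ?thesis by (simp add: coord_vector_not_smooth tangent_spaceD(4)[OF X])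
  qed
  then show ?thesis using that[OF v] by blast
qed

text \<open>Differentiability of the chart expression is asked at the single time \<open>t0\<close>,
  so the lemma also serves exponential curves before their smoothness is established.\<close>

lemma curve_derivative:
  assumes c: "(U, \<phi>) \<in> atlas M" and f: "smooth_near M (\<gamma> t0) f"
    and T: "open T" "t0 \<in> T" "\<And>t. t \<in> T \<Longrightarrow> \<gamma> t \<in> U"
    and v: "v \<in> model M" "((\<lambda>t. \<phi> (\<gamma> t)) has_vector_derivative v) (at t0)"
  shows "((\<lambda>t. f (\<gamma> t)) has_real_derivative coord_vector M (U, \<phi>) v (\<gamma> t0) f) (at t0)"
proof -
  have p: "\<gamma> t0 \<in> U" using T by blast
  obtain D S where D: "openin (top_of_set (model M)) S" "\<phi> (\<gamma> t0) \<in> S" "S \<subseteq> \<phi> ` U"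
      "((\<lambda>y. f (inv_into U \<phi> y)) has_derivative D) (at (\<phi> (\<gamma> t0)) within S)"
    using smooth_near_derivative[OF c p f] .
  obtain Op where Op: "open Op" "S = model M \<inter> Op" using D(1) by (auto simp: openin_open)
  have "isCont (\<lambda>t. \<phi> (\<gamma> t)) t0" using v(2) has_vector_derivative_continuous by blast
  then have "eventually (\<lambda>t. \<phi> (\<gamma> t) \<in> Op) (nhds t0)"
    using Op D(2) unfolding continuous_at_open by (auto simp: eventually_nhds)
  then obtain T1 where T1: "open T1" "t0 \<in> T1" "\<And>t. t \<in> T1 \<Longrightarrow> \<phi> (\<gamma> t) \<in> Op"
    unfolding eventually_nhds by blast
  define T2 where "T2 = T \<inter> T1"
  have T2: "open T2" "t0 \<in> T2" using T T1 by (auto simp: T2_def)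
  have im: "(\<lambda>t. \<phi> (\<gamma> t)) ` T2 \<subseteq> S"
    using T(3) T1(3) Op(2) chart_image_subset[OF c] by (auto simp: T2_def)
  have "((\<lambda>t. \<phi> (\<gamma> t)) has_derivative (\<lambda>h. h *\<^sub>R v)) (at t0 within T2)"
    using v(2) has_derivative_at_withinI unfolding has_vector_derivative_def by blast
  then have "((\<lambda>t. f (inv_into U \<phi> (\<phi> (\<gamma> t)))) has_derivative (\<lambda>h. D (h *\<^sub>R v))) (at t0 within T2)"
    using has_derivative_subset[OF D(4) im] by (rule has_derivative_in_compose)
  then have "((\<lambda>t. f (inv_into U \<phi> (\<phi> (\<gamma> t)))) has_derivative (\<lambda>h. D (h *\<^sub>R v))) (at t0)"
    by (simp add: at_within_open[OF T2(2,1)])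
  then have "((\<lambda>t. f (\<gamma> t)) has_derivative (\<lambda>h. D (h *\<^sub>R v))) (at t0)"
    by (rule has_derivative_transform_within_open[OF _ T2]) (use T(3) c in \<open>simp add: T2_def\<close>)
  moreover have "D (h *\<^sub>R v) = D v * h" for h
    using linear_cmul[OF has_derivative_linear[OF D(4)]] by simp
  ultimately show ?thesis
    unfolding coord_vector_eq[OF c p f v(1) D(1,2,4)] has_field_derivative_def by simp
qed

lemma velocity_eq:
  assumes "(U, \<phi>) \<in> atlas M" "open T" "t0 \<in> T" "\<And>t. t \<in> T \<Longrightarrow> \<gamma> t \<in> U"
    "v \<in> model M" "((\<lambda>t. \<phi> (\<gamma> t)) has_vector_derivative v) (at t0)"
  shows "velocity M \<gamma> t0 = coord_vector M (U, \<phi>) v (\<gamma> t0)"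
proof
  fix f
  show "velocity M \<gamma> t0 f = coord_vector M (U, \<phi>) v (\<gamma> t0) f"
  proof (cases "smooth_near M (\<gamma> t0) f")
    case True
    then show ?thesis using curve_derivative[OF assms(1) True assms(2-)]
      by (simp add: velocity_def DERIV_imp_deriv)
  qed (simp add: velocity_def coord_vector_not_smooth)
qed

end

section \<open>Smooth maps between manifolds and their differentials\<close>

lemma smooth_on_transform:
  assumes "smooth_on V S f" "\<And>x. x \<in> S \<Longrightarrow> g x = f x"
  shows "smooth_on V S g"
  using smooth_on_cong[of S g f V, OF assms(2)] assms(1) by simp

lemma smooth_map_chart_smooth_on:
  "smooth_map M N F \<Longrightarrow> (U, \<phi>) \<in> atlas M \<Longrightarrow> (W, \<psi>) \<in> atlas N \<Longrightarrow>
    smooth_on (model M) (\<phi> ` (U \<inter> F -` W)) (\<lambda>y. \<psi> (F (inv_into U \<phi> y)))"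
  unfolding smooth_map_def by blast

lemma smooth_map_chart:
  assumes M: "smooth_manifold M" and N: "smooth_manifold N" and F: "smooth_map M N F"
    and c: "(U, \<phi>) \<in> atlas M" and d: "(W, \<psi>) \<in> atlas N"
  shows "openin (mtop M) (U \<inter> F -` W)"
    "openin (top_of_set (model M)) (\<phi> ` (U \<inter> F -` W))"
    "smooth_on (model M) (\<phi> ` (U \<inter> F -` W)) (\<lambda>y. \<psi> (F (inv_into U \<phi> y)))"
proof -
  interpret M: smooth_manifold M by (rule M)
  interpret N: smooth_manifold N by (rule N)
  have "continuous_map (mtop M) (mtop N) F" using F by (simp add: smooth_map_def)
  then have "openin (mtop M) {x \<in> points M. F x \<in> W}"
    using N.chart_open[OF d] by (rule openin_continuous_map_preimage)
  then have "openin (mtop M) (U \<inter> {x \<in> points M. F x \<in> W})"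
    using M.chart_open[OF c] by blast
  moreover have "U \<inter> {x \<in> points M. F x \<in> W} = U \<inter> F -` W" using M.chart_subset_points[OF c] by blast
  ultimately show o: "openin (mtop M) (U \<inter> F -` W)" by simp
  show "openin (top_of_set (model M)) (\<phi> ` (U \<inter> F -` W))"
    using M.chart_image_openin[OF c o] by (simp add: Int_assoc[symmetric])
  show "smooth_on (model M) (\<phi> ` (U \<inter> F -` W)) (\<lambda>y. \<psi> (F (inv_into U \<phi> y)))"
    by (rule smooth_map_chart_smooth_on[OF F c d])
qed

lemma smooth_map_points: "smooth_map M N F \<Longrightarrow> x \<in> points M \<Longrightarrow> F x \<in> points N"
  unfolding smooth_map_def using continuous_map_funspace by blast

lemma smooth_mapI:
  assumes M: "smooth_manifold M" and F: "continuous_map (mtop M) (mtop N) F"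
    and loc: "\<And>p U \<phi> W \<psi>. (U, \<phi>) \<in> atlas M \<Longrightarrow> (W, \<psi>) \<in> atlas N \<Longrightarrow> p \<in> U \<Longrightarrow> F p \<in> W \<Longrightarrow>
      \<exists>S. openin (top_of_set (model M)) S \<and> \<phi> p \<in> S \<and> S \<subseteq> \<phi> ` (U \<inter> F -` W) \<and>
          smooth_on (model M) S (\<lambda>y. \<psi> (F (inv_into U \<phi> y)))"
  shows "smooth_map M N F"
proof -
  interpret M: smooth_manifold M by (rule M)
  have "smooth_on (model M) (\<phi> ` (U \<inter> F -` W)) (\<lambda>y. \<psi> (F (inv_into U \<phi> y)))"
    if "(U, \<phi>) \<in> atlas M" "(W, \<psi>) \<in> atlas N" for U \<phi> W \<psi>
    using loc[OF that] by (intro smooth_on_local[OF M.subspace_model]) blast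
  then show ?thesis using F unfolding smooth_map_def by blast
qed

text \<open>The common core of the composition results: \<open>T\<close> is shrunk until
  \<open>F\<close> maps it into the patch \<open>S\<close>, after which the chain rule on subsets of
  the model spaces applies.\<close>

lemma smooth_map_compose_chart:
  fixes g :: "'b \<Rightarrow> 'h::real_normed_vector"
  assumes M: "smooth_manifold M" and N: "smooth_manifold N" and F: "smooth_map M N F"
    and c: "(U, \<phi>) \<in> atlas M" "p \<in> U" and d: "(W, \<psi>) \<in> atlas N" "F p \<in> W"
    and S: "openin (top_of_set (model N)) S" "\<psi> (F p) \<in> S"
    and g: "smooth_on (model N) S (\<lambda>y. g (inv_into W \<psi> y))"
  obtains T where "openin (top_of_set (model M)) T" "\<phi> p \<in> T" "T \<subseteq> \<phi> ` (U \<inter> F -` W)"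
    "\<And>y. y \<in> T \<Longrightarrow> \<psi> (F (inv_into U \<phi> y)) \<in> S"
    "smooth_on (model M) T (\<lambda>y. g (F (inv_into U \<phi> y)))"
proof -
  interpret M: smooth_manifold M by (rule M)
  interpret N: smooth_manifold N by (rule N)
  note sm = smooth_map_chart[OF M N F c(1) d(1)]
  define A where "A = {x \<in> U \<inter> F -` W. F x \<in> {z \<in> W. \<psi> z \<in> S}}"
  have "openin (mtop M) {x \<in> points M. F x \<in> {z \<in> W. \<psi> z \<in> S}}"
    using F N.chart_preimage_openin[OF d(1) S(1)] unfolding smooth_map_def
    by (blast intro: openin_continuous_map_preimage)
  then have "openin (mtop M) ((U \<inter> F -` W) \<inter> {x \<in> points M. F x \<in> {z \<in> W. \<psi> z \<in> S}})"
    using sm(1) by blast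
  moreover have "(U \<inter> F -` W) \<inter> {x \<in> points M. F x \<in> {z \<in> W. \<psi> z \<in> S}} = A"
    using M.chart_subset_points[OF c(1)] by (auto simp: A_def)
  ultimately have A: "openin (mtop M) A" by simp
  have AU: "U \<inter> A = A" "A \<subseteq> U \<inter> F -` W" by (auto simp: A_def)
  have T: "openin (top_of_set (model M)) (\<phi> ` A)" using M.chart_image_openin[OF c(1) A] AU by simp
  have im: "(\<lambda>y. \<psi> (F (inv_into U \<phi> y))) ` (\<phi> ` A) \<subseteq> S" using c(1) by (auto simp: A_def)
  have s1: "smooth_on (model M) (\<phi> ` A) (\<lambda>y. \<psi> (F (inv_into U \<phi> y)))"
    by (rule smooth_on_subset[OF sm(3)]) (use AU in blast)
  have SV: "S \<subseteq> model N" using S(1) openin_imp_subset by blast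
  have "smooth_on (model M) (\<phi> ` A) (\<lambda>y. g (inv_into W \<psi> (\<psi> (F (inv_into U \<phi> y)))))"
    by (rule smooth_on_compose[OF N.subspace_model SV im s1 g])
  moreover have "g (inv_into W \<psi> (\<psi> (F (inv_into U \<phi> y)))) = g (F (inv_into U \<phi> y))" if "y \<in> \<phi> ` A" for y
    using that c(1) d(1) by (auto simp: A_def)
  ultimately have "smooth_on (model M) (\<phi> ` A) (\<lambda>y. g (F (inv_into U \<phi> y)))"
    using smooth_on_cong[of "\<phi> ` A" "\<lambda>y. g (inv_into W \<psi> (\<psi> (F (inv_into U \<phi> y))))" "\<lambda>y. g (F (inv_into U \<phi> y))"]
    by blast
  moreover have "\<phi> p \<in> \<phi> ` A" using c d S by (auto simp: A_def)
  ultimately show ?thesis using that[of "\<phi> ` A"] T im AU by blast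
qed

lemma smooth_near_compose:
  assumes M: "smooth_manifold M" and N: "smooth_manifold N" and F: "smooth_map M N F"
    and p: "p \<in> points M" and f: "smooth_near N (F p) f"
  shows "smooth_near M p (\<lambda>x. f (F x))"
proof -
  interpret M: smooth_manifold M by (rule M)
  interpret N: smooth_manifold N by (rule N)
  obtain U \<phi> where c: "(U, \<phi>) \<in> atlas M" "p \<in> U" using M.chart_at[OF p] .
  obtain W \<psi> where d: "(W, \<psi>) \<in> atlas N" "F p \<in> W" using N.chart_at[OF smooth_map_points[OF F p]] .
  obtain S where S: "openin (top_of_set (model N)) S" "\<psi> (F p) \<in> S"
    "S \<subseteq> \<psi> ` W" "smooth_on (model N) S (\<lambda>y. f (inv_into W \<psi> y))" by (rule N.smooth_nearE[OF f d])
  obtain T where T: "openin (top_of_set (model M)) T" "\<phi> p \<in> T" "T \<subseteq> \<phi> ` (U \<inter> F -` W)"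
    "\<And>y. y \<in> T \<Longrightarrow> \<psi> (F (inv_into U \<phi> y)) \<in> S"
    "smooth_on (model M) T (\<lambda>y. f (F (inv_into U \<phi> y)))"
    by (rule smooth_map_compose_chart[OF M N F c d S(1,2,4)]) (rule that)
  show ?thesis
    by (rule M.smooth_nearI[OF c(1) T(1,2) c(2)]) (rule smooth_on_subset[OF T(5)], blast)
qed

lemma smooth_map_compose:
  assumes M: "smooth_manifold M" and N: "smooth_manifold N" and L: "smooth_manifold L"
    and F: "smooth_map M N F" and H: "smooth_map N L H"
  shows "smooth_map M L (\<lambda>x. H (F x))"
proof (rule smooth_mapI[OF M])
  show "continuous_map (mtop M) (mtop L) (\<lambda>x. H (F x))"
    using F H continuous_map_compose[of "mtop M" "mtop N" F "mtop L" H] by (simp add: smooth_map_def o_def)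
  interpret M: smooth_manifold M by (rule M)
  interpret N: smooth_manifold N by (rule N)
  fix p U \<phi> W \<psi>
  assume c: "(U, \<phi>) \<in> atlas M" and e: "(W, \<psi>) \<in> atlas L" and p: "p \<in> U" "H (F p) \<in> W"
  have "p \<in> points M" using M.chart_subset_points[OF c] p by blast
  then obtain W' \<psi>' where d: "(W', \<psi>') \<in> atlas N" "F p \<in> W'" using N.chart_at[OF smooth_map_points[OF F]] by metis
  note sm = smooth_map_chart[OF N L H d(1) e]
  have "\<psi>' (F p) \<in> \<psi>' ` (W' \<inter> H -` W)" using d p by blast
  then obtain T where T: "openin (top_of_set (model M)) T" "\<phi> p \<in> T" "T \<subseteq> \<phi> ` (U \<inter> F -` W')"
    "\<And>y. y \<in> T \<Longrightarrow> \<psi>' (F (inv_into U \<phi> y)) \<in> \<psi>' ` (W' \<inter> H -` W)"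
    "smooth_on (model M) T (\<lambda>y. \<psi> (H (F (inv_into U \<phi> y))))"
    by (rule smooth_map_compose_chart[OF M N F c p(1) d sm(2) _ sm(3)]) (rule that)
  have "y \<in> \<phi> ` (U \<inter> (\<lambda>x. H (F x)) -` W)" if "y \<in> T" for y
  proof -
    from T(3) that obtain x where x: "x \<in> U" "F x \<in> W'" "y = \<phi> x" by blast
    with T(4)[OF that] c obtain z where z: "\<psi>' (F x) = \<psi>' z" "z \<in> W'" "H z \<in> W" by auto
    then have "F x = z" using N.chart_inj[OF d(1)] x by (meson inj_onD)
    with x z show ?thesis by blast
  qed
  with T show "\<exists>S. openin (top_of_set (model M)) S \<and> \<phi> p \<in> S \<and> S \<subseteq> \<phi> ` (U \<inter> (\<lambda>x. H (F x)) -` W) \<and>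
          smooth_on (model M) S (\<lambda>y. \<psi> (H (F (inv_into U \<phi> y))))" by blast
qed

text \<open>The vector with components \<open>v\<close> differentiates along the chart line through
  \<open>\<phi> p\<close> in direction \<open>v\<close>. The image of this line is a curve in
  \<open>N\<close> with chart velocity \<open>D v\<close>.\<close>

lemma differential_coord_vector:
  assumes M: "smooth_manifold M" and N: "smooth_manifold N" and F: "smooth_map M N F"
    and c: "(U, \<phi>) \<in> atlas M" "p \<in> U" and d: "(W, \<psi>) \<in> atlas N" "F p \<in> W"
    and S: "openin (top_of_set (model M)) S" "\<phi> p \<in> S"
    and D: "((\<lambda>y. \<psi> (F (inv_into U \<phi> y))) has_derivative D) (at (\<phi> p) within S)"
    and v: "v \<in> model M"
  shows "D v \<in> model N" "differential N F p (coord_vector M (U, \<phi>) v p) = coord_vector N (W, \<psi>) (D v) (F p)"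
proof -
  interpret M: smooth_manifold M by (rule M)
  interpret N: smooth_manifold N by (rule N)
  note sm = smooth_map_chart[OF M N F c(1) d(1)]
  define S' where "S' = S \<inter> \<phi> ` (U \<inter> F -` W)"
  have S': "openin (top_of_set (model M)) S'" "\<phi> p \<in> S'" using sm(2) S c d by (auto simp: S'_def)
  have D': "((\<lambda>y. \<psi> (F (inv_into U \<phi> y))) has_derivative D) (at (\<phi> p) within S')"
    by (rule has_derivative_subset[OF D]) (simp add: S'_def)
  have FW: "y \<in> S' \<Longrightarrow> F (inv_into U \<phi> y) \<in> W" for y using c(1) by (auto simp: S'_def)
  show Dv: "D v \<in> model N"
    by (rule derivative_in_subspace[OF M.subspace_model S'(1) N.subspace_model _ S'(2) v D'])
      (use FW N.chart_image_subset[OF d(1)] in blast)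
  show "differential N F p (coord_vector M (U, \<phi>) v p) = coord_vector N (W, \<psi>) (D v) (F p)"
  proof
    fix f
    show "differential N F p (coord_vector M (U, \<phi>) v p) f = coord_vector N (W, \<psi>) (D v) (F p) f"
    proof (cases "smooth_near N (F p) f")
      case True
      have "p \<in> points M" using c M.chart_subset_points by blast
      from smooth_near_compose[OF M N F this True]
      have 1: "coord_vector M (U, \<phi>) v p (\<lambda>x. f (F x)) = deriv (\<lambda>t. f (F (inv_into U \<phi> (\<phi> p + t *\<^sub>R v)))) 0"
        by (simp add: coord_vector_def)
      obtain T where T: "open T" "(0::real) \<in> T" "\<And>t. t \<in> T \<Longrightarrow> \<phi> p + t *\<^sub>R v \<in> S'"
        using openin_subspace_line[OF M.subspace_model S' v] by blast
      let ?g = "\<lambda>t. F (inv_into U \<phi> (\<phi> p + t *\<^sub>R v))"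
      have g0: "?g 0 = F p" using c by simp
      have "((\<lambda>t. f (?g t)) has_real_derivative coord_vector N (W, \<psi>) (D v) (?g 0) f) (at 0)"
      proof (rule N.curve_derivative[OF d(1) _ T(1,2) _ Dv])
        show "smooth_near N (?g 0) f" using True g0 by simp
        show "?g t \<in> W" if "t \<in> T" for t using FW T(3)[OF that] by blast
        show "((\<lambda>t. \<psi> (?g t)) has_vector_derivative D v) (at 0)"
          by (rule has_derivative_line[OF M.subspace_model S' v D'])
      qed
      then show ?thesis using True 1 g0 by (simp add: differential_def DERIV_imp_deriv)
    qed (simp add: differential_def N.coord_vector_not_smooth)
  qed
qed

section \<open>Multiplication of a Lie group in charts\<close>

context lie_group
begin

lemma mult_continuous: "continuous_map (prod_topology (mtop M) (mtop M)) (mtop M) (\<lambda>(x, y). x \<otimes> y)"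
  using mult_smooth by (simp add: smooth_map_def prod_manifold_def)

lemma smooth_manifold_M: "smooth_manifold M" by (rule smooth_manifold_axioms)

lemma continuous_map_mult:
  assumes "continuous_map X (mtop M) f" "continuous_map X (mtop M) g"
  shows "continuous_map X (mtop M) (\<lambda>x. f x \<otimes> g x)"
proof -
  have "continuous_map X (prod_topology (mtop M) (mtop M)) (\<lambda>x. (f x, g x))"
    using assms by (simp add: continuous_map_pairedI)
  from continuous_map_compose[OF this mult_continuous] show ?thesis by (simp add: o_def)
qed

lemma continuous_map_inv: "continuous_map (mtop M) (mtop M) (\<lambda>x. inv x)"
  using inv_smooth by (simp add: smooth_map_def)

lemma continuous_map_pow:
  assumes "continuous_map X (mtop M) f"
  shows "continuous_map X (mtop M) (\<lambda>x. f x [^] (n::nat))"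
proof (induction n)
  case 0
  then show ?case by (simp add: points_eq)
next
  case (Suc n)
  then show ?case using continuous_map_mult[OF Suc assms] by simp
qed

text \<open>\<open>mult_smooth\<close> speaks of product charts. Here they are unpacked: continuity
  supplies a product of patches mapped into \<open>W\<close>, and the inverse of a product chart is
  taken componentwise.\<close>

lemma mult_chart:
  assumes c: "(U, \<phi>) \<in> atlas M" "a \<in> U" and d: "(U', \<phi>') \<in> atlas M" "b \<in> U'" and e: "(W, \<psi>) \<in> atlas M" "a \<otimes> b \<in> W"
  obtains S S' where "openin (top_of_set (model M)) S" "\<phi> a \<in> S" "S \<subseteq> \<phi> ` U"
    "openin (top_of_set (model M)) S'" "\<phi>' b \<in> S'" "S' \<subseteq> \<phi>' ` U'"
    "\<And>y z. y \<in> S \<Longrightarrow> z \<in> S' \<Longrightarrow> inv_into U \<phi> y \<otimes> inv_into U' \<phi>' z \<in> W"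
    "smooth_on (model M \<times> model M) (S \<times> S') (\<lambda>p. \<psi> (inv_into U \<phi> (fst p) \<otimes> inv_into U' \<phi>' (snd p)))"
proof -
  define Z where "Z = {p \<in> topspace (prod_topology (mtop M) (mtop M)). (\<lambda>(x, y). x \<otimes> y) p \<in> W}"
  have Z: "openin (prod_topology (mtop M) (mtop M)) Z"
    unfolding Z_def by (rule openin_continuous_map_preimage[OF mult_continuous chart_open[OF e(1)]])
  have abZ: "(a, b) \<in> Z"
    unfolding Z_def using c d e chart_subset_points by auto
  obtain A B where AB: "openin (mtop M) A" "openin (mtop M) B" "a \<in> A" "b \<in> B" "A \<times> B \<subseteq> Z"
    using openin_prod_topology_alt[THEN iffD1, rule_format, OF Z abZ] by (elim exE conjE)
  have ABW: "x \<otimes> y \<in> W" if "x \<in> A" "y \<in> B" for x y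
    using AB(5) that unfolding Z_def by auto
  let ?S = "\<phi> ` (U \<inter> A)" and ?S' = "\<phi>' ` (U' \<inter> B)"
  have im: "?S \<times> ?S' \<subseteq> map_prod \<phi> \<phi>' ` ((U \<times> U') \<inter> (\<lambda>(x, y). x \<otimes> y) -` W)"
  proof
    fix q assume "q \<in> ?S \<times> ?S'"
    then obtain x y where xy: "q = (\<phi> x, \<phi>' y)" "x \<in> U \<inter> A" "y \<in> U' \<inter> B" by blast
    show "q \<in> map_prod \<phi> \<phi>' ` ((U \<times> U') \<inter> (\<lambda>(x, y). x \<otimes> y) -` W)"
      by (rule image_eqI[of _ _ "(x, y)"]) (use xy ABW in auto)
  qed
  have inv: "inv_into (U \<times> U') (map_prod \<phi> \<phi>') (\<phi> x, \<phi>' y) = (x, y)" if "x \<in> U" "y \<in> U'" for x y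
  proof -
    have "inj_on (map_prod \<phi> \<phi>') (U \<times> U')"
      using map_prod_inj_on[OF chart_inj[OF c(1)] chart_inj[OF d(1)]] .
    then show ?thesis using inv_into_f_f[of "map_prod \<phi> \<phi>'" "U \<times> U'" "(x, y)"] that by simp
  qed
  have "(U \<times> U', map_prod \<phi> \<phi>') \<in> atlas (prod_manifold M M)"
    using c d by (auto simp: prod_manifold_def)
  from smooth_map_chart_smooth_on[OF mult_smooth this e(1)]
  have "smooth_on (model M \<times> model M) (map_prod \<phi> \<phi>' ` ((U \<times> U') \<inter> (\<lambda>(x, y). x \<otimes> y) -` W))
      (\<lambda>p. \<psi> ((\<lambda>(x, y). x \<otimes> y) (inv_into (U \<times> U') (map_prod \<phi> \<phi>') p)))"
    by (simp add: prod_manifold_def)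
  then have "smooth_on (model M \<times> model M) (?S \<times> ?S')
      (\<lambda>p. \<psi> ((\<lambda>(x, y). x \<otimes> y) (inv_into (U \<times> U') (map_prod \<phi> \<phi>') p)))"
    using im by (rule smooth_on_subset)
  moreover have "\<psi> ((\<lambda>(x, y). x \<otimes> y) (inv_into (U \<times> U') (map_prod \<phi> \<phi>') p)) =
      \<psi> (inv_into U \<phi> (fst p) \<otimes> inv_into U' \<phi>' (snd p))" if "p \<in> ?S \<times> ?S'" for p
    using that c d by (auto simp: inv)
  ultimately have "smooth_on (model M \<times> model M) (?S \<times> ?S') (\<lambda>p. \<psi> (inv_into U \<phi> (fst p) \<otimes> inv_into U' \<phi>' (snd p)))"
    using smooth_on_cong[of "?S \<times> ?S'" "\<lambda>p. \<psi> ((\<lambda>(x, y). x \<otimes> y) (inv_into (U \<times> U') (map_prod \<phi> \<phi>') p))"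
      "\<lambda>p. \<psi> (inv_into U \<phi> (fst p) \<otimes> inv_into U' \<phi>' (snd p))" "model M \<times> model M"] by simp
  moreover have "inv_into U \<phi> y \<otimes> inv_into U' \<phi>' z \<in> W" if "y \<in> ?S" "z \<in> ?S'" for y z
    using that c d ABW by auto
  moreover have "\<phi> a \<in> ?S" "?S \<subseteq> \<phi> ` U" "\<phi>' b \<in> ?S'" "?S' \<subseteq> \<phi>' ` U'" using c d AB(3,4) by auto
  ultimately show ?thesis
    using that[of ?S ?S'] chart_image_openin[OF c(1) AB(1)] chart_image_openin[OF d(1) AB(2)] by simp
qed

lemma smooth_map_mult:
  fixes N :: "('b, 'f::euclidean_space) manifold"
  assumes N: "smooth_manifold N" and F: "smooth_map N M F" and H: "smooth_map N M H"
  shows "smooth_map N M (\<lambda>x. F x \<otimes> H x)"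
proof (rule smooth_mapI[OF N])
  interpret N: smooth_manifold N by (rule N)
  show "continuous_map (mtop N) (mtop M) (\<lambda>x. F x \<otimes> H x)"
    using F H by (intro continuous_map_mult) (auto simp: smooth_map_def)
  fix p U \<phi> W \<psi>
  assume c: "(U, \<phi>) \<in> atlas N" and e: "(W, \<psi>) \<in> atlas M" and p: "p \<in> U" "F p \<otimes> H p \<in> W"
  have pN: "p \<in> points N" using c p N.chart_subset_points by blast
  obtain A \<alpha> where A: "(A, \<alpha>) \<in> atlas M" "F p \<in> A" using chart_at smooth_map_points[OF F pN] by metis
  obtain B \<beta> where B: "(B, \<beta>) \<in> atlas M" "H p \<in> B" using chart_at smooth_map_points[OF H pN] by metis
  obtain S S' where S: "openin (top_of_set (model M)) S" "\<alpha> (F p) \<in> S" "S \<subseteq> \<alpha> ` A"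
    "openin (top_of_set (model M)) S'" "\<beta> (H p) \<in> S'" "S' \<subseteq> \<beta> ` B"
    "\<And>y z. y \<in> S \<Longrightarrow> z \<in> S' \<Longrightarrow> inv_into A \<alpha> y \<otimes> inv_into B \<beta> z \<in> W"
    "smooth_on (model M \<times> model M) (S \<times> S') (\<lambda>p. \<psi> (inv_into A \<alpha> (fst p) \<otimes> inv_into B \<beta> (snd p)))"
    by (rule mult_chart[OF A B e p(2)]) (rule that)
  have "smooth_on (model M) S (\<lambda>y. \<alpha> (inv_into A \<alpha> y))"
    by (rule smooth_on_transform[OF smooth_on_id]) (use S(3) in \<open>auto simp: f_inv_into_f\<close>)
  then obtain T where T: "openin (top_of_set (model N)) T" "\<phi> p \<in> T" "T \<subseteq> \<phi> ` (U \<inter> F -` A)"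
    "\<And>y. y \<in> T \<Longrightarrow> \<alpha> (F (inv_into U \<phi> y)) \<in> S" "smooth_on (model N) T (\<lambda>y. \<alpha> (F (inv_into U \<phi> y)))"
    by (rule smooth_map_compose_chart[OF N smooth_manifold_M F c p(1) A S(1,2)]) (rule that)
  have "smooth_on (model M) S' (\<lambda>y. \<beta> (inv_into B \<beta> y))"
    by (rule smooth_on_transform[OF smooth_on_id]) (use S(6) in \<open>auto simp: f_inv_into_f\<close>)
  then obtain T' where T': "openin (top_of_set (model N)) T'" "\<phi> p \<in> T'" "T' \<subseteq> \<phi> ` (U \<inter> H -` B)"
    "\<And>y. y \<in> T' \<Longrightarrow> \<beta> (H (inv_into U \<phi> y)) \<in> S'" "smooth_on (model N) T' (\<lambda>y. \<beta> (H (inv_into U \<phi> y)))"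
    by (rule smooth_map_compose_chart[OF N smooth_manifold_M H c p(1) B S(4,5)]) (rule that)
  let ?f = "\<lambda>y. (\<alpha> (F (inv_into U \<phi> y)), \<beta> (H (inv_into U \<phi> y)))"
  have sub: "S \<times> S' \<subseteq> model M \<times> model M" using S(1,4) openin_imp_subset by blast
  have 1: "smooth_on (model N) (T \<inter> T') ?f"
    by (intro smooth_on_Pair smooth_on_subset[OF T(5)] smooth_on_subset[OF T'(5)]) auto
  have 2: "?f ` (T \<inter> T') \<subseteq> S \<times> S'" using T(4) T'(4) by blast
  have 3: "smooth_on (model N) (T \<inter> T') (\<lambda>y. \<psi> (inv_into A \<alpha> (fst (?f y)) \<otimes> inv_into B \<beta> (snd (?f y))))"
    by (rule smooth_on_compose[OF subspace_Times[OF subspace_model subspace_model] sub 2 1 S(8)])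
  have 4: "inv_into A \<alpha> (fst (?f y)) \<otimes> inv_into B \<beta> (snd (?f y)) = F (inv_into U \<phi> y) \<otimes> H (inv_into U \<phi> y)"
    if "y \<in> T \<inter> T'" for y
  proof -
    have "F (inv_into U \<phi> y) \<in> A" "H (inv_into U \<phi> y) \<in> B" using that T(3) T'(3) c by auto
    then show ?thesis using A(1) B(1) by simp
  qed
  have "smooth_on (model N) (T \<inter> T') (\<lambda>y. \<psi> (F (inv_into U \<phi> y) \<otimes> H (inv_into U \<phi> y)))"
    using smooth_on_cong[of "T \<inter> T'" "\<lambda>y. \<psi> (inv_into A \<alpha> (fst (?f y)) \<otimes> inv_into B \<beta> (snd (?f y)))"
      "\<lambda>y. \<psi> (F (inv_into U \<phi> y) \<otimes> H (inv_into U \<phi> y))" "model N"] 3 4 by simp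
  moreover have "T \<inter> T' \<subseteq> \<phi> ` (U \<inter> (\<lambda>x. F x \<otimes> H x) -` W)"
  proof
    fix y assume y: "y \<in> T \<inter> T'"
    then obtain x where x: "x \<in> U" "y = \<phi> x" using T(3) by blast
    have "inv_into A \<alpha> (fst (?f y)) \<otimes> inv_into B \<beta> (snd (?f y)) \<in> W"
      using S(7)[of "fst (?f y)" "snd (?f y)"] 2 y by auto
    then have "F x \<otimes> H x \<in> W" using 4[OF y] x c by simp
    then show "y \<in> \<phi> ` (U \<inter> (\<lambda>x. F x \<otimes> H x) -` W)" using x by blast
  qed
  moreover have "openin (top_of_set (model N)) (T \<inter> T')" "\<phi> p \<in> T \<inter> T'" using T T' by auto
  ultimately show "\<exists>S. openin (top_of_set (model N)) S \<and> \<phi> p \<in> S \<and> S \<subseteq> \<phi> ` (U \<inter> (\<lambda>x. F x \<otimes> H x) -` W) \<and>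
          smooth_on (model N) S (\<lambda>y. \<psi> (F (inv_into U \<phi> y) \<otimes> H (inv_into U \<phi> y)))" by blast
qed

lemma smooth_map_const:
  assumes N: "smooth_manifold N" and a: "a \<in> carrier G"
  shows "smooth_map N M (\<lambda>x. a)"
  using a by (auto simp: smooth_map_def points_eq smooth_on_const)

lemma smooth_map_id: "smooth_map M M (\<lambda>x. x)"
proof -
  have "smooth_on (model M) (\<phi> ` (U \<inter> (\<lambda>x. x) -` W)) (\<lambda>y. \<psi> (inv_into U \<phi> y))"
    if "(U, \<phi>) \<in> atlas M" "(W, \<psi>) \<in> atlas M" for U \<phi> W \<psi>
    using transition_smooth[OF that] by (simp add: vimage_def)
  then show ?thesis by (auto simp: smooth_map_def)
qed

lemma conj_smooth:
  assumes "a \<in> carrier G"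
  shows "smooth_map M M (\<lambda>x. a \<otimes> x \<otimes> inv a)"
  using assms by (intro smooth_map_mult smooth_map_const smooth_map_id smooth_manifold_M) auto

end

section \<open>Linearization of a squaring map\<close>

lemma tame_quadratic:
  assumes "tame V L f" "subspace V" "linear L"
  obtains C r where "C \<ge> 0" "r > 0" "\<And>x. x \<in> V \<Longrightarrow> norm x < r \<Longrightarrow> norm (f x - L x) \<le> C * (norm x)\<^sup>2"
proof -
  obtain C r where T: "tame_within V L f C r" using assms(1) tame_def by metis
  note t = tame_withinD[OF T]
  have "norm (f x - L x) \<le> C * (norm x)\<^sup>2" if "x \<in> V" "norm x < r" for x
    using t(4)[OF that(1) subspace_0[OF assms(2)] that(2)] t(1,3) linear_0[OF assms(3)]
    by (simp add: power2_eq_square mult.assoc)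
  then show ?thesis using that t(1,2) by blast
qed

text \<open>Both remainders are quadratic, so \<open>|L (t x) - M (t x)|\<close> is at most
  \<open>K t^2\<close>; dividing by \<open>t\<close> leaves \<open>K t\<close>.\<close>

lemma tame_derivative_unique:
  assumes f: "tame V L f" "tame V M f" and V: "subspace V" and lin: "linear L" "linear M" and x: "x \<in> V"
  shows "L x = M x"
proof -
  obtain C1 r1 where 1: "C1 \<ge> 0" "r1 > 0" "\<And>x. x \<in> V \<Longrightarrow> norm x < r1 \<Longrightarrow> norm (f x - L x) \<le> C1 * (norm x)\<^sup>2"
    using tame_quadratic[OF f(1) V lin(1)] by metis
  obtain C2 r2 where 2: "C2 \<ge> 0" "r2 > 0" "\<And>x. x \<in> V \<Longrightarrow> norm x < r2 \<Longrightarrow> norm (f x - M x) \<le> C2 * (norm x)\<^sup>2"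
    using tame_quadratic[OF f(2) V lin(2)] by metis
  have "norm (L x - M x) \<le> 0 + e" if e: "e > 0" for e
  proof -
    define K where "K = (C1 + C2) * (norm x)\<^sup>2"
    have K: "K \<ge> 0" using 1 2 by (simp add: K_def)
    \<comment> \<open>The first entry keeps \<open>t x\<close> inside both balls, the second makes
      \<open>t K\<close> at most \<open>e\<close>.\<close>
    define t where "t = min (min r1 r2 / (2 * (norm x + 1))) (e / (K + 1))"
    have t: "t > 0" using 1 2 e K by (simp add: t_def add_nonneg_pos)
    have "t * norm x \<le> min r1 r2 / (2 * (norm x + 1)) * (norm x + 1)"
      using t by (intro mult_mono) (auto simp: t_def)
    also have "\<dots> = min r1 r2 / 2"
      using norm_ge_zero[of x] by (simp add: field_simps add_nonneg_eq_0_iff)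
    also have "\<dots> < min r1 r2" using 1(2) 2(2) by linarith
    finally have n: "norm (t *\<^sub>R x) < min r1 r2" using t by simp
    have tx: "t *\<^sub>R x \<in> V" using x V by (simp add: subspace_scale)
    have "t * norm (L x - M x) = norm (L (t *\<^sub>R x) - M (t *\<^sub>R x))"
      using t by (simp add: linear_cmul[OF lin(1)] linear_cmul[OF lin(2)] flip: scaleR_diff_right)
    also have "\<dots> = norm ((f (t *\<^sub>R x) - M (t *\<^sub>R x)) - (f (t *\<^sub>R x) - L (t *\<^sub>R x)))" by simp
    also have "\<dots> \<le> C2 * (norm (t *\<^sub>R x))\<^sup>2 + C1 * (norm (t *\<^sub>R x))\<^sup>2"
      using norm_triangle_ineq4 1(3)[OF tx] 2(3)[OF tx] n by (smt (verit))
    also have "\<dots> = t * (t * K)" by (simp add: K_def power2_eq_square algebra_simps)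
    finally have "norm (L x - M x) \<le> t * K" using t by simp
    also have "\<dots> \<le> e / (K + 1) * (K + 1)" using t K by (intro mult_mono) (auto simp: t_def)
    also have "\<dots> = e" using K by simp
    finally show ?thesis by simp
  qed
  then have "norm (L x - M x) \<le> 0" by (rule field_le_epsilon)
  then show ?thesis by simp
qed

lemma tame_bounds:
  fixes V :: "'e::euclidean_space set"
  assumes "tame V L f" "subspace V" "linear L"
  obtains C r K where "tame_within V L f C r" "K > 0"
    "\<And>x y. x \<in> V \<Longrightarrow> y \<in> V \<Longrightarrow> norm x < r \<Longrightarrow> norm y < r \<Longrightarrow> norm (f x - f y) \<le> K * norm (x - y)"
    "\<And>x. x \<in> V \<Longrightarrow> norm x < r \<Longrightarrow> norm (f x) \<le> K * norm x"
proof -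
  obtain C r where T: "tame_within V L f C r" using assms(1) tame_def by metis
  note t = tame_withinD[OF T]
  obtain K where K: "K > 0" "\<And>x. norm (L x) \<le> K * norm x" using linear_bounded_pos[OF assms(3)] by blast
  have lip: "norm (f x - f y) \<le> (K + 2 * C * r) * norm (x - y)"
    if "x \<in> V" "y \<in> V" "norm x < r" "norm y < r" for x y
    using tame_lipschitz[OF T assms(3) K(2) that] .
  show ?thesis
  proof (rule that[OF T _ lip])
    show "0 < K + 2 * C * r" using K t by (simp add: add_pos_nonneg)
    show "norm (f x) \<le> (K + 2 * C * r) * norm x" if "x \<in> V" "norm x < r" for x
      using lip[OF that(1) subspace_0[OF assms(2)] that(2)] t by simp
  qed
qed

text \<open>The estimates for the iterates are uniform in \<open>n\<close>, with constants that are
  fixed points of the recursion: one step turns a first-order constant \<open>c\<close> into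
  \<open>C + c/2\<close> and a second-difference constant \<open>c\<close> into
  \<open>C + (3/4) c\<close>. This is the origin of \<open>2 * C\<close> and
  \<open>4 * C\<close>.\<close>

lemma squaring_linearization:
  fixes V :: "'e::euclidean_space set" and q :: "'e \<Rightarrow> 'e"
  assumes V: "subspace V" and q: "tame V (\<lambda>x. 2 *\<^sub>R x) q"
    and qV: "\<rho> > 0" "\<And>x. x \<in> V \<Longrightarrow> norm x < \<rho> \<Longrightarrow> q x \<in> V"
  obtains E R where "R > 0" "R \<le> \<rho>" "tame V (\<lambda>x. x) E"
    "\<And>x. x \<in> V \<Longrightarrow> norm x < R \<Longrightarrow> E x \<in> V" "\<And>x. x \<in> V \<Longrightarrow> norm x < R \<Longrightarrow> norm (E x) \<le> 2 * norm x"
    "\<And>x. x \<in> V \<Longrightarrow> norm x < R \<Longrightarrow> E x = q (E ((1/2) *\<^sub>R x))"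
    "\<And>x y. x \<in> V \<Longrightarrow> y \<in> V \<Longrightarrow> norm x < R \<Longrightarrow> norm y < R \<Longrightarrow> norm (E x - E y - (x - y)) \<le> (1/2) * norm (x - y)"
proof -
  obtain C0 r0 where T0: "tame_within V (\<lambda>x. 2 *\<^sub>R x) q C0 r0" using q tame_def by metis
  define C where "C = C0 + 1"
  \<comment> \<open>Then \<open>C (|u| + |v|) \<le> 2 C r \<le> 1/2\<close> on the ball, so
    \<open>q\<close> is Lipschitz with constant 3.\<close>
  define r where "r = min (min r0 \<rho>) (1 / (4 * C))"
  have C: "C > 0" using tame_withinD(2)[OF T0] by (simp add: C_def)
  have r: "r > 0" "r \<le> r0" "r \<le> \<rho>" "r \<le> 1 / (4 * C)"
    using tame_withinD(1)[OF T0] qV(1) C by (auto simp: r_def)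
  have T: "tame_within V (\<lambda>x. 2 *\<^sub>R x) q C r"
    using tame_within_mono[OF T0 _ r(1,2)] by (simp add: C_def)
  note t = tame_withinD[OF T]
  have Cr: "C * r \<le> 1 / 4" using r(4) C by (simp add: field_simps)
  have qlip: "norm (q u - q v) \<le> 3 * norm (u - v)" if "u \<in> V" "v \<in> V" "norm u < r" "norm v < r" for u v
  proof -
    have "norm (q u - q v) \<le> norm (q u - q v - 2 *\<^sub>R (u - v)) + norm (2 *\<^sub>R (u - v))"
      by (metis diff_add_cancel norm_triangle_ineq)
    also have "\<dots> \<le> C * (norm u + norm v) * norm (u - v) + 2 * norm (u - v)"
      using t(4)[OF that] by simp
    also have "C * (norm u + norm v) * norm (u - v) \<le> C * (2 * r) * norm (u - v)"
      using that C by (intro mult_right_mono mult_left_mono) auto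
    also have "C * (2 * r) * norm (u - v) \<le> 1 * norm (u - v)"
      using Cr by (intro mult_right_mono) auto
    finally show ?thesis by simp
  qed
  \<comment> \<open>The iterates at most double norms, so starting within \<open>r / 4\<close> they
    stay inside the ball of radius \<open>r\<close>.\<close>
  define R where "R = r / 4"
  have R: "R > 0" "R < r" using r by (auto simp: R_def)
  have CR: "4 * C * R \<le> 1 / 2" using Cr by (simp add: R_def)
  define En where "En = rec_nat (\<lambda>x. x) (\<lambda>n E x. q (E ((1/2) *\<^sub>R x)))"
  have En0: "En 0 x = x" and EnS: "En (Suc n) x = q (En n ((1/2) *\<^sub>R x))" for n x
    by (simp_all add: En_def)
  have half: "(1/2) *\<^sub>R x \<in> V" "norm ((1/2) *\<^sub>R x) < R" if "x \<in> V" "norm x < R" for x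
    using that V R by (auto simp: subspace_scale)
  \<comment> \<open>Membership in \<open>V\<close> and the value at 0 are part of the induction:
    comparison with \<open>y = 0\<close> yields \<open>|En n z| \<le> 2 |z|\<close>, which is what
    allows \<open>q\<close> to be applied once more.\<close>
  have E1: "En n x \<in> V \<and> norm (En n x - En n y - (x - y)) \<le> 2 * C * (norm x + norm y) * norm (x - y)
      \<and> En n 0 = 0"
    if "x \<in> V" "y \<in> V" "norm x < R" "norm y < R" for n x y
    using that
  proof (induction n arbitrary: x y)
    case 0
    then show ?case using C by (simp add: En0)
  next
    case (Suc n)
    let ?x = "(1/2) *\<^sub>R x" and ?y = "(1/2) *\<^sub>R y"
    have h: "?x \<in> V" "norm ?x < R" "?y \<in> V" "norm ?y < R" using half Suc.prems by blast+
    have "0 \<in> V" using V subspace_0 by blast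
    have bd: "En n z \<in> V" "norm (En n z) \<le> 2 * norm z" if "z \<in> V" "norm z < R" for z
    proof -
      have *: "norm (En n z - En n 0 - (z - 0)) \<le> 2 * C * (norm z + norm (0::'e)) * norm (z - 0)" "En n 0 = 0" "En n z \<in> V"
        using Suc.IH[of z 0] that \<open>0 \<in> V\<close> R by auto
      then show "En n z \<in> V" by simp
      have "2 * C * norm z * norm z \<le> 2 * C * R * norm z"
        using that C by (intro mult_right_mono mult_left_mono) auto
      also have "\<dots> \<le> 1 * norm z" using CR by (intro mult_right_mono) auto
      finally have "norm (En n z - z) \<le> norm z" using * by simp
      then show "norm (En n z) \<le> 2 * norm z" using norm_triangle_ineq2[of "En n z" z] by simp
    qed
    have rr: "norm (En n ?x) < r" "norm (En n ?y) < r"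
      using bd(2)[OF h(1,2)] bd(2)[OF h(3,4)] Suc.prems R by auto
    have IH: "norm (En n ?x - En n ?y - (?x - ?y)) \<le> 2 * C * (norm ?x + norm ?y) * norm (?x - ?y)" "En n 0 = 0"
      using Suc.IH[OF h(1,3,2,4)] by auto
    have d: "norm (?x - ?y) = norm (x - y) / 2"
    proof -
      have "?x - ?y = (1/2) *\<^sub>R (x - y)" by (simp add: scaleR_diff_right)
      then show ?thesis by simp
    qed
    have dl: "norm (En n ?x - En n ?y) \<le> norm (x - y)"
    proof -
      have "2 * C * (norm ?x + norm ?y) * norm (?x - ?y) \<le> 2 * C * (2 * R) * norm (?x - ?y)"
        using h C by (intro mult_right_mono mult_left_mono) auto
      also have "\<dots> \<le> 1 * norm (?x - ?y)" using CR by (intro mult_right_mono) auto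
      finally have "norm (En n ?x - En n ?y - (?x - ?y)) \<le> norm (?x - ?y)" using IH by simp
      then show ?thesis using norm_triangle_ineq2[of "En n ?x - En n ?y" "?x - ?y"] d by simp
    qed
    have "norm (q (En n ?x) - q (En n ?y) - 2 *\<^sub>R (En n ?x - En n ?y))
        \<le> C * (norm (En n ?x) + norm (En n ?y)) * norm (En n ?x - En n ?y)"
      using bd h rr by (intro t(4)) auto
    also have "\<dots> \<le> C * (norm x + norm y) * norm (x - y)"
      using bd(2)[OF h(1,2)] bd(2)[OF h(3,4)] dl C by (intro mult_mono mult_left_mono add_mono) auto
    finally have 1: "norm (q (En n ?x) - q (En n ?y) - 2 *\<^sub>R (En n ?x - En n ?y)) \<le> C * (norm x + norm y) * norm (x - y)" .
    have "norm (2 *\<^sub>R (En n ?x - En n ?y - (?x - ?y))) \<le> 2 * (2 * C * (norm ?x + norm ?y) * norm (?x - ?y))"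
      using IH(1) by simp
    also have "\<dots> = C * (norm x + norm y) * norm (x - y)" unfolding d by (simp add: algebra_simps)
    finally have 2: "norm (2 *\<^sub>R (En n ?x - En n ?y - (?x - ?y))) \<le> C * (norm x + norm y) * norm (x - y)" .
    have "En (Suc n) x - En (Suc n) y - (x - y) =
      (q (En n ?x) - q (En n ?y) - 2 *\<^sub>R (En n ?x - En n ?y)) + 2 *\<^sub>R (En n ?x - En n ?y - (?x - ?y))"
      by (simp add: EnS algebra_simps)
    then have "norm (En (Suc n) x - En (Suc n) y - (x - y)) \<le> C * (norm x + norm y) * norm (x - y) + C * (norm x + norm y) * norm (x - y)"
      using norm_triangle_mono[OF 1 2] by simp
    moreover have "En (Suc n) 0 = 0" using IH(2) t(3) by (simp add: EnS)
    moreover have "En (Suc n) x \<in> V"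
      unfolding EnS using bd(1)[OF h(1,2)] rr(1) r(3) by (intro qV(2)) auto
    ultimately show ?case by (simp add: algebra_simps)
  qed
  have "0 \<in> V" using V subspace_0 by blast
  have bd: "En n z \<in> V" "norm (En n z) \<le> 2 * norm z" "norm (En n z) < r" if "z \<in> V" "norm z < R" for n z
  proof -
    have *: "norm (En n z - En n 0 - (z - 0)) \<le> 2 * C * (norm z + norm (0::'e)) * norm (z - 0)" "En n 0 = 0" "En n z \<in> V"
      using E1[of z 0 n] that \<open>0 \<in> V\<close> R by auto
    then show "En n z \<in> V" by simp
    have "2 * C * norm z * norm z \<le> 2 * C * R * norm z"
      using that C by (intro mult_right_mono mult_left_mono) auto
    also have "\<dots> \<le> 1 * norm z" using CR by (intro mult_right_mono) auto
    finally have "norm (En n z - z) \<le> norm z" using * by simp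
    then show "norm (En n z) \<le> 2 * norm z" using norm_triangle_ineq2[of "En n z" z] by simp
    then show "norm (En n z) < r" using that(2) R_def r(1) by linarith
  qed
  have dl: "norm (En n x - En n y) \<le> 2 * norm (x - y)" if "x \<in> V" "y \<in> V" "norm x < R" "norm y < R" for n x y
  proof -
    have "2 * C * (norm x + norm y) * norm (x - y) \<le> 2 * C * (2 * R) * norm (x - y)"
      using that C by (intro mult_right_mono mult_left_mono) auto
    also have "\<dots> \<le> 1 * norm (x - y)" using CR by (intro mult_right_mono) auto
    finally have "norm (En n x - En n y - (x - y)) \<le> norm (x - y)" using E1[OF that, of n] by simp
    then show ?thesis using norm_triangle_ineq2[of "En n x - En n y" "x - y"] by simp
  qed
  \<comment> \<open>In one step, \<open>q\<close> at the images \<open>a\<close> and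
    \<open>b\<close> of the two halved outer points is compared with \<open>q\<close> at their
    midpoint \<open>m\<close>, and then \<open>m\<close> with the image \<open>c\<close> of the
    halved centre, by the induction hypothesis and the Lipschitz constant 3.\<close>
  have E2: "norm (En n (x + w) + En n (x - w) - 2 *\<^sub>R En n x) \<le> 4 * C * (norm w)\<^sup>2"
    if "x \<in> V" "w \<in> V" "norm x < R" "norm (x + w) < R" "norm (x - w) < R" for n x w
    using that
  proof (induction n arbitrary: x w)
    case 0
    then show ?case using C by (simp add: En0 scaleR_2)
  next
    case (Suc n)
    let ?x = "(1/2) *\<^sub>R x" and ?w = "(1/2) *\<^sub>R w"
    have V': "x + w \<in> V" "x - w \<in> V" using Suc.prems V by (auto intro: subspace_add subspace_diff)
    have eqs: "(1/2) *\<^sub>R (x + w) = ?x + ?w" "(1/2) *\<^sub>R (x - w) = ?x - ?w"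
      by (simp_all add: scaleR_add_right scaleR_diff_right)
    have h: "?x \<in> V" "norm ?x < R" "?w \<in> V" "?x + ?w \<in> V" "norm (?x + ?w) < R" "?x - ?w \<in> V" "norm (?x - ?w) < R"
      using half[OF Suc.prems(1,3)] half[OF V'(1) Suc.prems(4)] half[OF V'(2) Suc.prems(5)]
        Suc.prems(2) V by (auto simp: eqs subspace_scale)
    define a b c where "a = En n (?x + ?w)" and "b = En n (?x - ?w)" and "c = En n ?x"
    have abc: "a \<in> V" "b \<in> V" "c \<in> V" "norm a < r" "norm b < r" "norm c < r"
      using bd h by (auto simp: a_def b_def c_def)
    define m d where "m = (1/2) *\<^sub>R (a + b)" and "d = (1/2) *\<^sub>R (a - b)"
    have md: "m + d = a" "m - d = b"
      unfolding m_def d_def by (simp_all add: algebra_simps flip: scaleR_add_left)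
    have mdV: "m \<in> V" "d \<in> V" using abc V by (auto simp: m_def d_def intro!: subspace_scale subspace_add subspace_diff)
    have "norm m \<le> (1/2) * (norm a + norm b)" unfolding m_def by (simp add: norm_triangle_ineq)
    then have mr: "norm m < r" using abc by simp
    have "norm (a - b) \<le> 2 * norm (?x + ?w - (?x - ?w))" unfolding a_def b_def using h by (intro dl) auto
    also have "?x + ?w - (?x - ?w) = w" by (simp add: flip: scaleR_add_left)
    finally have "norm d \<le> norm w" by (simp add: d_def)
    then have "C * (norm d)\<^sup>2 \<le> C * (norm w)\<^sup>2" using C by (intro mult_left_mono power_mono) auto
    moreover have "norm (q (m + d) + q (m - d) - 2 *\<^sub>R q m) \<le> C * (norm d)\<^sup>2"
      using mdV mr abc by (intro t(5)) (auto simp: md)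
    ultimately have 1: "norm (q a + q b - 2 *\<^sub>R q m) \<le> C * (norm w)\<^sup>2" by (simp add: md)
    have "norm (q m - q c) \<le> 3 * norm (m - c)" using mdV mr abc by (intro qlip) auto
    also have "m - c = (1/2) *\<^sub>R (a + b - 2 *\<^sub>R c)" by (simp add: m_def algebra_simps)
    also have "norm \<dots> \<le> (1/2) * (4 * C * (norm ?w)\<^sup>2)"
      using Suc.IH[OF h(1,3,2,5,7)] by (simp add: a_def b_def c_def)
    also have "3 * ((1/2) * (4 * C * (norm ?w)\<^sup>2)) = (3/2) * C * (norm w)\<^sup>2"
      by (simp add: power_divide)
    finally have 2: "norm (2 *\<^sub>R (q m - q c)) \<le> 3 * C * (norm w)\<^sup>2" by simp
    have eq: "En (Suc n) (x + w) + En (Suc n) (x - w) - 2 *\<^sub>R En (Suc n) x = (q a + q b - 2 *\<^sub>R q m) + 2 *\<^sub>R (q m - q c)"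
      unfolding EnS eqs a_def[symmetric] b_def[symmetric] c_def[symmetric] by (simp add: algebra_simps)
    show ?case unfolding eq using norm_triangle_mono[OF 1 2] by simp
  qed
  \<comment> \<open>Each further application of \<open>q\<close> costs a factor 3, whereas
    evaluating the quadratic bound at half the argument gains a factor 4.\<close>
  have E3: "norm (En (Suc n) x - En n x) \<le> (3/4)^n * (C * (norm x)\<^sup>2)" if "x \<in> V" "norm x < R" for n x
    using that
  proof (induction n arbitrary: x)
    case 0
    have "norm (q ((1/2) *\<^sub>R x) - q 0 - 2 *\<^sub>R ((1/2) *\<^sub>R x - 0)) \<le> C * (norm ((1/2) *\<^sub>R x) + norm (0::'e)) * norm ((1/2) *\<^sub>R x - 0)"
      using half[OF 0] \<open>0 \<in> V\<close> R by (intro t(4)) auto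
    also have "\<dots> \<le> C * (norm x)\<^sup>2" using C by (simp add: power2_eq_square mult_left_mono)
    finally show ?case by (simp add: En0 EnS t(3))
  next
    case (Suc n)
    let ?x = "(1/2) *\<^sub>R x"
    note h = half[OF Suc.prems]
    have "norm (En (Suc (Suc n)) x - En (Suc n) x) = norm (q (En (Suc n) ?x) - q (En n ?x))" by (simp add: EnS[of "Suc n"] EnS[of n x])
    also have "\<dots> \<le> 3 * norm (En (Suc n) ?x - En n ?x)" using bd[OF h] by (intro qlip) auto
    also have "\<dots> \<le> 3 * ((3/4)^n * (C * (norm ?x)\<^sup>2))" using Suc.IH[OF h] by simp
    also have "\<dots> = (3/4) ^ Suc n * (C * (norm x)\<^sup>2)" by (simp add: power_divide)
    finally show ?case .
  qed
  have conv: "convergent (\<lambda>n. En n x)" if "x \<in> V" "norm x < R" for x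
  proof -
    have "summable (\<lambda>n. (3/4)^n * (C * (norm x)\<^sup>2))" by (intro summable_mult2 summable_geometric) simp
    then have "summable (\<lambda>n. En (Suc n) x - En n x)"
      by (rule summable_comparison_test'[where N = 0]) (use E3[OF that] in blast)
    then have "convergent (\<lambda>n. \<Sum>k<n. En (Suc k) x - En k x)" by (simp add: summable_iff_convergent)
    then have "convergent (\<lambda>n. En n x - En 0 x)"
      by (simp only: sum_lessThan_telescope[of "\<lambda>n. En n x"])
    then have "convergent (\<lambda>n. (En n x - En 0 x) + En 0 x)" by (intro convergent_add convergent_const)
    then show ?thesis by simp
  qed
  define E where "E = (\<lambda>x. lim (\<lambda>n. En n x))"
  have lim: "(\<lambda>n. En n x) \<longlonglongrightarrow> E x" if "x \<in> V" "norm x < R" for x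
    using conv[OF that] unfolding E_def convergent_LIMSEQ_iff .
  have cV: "closed V" using V closed_subspace by blast
  have EV: "E x \<in> V" if "x \<in> V" "norm x < R" for x
    by (rule closed_sequentially[OF cV bd(1)[OF that] lim[OF that]])
  have Ebd: "norm (E x) \<le> 2 * norm x" if "x \<in> V" "norm x < R" for x
    by (rule Lim_norm_ubound[OF _ lim[OF that]]) (simp_all add: bd(2)[OF that] always_eventually)
  have E1': "norm (E x - E y - (x - y)) \<le> 2 * C * (norm x + norm y) * norm (x - y)"
    if "x \<in> V" "y \<in> V" "norm x < R" "norm y < R" for x y
  proof (rule Lim_norm_ubound)
    show "(\<lambda>n. En n x - En n y - (x - y)) \<longlonglongrightarrow> E x - E y - (x - y)"
      using lim that by (intro tendsto_intros) auto
    show "\<forall>\<^sub>F n in sequentially. norm (En n x - En n y - (x - y)) \<le> 2 * C * (norm x + norm y) * norm (x - y)"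
      using E1[OF that] by (simp add: always_eventually)
  qed simp
  have E2': "norm (E (x + w) + E (x - w) - 2 *\<^sub>R E x) \<le> 4 * C * (norm w)\<^sup>2"
    if "x \<in> V" "w \<in> V" "norm x < R" "norm (x + w) < R" "norm (x - w) < R" for x w
  proof -
    have "x + w \<in> V" "x - w \<in> V" using that V by (auto intro: subspace_add subspace_diff)
    show ?thesis
    proof (rule Lim_norm_ubound)
      show "(\<lambda>n. En n (x + w) + En n (x - w) - 2 *\<^sub>R En n x) \<longlonglongrightarrow> E (x + w) + E (x - w) - 2 *\<^sub>R E x"
        using lim that \<open>x + w \<in> V\<close> \<open>x - w \<in> V\<close> by (intro tendsto_intros) auto
      show "\<forall>\<^sub>F n in sequentially. norm (En n (x + w) + En n (x - w) - 2 *\<^sub>R En n x) \<le> 4 * C * (norm w)\<^sup>2"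
        using E2[OF that] by (simp add: always_eventually)
    qed simp
  qed
  have E0: "E 0 = 0" using Ebd[of 0] \<open>0 \<in> V\<close> R by simp
  have T': "tame_within V (\<lambda>x. x) E (4 * C) R"
    unfolding tame_within_def
  proof (intro conjI ballI impI)
    fix x y assume *: "x \<in> V" "y \<in> V" "norm x < R" "norm y < R"
    have "2 * C * (norm x + norm y) * norm (x - y) \<le> 4 * C * (norm x + norm y) * norm (x - y)"
      using C by (intro mult_right_mono) auto
    then show "norm (E x - E y - (x - y)) \<le> 4 * C * (norm x + norm y) * norm (x - y)"
      using E1'[OF *] by linarith
  qed (use R C E0 E2' in auto)
  have Eq: "E x = q (E ((1/2) *\<^sub>R x))" if "x \<in> V" "norm x < R" for x
  proof -
    let ?x = "(1/2) *\<^sub>R x"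
    note h = half[OF that]
    have "norm (E ?x) < r" using Ebd[OF h] that R by simp
    then have *: "norm (q (En n ?x) - q (E ?x)) \<le> 3 * norm (En n ?x - E ?x)" for n
      using bd[OF h] EV[OF h] by (intro qlip) auto
    have **: "(\<lambda>n. 3 * norm (En n ?x - E ?x)) \<longlonglongrightarrow> 0"
      using tendsto_mult_right_zero[OF tendsto_norm_zero[OF LIM_zero[OF lim[OF h]]]] .
    have "(\<lambda>n. q (En n ?x) - q (E ?x)) \<longlonglongrightarrow> 0"
      by (rule Lim_null_comparison[OF always_eventually[OF allI[OF *]] **])
    then have "(\<lambda>n. En (Suc n) x) \<longlonglongrightarrow> q (E ?x)" by (simp add: EnS LIM_zero_iff)
    moreover have "(\<lambda>n. En (Suc n) x) \<longlonglongrightarrow> E x" using lim[OF that] by (rule LIMSEQ_Suc)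
    ultimately show ?thesis by (rule LIMSEQ_unique[rotated])
  qed
  have half_id: "norm (E x - E y - (x - y)) \<le> (1/2) * norm (x - y)" if "x \<in> V" "y \<in> V" "norm x < R" "norm y < R" for x y
  proof -
    have "2 * C * (norm x + norm y) * norm (x - y) \<le> 2 * C * (2 * R) * norm (x - y)"
      using that C by (intro mult_right_mono mult_left_mono) auto
    also have "\<dots> \<le> (1/2) * norm (x - y)" using CR by (intro mult_right_mono) auto
    finally show ?thesis using E1'[OF that] by linarith
  qed
  show ?thesis
  proof (rule that[OF R(1) _ _ EV Ebd Eq half_id])
    show "R \<le> \<rho>" using R(2) r(3) by simp
    show "tame V (\<lambda>x. x) E" unfolding tame_def using T' by blast
  qed
qed

text \<open>Going back \<open>n\<close> steps multiplies the discrepancy by at most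
  \<open>3^n\<close>, so at index 0 it is at most a constant times \<open>(3/4)^n\<close> for every
  \<open>n\<close>. The rate \<open>4^-n\<close> comes from agreement up to second order at the
  origin.\<close>

lemma squaring_unique:
  fixes u v :: "nat \<Rightarrow> 'e::real_normed_vector"
  assumes lip: "\<And>n. norm (u n - v n) \<le> 3 * norm (u (Suc n) - v (Suc n))"
    and C: "\<And>n. norm (u n - v n) \<le> C * (1/4)^n"
  shows "u 0 = v 0"
proof -
  have "norm (u 0 - v 0) \<le> 3 ^ n * norm (u n - v n)" for n
  proof (induction n)
    case (Suc n)
    have "3 ^ n * norm (u n - v n) \<le> 3 ^ n * (3 * norm (u (Suc n) - v (Suc n)))"
      using lip by (intro mult_left_mono) auto
    also have "\<dots> = 3 ^ Suc n * norm (u (Suc n) - v (Suc n))" by simp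
    finally show ?case using Suc by (rule order_trans[rotated])
  qed simp
  moreover have "3 ^ n * norm (u n - v n) \<le> (3/4) ^ n * C" for n
    using mult_left_mono[OF C[of n], of "3 ^ n"] by (simp add: power_divide field_simps)
  ultimately have "norm (u 0 - v 0) \<le> (3/4) ^ n * C" for n by (meson order_trans)
  moreover have "(\<lambda>n. (3/4) ^ n * C) \<longlonglongrightarrow> 0" by (intro tendsto_mult_left_zero LIMSEQ_power_zero) simp
  ultimately have "norm (u 0 - v 0) \<le> 0" by (intro LIMSEQ_le_const) auto
  then show ?thesis by simp
qed

section \<open>Charts recentred at a point\<close>

lemma openin_subspace_translate:
  fixes V :: "'e::euclidean_space set"
  assumes "subspace V" "openin (top_of_set V) S" "a \<in> V"
  shows "openin (top_of_set V) {y \<in> V. a + y \<in> S}"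
proof -
  obtain Op where Op: "open Op" "S = V \<inter> Op" using assms(2) by (auto simp: openin_open)
  have "{y \<in> V. a + y \<in> S} = V \<inter> ((\<lambda>y. a + y) -` Op)"
    using assms Op by (auto intro: subspace_add)
  moreover have "open ((\<lambda>y. a + y) -` Op)" by (intro open_vimage Op continuous_intros)
  ultimately show ?thesis by (auto simp: openin_open)
qed

lemma openin_subspace_ball:
  fixes V :: "'e::euclidean_space set"
  assumes "openin (top_of_set V) S" "0 \<in> S"
  obtains r where "r > 0" "V \<inter> ball 0 r \<subseteq> S"
proof -
  obtain Op where Op: "open Op" "S = V \<inter> Op" using assms(1) by (auto simp: openin_open)
  then obtain r where "r > 0" "ball 0 r \<subseteq> Op" using assms(2) open_contains_ball by blast
  then show ?thesis using that[of r] Op by blast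
qed

text \<open>One map \<open>L\<close> in three roles: Frechet derivative of the recentred chart
  expression, linear part in the sense of tameness, and matrix of the differential on coordinate
  vectors. Identities proved through tameness can thus be read as identities of
  differentials.\<close>

lemma centered_chart_map:
  fixes N :: "('b, 'f::euclidean_space) manifold"
  assumes M: "smooth_manifold M" and N: "smooth_manifold N" and F: "smooth_map M N F"
    and c: "(U, \<phi>) \<in> atlas M" "p \<in> U" and d: "(W, \<psi>) \<in> atlas N" "F p \<in> W"
  obtains L r where "linear L" "\<And>v. v \<in> model M \<Longrightarrow> L v \<in> model N" "r > 0"
    "\<And>y. y \<in> model M \<Longrightarrow> norm y < r \<Longrightarrow> \<phi> p + y \<in> \<phi> ` U \<and> F (inv_into U \<phi> (\<phi> p + y)) \<in> W"
    "smooth_on (model M) (model M \<inter> ball 0 r) (\<lambda>y. \<psi> (F (inv_into U \<phi> (\<phi> p + y))) - \<psi> (F p))"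
    "((\<lambda>y. \<psi> (F (inv_into U \<phi> (\<phi> p + y))) - \<psi> (F p)) has_derivative L) (at 0 within model M \<inter> ball 0 r)"
    "tame (model M) L (\<lambda>y. \<psi> (F (inv_into U \<phi> (\<phi> p + y))) - \<psi> (F p))"
    "\<And>v. v \<in> model M \<Longrightarrow>
      differential N F p (coord_vector M (U, \<phi>) v p) = coord_vector N (W, \<psi>) (L v) (F p)"
proof -
  interpret M: smooth_manifold M by (rule M)
  interpret N: smooth_manifold N by (rule N)
  note sm = smooth_map_chart[OF M N F c(1) d(1)]
  define S where "S = \<phi> ` (U \<inter> F -` W)"
  have pS: "\<phi> p \<in> S" using c d by (auto simp: S_def)
  have So: "openin (top_of_set (model M)) S" using sm(2) by (simp add: S_def)
  have SV: "S \<subseteq> model M" using So openin_imp_subset by blast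
  have pV: "\<phi> p \<in> model M" using pS SV by blast
  obtain L where L: "((\<lambda>y. \<psi> (F (inv_into U \<phi> y))) has_derivative L) (at (\<phi> p) within S)"
    using smooth_on_differentiable[OF sm(3)[folded S_def] pS] .
  have lin: "linear L" using has_derivative_linear[OF L] .
  define S0 where "S0 = {y \<in> model M. \<phi> p + y \<in> S}"
  have S0: "openin (top_of_set (model M)) S0" "0 \<in> S0"
    using openin_subspace_translate[OF M.subspace_model So pV] pS subspace_0[OF M.subspace_model]
    by (auto simp: S0_def)
  obtain r where r: "r > 0" "model M \<inter> ball 0 r \<subseteq> S0" using openin_subspace_ball[OF S0] .
  define B where "B = model M \<inter> ball 0 r"
  have B: "openin (top_of_set (model M)) B" "0 \<in> B"
    using r subspace_0[OF M.subspace_model] by (auto simp: B_def openin_open)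
  have im: "(\<lambda>y. \<phi> p + y) ` B \<subseteq> S" using r(2) by (auto simp: B_def S0_def)
  let ?f = "\<lambda>y. \<psi> (F (inv_into U \<phi> (\<phi> p + y))) - \<psi> (F p)"
  have shift: "smooth_on (model M) B (\<lambda>y. \<phi> p + y)"
    by (intro smooth_on_add smooth_on_const smooth_on_id)
  have "smooth_on (model M) B (\<lambda>y. \<psi> (F (inv_into U \<phi> (\<phi> p + y))) + - \<psi> (F p))"
    by (intro smooth_on_add smooth_on_const smooth_on_compose[OF M.subspace_model SV im shift]) (use sm(3) S_def in simp)
  then have f: "smooth_on (model M) B ?f" by simp
  have "((\<lambda>y. \<phi> p + y) has_derivative (\<lambda>v. v)) (at 0 within B)"
    by (rule derivative_eq_intros refl | simp)+
  moreover have "((\<lambda>y. \<psi> (F (inv_into U \<phi> y))) has_derivative L) (at (\<phi> p + 0) within (\<lambda>y. \<phi> p + y) ` B)"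
    using has_derivative_subset[OF L im] by simp
  ultimately have "((\<lambda>y. \<psi> (F (inv_into U \<phi> (\<phi> p + y)))) has_derivative (\<lambda>v. L v)) (at 0 within B)"
    by (rule has_derivative_in_compose)
  from has_derivative_diff[OF this has_derivative_const[of "\<psi> (F p)"]]
  have D: "(?f has_derivative L) (at 0 within B)" by simp
  have f0: "?f 0 = 0" using c by simp
  show ?thesis
  proof (rule that[OF lin _ r(1)])
    show "L v \<in> model N" if "v \<in> model M" for v
      using differential_coord_vector(1)[OF M N F c d So pS L that] .
    show "\<phi> p + y \<in> \<phi> ` U \<and> F (inv_into U \<phi> (\<phi> p + y)) \<in> W" if "y \<in> model M" "norm y < r" for y
    proof -
      have "\<phi> p + y \<in> S" using im that by (auto simp: B_def)
      then obtain x where "x \<in> U" "F x \<in> W" "\<phi> p + y = \<phi> x" unfolding S_def by blast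
      then show ?thesis using c(1) by simp
    qed
    show "smooth_on (model M) (model M \<inter> ball 0 r) ?f" using f B_def by simp
    show "(?f has_derivative L) (at 0 within model M \<inter> ball 0 r)" using D B_def by simp
    show "tame (model M) L ?f" by (rule tame_smooth[OF M.subspace_model B f f0 D])
    show "differential N F p (coord_vector M (U, \<phi>) v p) = coord_vector N (W, \<psi>) (L v) (F p)" if "v \<in> model M" for v
      using differential_coord_vector(2)[OF M N F c d So pS L that] .
  qed
qed

section \<open>The exponential map\<close>

locale lie_group_chart = lie_group G M
  for G :: "('g, 'r) monoid_scheme" (structure)
    and M :: "('g, 'e::euclidean_space) manifold" +
  fixes U :: "'g set" and \<phi> :: "'g \<Rightarrow> 'e"
  assumes chart: "(U, \<phi>) \<in> atlas M" and one_U: "\<one> \<in> U"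
begin

abbreviation V :: "'e set" where "V \<equiv> model M"

text \<open>The chart recentred at the identity: \<open>lg\<close> and \<open>ex\<close> are crude
  substitutes for logarithm and exponential, mutually inverse near \<open>\<one>\<close> and
  0.\<close>

definition lg :: "'g \<Rightarrow> 'e" where "lg x = \<phi> x - \<phi> \<one>"

definition ex :: "'e \<Rightarrow> 'g" where "ex y = inv_into U \<phi> (\<phi> \<one> + y)"

lemma V: "subspace V" by (rule subspace_model)

lemma U_carrier: "x \<in> U \<Longrightarrow> x \<in> carrier G"
  using chart_subset_points[OF chart] points_eq by blast

lemma lg_one [simp]: "lg \<one> = 0" by (simp add: lg_def)

lemma ex_zero [simp]: "ex 0 = \<one>" using chart one_U by (simp add: ex_def)

lemma lg_V: "x \<in> U \<Longrightarrow> lg x \<in> V"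
  using chart_image_subset[OF chart] one_U V by (auto simp: lg_def intro!: subspace_diff)

lemma ex_lg [simp]: "x \<in> U \<Longrightarrow> ex (lg x) = x"
  using chart by (simp add: ex_def lg_def)

lemma lg_inj: "x \<in> U \<Longrightarrow> y \<in> U \<Longrightarrow> lg x = lg y \<Longrightarrow> x = y"
  using ex_lg by metis

lemma ex_near:
  assumes "openin (mtop M) A" "\<one> \<in> A"
  obtains r where "r > 0" "\<And>y. y \<in> V \<Longrightarrow> norm y < r \<Longrightarrow> ex y \<in> A \<and> ex y \<in> U \<and> lg (ex y) = y"
proof -
  have o: "openin (top_of_set V) (\<phi> ` (U \<inter> A))" by (rule chart_image_openin[OF chart assms(1)])
  have "\<phi> \<one> \<in> V" using chart_image_subset[OF chart] one_U by blast
  then have "openin (top_of_set V) {y \<in> V. \<phi> \<one> + y \<in> \<phi> ` (U \<inter> A)}" "0 \<in> {y \<in> V. \<phi> \<one> + y \<in> \<phi> ` (U \<inter> A)}"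
    using openin_subspace_translate[OF V o] one_U assms subspace_0[OF V] by auto
  then obtain r where r: "r > 0" "V \<inter> ball 0 r \<subseteq> {y \<in> V. \<phi> \<one> + y \<in> \<phi> ` (U \<inter> A)}"
    using openin_subspace_ball by blast
  show ?thesis
  proof (rule that[OF r(1)])
    fix y assume "y \<in> V" "norm y < r"
    then have "\<phi> \<one> + y \<in> \<phi> ` (U \<inter> A)" using r(2) by auto
    then obtain x where x: "x \<in> U" "x \<in> A" "\<phi> \<one> + y = \<phi> x" by blast
    then show "ex y \<in> A \<and> ex y \<in> U \<and> lg (ex y) = y"
      using chart by (simp add: ex_def lg_def algebra_simps)
  qed
qed

lemma lg_near:
  assumes "e > 0"
  shows "openin (mtop M) {x \<in> U. norm (lg x) < e}" "\<one> \<in> {x \<in> U. norm (lg x) < e}"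
proof -
  have "openin (top_of_set V) (V \<inter> ball (\<phi> \<one>) e)" by (auto simp: openin_open)
  from chart_preimage_openin[OF chart this]
  have "openin (mtop M) {x \<in> U. \<phi> x \<in> V \<inter> ball (\<phi> \<one>) e}" .
  moreover have "{x \<in> U. \<phi> x \<in> V \<inter> ball (\<phi> \<one>) e} = {x \<in> U. norm (lg x) < e}"
    using chart_image_subset[OF chart] by (auto simp: lg_def dist_norm norm_minus_commute)
  ultimately show "openin (mtop M) {x \<in> U. norm (lg x) < e}" by simp
  show "\<one> \<in> {x \<in> U. norm (lg x) < e}" using one_U assms by simp
qed

text \<open>Tameness in the chart; the explicit chart condition is needed because \<open>lg\<close> is junk outside \<open>U\<close>.\<close>

definition gtame :: "'f::euclidean_space set \<Rightarrow> ('f \<Rightarrow> 'e) \<Rightarrow> ('f \<Rightarrow> 'g) \<Rightarrow> bool" where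
  "gtame V' L a \<longleftrightarrow> subspace V' \<and> linear L \<and> tame V' L (\<lambda>x. lg (a x)) \<and>
    (\<exists>r>0. \<forall>x\<in>V'. norm x < r \<longrightarrow> a x \<in> U)"

lemma gtameD:
  assumes "gtame V' L a"
  shows "subspace V'" "linear L" "tame V' L (\<lambda>x. lg (a x))" "\<exists>r>0. \<forall>x\<in>V'. norm x < r \<longrightarrow> a x \<in> U"
  using assms by (auto simp: gtame_def)

lemma gtame_small:
  assumes "gtame V' L a" "e > 0"
  obtains r where "r > 0" "\<And>x. x \<in> V' \<Longrightarrow> norm x < r \<Longrightarrow> a x \<in> U \<and> norm (lg (a x)) < e"
proof -
  note g = gtameD[OF assms(1)]
  obtain C r0 K where T: "tame_within V' L (\<lambda>x. lg (a x)) C r0" "K > 0"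
    and K: "\<And>x. x \<in> V' \<Longrightarrow> norm x < r0 \<Longrightarrow> norm (lg (a x)) \<le> K * norm x"
    using tame_bounds[OF g(3,1,2)] by metis
  obtain r1 where r1: "r1 > 0" "\<forall>x\<in>V'. norm x < r1 \<longrightarrow> a x \<in> U" using g(4) by blast
  define r where "r = min (min r0 r1) (e / K)"
  have r: "r > 0" "r \<le> r0" "r \<le> r1" "r \<le> e / K"
    using tame_withinD(1)[OF T(1)] r1 T(2) assms(2) by (auto simp: r_def)
  show ?thesis
  proof (rule that[OF r(1)])
    fix x assume x: "x \<in> V'" "norm x < r"
    have "K * norm x < K * (e / K)" using x r T(2) by (intro mult_strict_left_mono) auto
    then have "K * norm x < e" using T(2) by simp
    moreover have "norm (lg (a x)) \<le> K * norm x" using K x r by simp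
    moreover have "a x \<in> U" using r1(2) x r by simp
    ultimately show "a x \<in> U \<and> norm (lg (a x)) < e" by simp
  qed
qed

lemma gtame_cong:
  assumes "gtame V' L a" "r > 0" "\<And>x. x \<in> V' \<Longrightarrow> norm x < r \<Longrightarrow> b x = a x"
    "\<And>x. x \<in> V' \<Longrightarrow> L' x = L x" "linear L'"
  shows "gtame V' L' b"
proof -
  note g = gtameD[OF assms(1)]
  have "tame V' L' (\<lambda>x. lg (b x))"
    by (rule tame_cong[OF g(3) assms(2) g(1)]) (simp_all add: assms)
  moreover obtain r1 where r1: "r1 > 0" "\<forall>x\<in>V'. norm x < r1 \<longrightarrow> a x \<in> U" using g(4) by blast
  have "\<exists>r>0. \<forall>x\<in>V'. norm x < r \<longrightarrow> b x \<in> U"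
    by (rule exI[of _ "min r r1"]) (use r1 assms(2,3) in simp)
  ultimately show ?thesis using g assms(5) by (simp add: gtame_def)
qed

lemma gtame_compose:
  assumes a: "gtame V' L a" and f: "tame V'' A f" and V'': "subspace V''" and A: "linear A"
    and r: "r > 0" "\<And>x. x \<in> V'' \<Longrightarrow> norm x < r \<Longrightarrow> f x \<in> V'"
  shows "gtame V'' (\<lambda>x. L (A x)) (\<lambda>x. a (f x))"
proof -
  note g = gtameD[OF a]
  obtain r1 where r1: "r1 > 0" "\<forall>x\<in>V'. norm x < r1 \<longrightarrow> a x \<in> U" using g(4) by blast
  obtain C r0 K where T: "tame_within V'' A f C r0" "K > 0"
    and K: "\<And>x. x \<in> V'' \<Longrightarrow> norm x < r0 \<Longrightarrow> norm (f x) \<le> K * norm x"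
    using tame_bounds[OF f V'' A] by metis
  define r2 where "r2 = min (min r0 r) (r1 / K)"
  have r2: "r2 > 0" "r2 \<le> r0" "r2 \<le> r" "r2 \<le> r1 / K"
    using tame_withinD(1)[OF T(1)] r1 T(2) r(1) by (auto simp: r2_def)
  have "a (f x) \<in> U" if x: "x \<in> V''" "norm x < r2" for x
  proof -
    have "K * norm x < K * (r1 / K)" using x r2 T(2) by (intro mult_strict_left_mono) auto
    then have "K * norm x < r1" using T(2) by simp
    moreover have "norm (f x) \<le> K * norm x" using K x r2 by simp
    moreover have "f x \<in> V'" using r(2) x r2 by simp
    ultimately show ?thesis using r1(2) by simp
  qed
  moreover have "linear (\<lambda>x. L (A x))" using linear_compose[OF A g(2)] by (simp add: o_def)
  moreover have "tame V'' (\<lambda>x. L (A x)) (\<lambda>x. lg (a (f x)))"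
    by (rule tame_compose[OF V'' g(1) f g(3) A g(2) r])
  ultimately show ?thesis using r2(1) V'' unfolding gtame_def by blast
qed

lemma gtame_linear_compose:
  assumes "gtame V' L a" "subspace V''" "linear A" "\<And>x. x \<in> V'' \<Longrightarrow> A x \<in> V'"
  shows "gtame V'' (\<lambda>x. L (A x)) (\<lambda>x. a (A x))"
  by (rule gtame_compose[OF assms(1) tame_linear[OF assms(3)] assms(2,3) zero_less_one assms(4)])

text \<open>Near 0 the map \<open>F (a x)\<close> equals \<open>F (ex (lg (a x)))\<close>, so a
  single \<open>L\<close>, the differential of \<open>F\<close> in the chart, acts on the linear
  part of every tame \<open>a\<close>.\<close>

lemma gtame_smooth_map:
  assumes F: "smooth_map M M F" "F \<one> = \<one>"
  obtains L where "linear L" "\<And>v. v \<in> V \<Longrightarrow> L v \<in> V"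
    "\<And>v. v \<in> V \<Longrightarrow> differential M F \<one> (coord_vector M (U, \<phi>) v \<one>) = coord_vector M (U, \<phi>) (L v) \<one>"
    "gtame V L (\<lambda>y. F (ex y))"
    "\<And>V' A a. gtame V' A a \<Longrightarrow> gtame V' (\<lambda>x. L (A x)) (\<lambda>x. F (a x))"
proof -
  have F1: "F \<one> \<in> U" using F one_U by simp
  obtain L r where L: "linear L" "\<And>v. v \<in> V \<Longrightarrow> L v \<in> V" "r > 0"
    "\<And>y. y \<in> V \<Longrightarrow> norm y < r \<Longrightarrow> \<phi> \<one> + y \<in> \<phi> ` U \<and> F (inv_into U \<phi> (\<phi> \<one> + y)) \<in> U"
    "tame V L (\<lambda>y. \<phi> (F (inv_into U \<phi> (\<phi> \<one> + y))) - \<phi> (F \<one>))"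
    "\<And>v. v \<in> V \<Longrightarrow> differential M F \<one> (coord_vector M (U, \<phi>) v \<one>) = coord_vector M (U, \<phi>) (L v) (F \<one>)"
    using centered_chart_map[OF smooth_manifold_M smooth_manifold_M F(1) chart one_U chart F1] by metis
  have g: "gtame V L (\<lambda>y. F (ex y))"
    unfolding gtame_def using L(1,3,4,5) V F(2) by (auto simp: ex_def lg_def)
  have "gtame V' (\<lambda>x. L (A x)) (\<lambda>x. F (a x))" if a: "gtame V' A a" for V' :: "'b::euclidean_space set" and A a
  proof -
    note ga = gtameD[OF a]
    obtain r1 where r1: "r1 > 0" "\<forall>x\<in>V'. norm x < r1 \<longrightarrow> a x \<in> U" using ga(4) by blast
    have "gtame V' (\<lambda>x. L (A x)) (\<lambda>x. F (ex (lg (a x))))"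
      by (rule gtame_compose[OF g ga(3,1,2) r1(1)]) (use r1(2) lg_V in blast)
    then show ?thesis
      by (rule gtame_cong[OF _ r1(1)])
        (use r1(2) linear_compose[OF ga(2) L(1)] in \<open>auto simp: o_def\<close>)
  qed
  with L g F show ?thesis using that by metis
qed

text \<open>The derivative of multiplication at the identity is addition: multiplying by
  \<open>\<one>\<close> on either side is the identity map, which determines the derivative on both
  coordinate subspaces.\<close>

lemma mult_gtame: "gtame (V \<times> V) (\<lambda>p. fst p + snd p) (\<lambda>p. ex (fst p) \<otimes> ex (snd p))"
proof -
  have oo: "\<one> \<otimes> \<one> \<in> U" using one_U by simp
  obtain S S' where S: "openin (top_of_set V) S" "\<phi> \<one> \<in> S" "S \<subseteq> \<phi> ` U"
    "openin (top_of_set V) S'" "\<phi> \<one> \<in> S'" "S' \<subseteq> \<phi> ` U"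
    "\<And>y z. y \<in> S \<Longrightarrow> z \<in> S' \<Longrightarrow> inv_into U \<phi> y \<otimes> inv_into U \<phi> z \<in> U"
    "smooth_on (V \<times> V) (S \<times> S') (\<lambda>p. \<phi> (inv_into U \<phi> (fst p) \<otimes> inv_into U \<phi> (snd p)))"
    by (rule mult_chart[OF chart one_U chart one_U chart oo]) (rule that)
  have VV: "subspace (V \<times> V)" using V V by (rule subspace_Times)
  have o: "openin (top_of_set (V \<times> V)) (S \<times> S')" using S(1,4) by (rule openin_Times)
  have pV: "(\<phi> \<one>, \<phi> \<one>) \<in> V \<times> V" using S openin_imp_subset by blast
  define S0 where "S0 = {y \<in> V \<times> V. (\<phi> \<one>, \<phi> \<one>) + y \<in> S \<times> S'}"
  have S0: "openin (top_of_set (V \<times> V)) S0" "0 \<in> S0"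
    using openin_subspace_translate[OF VV o pV] S(2,5) subspace_0[OF VV] by (auto simp: S0_def)
  obtain r where r: "r > 0" "V \<times> V \<inter> ball 0 r \<subseteq> S0" using openin_subspace_ball[OF S0] .
  define B where "B = V \<times> V \<inter> ball 0 r"
  have B: "openin (top_of_set (V \<times> V)) B" "0 \<in> B"
    using r subspace_0[OF VV] by (auto simp: B_def openin_open)
  let ?f = "\<lambda>p. lg (ex (fst p) \<otimes> ex (snd p))"
  have im: "(\<lambda>y. (\<phi> \<one>, \<phi> \<one>) + y) ` B \<subseteq> S \<times> S'" using r(2) unfolding B_def S0_def by blast
  have SV: "S \<times> S' \<subseteq> V \<times> V" using o openin_imp_subset by blast
  have shift: "smooth_on (V \<times> V) B (\<lambda>y. (\<phi> \<one>, \<phi> \<one>) + y)"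
    by (intro smooth_on_add smooth_on_const smooth_on_id)
  have "smooth_on (V \<times> V) B (\<lambda>y. \<phi> (inv_into U \<phi> (fst ((\<phi> \<one>, \<phi> \<one>) + y)) \<otimes> inv_into U \<phi> (snd ((\<phi> \<one>, \<phi> \<one>) + y))) + - \<phi> \<one>)"
    by (intro smooth_on_add smooth_on_const smooth_on_compose[OF VV SV im shift S(8)])
  then have f: "smooth_on (V \<times> V) B ?f" by (simp add: lg_def ex_def)
  obtain D where D: "(?f has_derivative D) (at 0 within B)" using smooth_on_differentiable[OF f B(2)] .
  have linD: "linear D" using has_derivative_linear[OF D] .
  have f0: "?f 0 = 0" by simp
  have tame: "tame (V \<times> V) D ?f" by (rule tame_smooth[OF VV B f f0 D])
  obtain r1 where r1: "r1 > 0" "\<And>y. y \<in> V \<Longrightarrow> norm y < r1 \<Longrightarrow> ex y \<in> U \<and> ex y \<in> U \<and> lg (ex y) = y"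
    using ex_near[OF chart_open[OF chart] one_U] by metis
  have lin1: "linear (\<lambda>x. (x, 0))" "linear (\<lambda>x. (0, x))" by (auto intro!: linearI)
  have D1: "D (x, 0) = x" if "x \<in> V" for x
  proof (rule tame_derivative_unique[OF _ _ V _ linear_id[unfolded id_def] that])
    show "linear (\<lambda>x. D (x, 0))" using linear_compose[OF lin1(1) linD] by (simp add: o_def)
    show t: "tame V (\<lambda>x. D (x, 0)) (\<lambda>x. ?f (x, 0))"
      by (rule tame_compose[OF V VV tame_linear[OF lin1(1)] tame lin1(1) linD zero_less_one])
        (simp add: subspace_0[OF V])
    show "tame V (\<lambda>x. x) (\<lambda>x. ?f (x, 0))"
      by (rule tame_cong[OF tame_linear[OF linear_id[unfolded id_def]] r1(1) V])
        (use r1(2) U_carrier in auto)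
  qed
  have D2: "D (0, x) = x" if "x \<in> V" for x
  proof (rule tame_derivative_unique[OF _ _ V _ linear_id[unfolded id_def] that])
    show "linear (\<lambda>x. D (0, x))" using linear_compose[OF lin1(2) linD] by (simp add: o_def)
    show t: "tame V (\<lambda>x. D (0, x)) (\<lambda>x. ?f (0, x))"
      by (rule tame_compose[OF V VV tame_linear[OF lin1(2)] tame lin1(2) linD zero_less_one])
        (simp add: subspace_0[OF V])
    show "tame V (\<lambda>x. x) (\<lambda>x. ?f (0, x))"
      by (rule tame_cong[OF tame_linear[OF linear_id[unfolded id_def]] r1(1) V])
        (use r1(2) U_carrier in auto)
  qed
  have D: "fst p + snd p = D p" if p: "p \<in> V \<times> V" for p
  proof -
    have "D p = D ((fst p, 0) + (0, snd p))" by simp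
    also have "\<dots> = D (fst p, 0) + D (0, snd p)" using linear_add[OF linD] .
    also have "\<dots> = fst p + snd p" using D1 D2 p by (auto simp: mem_Times_iff)
    finally show ?thesis by simp
  qed
  have "tame (V \<times> V) (\<lambda>p. fst p + snd p) ?f"
    by (rule tame_cong[OF tame zero_less_one VV refl D])
  moreover have "ex (fst p) \<otimes> ex (snd p) \<in> U" if "p \<in> V \<times> V" "norm p < r" for p
  proof -
    have "p \<in> B" using that by (simp add: B_def)
    then have "(\<phi> \<one>, \<phi> \<one>) + p \<in> S \<times> S'" using im by blast
    then show ?thesis using S(7)[of "\<phi> \<one> + fst p" "\<phi> \<one> + snd p"] by (cases p) (auto simp: ex_def)
  qed
  moreover have "linear (\<lambda>p::'e \<times> 'e. fst p + snd p)" by (auto intro!: linearI simp: algebra_simps)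
  ultimately show ?thesis unfolding gtame_def using VV r(1) by blast
qed

lemma gtame_mult:
  assumes a: "gtame V' L a" and b: "gtame V' L' b"
  shows "gtame V' (\<lambda>x. L x + L' x) (\<lambda>x. a x \<otimes> b x)"
proof -
  note ga = gtameD[OF a] and gb = gtameD[OF b]
  obtain r1 where r1: "r1 > 0" "\<forall>x\<in>V'. norm x < r1 \<longrightarrow> a x \<in> U" using ga(4) by blast
  obtain r2 where r2: "r2 > 0" "\<forall>x\<in>V'. norm x < r2 \<longrightarrow> b x \<in> U" using gb(4) by blast
  define r where "r = min r1 r2"
  have r: "r > 0" "\<And>x. x \<in> V' \<Longrightarrow> norm x < r \<Longrightarrow> a x \<in> U" "\<And>x. x \<in> V' \<Longrightarrow> norm x < r \<Longrightarrow> b x \<in> U"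
    using r1 r2 by (auto simp: r_def)
  have lin: "linear (\<lambda>x. (L x, L' x))" "linear (\<lambda>x. L x + L' x)"
    using ga(2) gb(2) by (auto intro!: linearI simp: linear_add linear_cmul algebra_simps)
  have "gtame V' (\<lambda>x. fst (L x, L' x) + snd (L x, L' x))
    (\<lambda>x. ex (fst (lg (a x), lg (b x))) \<otimes> ex (snd (lg (a x), lg (b x))))"
    by (rule gtame_compose[OF mult_gtame tame_Pair[OF ga(3) gb(3)] ga(1) lin(1) r(1)])
      (use r lg_V in simp)
  then show ?thesis by (rule gtame_cong[OF _ r(1)]) (use r lin in auto)
qed

lemma gtame_ex: "gtame V (\<lambda>x. x) ex"
proof -
  obtain r1 where r1: "r1 > 0" "\<And>y. y \<in> V \<Longrightarrow> norm y < r1 \<Longrightarrow> ex y \<in> U \<and> ex y \<in> U \<and> lg (ex y) = y"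
    using ex_near[OF chart_open[OF chart] one_U] by metis
  have "tame V (\<lambda>x. x) (\<lambda>x. lg (ex x))"
    by (rule tame_cong[OF tame_linear[OF linear_id[unfolded id_def]] r1(1) V]) (use r1(2) in auto)
  then show ?thesis unfolding gtame_def using V r1 linear_id[unfolded id_def] by blast
qed

text \<open>Doubling together with first-order normalisation at 0. By \<open>Exp_unique\<close> this
  pins down the function on \<open>V\<close>; additivity along lines is derived from it in
  \<open>Exp_add\<close>.\<close>

definition exp_like :: "('e \<Rightarrow> 'g) \<Rightarrow> bool" where
  "exp_like f \<longleftrightarrow> gtame V (\<lambda>x. x) f \<and>
     (\<forall>X\<in>V. f X \<in> carrier G \<and> f X = f ((1/2) *\<^sub>R X) \<otimes> f ((1/2) *\<^sub>R X))"

text \<open>A local solution \<open>loc\<close> comes from linearizing the squaring map in the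
  chart. It is spread over all of \<open>V\<close> by taking the \<open>2^n\<close>-th power of its
  value at \<open>X / 2^n\<close>.\<close>

lemma ex_exp_like: "\<exists>f. exp_like f"
proof -
  define q where "q = (\<lambda>x. lg (ex x \<otimes> ex x))"
  have sq: "gtame V (\<lambda>x. x + x) (\<lambda>x. ex x \<otimes> ex x)" by (rule gtame_mult[OF gtame_ex gtame_ex])
  note gq = gtameD[OF sq]
  have qt: "tame V (\<lambda>x. 2 *\<^sub>R x) q"
    unfolding q_def by (rule tame_cong[OF gq(3) zero_less_one V]) (simp_all add: scaleR_2)
  obtain \<rho> where \<rho>: "\<rho> > 0" "\<And>x. x \<in> V \<Longrightarrow> norm x < \<rho> \<Longrightarrow> ex x \<otimes> ex x \<in> U" using gq(4) by metis
  have qV: "q x \<in> V" if "x \<in> V" "norm x < \<rho>" for x unfolding q_def using \<rho>(2)[OF that] lg_V by blast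
  obtain E R where E: "R > 0" "R \<le> \<rho>" "tame V (\<lambda>x. x) E"
    "\<And>x. x \<in> V \<Longrightarrow> norm x < R \<Longrightarrow> E x \<in> V" "\<And>x. x \<in> V \<Longrightarrow> norm x < R \<Longrightarrow> norm (E x) \<le> 2 * norm x"
    "\<And>x. x \<in> V \<Longrightarrow> norm x < R \<Longrightarrow> E x = q (E ((1/2) *\<^sub>R x))"
    using squaring_linearization[OF V qt \<rho>(1) qV] by metis
  obtain r1 where r1: "r1 > 0" "\<And>y. y \<in> V \<Longrightarrow> norm y < r1 \<Longrightarrow> ex y \<in> U \<and> ex y \<in> U \<and> lg (ex y) = y"
    using ex_near[OF chart_open[OF chart] one_U] by metis
  \<comment> \<open>\<open>E\<close> at most doubles norms, so within \<open>R1\<close> its values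
    lie where \<open>ex\<close> inverts \<open>lg\<close> and where squares remain in the
    chart.\<close>
  define R1 where "R1 = min R (min (r1 / 2) (\<rho> / 2))"
  have R1: "R1 > 0" "R1 \<le> R" "2 * R1 \<le> r1" "2 * R1 \<le> \<rho>" using E(1) r1(1) \<rho>(1) by (auto simp: R1_def)
  define loc where "loc = (\<lambda>x. ex (E x))"
  have EV: "E x \<in> V" "norm (E x) < r1" "norm (E x) < \<rho>" if "x \<in> V" "norm x < R1" for x
    using E(4,5)[OF that(1)] that R1 by auto
  have locU: "loc x \<in> U" "lg (loc x) = E x" if "x \<in> V" "norm x < R1" for x
    using r1(2)[OF EV(1,2)[OF that]] by (auto simp: loc_def)
  have loc2: "loc x = loc ((1/2) *\<^sub>R x) \<otimes> loc ((1/2) *\<^sub>R x)" if "x \<in> V" "norm x < R1" for x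
  proof -
    have h: "(1/2) *\<^sub>R x \<in> V" "norm ((1/2) *\<^sub>R x) < R1" using that V R1 by (auto simp: subspace_scale)
    have "loc x = ex (q (E ((1/2) *\<^sub>R x)))" using E(6)[OF that(1)] that(2) R1 by (simp add: loc_def)
    also have "\<dots> = loc ((1/2) *\<^sub>R x) \<otimes> loc ((1/2) *\<^sub>R x)"
      using \<rho>(2)[OF EV(1)[OF h] EV(3)[OF h]] by (simp add: q_def loc_def)
    finally show ?thesis .
  qed
  define sc where "sc = (\<lambda>n::nat. \<lambda>X::'e. (1/2)^n *\<^sub>R X)"
  have scV: "sc n X \<in> V" if "X \<in> V" for n X using that V by (simp add: sc_def subspace_scale)
  have scn: "norm (sc n X) < R1 \<longleftrightarrow> norm X < R1 * 2 ^ n" for n X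
    by (simp add: sc_def power_divide field_simps)
  have scS: "(1/2) *\<^sub>R sc n X = sc (Suc n) X" "sc n ((1/2) *\<^sub>R X) = sc (Suc n) X" for n X by (simp_all add: sc_def)
  \<comment> \<open>Every sufficiently large exponent gives the same value, see \<open>f_eq\<close>.
    Near 0 the exponent 0 is admissible, so there \<open>f\<close> is \<open>loc\<close> and
    inherits tameness.\<close>
  define f where "f = (\<lambda>X. let n = (LEAST n. norm X < R1 * 2 ^ n) in loc (sc n X) [^] (2 ^ n :: nat))"
  have scale_step: "loc (sc m X) [^] (2 ^ m :: nat) = loc (sc (Suc m) X) [^] (2 ^ Suc m :: nat)"
    if "X \<in> V" "norm X < R1 * 2 ^ m" for X m
  proof -
    have n: "norm (sc m X) < R1" using scn that by blast
    have "norm (sc (Suc m) X) < R1" using n R1(1) by (simp add: scS(1)[symmetric])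
    then have c: "loc (sc (Suc m) X) \<in> carrier G" using locU(1) scV that U_carrier by blast
    have "loc (sc m X) = loc (sc (Suc m) X) [^] (2::nat)"
      using loc2[OF scV[OF that(1)] n] c by (simp add: scS numeral_2_eq_2)
    then show ?thesis using c by (simp add: nat_pow_pow)
  qed
  have f_eq: "f X = loc (sc n X) [^] (2 ^ n :: nat)" if X: "X \<in> V" "norm X < R1 * 2 ^ n" for X n
  proof -
    define n0 where "n0 = (LEAST n. norm X < R1 * 2 ^ n)"
    have n0: "norm X < R1 * 2 ^ n0" unfolding n0_def using X(2) by (rule LeastI)
    have "n0 \<le> n" unfolding n0_def using X(2) by (rule Least_le)
    then have "loc (sc n X) [^] (2 ^ n :: nat) = loc (sc n0 X) [^] (2 ^ n0 :: nat)"
    proof (induction n rule: dec_induct)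
      case (step m)
      have "R1 * 2 ^ n0 \<le> R1 * 2 ^ m" using step R1(1) by simp
      then have "norm X < R1 * 2 ^ m" using n0 by simp
      from scale_step[OF X(1) this] show ?case using step.IH by simp
    qed simp
    then show ?thesis by (simp add: f_def n0_def Let_def)
  qed
  have exn: "\<exists>n. norm X < R1 * 2 ^ n" for X :: 'e
  proof -
    obtain n where "norm X / R1 < 2 ^ n" using real_arch_pow[of 2 "norm X / R1"] by auto
    then show ?thesis using R1(1) by (auto simp: field_simps)
  qed
  have fc: "f X \<in> carrier G \<and> f X = f ((1/2) *\<^sub>R X) \<otimes> f ((1/2) *\<^sub>R X)" if X: "X \<in> V" for X
  proof -
    obtain n where n: "norm X < R1 * 2 ^ n" using exn by blast
    have "R1 * 2 ^ n \<le> R1 * 2 ^ Suc n" using R1(1) by simp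
    with n have n': "norm X < R1 * 2 ^ Suc n" by (rule less_le_trans)
    have h: "(1/2) *\<^sub>R X \<in> V" "norm ((1/2) *\<^sub>R X) < R1 * 2 ^ n"
      using X V n' by (simp_all add: subspace_scale)
    have "norm (sc (Suc n) X) < R1" using n' scn by blast
    then have c: "loc (sc (Suc n) X) \<in> carrier G" using locU(1) scV X U_carrier by blast
    have "f X = loc (sc (Suc n) X) [^] (2 ^ Suc n :: nat)" by (rule f_eq[OF X n'])
    moreover have "f ((1/2) *\<^sub>R X) = loc (sc (Suc n) X) [^] (2 ^ n :: nat)" using f_eq[OF h] by (simp add: scS)
    ultimately show ?thesis using c by (simp add: nat_pow_mult mult_2)
  qed
  have "gtame V (\<lambda>x. x) loc"
  proof -
    have "tame V (\<lambda>x. x) (\<lambda>x. lg (loc x))"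
      by (rule tame_cong[OF E(3) R1(1) V]) (use locU in auto)
    then show ?thesis unfolding gtame_def using V R1(1) locU(1) linear_id[unfolded id_def] by blast
  qed
  then have "gtame V (\<lambda>x. x) f"
    by (rule gtame_cong[OF _ R1(1)]) (use f_eq[of _ 0] locU(1) U_carrier in \<open>auto simp: sc_def linear_id[unfolded id_def]\<close>)
  with fc show ?thesis unfolding exp_like_def by blast
qed

section \<open>The exponential map and its characterisation\<close>

definition Exp :: "'e \<Rightarrow> 'g" where "Exp = (SOME f. exp_like f)"

lemma exp_like_Exp: "exp_like Exp"
  unfolding Exp_def using ex_exp_like by (rule someI_ex)

lemma gtame_Exp: "gtame V (\<lambda>x. x) Exp"
  and Exp_carrier [simp]: "X \<in> V \<Longrightarrow> Exp X \<in> carrier G"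
  and Exp_half: "X \<in> V \<Longrightarrow> Exp X = Exp ((1/2) *\<^sub>R X) \<otimes> Exp ((1/2) *\<^sub>R X)"
  using exp_like_Exp unfolding exp_like_def by blast+

text \<open>Squaring has derivative twice the identity, and the radius
  \<open>1 / (2 (C + 1))\<close> keeps the deviation at most 1. The resulting 3 stays below 4, the
  factor by which halving shrinks a quadratic error.\<close>

lemma square_lipschitz:
  obtains r where "r > 0" "\<And>x y. x \<in> V \<Longrightarrow> y \<in> V \<Longrightarrow> norm x < r \<Longrightarrow> norm y < r \<Longrightarrow>
    norm (lg (ex x \<otimes> ex x) - lg (ex y \<otimes> ex y)) \<le> 3 * norm (x - y)"
proof -
  have sq: "gtame V (\<lambda>x. x + x) (\<lambda>x. ex x \<otimes> ex x)" by (rule gtame_mult[OF gtame_ex gtame_ex])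
  obtain C r0 where T: "tame_within V (\<lambda>x. x + x) (\<lambda>x. lg (ex x \<otimes> ex x)) C r0"
    using gtameD(3)[OF sq] tame_def by metis
  define r where "r = min r0 (1 / (2 * (C + 1)))"
  have r: "r > 0" "r \<le> r0" "r \<le> 1 / (2 * (C + 1))"
    using tame_withinD(1,2)[OF T] by (auto simp: r_def)
  have T': "tame_within V (\<lambda>x. x + x) (\<lambda>x. lg (ex x \<otimes> ex x)) C r"
    by (rule tame_within_mono[OF T order_refl r(1,2)])
  have "C * r \<le> C * (1 / (2 * (C + 1)))" using r tame_withinD(2)[OF T] by (intro mult_left_mono) auto
  also have "\<dots> \<le> 1 / 2" using tame_withinD(2)[OF T] by (simp add: field_simps)
  finally have Cr: "2 * C * r \<le> 1" by simp
  have n: "norm (x + x) \<le> 2 * norm x" for x :: 'e using norm_triangle_ineq[of x x] by simp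
  show ?thesis
  proof (rule that[OF r(1)])
    fix x y assume xy: "x \<in> V" "y \<in> V" "norm x < r" "norm y < r"
    have "norm (lg (ex x \<otimes> ex x) - lg (ex y \<otimes> ex y)) \<le> (2 + 2 * C * r) * norm (x - y)"
      by (rule tame_lipschitz[OF T' _ n xy]) (auto intro!: linearI simp: algebra_simps)
    also have "\<dots> \<le> 3 * norm (x - y)" using Cr by (intro mult_right_mono) auto
    finally show "norm (lg (ex x \<otimes> ex x) - lg (ex y \<otimes> ex y)) \<le> 3 * norm (x - y)" .
  qed
qed

text \<open>The main tool for identities involving \<open>Exp\<close>: to show that a product or
  image of exponentials is an exponential, it is enough to check doubling and to compute the linear
  part. The domain \<open>V'\<close> is arbitrary so that curves, with \<open>V'\<close> the real
  line, are included.\<close>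

theorem Exp_unique:
  assumes a: "gtame V' L a" and ac: "\<And>x. x \<in> V' \<Longrightarrow> a x \<in> carrier G"
    and a2: "\<And>x. x \<in> V' \<Longrightarrow> a x = a ((1/2) *\<^sub>R x) \<otimes> a ((1/2) *\<^sub>R x)"
    and L: "\<And>x. x \<in> V' \<Longrightarrow> L x \<in> V" and X: "X \<in> V'"
  shows "a X = Exp (L X)"
proof -
  note ga = gtameD[OF a]
  have b: "gtame V' L (\<lambda>x. Exp (L x))"
    using gtame_linear_compose[OF gtame_Exp ga(1,2) L] .
  obtain r where r: "r > 0" "\<And>x y. x \<in> V \<Longrightarrow> y \<in> V \<Longrightarrow> norm x < r \<Longrightarrow> norm y < r \<Longrightarrow>
    norm (lg (ex x \<otimes> ex x) - lg (ex y \<otimes> ex y)) \<le> 3 * norm (x - y)" using square_lipschitz by metis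
  obtain r1 where r1: "r1 > 0" "\<And>x. x \<in> V' \<Longrightarrow> norm x < r1 \<Longrightarrow> a x \<in> U \<and> norm (lg (a x)) < r"
    using gtame_small[OF a r(1)] by metis
  obtain r2 where r2: "r2 > 0" "\<And>x. x \<in> V' \<Longrightarrow> norm x < r2 \<Longrightarrow> Exp (L x) \<in> U \<and> norm (lg (Exp (L x))) < r"
    using gtame_small[OF b r(1)] by metis
  obtain C1 r3 where C1: "C1 \<ge> 0" "r3 > 0" "\<And>x. x \<in> V' \<Longrightarrow> norm x < r3 \<Longrightarrow> norm (lg (a x) - L x) \<le> C1 * (norm x)\<^sup>2"
    using tame_quadratic[OF ga(3,1,2)] by metis
  obtain C2 r4 where C2: "C2 \<ge> 0" "r4 > 0" "\<And>x. x \<in> V' \<Longrightarrow> norm x < r4 \<Longrightarrow> norm (lg (Exp (L x)) - L x) \<le> C2 * (norm x)\<^sup>2"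
    using tame_quadratic[OF gtameD(3)[OF b] ga(1,2)] by metis
  define R where "R = min (min r1 r2) (min r3 r4)"
  have R: "R > 0" "R \<le> r1" "R \<le> r2" "R \<le> r3" "R \<le> r4" using r1 r2 C1 C2 by (auto simp: R_def)
  have local: "a x = Exp (L x)" if x: "x \<in> V'" "norm x < R" for x
  proof -
    define s where "s = (\<lambda>n::nat. (1/2)^n *\<^sub>R x)"
    have sV: "s n \<in> V'" for n using x ga(1) by (simp add: s_def subspace_scale)
    have ns: "norm (s n) \<le> norm x" "norm (s n) < R" for n
    proof -
      have "(1/2::real)^n \<le> 1" by (simp add: power_le_one)
      then have "(1/2)^n * norm x \<le> 1 * norm x" by (intro mult_right_mono) auto
      then show "norm (s n) \<le> norm x" by (simp add: s_def)
      then show "norm (s n) < R" using x by simp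
    qed
    have sS: "(1/2) *\<^sub>R s n = s (Suc n)" for n by (simp add: s_def)
    have A: "a (s n) \<in> U" "norm (lg (a (s n))) < r" for n using r1(2)[OF sV] ns(2)[of n] R by auto
    have B: "Exp (L (s n)) \<in> U" "norm (lg (Exp (L (s n)))) < r" for n using r2(2)[OF sV] ns(2)[of n] R by auto
    have lin: "L ((1/2) *\<^sub>R y) = (1/2) *\<^sub>R L y" for y using linear_cmul[OF ga(2)] .
    \<comment> \<open>Both chart expressions have linear part \<open>L\<close>, so at
      \<open>x / 2^n\<close> they differ by order \<open>|x|^2 / 4^n\<close>, while one squaring
      relates index \<open>n + 1\<close> to index \<open>n\<close>.\<close>
    have "lg (a (s 0)) = lg (Exp (L (s 0)))"
    proof (rule squaring_unique[where C = "(C1 + C2) * (norm x)\<^sup>2"])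
      fix n
      have 1: "a (s n) = ex (lg (a (s (Suc n)))) \<otimes> ex (lg (a (s (Suc n))))"
        using a2[OF sV[of n]] A(1)[of "Suc n"] by (simp add: sS)
      have 2: "Exp (L (s n)) = ex (lg (Exp (L (s (Suc n))))) \<otimes> ex (lg (Exp (L (s (Suc n)))))"
        using Exp_half[OF L[OF sV[of n]]] B(1)[of "Suc n"] by (simp add: sS lin[symmetric])
      show "norm (lg (a (s n)) - lg (Exp (L (s n)))) \<le> 3 * norm (lg (a (s (Suc n))) - lg (Exp (L (s (Suc n)))))"
        unfolding 1 2 using A B lg_V by (intro r(2)) auto
      have "norm (lg (a (s n)) - lg (Exp (L (s n)))) = norm ((lg (a (s n)) - L (s n)) - (lg (Exp (L (s n))) - L (s n)))"
        by simp
      also have "\<dots> \<le> norm (lg (a (s n)) - L (s n)) + norm (lg (Exp (L (s n))) - L (s n))"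
        by (rule norm_triangle_ineq4)
      also have "\<dots> \<le> C1 * (norm (s n))\<^sup>2 + C2 * (norm (s n))\<^sup>2"
        using C1(3)[OF sV] C2(3)[OF sV] ns(2)[of n] R by (intro add_mono) auto
      also have "(norm (s n))\<^sup>2 = (norm x)\<^sup>2 * (1/4)^n"
        by (simp add: s_def power_mult_distrib power_divide flip: power_mult power_mult_distrib)
          (simp add: power_mult mult.commute[of n])
      finally show "norm (lg (a (s n)) - lg (Exp (L (s n)))) \<le> (C1 + C2) * (norm x)\<^sup>2 * (1/4)^n"
        by (simp add: algebra_simps)
    qed
    then show ?thesis using lg_inj A(1)[of 0] B(1)[of 0] by (simp add: s_def)
  qed
  obtain n where "norm X / R < 2 ^ n" using real_arch_pow[of 2 "norm X / R"] by auto
  then have n: "norm ((1/2)^n *\<^sub>R X) < R" using R(1) by (simp add: power_divide field_simps)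
  have sV: "(1/2)^n *\<^sub>R X \<in> V'" for n using X ga(1) by (simp add: subspace_scale)
  \<comment> \<open>Doubling carries equality from the small multiple outwards to
    \<open>X\<close>.\<close>
  have "a ((1/2)^n *\<^sub>R X) = Exp (L ((1/2)^n *\<^sub>R X)) \<Longrightarrow> a X = Exp (L X)"
  proof (induction n)
    case (Suc n)
    have eq: "(1/2) *\<^sub>R ((1/2)^n *\<^sub>R X) = (1/2) ^ Suc n *\<^sub>R X" by simp
    have "a ((1/2)^n *\<^sub>R X) = Exp (L ((1/2)^n *\<^sub>R X))"
      using a2[OF sV, of n] Exp_half[OF L[OF sV], of n] Suc.prems
      unfolding linear_cmul[OF ga(2), symmetric] eq by simp
    then show ?case by (rule Suc.IH)
  qed simp
  then show ?thesis using local[OF sV n] by blast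
qed

end

section \<open>One-parameter subgroups and their smoothness\<close>

lemma tame_has_vector_derivative:
  fixes f :: "real \<Rightarrow> 'e::real_normed_vector"
  assumes "tame UNIV (\<lambda>t. t *\<^sub>R v) f"
  shows "(f has_vector_derivative v) (at 0)"
proof -
  obtain C r where T: "tame_within UNIV (\<lambda>t. t *\<^sub>R v) f C r" using assms tame_def by metis
  note t = tame_withinD[OF T]
  have q: "norm (f x - x *\<^sub>R v) \<le> C * \<bar>x\<bar> * \<bar>x\<bar>" if "\<bar>x\<bar> < r" for x
    using t(4)[of x 0] t(1,3) that by simp
  show ?thesis unfolding has_vector_derivative_def has_derivative_within_alt
  proof (intro conjI allI impI)
    show "bounded_linear (\<lambda>h. h *\<^sub>R v)" by (rule bounded_linear_scaleR_left)
    fix e :: real assume e: "e > 0"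
    show "\<exists>d>0. \<forall>y\<in>UNIV. norm (y - 0) < d \<longrightarrow> norm (f y - f 0 - (y - 0) *\<^sub>R v) \<le> e * norm (y - 0)"
    proof (intro exI[of _ "min r (e / (C + 1))"] conjI ballI impI)
      fix y :: real assume y: "norm (y - 0) < min r (e / (C + 1))"
      have "C * \<bar>y\<bar> \<le> (C + 1) * (e / (C + 1))" using y t(2) by (intro mult_mono) auto
      also have "\<dots> = e" using t(2) by simp
      finally have "C * \<bar>y\<bar> * \<bar>y\<bar> \<le> e * \<bar>y\<bar>" by (intro mult_right_mono) auto
      then show "norm (f y - f 0 - (y - 0) *\<^sub>R v) \<le> e * norm (y - 0)" using q[of y] y t(3) by simp
    qed (use t(1,2) e in simp)
  qed
qed

lemma has_vector_derivative_shift: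
  assumes "((\<lambda>h. b (t + h)) has_vector_derivative v) (at (0::real))"
  shows "(b has_vector_derivative v) (at t)"
proof -
  have "((\<lambda>s. s - t) has_vector_derivative 1) (at t)"
    by (rule derivative_eq_intros refl | simp)+
  moreover have "((\<lambda>h. b (t + h)) has_vector_derivative v) (at (t - t))" using assms by simp
  ultimately have "((\<lambda>h. b (t + h)) \<circ> (\<lambda>s. s - t) has_vector_derivative 1 *\<^sub>R v) (at t)"
    by (rule vector_diff_chain_at)
  then show ?thesis by (simp add: o_def)
qed

lemma real_line_simps [simp]:
  "mtop real_line = euclidean" "model real_line = UNIV" "atlas real_line = {(UNIV, \<lambda>x. x)}"
  by (simp_all add: real_line_def)

lemma inv_into_real_line [simp]: "inv_into UNIV (\<lambda>x. x) y = y"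
  by (metis UNIV_I f_inv_into_f rangeI)

lemma smooth_manifold_real_line: "smooth_manifold real_line"
proof
  show "Hausdorff_space (mtop real_line)" by simp
  obtain B :: "real set set" where B: "countable B" "topological_basis B" using ex_countable_basis by blast
  show "second_countable (mtop real_line)"
    unfolding second_countable_def
  proof (intro exI[of _ B] conjI ballI allI impI)
    show "openin (mtop real_line) V" if "V \<in> B" for V using topological_basis_open[OF B(2) that] by simp
    fix U and x :: real assume "openin (mtop real_line) U \<and> x \<in> U"
    then show "\<exists>V\<in>B. x \<in> V \<and> V \<subseteq> U" using topological_basisE[OF B(2), of U x] by (metis open_openin real_line_simps(1))
  qed (rule B(1))
qed (use homeomorphic_map_id[of euclideanreal euclideanreal] in \<open>auto simp: is_chart_def smooth_on_id id_def\<close>)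

context lie_group_chart
begin

lemma Exp_zero [simp]: "Exp 0 = \<one>"
  using Exp_half[OF subspace_0[OF V]] Exp_carrier[OF subspace_0[OF V]] l_cancel_one by simp

text \<open>In the induction step \<open>Exp (j x) \<otimes> Exp x\<close> has linear part
  \<open>(j + 1) x\<close>. It satisfies doubling because, by the induction hypothesis at
  \<open>x / 2\<close>, both factors are products of powers of the one element
  \<open>Exp (x / 2)\<close> and hence commute.\<close>

lemma Exp_nat: "X \<in> V \<Longrightarrow> Exp (real j *\<^sub>R X) = Exp X [^] j"
proof (induction j arbitrary: X)
  case 0
  then show ?case by simp
next
  case (Suc j)
  have lin: "linear (\<lambda>x. real j *\<^sub>R x)" by (auto intro!: linearI simp: algebra_simps)
  have sV: "c *\<^sub>R Y \<in> V" if "Y \<in> V" for c and Y :: 'e using that V by (simp add: subspace_scale)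
  have "gtame V (\<lambda>x. real j *\<^sub>R x) (\<lambda>x. Exp (real j *\<^sub>R x))"
    using gtame_linear_compose[OF gtame_Exp V lin] sV by blast
  from gtame_mult[OF this gtame_Exp]
  have g: "gtame V (\<lambda>x. real j *\<^sub>R x + x) (\<lambda>x. Exp (real j *\<^sub>R x) \<otimes> Exp x)" .
  have "Exp (real j *\<^sub>R X) \<otimes> Exp X = Exp (real j *\<^sub>R X + X)"
  proof (rule Exp_unique[OF g])
    show "Exp (real j *\<^sub>R x) \<otimes> Exp x \<in> carrier G" if "x \<in> V" for x using that sV by simp
    show "real j *\<^sub>R x + x \<in> V" if "x \<in> V" for x using that sV V by (simp add: subspace_add)
    show "X \<in> V" by (rule Suc.prems)
    fix x assume x: "x \<in> V"
    let ?y = "Exp ((1/2) *\<^sub>R x)"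
    have y: "?y \<in> carrier G" using x sV by simp
    have h: "(1/2) *\<^sub>R (real j *\<^sub>R x) = real j *\<^sub>R ((1/2) *\<^sub>R x)" by simp
    have 1: "Exp (real j *\<^sub>R ((1/2) *\<^sub>R x)) = ?y [^] j" using Suc.IH[OF sV[OF x]] .
    have "Exp (real j *\<^sub>R x) \<otimes> Exp x = (?y [^] j \<otimes> ?y [^] j) \<otimes> (?y \<otimes> ?y)"
      using Exp_half[OF sV[OF x, of "real j"]] Exp_half[OF x] unfolding h 1 by simp
    also have "\<dots> = ?y [^] (j + j + 2)" using y by (simp add: nat_pow_mult[symmetric] numeral_2_eq_2 m_assoc)
    also have "j + j + 2 = Suc j + Suc j" by simp
    also have "?y [^] (Suc j + Suc j) = (?y [^] j \<otimes> ?y) \<otimes> (?y [^] j \<otimes> ?y)"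
      using y by (simp only: nat_pow_mult[symmetric] nat_pow_Suc)
    finally show "Exp (real j *\<^sub>R x) \<otimes> Exp x =
      Exp (real j *\<^sub>R ((1/2) *\<^sub>R x)) \<otimes> ?y \<otimes> (Exp (real j *\<^sub>R ((1/2) *\<^sub>R x)) \<otimes> ?y)" unfolding 1 .
  qed
  then show ?case using Suc.IH[OF Suc.prems] by (simp add: algebra_simps)
qed

text \<open>Compatibility is asked only on squares, since doubling is all that
  \<open>Exp_unique\<close> checks. The lemma therefore covers inversion as well as
  automorphisms.\<close>

lemma Exp_smooth_map:
  assumes F: "smooth_map M M F" "F \<one> = \<one>" "\<And>x. x \<in> carrier G \<Longrightarrow> F x \<in> carrier G"
    and hom: "\<And>x. x \<in> carrier G \<Longrightarrow> F (x \<otimes> x) = F x \<otimes> F x"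
  obtains L where "linear L" "\<And>v. v \<in> V \<Longrightarrow> L v \<in> V"
    "\<And>v. v \<in> V \<Longrightarrow> differential M F \<one> (coord_vector M (U, \<phi>) v \<one>) = coord_vector M (U, \<phi>) (L v) \<one>"
    "gtame V L (\<lambda>y. F (ex y))" "gtame V L (\<lambda>x. F (Exp x))" "\<And>X. X \<in> V \<Longrightarrow> F (Exp X) = Exp (L X)"
proof -
  obtain L where L: "linear L" "\<And>v. v \<in> V \<Longrightarrow> L v \<in> V"
    "\<And>v. v \<in> V \<Longrightarrow> differential M F \<one> (coord_vector M (U, \<phi>) v \<one>) = coord_vector M (U, \<phi>) (L v) \<one>"
    "gtame V L (\<lambda>y. F (ex y))"
    and La: "\<And>(V'::'e set) A a. gtame V' A a \<Longrightarrow> gtame V' (\<lambda>x. L (A x)) (\<lambda>x. F (a x))"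
    using gtame_smooth_map[OF F(1,2)] by metis
  have g: "gtame V L (\<lambda>x. F (Exp x))" by (rule La[OF gtame_Exp])
  have "F (Exp X) = Exp (L X)" if X: "X \<in> V" for X
  proof (rule Exp_unique[OF g _ _ L(2) X])
    fix x assume x: "x \<in> V"
    show "F (Exp x) \<in> carrier G" using F(3) x by simp
    have "(1/2) *\<^sub>R x \<in> V" using x V by (simp add: subspace_scale)
    from hom[OF Exp_carrier[OF this]]
    show "F (Exp x) = F (Exp ((1/2) *\<^sub>R x)) \<otimes> F (Exp ((1/2) *\<^sub>R x))" using Exp_half[OF x] by simp
  qed
  with L g show ?thesis using that by blast
qed

text \<open>Inversion acts on exponents by some linear \<open>L\<close>. The product of
  \<open>Exp x\<close> with its inverse is constant, so its linear part \<open>x + L x\<close>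
  vanishes.\<close>

lemma Exp_minus: assumes X: "X \<in> V" shows "Exp (- X) = inv Exp X"
proof -
  obtain L where L: "linear L" "\<And>v. v \<in> V \<Longrightarrow> L v \<in> V" "gtame V L (\<lambda>x. inv (Exp x))"
    "\<And>X. X \<in> V \<Longrightarrow> inv (Exp X) = Exp (L X)"
    using Exp_smooth_map[OF inv_smooth] by (metis inv_closed inv_mult_group inv_one)
  note g = gtame_mult[OF gtame_Exp L(3)]
  have "tame V (\<lambda>x. x + L x) (\<lambda>x. 0)"
    by (rule tame_cong[OF gtameD(3)[OF g] zero_less_one V]) simp_all
  moreover have "tame V (\<lambda>x. 0) (\<lambda>x. 0)" by (rule tame_linear[OF linear_zero])
  ultimately have "X + L X = 0"
    by (rule tame_derivative_unique[OF _ _ V gtameD(2)[OF g] linear_zero X])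
  then have "L X = - X" by (simp add: add_eq_0_iff)
  then show ?thesis using L(4)[OF X] by simp
qed

lemma Exp_int: assumes X: "X \<in> V" shows "Exp (of_int i *\<^sub>R X) = Exp X [^] i"
proof (cases i rule: int_cases2)
  case (nonneg n)
  then show ?thesis using Exp_nat[OF X, of n] by (simp add: int_pow_int)
next
  case (nonpos n)
  have "Exp (of_int i *\<^sub>R X) = Exp (- (real n *\<^sub>R X))" using nonpos by simp
  also have "\<dots> = inv (Exp X [^] n)"
    using Exp_minus[of "real n *\<^sub>R X"] X V by (simp add: Exp_nat subspace_scale)
  also have "\<dots> = Exp X [^] i" unfolding nonpos by (rule int_pow_neg_int[OF Exp_carrier[OF X], symmetric])
  finally show ?thesis .
qed

text \<open>Near 0 the chart expression is Lipschitz. On the ball of radius \<open>R * 2^n\<close>,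
  \<open>Exp x\<close> is the \<open>2^n\<close>-th power of \<open>Exp (x / 2^n)\<close>, which
  reduces continuity to the small ball.\<close>

lemma Exp_continuous: "continuous_map (top_of_set V) (mtop M) Exp"
proof -
  obtain r where r: "r > 0" "\<And>x. x \<in> V \<Longrightarrow> norm x < r \<Longrightarrow> Exp x \<in> U"
    using gtameD(4)[OF gtame_Exp] by blast
  obtain C r' K where T: "tame_within V (\<lambda>x. x) (\<lambda>x. lg (Exp x)) C r'" "K > 0"
    and K: "\<And>x y. x \<in> V \<Longrightarrow> y \<in> V \<Longrightarrow> norm x < r' \<Longrightarrow> norm y < r' \<Longrightarrow> norm (lg (Exp x) - lg (Exp y)) \<le> K * norm (x - y)"
    using tame_bounds[OF gtameD(3,1,2)[OF gtame_Exp]] by metis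
  define R where "R = min r r'"
  have R: "R > 0" "R \<le> r" "R \<le> r'" using r(1) tame_withinD(1)[OF T(1)] by (auto simp: R_def)
  have contlg: "continuous_on (V \<inter> ball 0 R) (\<lambda>x. \<phi> (Exp x))"
  proof -
    have "K-lipschitz_on (V \<inter> ball 0 R) (\<lambda>x. \<phi> (Exp x))"
    proof (rule lipschitz_onI)
      fix x y assume "x \<in> V \<inter> ball 0 R" "y \<in> V \<inter> ball 0 R"
      then show "dist (\<phi> (Exp x)) (\<phi> (Exp y)) \<le> K * dist x y"
        using K[of x y] R by (simp add: lg_def dist_norm)
    qed (use T in simp)
    then show ?thesis by (rule lipschitz_on_continuous_on)
  qed
  have loc: "continuous_map (top_of_set (V \<inter> ball 0 R)) (mtop M) Exp"
    unfolding continuous_map_def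
  proof (intro conjI allI impI)
    show "Exp \<in> topspace (top_of_set (V \<inter> ball 0 R)) \<rightarrow> points M"
      using points_eq by auto
    fix A assume A: "openin (mtop M) A"
    obtain Op where Op: "open Op" "\<phi> ` (U \<inter> A) = V \<inter> Op"
      using chart_image_openin[OF chart A] by (auto simp: openin_open)
    have "{x \<in> topspace (top_of_set (V \<inter> ball 0 R)). Exp x \<in> A} = (V \<inter> ball 0 R) \<inter> (\<lambda>x. \<phi> (Exp x)) -` Op"
    proof (intro equalityI subsetI)
      fix x assume "x \<in> {x \<in> topspace (top_of_set (V \<inter> ball 0 R)). Exp x \<in> A}"
      then have "x \<in> V \<inter> ball 0 R" "Exp x \<in> U \<inter> A" using r(2) R by auto
      then show "x \<in> (V \<inter> ball 0 R) \<inter> (\<lambda>x. \<phi> (Exp x)) -` Op" using Op(2) by blast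
    next
      fix x assume x: "x \<in> (V \<inter> ball 0 R) \<inter> (\<lambda>x. \<phi> (Exp x)) -` Op"
      then have U: "Exp x \<in> U" using r(2) R by auto
      then have "\<phi> (Exp x) \<in> V \<inter> Op" using x chart_image_subset[OF chart] by blast
      then have "\<phi> (Exp x) \<in> \<phi> ` (U \<inter> A)" using Op(2) by simp
      then have "Exp x \<in> A" using chart_inj[OF chart] U by (auto dest: inj_onD)
      then show "x \<in> {x \<in> topspace (top_of_set (V \<inter> ball 0 R)). Exp x \<in> A}" using x by simp
    qed
    moreover have "openin (top_of_set (V \<inter> ball 0 R)) ((V \<inter> ball 0 R) \<inter> (\<lambda>x. \<phi> (Exp x)) -` Op)"
      by (rule continuous_openin_preimage_gen[OF contlg Op(1)])
    ultimately show "openin (top_of_set (V \<inter> ball 0 R)) {x \<in> topspace (top_of_set (V \<inter> ball 0 R)). Exp x \<in> A}"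
      by simp
  qed
  have ball: "continuous_map (top_of_set (V \<inter> ball 0 (R * 2 ^ n))) (mtop M) Exp" for n
  proof -
    let ?B = "V \<inter> ball 0 (R * 2 ^ n)"
    let ?s = "\<lambda>x. (1 / 2 ^ n) *\<^sub>R x"
    have im: "?s ` ?B \<subseteq> V \<inter> ball 0 R" using V by (auto simp: subspace_scale field_simps)
    have "continuous_map (top_of_set ?B) (top_of_set (V \<inter> ball 0 R)) ?s"
      using im by (auto simp: continuous_map_in_subtopology intro!: continuous_intros)
    from continuous_map_compose[OF this loc]
    have "continuous_map (top_of_set ?B) (mtop M) (\<lambda>x. Exp (?s x))" by (simp add: o_def)
    from continuous_map_pow[OF this, of "2 ^ n"]
    have "continuous_map (top_of_set ?B) (mtop M) (\<lambda>x. Exp (?s x) [^] (2 ^ n :: nat))" .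
    moreover have "Exp (?s x) [^] (2 ^ n :: nat) = Exp x" if "x \<in> ?B" for x
      using Exp_nat[of "?s x" "2 ^ n"] that V by (simp add: subspace_scale)
    ultimately show ?thesis by (rule continuous_map_eq) simp
  qed
  show ?thesis unfolding continuous_map_def
  proof (intro conjI allI impI)
    show "Exp \<in> topspace (top_of_set V) \<rightarrow> points M" using points_eq by auto
    fix A assume A: "openin (mtop M) A"
    show "openin (top_of_set V) {x \<in> topspace (top_of_set V). Exp x \<in> A}"
    proof (subst openin_subopen, intro ballI)
      fix x assume x: "x \<in> {x \<in> topspace (top_of_set V). Exp x \<in> A}"
      obtain n where "norm x / R < 2 ^ n" using real_arch_pow[of 2 "norm x / R"] by auto
      then have n: "norm x < R * 2 ^ n" using R(1) by (simp add: field_simps)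
      let ?B = "V \<inter> ball 0 (R * 2 ^ n)"
      let ?T = "{x \<in> topspace (top_of_set ?B). Exp x \<in> A}"
      have "openin (top_of_set ?B) ?T" using ball[of n] A by (rule openin_continuous_map_preimage)
      moreover have "openin (top_of_set V) ?B" by (auto simp: openin_open)
      ultimately have "openin (top_of_set V) ?T" by (rule openin_trans)
      then show "\<exists>T. openin (top_of_set V) T \<and> x \<in> T \<and> T \<subseteq> {x \<in> topspace (top_of_set V). Exp x \<in> A}"
        using x n by (intro exI[of _ ?T]) auto
    qed
  qed
qed

text \<open>For rational \<open>s\<close> and \<open>t\<close> both sides are integer powers of one
  exponential, over a common denominator. The rational pairs are dense and the group is Hausdorff,
  so continuity gives all reals.\<close>

lemma Exp_add:
  assumes X: "X \<in> V"
  shows "Exp ((s + t) *\<^sub>R X) = Exp (s *\<^sub>R X) \<otimes> Exp (t *\<^sub>R X)"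
proof -
  have sV: "c *\<^sub>R X \<in> V" for c using X V by (simp add: subspace_scale)
  have cont: "continuous_map euclidean (mtop M) (\<lambda>p::real \<times> real. Exp (f p *\<^sub>R X))" if "continuous_on UNIV f" for f
  proof -
    have "continuous_map euclidean (top_of_set V) (\<lambda>p::real \<times> real. f p *\<^sub>R X)"
      using sV that by (auto simp: continuous_map_in_subtopology intro!: continuous_intros)
    from continuous_map_compose[OF this Exp_continuous] show ?thesis by (simp add: o_def)
  qed
  have "Exp ((fst p + snd p) *\<^sub>R X) = Exp (fst p *\<^sub>R X) \<otimes> Exp (snd p *\<^sub>R X)" for p :: "real \<times> real"
  proof (rule forall_in_closure_of_eq[OF _ Hausdorff, where S = "(\<rat>::real set) \<times> (\<rat>::real set)" and X = euclidean
      and f = "\<lambda>p. Exp ((fst p + snd p) *\<^sub>R X)" and g = "\<lambda>p. Exp (fst p *\<^sub>R X) \<otimes> Exp (snd p *\<^sub>R X)"])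
    show "p \<in> euclidean closure_of ((\<rat>::real set) \<times> (\<rat>::real set))" by (simp add: closure_Times Rats_closure_real)
    show "continuous_map euclidean (mtop M) (\<lambda>p::real \<times> real. Exp ((fst p + snd p) *\<^sub>R X))"
      by (intro cont continuous_intros)
    show "continuous_map euclidean (mtop M) (\<lambda>p::real \<times> real. Exp (fst p *\<^sub>R X) \<otimes> Exp (snd p *\<^sub>R X))"
      by (intro continuous_map_mult cont continuous_intros)
    fix q :: "real \<times> real" assume "q \<in> \<rat> \<times> \<rat>"
    then obtain s t where q: "q = (s, t)" "s \<in> \<rat>" "t \<in> \<rat>" by blast
    obtain a b :: int where ab: "b > 0" "s = of_int a / of_int b" using Rats_cases'[OF q(2)] by metis
    obtain c d :: int where cd: "d > 0" "t = of_int c / of_int d" using Rats_cases'[OF q(3)] by metis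
    define Y where "Y = (1 / (of_int b * of_int d)) *\<^sub>R X"
    have Y: "Y \<in> V" using sV by (simp add: Y_def)
    have s: "s *\<^sub>R X = of_int (a * d) *\<^sub>R Y" and t: "t *\<^sub>R X = of_int (c * b) *\<^sub>R Y"
      using ab cd by (auto simp: Y_def)
    have "(s + t) *\<^sub>R X = of_int (a * d + c * b) *\<^sub>R Y" using s t by (simp add: scaleR_add_left)
    then have "Exp ((s + t) *\<^sub>R X) = Exp (s *\<^sub>R X) \<otimes> Exp (t *\<^sub>R X)"
      unfolding s t by (simp only: Exp_int[OF Y] int_pow_mult[OF Exp_carrier[OF Y]])
    then show "Exp ((fst q + snd q) *\<^sub>R X) = Exp (fst q *\<^sub>R X) \<otimes> Exp (snd q *\<^sub>R X)" by (simp add: q)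
  qed
  from this[of "(s, t)"] show ?thesis by simp
qed

lemma Exp_curve_gtame:
  assumes "X \<in> V"
  shows "gtame UNIV (\<lambda>t::real. t *\<^sub>R X) (\<lambda>t. Exp (t *\<^sub>R X))"
  using gtame_linear_compose[OF gtame_Exp subspace_UNIV, of "\<lambda>t::real. t *\<^sub>R X"] assms V
  by (simp add: subspace_scale linear_scaleR_left)

lemma gtame_curve_derivative:
  assumes "gtame UNIV (\<lambda>t::real. t *\<^sub>R X) \<gamma>"
  obtains T where "open T" "0 \<in> T" "\<And>t. t \<in> T \<Longrightarrow> \<gamma> t \<in> U"
    "((\<lambda>t. \<phi> (\<gamma> t)) has_vector_derivative X) (at 0)"
proof -
  note g = gtameD[OF assms]
  obtain r where r: "r > 0" "\<forall>x\<in>UNIV. norm x < r \<longrightarrow> \<gamma> x \<in> U" using g(4) by blast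
  have "((\<lambda>t. lg (\<gamma> t)) has_vector_derivative X) (at 0)"
    by (rule tame_has_vector_derivative[OF g(3)])
  then have "((\<lambda>t. lg (\<gamma> t) + \<phi> \<one>) has_vector_derivative X + 0) (at 0)"
    by (intro has_vector_derivative_add has_vector_derivative_const)
  then have "((\<lambda>t. \<phi> (\<gamma> t)) has_vector_derivative X) (at 0)" by (simp add: lg_def)
  then show ?thesis using that[of "ball 0 r"] r by simp
qed

lemma gtame_curve_velocity:
  assumes g: "gtame UNIV (\<lambda>t::real. t *\<^sub>R X) \<gamma>" and X: "X \<in> V"
  shows "velocity M \<gamma> 0 = coord_vector M (U, \<phi>) X (\<gamma> 0)"
proof -
  obtain T where T: "open T" "0 \<in> T" "\<And>t. t \<in> T \<Longrightarrow> \<gamma> t \<in> U"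
    "((\<lambda>t. \<phi> (\<gamma> t)) has_vector_derivative X) (at 0)" using gtame_curve_derivative[OF g] by metis
  show ?thesis by (rule velocity_eq[OF chart T(1-3) X T(4)])
qed

lemma Exp_curve_continuous:
  assumes X: "X \<in> V"
  shows "continuous_map euclidean (mtop M) (\<lambda>t::real. Exp (t *\<^sub>R X))"
proof -
  have "continuous_map euclidean (top_of_set V) (\<lambda>t::real. t *\<^sub>R X)"
    using X V by (auto simp: continuous_map_in_subtopology subspace_scale intro!: continuous_intros)
  from continuous_map_compose[OF this Exp_continuous] show ?thesis by (simp add: o_def)
qed

text \<open>Tameness controls the curve only at time 0. Translation by the group law turns the
  derivative at 0 into a differential equation with smooth right-hand side at every time, and
  \<open>smooth_on_curveI\<close> bootstraps.\<close>

lemma Exp_curve_smooth: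
  assumes X: "X \<in> V"
  shows "smooth_map real_line M (\<lambda>t. Exp (t *\<^sub>R X))"
proof (rule smooth_mapI[OF smooth_manifold_real_line])
  let ?\<gamma> = "\<lambda>t. Exp (t *\<^sub>R X)"
  have cont: "continuous_map euclidean (mtop M) ?\<gamma>" by (rule Exp_curve_continuous[OF X])
  then show "continuous_map (mtop real_line) (mtop M) ?\<gamma>" by simp
  have \<gamma>c: "?\<gamma> t \<in> carrier G" for t using X V by (simp add: subspace_scale)
  fix p and U0 :: "real set" and \<phi>0 W \<psi>
  assume "(U0, \<phi>0) \<in> atlas real_line" and e: "(W, \<psi>) \<in> atlas M" and p: "p \<in> U0" "?\<gamma> p \<in> W"
  then have [simp]: "U0 = UNIV" "\<phi>0 = (\<lambda>x. x)" by auto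
  have pW: "?\<gamma> p \<otimes> \<one> \<in> W" using p \<gamma>c by simp
  obtain S S' where S: "openin (top_of_set V) S" "\<psi> (?\<gamma> p) \<in> S" "S \<subseteq> \<psi> ` W"
    "openin (top_of_set V) S'" "\<phi> \<one> \<in> S'" "S' \<subseteq> \<phi> ` U"
    "\<And>y z. y \<in> S \<Longrightarrow> z \<in> S' \<Longrightarrow> inv_into W \<psi> y \<otimes> inv_into U \<phi> z \<in> W"
    "smooth_on (V \<times> V) (S \<times> S') (\<lambda>p. \<psi> (inv_into W \<psi> (fst p) \<otimes> inv_into U \<phi> (snd p)))"
    by (rule mult_chart[OF e p(2) chart one_U e pW]) (rule that)
  let ?\<mu> = "\<lambda>p. \<psi> (inv_into W \<psi> (fst p) \<otimes> inv_into U \<phi> (snd p))"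
  have VV: "subspace (V \<times> V)" using V V by (rule subspace_Times)
  have SS: "openin (top_of_set (V \<times> V)) (S \<times> S')" using S(1,4) by (rule openin_Times)
  have SV: "S \<times> S' \<subseteq> V \<times> V" "S \<subseteq> V" using SS S(1) openin_imp_subset by blast+
  have X0: "(0, X) \<in> V \<times> V" using X subspace_0[OF V] by simp
  \<comment> \<open>The left-invariant vector field with value \<open>X\<close> at the identity, in
    the chart \<open>\<psi>\<close>: the derivative of multiplication in its second argument at
    \<open>\<one>\<close>.\<close>
  define F where "F = (\<lambda>y. dirD ?\<mu> (0, X) (y, \<phi> \<one>))"
  have F: "smooth_on V S F" unfolding F_def
    by (rule smooth_on_compose[OF VV SV(1) _ _ smooth_on_dirD[OF VV SS S(8) X0]])
      (use S(5) in \<open>auto intro!: smooth_on_Pair smooth_on_id smooth_on_const\<close>)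
  define T where "T = {t. ?\<gamma> t \<in> {x \<in> W. \<psi> x \<in> S}}"
  have "openin euclidean {t \<in> topspace euclidean. ?\<gamma> t \<in> {x \<in> W. \<psi> x \<in> S}}"
    by (rule openin_continuous_map_preimage[OF cont chart_preimage_openin[OF e S(1)]])
  then have T: "open T" by (simp add: T_def)
  have pT: "p \<in> T" using p(2) S(2) by (simp add: T_def)
  obtain T1 where T1: "open T1" "0 \<in> T1" "\<And>t. t \<in> T1 \<Longrightarrow> ?\<gamma> t \<in> U"
    "((\<lambda>t. \<phi> (?\<gamma> t)) has_vector_derivative X) (at 0)"
    using gtame_curve_derivative[OF Exp_curve_gtame[OF X]] by metis
  define T2 where "T2 = {t. ?\<gamma> t \<in> {x \<in> U. \<phi> x \<in> S'}}"
  have "openin euclidean {t \<in> topspace euclidean. ?\<gamma> t \<in> {x \<in> U. \<phi> x \<in> S'}}"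
    by (rule openin_continuous_map_preimage[OF cont chart_preimage_openin[OF chart S(4)]])
  then have T2: "open T2" by (simp add: T2_def)
  have T20: "0 \<in> T2" using one_U S(5) by (simp add: T2_def)
  \<comment> \<open>Since the curve at \<open>t + h\<close> is its value at \<open>t\<close> times
    its value at \<open>h\<close>, the derivative at \<open>t\<close> is the derivative of
    \<open>?\<mu>\<close> applied to that at 0.\<close>
  have der: "((\<lambda>t. \<psi> (?\<gamma> t)) has_vector_derivative F (\<psi> (?\<gamma> t))) (at t)" if t: "t \<in> T" for t
  proof (rule has_vector_derivative_shift)
    have tS: "\<psi> (?\<gamma> t) \<in> S" "?\<gamma> t \<in> W" using t by (auto simp: T_def)
    have pt: "(\<psi> (?\<gamma> t), \<phi> \<one>) \<in> S \<times> S'" using tS S(5) by simp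
    obtain D where D: "(?\<mu> has_derivative D) (at (\<psi> (?\<gamma> t), \<phi> \<one>) within S \<times> S')"
      using smooth_on_differentiable[OF S(8) pt] .
    have DF: "F (\<psi> (?\<gamma> t)) = D (0, X)" unfolding F_def by (rule dirD_eq[OF VV SS pt X0 D])
    let ?c = "\<lambda>h. (\<psi> (?\<gamma> t), \<phi> (?\<gamma> h))"
    have im: "?c ` T2 \<subseteq> S \<times> S'" using tS by (auto simp: T2_def)
    have "((\<lambda>h. \<phi> (?\<gamma> h)) has_derivative (\<lambda>h. h *\<^sub>R X)) (at 0 within T2)"
      using T1(4) has_derivative_at_withinI unfolding has_vector_derivative_def by blast
    then have "(?c has_derivative (\<lambda>h. (0, h *\<^sub>R X))) (at 0 within T2)"
      by (intro has_derivative_Pair has_derivative_const)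
    moreover have "(?\<mu> has_derivative D) (at (?c 0) within ?c ` T2)"
      using has_derivative_subset[OF D im] by simp
    ultimately have "((\<lambda>h. ?\<mu> (?c h)) has_derivative (\<lambda>h. D (0, h *\<^sub>R X))) (at 0 within T2)"
      by (rule has_derivative_in_compose)
    then have 1: "((\<lambda>h. ?\<mu> (?c h)) has_derivative (\<lambda>h. D (0, h *\<^sub>R X))) (at 0)"
      by (simp add: at_within_open[OF T20 T2])
    have "((\<lambda>h. \<psi> (?\<gamma> (t + h))) has_derivative (\<lambda>h. D (0, h *\<^sub>R X))) (at 0)"
    proof (rule has_derivative_transform_within_open[OF 1 T2 T20])
      fix h assume "h \<in> T2"
      then have "?\<gamma> h \<in> U" by (simp add: T2_def)
      then show "?\<mu> (?c h) = \<psi> (?\<gamma> (t + h))"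
        using tS e chart by (simp add: Exp_add[OF X])
    qed
    moreover have "D (0, h *\<^sub>R X) = h *\<^sub>R F (\<psi> (?\<gamma> t))" for h
      using linear_cmul[OF has_derivative_linear[OF D], of h "(0, X)"] DF by simp
    ultimately show "((\<lambda>h. \<psi> (?\<gamma> (t + h))) has_vector_derivative F (\<psi> (?\<gamma> t))) (at 0)"
      by (simp add: has_vector_derivative_def)
  qed
  have "smooth_on UNIV T (\<lambda>t. \<psi> (?\<gamma> t))"
    by (rule smooth_on_curveI[OF V T SV(2) _ F der]) (auto simp: T_def)
  then show "\<exists>S. openin (top_of_set (model real_line)) S \<and> \<phi>0 p \<in> S \<and> S \<subseteq> \<phi>0 ` (U0 \<inter> ?\<gamma> -` W) \<and>
          smooth_on (model real_line) S (\<lambda>y. \<psi> (?\<gamma> (inv_into U0 \<phi>0 y)))"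
    using T pT by (intro exI[of _ T]) (auto simp: T_def)
qed

lemma one_parameter_subgroup_Exp:
  assumes X: "X \<in> V"
  shows "one_parameter_subgroup G M (\<lambda>t. Exp (t *\<^sub>R X))"
  unfolding one_parameter_subgroup_def using Exp_curve_smooth[OF X] Exp_add[OF X] by blast

text \<open>A smooth homomorphism from the line is tame and satisfies doubling, so
  \<open>Exp_unique\<close> applies with \<open>V'\<close> the real line. Its velocity identifies
  the linear part.\<close>

lemma one_parameter_subgroup_unique:
  assumes \<gamma>: "one_parameter_subgroup G M \<gamma>" and v: "velocity M \<gamma> 0 = coord_vector M (U, \<phi>) X \<one>"
    and X: "X \<in> V"
  shows "\<gamma> t = Exp (t *\<^sub>R X)"
proof -
  have sm: "smooth_map real_line M \<gamma>" and add: "\<And>s t. \<gamma> (s + t) = \<gamma> s \<otimes> \<gamma> t"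
    using \<gamma> by (auto simp: one_parameter_subgroup_def)
  have c: "\<gamma> t \<in> carrier G" for t using smooth_map_points[OF sm, of t] points_eq by simp
  have "\<gamma> 0 \<otimes> \<gamma> 0 = \<gamma> 0" using add[of 0 0] by simp
  then have \<gamma>0: "\<gamma> 0 = \<one>" using c l_cancel_one' by (metis r_cancel_one' one_closed l_one)
  have ch: "(UNIV, \<lambda>x. x) \<in> atlas real_line" by simp
  have in_U: "\<gamma> 0 \<in> U" using \<gamma>0 one_U by simp
  obtain L r where L: "linear L" "\<And>v. v \<in> model real_line \<Longrightarrow> L v \<in> V" "r > 0"
    "\<And>y. y \<in> model real_line \<Longrightarrow> norm y < r \<Longrightarrow> 0 + y \<in> (\<lambda>x. x) ` UNIV \<and> \<gamma> (inv_into UNIV (\<lambda>x. x) (0 + y)) \<in> U"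
    "tame (model real_line) L (\<lambda>y. \<phi> (\<gamma> (inv_into UNIV (\<lambda>x. x) (0 + y))) - \<phi> (\<gamma> 0))"
    using centered_chart_map[OF smooth_manifold_real_line smooth_manifold_M sm ch UNIV_I chart in_U] by metis
  have Lt: "L t = t *\<^sub>R L 1" for t using linear_cmul[OF L(1), of t 1] by simp
  have L1: "L 1 \<in> V" using L(2) by simp
  have g: "gtame UNIV (\<lambda>t. t *\<^sub>R L 1) \<gamma>"
    unfolding gtame_def Lt[symmetric] using L(1,3,4,5) \<gamma>0 by (auto simp: lg_def)
  have eq: "\<gamma> t = Exp (t *\<^sub>R L 1)" for t
  proof (rule Exp_unique[OF g])
    show "\<gamma> x = \<gamma> ((1/2) *\<^sub>R x) \<otimes> \<gamma> ((1/2) *\<^sub>R x)" for x using add[of "(1/2) *\<^sub>R x" "(1/2) *\<^sub>R x"] by simp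
  qed (use c L1 V in \<open>auto simp: subspace_scale\<close>)
  have "velocity M \<gamma> 0 = coord_vector M (U, \<phi>) (L 1) \<one>" using gtame_curve_velocity[OF g L1] \<gamma>0 by simp
  then have "coord_vector M (U, \<phi>) (L 1) \<one> = coord_vector M (U, \<phi>) X \<one>" by (rule trans[OF sym v])
  then have "L 1 = X" by (rule coord_vector_inj[OF chart one_U L1 X])
  with eq[of t] show ?thesis by (simp only:)
qed

theorem lie_exp_coord_vector:
  assumes X: "X \<in> V"
  shows "lie_exp G M (coord_vector M (U, \<phi>) X \<one>) = Exp X"
proof -
  have vel: "velocity M (\<lambda>t. Exp (t *\<^sub>R X)) 0 = coord_vector M (U, \<phi>) X \<one>"
    using gtame_curve_velocity[OF Exp_curve_gtame[OF X] X] by simp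
  have "(THE \<gamma>. one_parameter_subgroup G M \<gamma> \<and> velocity M \<gamma> 0 = coord_vector M (U, \<phi>) X \<one>) = (\<lambda>t. Exp (t *\<^sub>R X))"
  proof (rule the_equality)
    show "one_parameter_subgroup G M (\<lambda>t. Exp (t *\<^sub>R X)) \<and>
        velocity M (\<lambda>t. Exp (t *\<^sub>R X)) 0 = coord_vector M (U, \<phi>) X \<one>"
      using one_parameter_subgroup_Exp[OF X] vel by blast
    show "\<gamma> = (\<lambda>t. Exp (t *\<^sub>R X))"
      if "one_parameter_subgroup G M \<gamma> \<and> velocity M \<gamma> 0 = coord_vector M (U, \<phi>) X \<one>" for \<gamma>
      using one_parameter_subgroup_unique[OF _ _ X] that by blast
  qed
  then show ?thesis by (simp add: lie_exp_def)
qed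

text \<open>\<open>gl\<close> after \<open>lg\<close> is the local logarithm, and
  \<open>\<rho>\<close> is also a radius of injectivity for \<open>Exp\<close>. The bound
  \<open>\<rho> / 4\<close> arises because \<open>perturbed_identity_surj\<close>, used on radius
  \<open>\<rho> / 2\<close>, solves for right-hand sides of half that size.\<close>

lemma Exp_near:
  obtains \<rho> gl where "\<rho> > 0" "tame V (\<lambda>x. x) gl"
    "\<And>X. X \<in> V \<Longrightarrow> norm X < \<rho> \<Longrightarrow> Exp X \<in> U \<and> norm (lg (Exp X)) \<le> 2 * norm X"
    "\<And>X Y. X \<in> V \<Longrightarrow> Y \<in> V \<Longrightarrow> norm X < \<rho> \<Longrightarrow> norm Y < \<rho> \<Longrightarrow> Exp X = Exp Y \<Longrightarrow> X = Y"
    "\<And>x. x \<in> U \<Longrightarrow> norm (lg x) < \<rho> / 4 \<Longrightarrow> gl (lg x) \<in> V \<and> norm (gl (lg x)) \<le> 2 * norm (lg x) \<and> Exp (gl (lg x)) = x"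
proof -
  let ?E = "\<lambda>X. lg (Exp X)"
  obtain C r where T: "tame_within V (\<lambda>x. x) ?E C r"
    and lip: "\<And>x y. x \<in> V \<Longrightarrow> y \<in> V \<Longrightarrow> norm x < r \<Longrightarrow> norm y < r \<Longrightarrow>
      norm (?E x - ?E y - (x - y)) \<le> (1/2) * norm (x - y)"
    using tame_near_identity[OF gtameD(3)[OF gtame_Exp]] by metis
  obtain r1 where r1: "r1 > 0" "\<forall>x\<in>V. norm x < r1 \<longrightarrow> Exp x \<in> U" using gtameD(4)[OF gtame_Exp] by blast
  define \<rho> where "\<rho> = min r r1"
  have \<rho>: "\<rho> > 0" "\<rho> \<le> r" "\<rho> \<le> r1" using r1(1) tame_withinD(1)[OF T] by (auto simp: \<rho>_def)
  have U: "Exp x \<in> U" if "x \<in> V" "norm x < \<rho>" for x using r1(2) that \<rho>(3) by simp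
  have bd: "norm (?E x) \<le> 2 * norm x" if "x \<in> V" "norm x < \<rho>" for x
  proof -
    have "norm (?E x - x) \<le> (1/2) * norm x"
      using lip[OF that(1) subspace_0[OF V]] that(2) \<rho> by simp
    then show ?thesis using norm_triangle_ineq2[of "?E x" x] norm_ge_zero[of x] by linarith
  qed
  have inj: "X = Y" if "X \<in> V" "Y \<in> V" "norm X < \<rho>" "norm Y < \<rho>" "Exp X = Exp Y" for X Y
    using lip[OF that(1,2)] that(3-5) \<rho> by (simp add: norm_minus_commute[of Y X])
  have surj: "\<exists>x. x \<in> V \<and> norm x \<le> 2 * norm y \<and> ?E x = y" if y: "y \<in> V" "norm y < \<rho> / 4" for y
  proof -
    have p: "0 < \<rho> / 2" using \<rho>(1) by simp
    obtain x where "x \<in> V" "norm x \<le> 2 * norm y" "?E x = y"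
    proof (rule perturbed_identity_surj[OF V p, where f = ?E and y = y])
      show "?E x \<in> V" if "x \<in> V" "norm x \<le> \<rho> / 2" for x using lg_V[OF U] that \<rho>(1) by simp
      show "norm (?E x - ?E z - (x - z)) \<le> 1 / 2 * norm (x - z)"
        if "x \<in> V" "z \<in> V" "norm x \<le> \<rho> / 2" "norm z \<le> \<rho> / 2" for x z
        using that \<rho> by (intro lip) auto
      show "norm y \<le> \<rho> / 2 / 2" using y(2) by simp
    qed (use y in auto)
    then show ?thesis by blast
  qed
  define gl where "gl = (\<lambda>y. SOME x. x \<in> V \<and> norm x \<le> 2 * norm y \<and> ?E x = y)"
  have gl: "gl y \<in> V \<and> norm (gl y) \<le> 2 * norm y \<and> ?E (gl y) = y" if "y \<in> V" "norm y < \<rho> / 4" for y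
    unfolding gl_def using surj[OF that] by (rule someI_ex)
  have "tame V (\<lambda>x. x) gl"
    by (rule tame_inverse[OF V gtameD(3)[OF gtame_Exp], where \<rho> = "\<rho> / 4"]) (use \<rho>(1) gl in auto)
  moreover have "gl (lg x) \<in> V \<and> norm (gl (lg x)) \<le> 2 * norm (lg x) \<and> Exp (gl (lg x)) = x"
    if x: "x \<in> U" "norm (lg x) < \<rho> / 4" for x
  proof -
    note g = gl[OF lg_V[OF x(1)] x(2)]
    then have "norm (gl (lg x)) < \<rho>" using x(2) norm_ge_zero[of "lg x"] by linarith
    then have "Exp (gl (lg x)) \<in> U" using U g by blast
    then show ?thesis using g lg_inj x(1) by blast
  qed
  ultimately show ?thesis using that[OF \<rho>(1)] U bd inj by blast
qed

text \<open>Converts group identities valid for all \<open>t\<close> into linear identities: curves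
  that agree have the same velocity.\<close>

lemma Exp_line_inj:
  assumes "X \<in> V" "Y \<in> V" "\<And>t. Exp (t *\<^sub>R X) = Exp (t *\<^sub>R Y)"
  shows "X = Y"
proof -
  have "(\<lambda>t. Exp (t *\<^sub>R X)) = (\<lambda>t. Exp (t *\<^sub>R Y))" using assms(3) by blast
  then have "coord_vector M (U, \<phi>) X \<one> = coord_vector M (U, \<phi>) Y \<one>"
    using gtame_curve_velocity[OF Exp_curve_gtame[OF assms(1)] assms(1)]
      gtame_curve_velocity[OF Exp_curve_gtame[OF assms(2)] assms(2)] by simp
  then show ?thesis by (rule coord_vector_inj[OF chart one_U assms(1,2)])
qed

section \<open>The adjoint action\<close>

lemma Exp_smooth_map_ex:
  assumes "smooth_map M M F" "F \<one> = \<one>" "\<And>x. x \<in> carrier G \<Longrightarrow> F x \<in> carrier G"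
    and "\<And>x. x \<in> carrier G \<Longrightarrow> F (x \<otimes> x) = F x \<otimes> F x"
  shows "\<exists>L. linear L \<and> (\<forall>v\<in>V. L v \<in> V) \<and>
     (\<forall>v\<in>V. differential M F \<one> (coord_vector M (U, \<phi>) v \<one>) = coord_vector M (U, \<phi>) (L v) \<one>) \<and>
     gtame V L (\<lambda>y. F (ex y)) \<and> (\<forall>X\<in>V. F (Exp X) = Exp (L X))"
proof (rule Exp_smooth_map[of F, OF assms(1,2)], goal_cases)
  case (3 L)
  then show ?case by (intro exI[of _ L]) simp
qed (rule assms(3,4), assumption)+

text \<open>Chosen by its intertwining relation with \<open>Exp\<close>. By
  \<open>Exp_line_inj\<close> this determines it on \<open>V\<close>; elsewhere the choice is
  arbitrary.\<close>

definition Ad :: "'g \<Rightarrow> 'e \<Rightarrow> 'e" where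
  "Ad a = (SOME L. linear L \<and> (\<forall>v\<in>V. L v \<in> V) \<and>
     (\<forall>X\<in>V. a \<otimes> Exp X \<otimes> inv a = Exp (L X)))"

lemma Ad:
  assumes a: "a \<in> carrier G"
  shows linear_Ad: "linear (Ad a)" and Ad_V: "v \<in> V \<Longrightarrow> Ad a v \<in> V"
    and Exp_Ad: "X \<in> V \<Longrightarrow> a \<otimes> Exp X \<otimes> inv a = Exp (Ad a X)"
proof -
  have one: "a \<otimes> \<one> \<otimes> inv a = \<one>" using a by simp
  have car: "a \<otimes> x \<otimes> inv a \<in> carrier G" if "x \<in> carrier G" for x using that a by simp
  have hom: "a \<otimes> (x \<otimes> x) \<otimes> inv a = a \<otimes> x \<otimes> inv a \<otimes> (a \<otimes> x \<otimes> inv a)" if "x \<in> carrier G" for x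
    using that a by (simp add: m_assoc inv_solve_left)
  have "\<exists>L. linear L \<and> (\<forall>v\<in>V. L v \<in> V) \<and>
     (\<forall>X\<in>V. a \<otimes> Exp X \<otimes> inv a = Exp (L X))"
  proof -
    have "\<exists>L. linear L \<and> (\<forall>v\<in>V. L v \<in> V) \<and>
      (\<forall>v\<in>V. differential M (\<lambda>x. a \<otimes> x \<otimes> inv a) \<one> (coord_vector M (U, \<phi>) v \<one>) = coord_vector M (U, \<phi>) (L v) \<one>) \<and>
      gtame V L (\<lambda>y. a \<otimes> ex y \<otimes> inv a) \<and> (\<forall>X\<in>V. a \<otimes> Exp X \<otimes> inv a = Exp (L X))"
      by (rule Exp_smooth_map_ex[of "\<lambda>x. a \<otimes> x \<otimes> inv a"]) (rule conj_smooth[OF a] one car hom, assumption?)+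
    then show ?thesis by blast
  qed
  then have "linear (Ad a) \<and> (\<forall>v\<in>V. Ad a v \<in> V) \<and>
     (\<forall>X\<in>V. a \<otimes> Exp X \<otimes> inv a = Exp (Ad a X))" unfolding Ad_def by (rule someI_ex)
  then show "linear (Ad a)" "v \<in> V \<Longrightarrow> Ad a v \<in> V"
    "X \<in> V \<Longrightarrow> a \<otimes> Exp X \<otimes> inv a = Exp (Ad a X)" by auto
qed

end

section \<open>Local Cartan decomposition\<close>

locale sym_chart = riemannian_symmetric_triple G M \<sigma> K + lie_group_chart G M U \<phi>
  for G :: "('g, 'r) monoid_scheme" (structure)
    and M :: "('g, 'e::euclidean_space) manifold" and \<sigma> :: "'g \<Rightarrow> 'g" and K :: "'g set"
    and U :: "'g set" and \<phi> :: "'g \<Rightarrow> 'e"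
begin

lemma \<sigma>_closed [simp]: "x \<in> carrier G \<Longrightarrow> \<sigma> x \<in> carrier G"
  using automorphism by (auto simp: iso_def hom_def)

lemma \<sigma>_mult: "x \<in> carrier G \<Longrightarrow> y \<in> carrier G \<Longrightarrow> \<sigma> (x \<otimes> y) = \<sigma> x \<otimes> \<sigma> y"
  using automorphism by (auto simp: iso_def hom_def)

lemma \<sigma>_one [simp]: "\<sigma> \<one> = \<one>"
  using \<sigma>_mult[of \<one> \<one>] l_cancel_one[of "\<sigma> \<one>" "\<sigma> \<one>"] by simp

lemma \<sigma>_inv:
  assumes x: "x \<in> carrier G"
  shows "\<sigma> (inv x) = inv (\<sigma> x)"
proof -
  have "\<sigma> (inv x) \<otimes> \<sigma> x = \<one>" using \<sigma>_mult[of "inv x" x] x by simp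
  then have "inv (\<sigma> x) = \<sigma> (inv x)" by (rule inv_equality) (use x in simp_all)
  then show ?thesis by (rule sym)
qed

lemma K_carrier: "k \<in> K \<Longrightarrow> k \<in> carrier G" and K_fixed: "k \<in> K \<Longrightarrow> \<sigma> k = k"
  by (simp_all add: K_eq)

lemma K_I: "k \<in> carrier G \<Longrightarrow> \<sigma> k = k \<Longrightarrow> k \<in> K" by (simp add: K_eq)

lemma K_subgroup: "subgroup K G"
  by (rule subgroupI) (auto simp: K_eq \<sigma>_mult \<sigma>_inv)

text \<open>The differential of \<open>\<sigma>\<close> in the chart. Its action on coordinate
  vectors gives the link to \<open>minus_eigenspace\<close>, its action under \<open>Exp\<close> is
  the form used in group computations.\<close>

definition ds :: "'e \<Rightarrow> 'e" where
  "ds = (SOME L. linear L \<and> (\<forall>v\<in>V. L v \<in> V) \<and>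
     (\<forall>v\<in>V. differential M \<sigma> \<one> (coord_vector M (U, \<phi>) v \<one>) = coord_vector M (U, \<phi>) (L v) \<one>) \<and>
     (\<forall>X\<in>V. \<sigma> (Exp X) = Exp (L X)))"

lemma linear_ds: "linear ds" and ds_V: "v \<in> V \<Longrightarrow> ds v \<in> V"
  and differential_ds: "v \<in> V \<Longrightarrow>
    differential M \<sigma> \<one> (coord_vector M (U, \<phi>) v \<one>) = coord_vector M (U, \<phi>) (ds v) \<one>"
  and \<sigma>_Exp: "X \<in> V \<Longrightarrow> \<sigma> (Exp X) = Exp (ds X)"
proof -
  have "\<exists>L. linear L \<and> (\<forall>v\<in>V. L v \<in> V) \<and>
     (\<forall>v\<in>V. differential M \<sigma> \<one> (coord_vector M (U, \<phi>) v \<one>) = coord_vector M (U, \<phi>) (L v) \<one>) \<and>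
     (\<forall>X\<in>V. \<sigma> (Exp X) = Exp (L X))"
  proof -
    have "\<exists>L. linear L \<and> (\<forall>v\<in>V. L v \<in> V) \<and>
      (\<forall>v\<in>V. differential M \<sigma> \<one> (coord_vector M (U, \<phi>) v \<one>) = coord_vector M (U, \<phi>) (L v) \<one>) \<and>
      gtame V L (\<lambda>y. \<sigma> (ex y)) \<and> (\<forall>X\<in>V. \<sigma> (Exp X) = Exp (L X))"
      by (rule Exp_smooth_map_ex[of \<sigma>, OF smooth_automorphism \<sigma>_one]) (simp_all add: \<sigma>_mult)
    then show ?thesis by blast
  qed
  then have "linear ds \<and> (\<forall>v\<in>V. ds v \<in> V) \<and>
     (\<forall>v\<in>V. differential M \<sigma> \<one> (coord_vector M (U, \<phi>) v \<one>) = coord_vector M (U, \<phi>) (ds v) \<one>) \<and>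
     (\<forall>X\<in>V. \<sigma> (Exp X) = Exp (ds X))" unfolding ds_def by (rule someI_ex)
  then show "linear ds" "v \<in> V \<Longrightarrow> ds v \<in> V"
    "v \<in> V \<Longrightarrow> differential M \<sigma> \<one> (coord_vector M (U, \<phi>) v \<one>) = coord_vector M (U, \<phi>) (ds v) \<one>"
    "X \<in> V \<Longrightarrow> \<sigma> (Exp X) = Exp (ds X)" by auto
qed

lemma ds_scale: "ds (t *\<^sub>R X) = t *\<^sub>R ds X"
  using linear_ds linear_cmul by blast

lemma V_scale: "X \<in> V \<Longrightarrow> t *\<^sub>R X \<in> V"
  using V by (simp add: subspace_scale)

lemma ds_ds: assumes X: "X \<in> V" shows "ds (ds X) = X"
proof (rule Exp_line_inj[OF ds_V[OF ds_V[OF X]] X])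
  fix t
  have "\<sigma> (\<sigma> (Exp (t *\<^sub>R X))) = Exp (t *\<^sub>R ds (ds X))"
    using X by (simp add: \<sigma>_Exp V_scale ds_V ds_scale)
  then show "Exp (t *\<^sub>R ds (ds X)) = Exp (t *\<^sub>R X)"
    using involution[of "Exp (t *\<^sub>R X)"] X by (simp add: V_scale)
qed

definition \<pp> :: "'e set" where "\<pp> = {X \<in> V. ds X = - X}"

lemma \<pp>_V: "X \<in> \<pp> \<Longrightarrow> X \<in> V" by (simp add: \<pp>_def)

lemma subspace_\<pp>: "subspace \<pp>"
  using V linear_ds by (auto simp: subspace_def \<pp>_def linear_add linear_cmul linear_0)

lemma \<sigma>_Exp_\<pp>: "X \<in> \<pp> \<Longrightarrow> \<sigma> (Exp X) = inv (Exp X)"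
  by (simp add: \<pp>_def \<sigma>_Exp Exp_minus)

lemma \<pp>_scale: "X \<in> \<pp> \<Longrightarrow> t *\<^sub>R X \<in> \<pp>"
  using subspace_\<pp> by (simp add: subspace_scale)

text \<open>Since \<open>\<sigma>\<close> fixes \<open>k\<close> and inverts
  \<open>Exp (t X)\<close>, it inverts the conjugate of \<open>Exp (t X)\<close> by
  \<open>k\<close>.\<close>

lemma Ad_\<pp>:
  assumes k: "k \<in> K" and X: "X \<in> \<pp>"
  shows "Ad k X \<in> \<pp>"
proof -
  note kc = K_carrier[OF k]
  have XV: "X \<in> V" using X \<pp>_V by blast
  have AV: "Ad k X \<in> V" using Ad_V[OF kc XV] .
  have "ds (Ad k X) = - Ad k X"
  proof (rule Exp_line_inj)
    fix t
    have tX: "t *\<^sub>R X \<in> V" "t *\<^sub>R X \<in> \<pp>" using XV X V_scale \<pp>_scale by auto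
    have eq: "Exp (t *\<^sub>R Ad k X) = k \<otimes> Exp (t *\<^sub>R X) \<otimes> inv k"
      using Exp_Ad[OF kc tX(1)] linear_cmul[OF linear_Ad[OF kc], of t X] by simp
    have "Exp (t *\<^sub>R ds (Ad k X)) = \<sigma> (k \<otimes> Exp (t *\<^sub>R X) \<otimes> inv k)"
      using \<sigma>_Exp[OF V_scale[OF AV], of t] by (simp add: ds_scale eq)
    also have "\<dots> = k \<otimes> inv (Exp (t *\<^sub>R X)) \<otimes> inv k"
      using kc tX k by (simp add: \<sigma>_mult \<sigma>_inv K_fixed \<sigma>_Exp_\<pp>)
    also have "\<dots> = inv (k \<otimes> Exp (t *\<^sub>R X) \<otimes> inv k)"
      using kc tX by (simp add: inv_mult_group m_assoc)
    also have "\<dots> = Exp (t *\<^sub>R - Ad k X)"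
      using Exp_minus[OF V_scale[OF AV], of t] eq by simp
    finally show "Exp (t *\<^sub>R ds (Ad k X)) = Exp (t *\<^sub>R - Ad k X)" .
  qed (use AV V ds_V in \<open>auto simp: subspace_neg\<close>)
  then show ?thesis using AV by (simp add: \<pp>_def)
qed

lemma Exp_\<pp>_in_image:
  assumes X: "X \<in> \<pp>"
  shows "Exp X \<in> lie_exp G M ` minus_eigenspace G M \<sigma>"
proof (rule image_eqI)
  have XV: "X \<in> V" using X \<pp>_V by blast
  show "Exp X = lie_exp G M (coord_vector M (U, \<phi>) X \<one>)" using lie_exp_coord_vector[OF XV] by simp
  have "coord_vector M (U, \<phi>) (- X) \<one> = (\<lambda>f. - coord_vector M (U, \<phi>) X \<one> f)"
    using coord_vector_linear[OF chart one_U XV XV, of "-1" 0] by simp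
  then show "coord_vector M (U, \<phi>) X \<one> \<in> minus_eigenspace G M \<sigma>"
    using coord_vector_in_tangent_space[OF chart one_U XV] differential_ds[OF XV] X
    by (simp add: minus_eigenspace_def lie_algebra_def \<pp>_def)
qed

lemma Exp_double: assumes "X \<in> V" shows "Exp (2 *\<^sub>R X) = Exp X \<otimes> Exp X"
  using Exp_add[OF assms, of 1 1] by simp

text \<open>The candidate for \<open>k\<close> is the inverse of \<open>Exp Z\<close> times
  \<open>a\<close>. The hypothesis says that the square of \<open>Exp Z\<close> is \<open>a\<close>
  times the inverse of \<open>\<sigma> a\<close>, which is the statement that this candidate is
  fixed by \<open>\<sigma>\<close>.\<close>

lemma cartan_decomposition:
  assumes a: "a \<in> carrier G" and Z: "Z \<in> \<pp>" and eq: "Exp (2 *\<^sub>R Z) = a \<otimes> inv (\<sigma> a)"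
  obtains k where "k \<in> K" "a = Exp Z \<otimes> k"
proof -
  have ZV: "Z \<in> V" using Z \<pp>_V by blast
  let ?z = "Exp Z" and ?k = "inv (Exp Z) \<otimes> a"
  have z: "?z \<in> carrier G" using ZV by simp
  have "?z \<otimes> ?z \<otimes> \<sigma> a = a"
    using eq[unfolded Exp_double[OF ZV]] a z by (simp add: m_assoc)
  then have "inv ?z \<otimes> a = ?z \<otimes> \<sigma> a" using a z by (metis \<sigma>_closed inv_solve_left m_assoc m_closed)
  then have "\<sigma> ?k = ?k" using a z Z by (simp add: \<sigma>_mult \<sigma>_inv \<sigma>_Exp_\<pp> involution)
  then have "?k \<in> K" using a z by (intro K_I) auto
  moreover have "a = ?z \<otimes> ?k" using a z by (simp flip: m_assoc)
  ultimately show ?thesis using that by blast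
qed

text \<open>The product of \<open>a\<close> with the inverse of \<open>\<sigma> a\<close> depends
  only on the coset of \<open>a\<close>; for \<open>a = Exp Z \<otimes> k\<close> it equals
  \<open>Exp (2 Z)\<close>.\<close>

lemma Exp_coset_eq:
  assumes Z: "Z \<in> \<pp>" "Z' \<in> \<pp>" and k: "k \<in> K" "k' \<in> K" and eq: "Exp Z \<otimes> k = Exp Z' \<otimes> k'"
  shows "Exp (2 *\<^sub>R Z) = Exp (2 *\<^sub>R Z')"
proof -
  have *: "Exp (2 *\<^sub>R Y) = Exp Y \<otimes> l \<otimes> inv (\<sigma> (Exp Y \<otimes> l))" if Y: "Y \<in> \<pp>" and l: "l \<in> K" for Y l
  proof -
    have YV: "Y \<in> V" using Y \<pp>_V by blast
    have "\<sigma> (Exp Y \<otimes> l) = inv (Exp Y) \<otimes> l"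
      using YV Y l by (simp add: \<sigma>_mult K_carrier K_fixed \<sigma>_Exp_\<pp>)
    then show ?thesis using YV K_carrier[OF l] Exp_double[OF YV]
      by (simp add: inv_mult_group m_assoc) (metis Exp_carrier inv_closed l_one m_assoc r_inv)
  qed
  show ?thesis using *[OF Z(1) k(1)] *[OF Z(2) k(2)] eq by simp
qed

text \<open>The hypothesis on \<open>X\<close> says that \<open>ds X\<close> and \<open>- X\<close>
  have the same exponential. The radius \<open>\<rho> / C\<close> makes \<open>ds X\<close> small
  enough for injectivity.\<close>

lemma antisymmetric_log:
  assumes "\<rho> > 0" and inj: "\<And>X Y. X \<in> V \<Longrightarrow> Y \<in> V \<Longrightarrow> norm X < \<rho> \<Longrightarrow> norm Y < \<rho> \<Longrightarrow> Exp X = Exp Y \<Longrightarrow> X = Y"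
  obtains r where "r > 0" "\<And>X. X \<in> V \<Longrightarrow> norm X < r \<Longrightarrow> \<sigma> (Exp X) = inv (Exp X) \<Longrightarrow> X \<in> \<pp>"
proof -
  obtain C where C: "C > 0" "\<And>x. norm (ds x) \<le> C * norm x" using linear_bounded_pos[OF linear_ds] by blast
  define r where "r = min \<rho> (\<rho> / C)"
  have r: "r > 0" "r \<le> \<rho>" "r \<le> \<rho> / C" using assms(1) C(1) by (auto simp: r_def)
  show ?thesis
  proof (rule that[OF r(1)])
    fix X assume X: "X \<in> V" "norm X < r" "\<sigma> (Exp X) = inv (Exp X)"
    have "C * norm X < C * (\<rho> / C)" using X r C by (intro mult_strict_left_mono) auto
    then have "norm (ds X) < \<rho>" using C(2)[of X] C(1) by simp
    moreover have "Exp (ds X) = Exp (- X)" using X by (simp add: \<sigma>_Exp Exp_minus)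
    ultimately have "ds X = - X" using X r V by (intro inj) (auto simp: ds_V subspace_neg)
    then show "X \<in> \<pp>" using X by (simp add: \<pp>_def)
  qed
qed

text \<open>\<open>\<sigma>\<close> inverts the product \<open>b\<close> of \<open>a\<close> with
  the inverse of \<open>\<sigma> a\<close>, so for \<open>a\<close> near \<open>\<one>\<close> the
  logarithm of \<open>b\<close> lies in \<open>\<pp>\<close>; half of it is the required
  \<open>Z\<close>.\<close>

lemma cartan_decomposition_near:
  assumes "e > 0"
  obtains A where "openin (mtop M) A" "\<one> \<in> A"
    "\<And>a. a \<in> A \<Longrightarrow> \<exists>Z\<in>\<pp>. \<exists>k\<in>K. norm Z < e \<and> a = Exp Z \<otimes> k"
proof -
  obtain \<rho> gl where \<rho>: "\<rho> > 0"
    "\<And>X. X \<in> V \<Longrightarrow> norm X < \<rho> \<Longrightarrow> Exp X \<in> U \<and> norm (lg (Exp X)) \<le> 2 * norm X"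
    "\<And>X Y. X \<in> V \<Longrightarrow> Y \<in> V \<Longrightarrow> norm X < \<rho> \<Longrightarrow> norm Y < \<rho> \<Longrightarrow> Exp X = Exp Y \<Longrightarrow> X = Y"
    "\<And>x. x \<in> U \<Longrightarrow> norm (lg x) < \<rho> / 4 \<Longrightarrow> gl (lg x) \<in> V \<and> norm (gl (lg x)) \<le> 2 * norm (lg x) \<and> Exp (gl (lg x)) = x"
    by (rule Exp_near) (rule that)
  obtain r where r: "r > 0" "\<And>X. X \<in> V \<Longrightarrow> norm X < r \<Longrightarrow> \<sigma> (Exp X) = inv (Exp X) \<Longrightarrow> X \<in> \<pp>"
    by (rule antisymmetric_log[OF \<rho>(1,3)]) (assumption | rule that)+
  define \<delta> where "\<delta> = min (\<rho> / 4) (min (r / 2) e)"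
  have \<delta>: "\<delta> > 0" "\<delta> \<le> \<rho> / 4" "\<delta> \<le> r / 2" "\<delta> \<le> e" using \<rho>(1) r(1) assms by (auto simp: \<delta>_def)
  have cont: "continuous_map (mtop M) (mtop M) (\<lambda>a. a \<otimes> inv (\<sigma> a))"
    using smooth_map_compose[OF smooth_manifold_M smooth_manifold_M smooth_manifold_M smooth_automorphism inv_smooth]
    by (intro continuous_map_mult) (auto simp: smooth_map_def)
  define A where "A = {a \<in> points M. a \<otimes> inv (\<sigma> a) \<in> {x \<in> U. norm (lg x) < \<delta>}}"
  show ?thesis
  proof (rule that)
    show "openin (mtop M) A" unfolding A_def
      by (rule openin_continuous_map_preimage[OF cont lg_near(1)[OF \<delta>(1)]])
    show "\<one> \<in> A" using points_eq one_U \<delta>(1) by (simp add: A_def)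
    fix a assume "a \<in> A"
    then have a: "a \<in> carrier G" "a \<otimes> inv (\<sigma> a) \<in> U" "norm (lg (a \<otimes> inv (\<sigma> a))) < \<delta>"
      using points_eq by (auto simp: A_def)
    let ?b = "a \<otimes> inv (\<sigma> a)"
    let ?X = "gl (lg ?b)"
    have X: "?X \<in> V" "norm ?X \<le> 2 * norm (lg ?b)" "Exp ?X = ?b" using \<rho>(4)[OF a(2)] a(3) \<delta>(2) by auto
    have "\<sigma> ?b = inv ?b" using a(1) involution by (simp add: \<sigma>_mult \<sigma>_inv inv_mult_group)
    then have Xp: "?X \<in> \<pp>" using X a(3) \<delta>(3) by (intro r(2)) auto
    let ?Z = "(1/2) *\<^sub>R ?X"
    have Z: "?Z \<in> \<pp>" "norm ?Z < e" using Xp X(2) a(3) \<delta>(4) \<pp>_scale by auto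
    have "Exp (2 *\<^sub>R ?Z) = a \<otimes> inv (\<sigma> a)" using X(3) by simp
    then obtain k where "k \<in> K" "a = Exp ?Z \<otimes> k" using cartan_decomposition[OF a(1) Z(1)] by blast
    then show "\<exists>Z\<in>\<pp>. \<exists>k\<in>K. norm Z < e \<and> a = Exp Z \<otimes> k" using Z by blast
  qed
qed

end

section \<open>The estimate for a corner in an invariant inner product\<close>

locale sym_chart_inner = sym_chart G M \<sigma> K U \<phi>
  for G :: "('g, 'r) monoid_scheme" (structure)
    and M :: "('g, 'e::euclidean_space) manifold" and \<sigma> :: "'g \<Rightarrow> 'g" and K :: "'g set"
    and U :: "'g set" and \<phi> :: "'g \<Rightarrow> 'e" +
  fixes B :: "'e \<Rightarrow> 'e \<Rightarrow> real"
  assumes B_bilinear: "bounded_bilinear B"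
    and B_sym: "B X Y = B Y X"
    and B_pos: "X \<in> \<pp> \<Longrightarrow> X \<noteq> 0 \<Longrightarrow> B X X > 0"
    and B_Ad: "k \<in> K \<Longrightarrow> X \<in> \<pp> \<Longrightarrow> B (Ad k X) (Ad k X) = B X X"
begin

lemmas B_simps = bounded_bilinear.add_left[OF B_bilinear] bounded_bilinear.add_right[OF B_bilinear]
  bounded_bilinear.diff_left[OF B_bilinear] bounded_bilinear.diff_right[OF B_bilinear]
  bounded_bilinear.scaleR_left[OF B_bilinear] bounded_bilinear.scaleR_right[OF B_bilinear]

lemma B_bounds:
  obtains c b where "c > 0" "b > 0" "\<And>X. X \<in> \<pp> \<Longrightarrow> c * (norm X)\<^sup>2 \<le> B X X"
    "\<And>X Y. \<bar>B X Y\<bar> \<le> b * norm X * norm Y"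
proof -
  obtain b where b: "b > 0" "\<And>X Y. norm (B X Y) \<le> norm X * norm Y * b"
    using bounded_bilinear.pos_bounded[OF B_bilinear] by blast
  have cont: "continuous_on T (\<lambda>X. B X X)" for T
    by (intro bounded_bilinear.continuous_on[OF B_bilinear] continuous_intros)
  have "\<exists>c>0. \<forall>X\<in>\<pp>. c * (norm X)\<^sup>2 \<le> B X X"
  \<comment> \<open>If \<open>\<pp>\<close> is trivial there is no unit vector at which to minimise,
    and every constant works.\<close>
  proof (cases "\<pp> \<inter> sphere 0 1 = {}")
    case True
    have "X = 0" if "X \<in> \<pp>" for X
    proof (rule ccontr)
      assume "X \<noteq> 0"
      then have "(1 / norm X) *\<^sub>R X \<in> \<pp> \<inter> sphere 0 1" using \<pp>_scale[OF that] by simp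
      then show False using True by blast
    qed
    then have "1 * (norm X)\<^sup>2 \<le> B X X" if "X \<in> \<pp>" for X
      using that bounded_bilinear.zero_left[OF B_bilinear, of 0] by (metis mult_1 norm_zero order_refl zero_power2)
    then show ?thesis by (intro exI[of _ 1]) simp
  next
    case False
    have "compact (\<pp> \<inter> sphere 0 1)"
      using closed_subspace[OF subspace_\<pp>] by (intro closed_Int_compact compact_sphere)
    then obtain Z where Z: "Z \<in> \<pp> \<inter> sphere 0 1" "\<And>X. X \<in> \<pp> \<inter> sphere 0 1 \<Longrightarrow> B Z Z \<le> B X X"
      using continuous_attains_inf[OF _ False cont] by blast
    have "B Z Z > 0" using Z(1) by (intro B_pos) auto
    moreover have "B Z Z * (norm X)\<^sup>2 \<le> B X X" if X: "X \<in> \<pp>" for X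
    proof (cases "X = 0")
      case False
      then have "(1 / norm X) *\<^sub>R X \<in> \<pp> \<inter> sphere 0 1" using \<pp>_scale[OF X] by simp
      from Z(2)[OF this] have "B Z Z \<le> B X X / (norm X)\<^sup>2" by (simp add: B_simps power2_eq_square)
      then show ?thesis using False by (simp add: field_simps)
    qed (simp add: bounded_bilinear.zero_left[OF B_bilinear])
    ultimately show ?thesis by blast
  qed
  then obtain c where "c > 0" "\<forall>X\<in>\<pp>. c * (norm X)\<^sup>2 \<le> B X X" by blast
  then show ?thesis using that b by (metis mult.commute mult.left_commute real_norm_def)
qed

lemma B_nonneg: "X \<in> \<pp> \<Longrightarrow> B X X \<ge> 0"
  using B_pos[of X] bounded_bilinear.zero_left[OF B_bilinear] by (cases "X = 0") (auto simp: less_imp_le)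

text \<open>For \<open>a = Exp X \<otimes> Exp Y\<close>, the product of \<open>a\<close> with the
  inverse of \<open>\<sigma> a\<close> is \<open>Exp X \<otimes> Exp (2 Y) \<otimes> Exp X\<close>.
  Half its logarithm is \<open>Z\<close>, so the linear part is
  \<open>(X + 2 Y + X) / 2 = X + Y\<close>.\<close>

lemma corner_coordinates:
  obtains Z r where "r > 0" "tame (V \<times> V) (\<lambda>p. fst p + snd p) Z"
    "\<And>S. S \<in> \<pp> \<Longrightarrow> norm S < r \<Longrightarrow> Z (S, S) = 2 *\<^sub>R S"
    "\<And>X Y. X \<in> \<pp> \<Longrightarrow> Y \<in> \<pp> \<Longrightarrow> norm X < r \<Longrightarrow> norm Y < r \<Longrightarrow> Z (X, Y) \<in> \<pp> \<and>
      (\<exists>k\<in>K. Exp X \<otimes> Exp Y = Exp (Z (X, Y)) \<otimes> k) \<and> B (Z (Y, X)) (Z (Y, X)) = B (Z (X, Y)) (Z (X, Y))"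
proof -
  obtain c b where cb: "c > 0" "b > 0" "\<And>X. X \<in> \<pp> \<Longrightarrow> c * (norm X)\<^sup>2 \<le> B X X"
    "\<And>X Y. \<bar>B X Y\<bar> \<le> b * norm X * norm Y" by (rule B_bounds) (rule that)
  obtain \<rho> gl where \<rho>: "\<rho> > 0" "tame V (\<lambda>x. x) gl"
    "\<And>X. X \<in> V \<Longrightarrow> norm X < \<rho> \<Longrightarrow> Exp X \<in> U \<and> norm (lg (Exp X)) \<le> 2 * norm X"
    "\<And>X Y. X \<in> V \<Longrightarrow> Y \<in> V \<Longrightarrow> norm X < \<rho> \<Longrightarrow> norm Y < \<rho> \<Longrightarrow> Exp X = Exp Y \<Longrightarrow> X = Y"
    "\<And>x. x \<in> U \<Longrightarrow> norm (lg x) < \<rho> / 4 \<Longrightarrow> gl (lg x) \<in> V \<and> norm (gl (lg x)) \<le> 2 * norm (lg x) \<and> Exp (gl (lg x)) = x"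
    by (rule Exp_near) (rule that)
  obtain r0 where r0: "r0 > 0" "\<And>X. X \<in> V \<Longrightarrow> norm X < r0 \<Longrightarrow> \<sigma> (Exp X) = inv (Exp X) \<Longrightarrow> X \<in> \<pp>"
    by (rule antisymmetric_log[OF \<rho>(1,4)]) (assumption | rule that)+
  \<comment> \<open>The entries place the logarithm in \<open>\<pp>\<close>, keep it in the domain
    of \<open>gl\<close>, and keep twice a conjugate of \<open>Z\<close> within the injectivity
    radius. Invariance of \<open>B\<close> bounds \<open>Ad\<close> on \<open>\<pp>\<close> by
    \<open>sqrt (b / c)\<close> in the Euclidean norm, uniformly over \<open>K\<close>.\<close>
  define e where "e = min (r0 / 2) (min (\<rho> / 4) (\<rho> / (2 * sqrt (b / c) + 2)))"
  have e: "e > 0" "e \<le> r0 / 2" "e \<le> \<rho> / 4" "e \<le> \<rho> / (2 * sqrt (b / c) + 2)"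
    using r0(1) \<rho>(1) cb(1,2) unfolding e_def
    by (simp_all only: min.cobounded1 min.coboundedI2 min.cobounded2) (simp add: add_nonneg_pos)
  have VV: "subspace (V \<times> V)" using V V by (rule subspace_Times)
  have lin: "linear fst" "linear (\<lambda>p. 2 *\<^sub>R snd p)" "linear (\<lambda>p::'e \<times> 'e. fst p + snd p)" "linear (\<lambda>x::'e. (1/2) *\<^sub>R x)"
    by (auto intro!: linearI simp: algebra_simps)
  have g1: "gtame (V \<times> V) fst (\<lambda>p. Exp (fst p))"
    by (rule gtame_linear_compose[OF gtame_Exp VV lin(1)]) auto
  have g2: "gtame (V \<times> V) (\<lambda>p. 2 *\<^sub>R snd p) (\<lambda>p. Exp (2 *\<^sub>R snd p))"
    by (rule gtame_linear_compose[OF gtame_Exp VV lin(2)]) (auto simp: V_scale)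
  define cc where "cc = (\<lambda>p. Exp (fst p) \<otimes> Exp (2 *\<^sub>R snd p) \<otimes> Exp (fst p))"
  have g: "gtame (V \<times> V) (\<lambda>p. fst p + 2 *\<^sub>R snd p + fst p) cc"
    unfolding cc_def by (rule gtame_mult[OF gtame_mult[OF g1 g2] g1])
  note gg = gtameD[OF g]
  obtain r1 where r1: "r1 > 0" "\<And>p. p \<in> V \<times> V \<Longrightarrow> norm p < r1 \<Longrightarrow> cc p \<in> U \<and> norm (lg (cc p)) < e"
    by (rule gtame_small[OF g e(1)]) (rule that)
  have t1: "tame (V \<times> V) (\<lambda>p. fst p + 2 *\<^sub>R snd p + fst p) (\<lambda>p. gl (lg (cc p)))"
    by (rule tame_compose[OF VV V gg(3) \<rho>(2) gg(2) linear_id[unfolded id_def] r1(1)]) (use r1(2) lg_V in blast)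
  define Z where "Z = (\<lambda>p. (1/2) *\<^sub>R gl (lg (cc p)))"
  have "tame (V \<times> V) (\<lambda>p. (1/2) *\<^sub>R (fst p + 2 *\<^sub>R snd p + fst p)) Z"
    unfolding Z_def
    by (rule tame_compose[OF VV subspace_UNIV t1 tame_linear[OF lin(4)] gg(2) lin(4) zero_less_one]) simp
  then have tZ: "tame (V \<times> V) (\<lambda>p. fst p + snd p) Z"
    by (rule tame_cong[OF _ zero_less_one VV refl]) (simp add: scaleR_2 algebra_simps flip: scaleR_add_left)
  have pV: "(X, Y) \<in> V \<times> V" if "X \<in> \<pp>" "Y \<in> \<pp>" for X Y using that \<pp>_V by blast
  have pn: "norm (X, Y) < r1" if "norm X < r1 / 2" "norm Y < r1 / 2" for X Y :: 'e
    using norm_Pair_le[of X Y] that by simp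
  have Zp: "Z (X, Y) \<in> \<pp>" "norm (Z (X, Y)) < e" "Exp (2 *\<^sub>R Z (X, Y)) = cc (X, Y)"
    "\<exists>k\<in>K. Exp X \<otimes> Exp Y = Exp (Z (X, Y)) \<otimes> k"
    if X: "X \<in> \<pp>" "norm X < r1 / 2" and Y: "Y \<in> \<pp>" "norm Y < r1 / 2" for X Y
  proof -
    have XV: "X \<in> V" "Y \<in> V" using X Y \<pp>_V by auto
    have cU: "cc (X, Y) \<in> U" "norm (lg (cc (X, Y))) < e" using r1(2)[OF pV[OF X(1) Y(1)] pn[OF X(2) Y(2)]] by auto
    have gl: "gl (lg (cc (X, Y))) \<in> V" "norm (gl (lg (cc (X, Y)))) \<le> 2 * norm (lg (cc (X, Y)))"
      "Exp (gl (lg (cc (X, Y)))) = cc (X, Y)" using \<rho>(5)[OF cU(1)] cU(2) e(3) by auto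
    have X2: "2 *\<^sub>R Y \<in> \<pp>" "2 *\<^sub>R Y \<in> V" using \<pp>_scale[OF Y(1)] V_scale[OF XV(2)] by auto
    have "\<sigma> (cc (X, Y)) = inv (cc (X, Y))"
      using XV X X2 by (simp add: cc_def \<sigma>_mult \<sigma>_Exp_\<pp> inv_mult_group m_assoc)
    then have gp: "gl (lg (cc (X, Y))) \<in> \<pp>" using gl cU(2) e(2) by (intro r0(2)) auto
    then show Zp: "Z (X, Y) \<in> \<pp>" unfolding Z_def by (rule \<pp>_scale)
    show "norm (Z (X, Y)) < e" unfolding Z_def using gl(2) cU(2) by simp
    show E2: "Exp (2 *\<^sub>R Z (X, Y)) = cc (X, Y)" using gl(3) by (simp add: Z_def)
    let ?a = "Exp X \<otimes> Exp Y"
    have "?a \<otimes> inv (\<sigma> ?a) = cc (X, Y)"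
      using XV X(1) Y(1) by (simp add: cc_def \<sigma>_mult \<sigma>_Exp_\<pp> inv_mult_group m_assoc Exp_double)
    then show "\<exists>k\<in>K. ?a = Exp (Z (X, Y)) \<otimes> k"
      using cartan_decomposition[of ?a "Z (X, Y)"] XV Zp E2 by (metis Exp_carrier m_closed)
  qed
  define r where "r = min (r1 / 2) (\<rho> / 4)"
  have r: "r > 0" "r \<le> r1 / 2" "r \<le> \<rho> / 4" using r1(1) \<rho>(1) by (auto simp: r_def)
  show ?thesis
  proof (rule that[OF r(1) tZ])
    fix S assume S: "S \<in> \<pp>" "norm S < r"
    have SV: "S \<in> V" using S \<pp>_V by blast
    have n: "norm S < r1 / 2" using S(2) r(2) by simp
    note z = Zp[OF S(1) n S(1) n]
    have "cc (S, S) = Exp (4 *\<^sub>R S)"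
      using Exp_add[OF SV, of 1 2] Exp_add[OF SV, of "1 + 2" 1] by (simp add: cc_def)
    then have "Exp (2 *\<^sub>R Z (S, S)) = Exp (4 *\<^sub>R S)" using z(3) by simp
    moreover have "norm (2 *\<^sub>R Z (S, S)) < \<rho>" using z(2) e(3) \<rho>(1) by simp
    moreover have "norm (4 *\<^sub>R S) < \<rho>" using S(2) r(3) by simp
    ultimately have "2 *\<^sub>R Z (S, S) = 4 *\<^sub>R S" using z(1) \<pp>_V SV V_scale by (intro \<rho>(4)) auto
    then have "(1/2) *\<^sub>R (2 *\<^sub>R Z (S, S)) = (1/2) *\<^sub>R (4 *\<^sub>R S)" by simp
    then show "Z (S, S) = 2 *\<^sub>R S" by simp
  next
    fix X Y assume XY: "X \<in> \<pp>" "Y \<in> \<pp>" "norm X < r" "norm Y < r"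
    have n: "norm X < r1 / 2" "norm Y < r1 / 2" using XY r(2) by auto
    note z = Zp[OF XY(1) n(1) XY(2) n(2)] and z' = Zp[OF XY(2) n(2) XY(1) n(1)]
    have XV: "X \<in> V" "Y \<in> V" using XY \<pp>_V by auto
    let ?Z = "Z (X, Y)" and ?Z' = "Z (Y, X)"
    have ZV: "?Z \<in> V" "?Z' \<in> V" using z z' \<pp>_V by auto
    obtain k where k: "k \<in> K" "Exp X \<otimes> Exp Y = Exp ?Z \<otimes> k" using z(4) by blast
    obtain k' where k': "k' \<in> K" "Exp Y \<otimes> Exp X = Exp ?Z' \<otimes> k'" using z'(4) by blast
    have kc: "k \<in> carrier G" using k K_carrier by blast
    have ik: "inv k \<in> K" "inv k \<in> carrier G" using subgroup.m_inv_closed[OF K_subgroup k(1)] kc by auto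
    \<comment> \<open>Inversion after \<open>\<sigma>\<close> reverses products, fixes exponentials
      of elements of \<open>\<pp>\<close> and inverts elements of \<open>K\<close>.\<close>
    have "inv (\<sigma> (Exp X \<otimes> Exp Y)) = inv (\<sigma> (Exp ?Z \<otimes> k))" using k(2) by simp
    then have "Exp Y \<otimes> Exp X = inv k \<otimes> Exp ?Z"
      using XV ZV kc k(1) XY z(1) by (simp add: \<sigma>_mult \<sigma>_Exp_\<pp> K_fixed inv_mult_group)
    also have "\<dots> = Exp (Ad (inv k) ?Z) \<otimes> inv k"
      using Exp_Ad[OF ik(2) ZV(1)] ZV kc by (simp add: m_assoc flip: Exp_Ad[OF ik(2) ZV(1)])
    finally have "Exp ?Z' \<otimes> k' = Exp (Ad (inv k) ?Z) \<otimes> inv k" using k'(2) by simp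
    then have eq: "Exp (2 *\<^sub>R ?Z') = Exp (2 *\<^sub>R Ad (inv k) ?Z)"
      by (rule Exp_coset_eq[OF z'(1) Ad_\<pp>[OF ik(1) z(1)] k'(1) ik(1)])
    have A\<pp>: "Ad (inv k) ?Z \<in> \<pp>" using Ad_\<pp>[OF ik(1) z(1)] .
    have "c * (norm (Ad (inv k) ?Z))\<^sup>2 \<le> B ?Z ?Z" using cb(3)[OF A\<pp>] B_Ad[OF ik(1) z(1)] by simp
    also have "\<dots> \<le> b * (norm ?Z)\<^sup>2" using cb(4)[of ?Z ?Z] by (simp add: power2_eq_square)
    finally have "(norm (Ad (inv k) ?Z))\<^sup>2 \<le> (b / c) * (norm ?Z)\<^sup>2" using cb(1) by (simp add: field_simps)
    then have "sqrt ((norm (Ad (inv k) ?Z))\<^sup>2) \<le> sqrt ((b / c) * (norm ?Z)\<^sup>2)" by (rule real_sqrt_le_mono)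
    then have "norm (Ad (inv k) ?Z) \<le> sqrt (b / c) * norm ?Z"
      by (simp only: real_sqrt_mult real_sqrt_abs abs_norm_cancel)
    also have "\<dots> \<le> sqrt (b / c) * e" using z(2) cb by (intro mult_left_mono) auto
    finally have "2 * norm (Ad (inv k) ?Z) \<le> 2 * sqrt (b / c) * e" by simp
    also have "\<dots> < (2 * sqrt (b / c) + 2) * e" using e(1) by (simp add: algebra_simps)
    also have "\<dots> \<le> (2 * sqrt (b / c) + 2) * (\<rho> / (2 * sqrt (b / c) + 2))"
      using e(4) cb by (intro mult_left_mono) (auto simp: add_nonneg_nonneg)
    also have "\<dots> = \<rho>"
    proof -
      have "2 * sqrt (b / c) + 2 > 0" using cb by (simp add: add_nonneg_pos)
      then show ?thesis by simp
    qed
    finally have "norm (2 *\<^sub>R Ad (inv k) ?Z) < \<rho>" by simp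
    moreover have "norm (2 *\<^sub>R ?Z') < \<rho>" using z'(2) e(3) \<rho>(1) by simp
    ultimately have "2 *\<^sub>R ?Z' = 2 *\<^sub>R Ad (inv k) ?Z"
      using eq ZV A\<pp> \<pp>_V V_scale by (intro \<rho>(4)) auto
    then have "?Z' = Ad (inv k) ?Z" by simp
    then show "?Z \<in> \<pp> \<and> (\<exists>k\<in>K. Exp X \<otimes> Exp Y = Exp ?Z \<otimes> k) \<and> B ?Z' ?Z' = B ?Z ?Z"
      using z(1) k B_Ad[OF ik(1) z(1)] by auto
  qed
qed

text \<open>
  Applying \<open>\<sigma>\<close> and inversion to \<open>Exp X Exp Y = Exp Z k\<close> shows that exchanging \<open>X\<close> and
  \<open>Y\<close> replaces \<open>Z\<close> by an \<open>Ad K\<close>-conjugate. Hence, for \<open>X = S + W\<close> and \<open>Y = S - W\<close>,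
  the norm of \<open>Z\<close> is even in \<open>W\<close>, and \<open>|Z|\<^sup>2\<close> exceeds \<open>4 |S|\<^sup>2\<close> at most by a small
  multiple of \<open>|W|\<^sup>2\<close>, whereas \<open>2 (|X|\<^sup>2 + |Y|\<^sup>2) = 4 |S|\<^sup>2 + 4 |W|\<^sup>2\<close>.
\<close>

theorem corner:
  obtains r where "r > 0" "\<And>X Y. X \<in> \<pp> \<Longrightarrow> Y \<in> \<pp> \<Longrightarrow> norm X < r \<Longrightarrow> norm Y < r \<Longrightarrow> X \<noteq> Y \<Longrightarrow>
    \<exists>Z\<in>\<pp>. \<exists>k\<in>K. Exp X \<otimes> Exp Y = Exp Z \<otimes> k \<and> B Z Z < 2 * (B X X + B Y Y)"
proof -
  obtain c b where cb: "c > 0" "b > 0" "\<And>X. X \<in> \<pp> \<Longrightarrow> c * (norm X)\<^sup>2 \<le> B X X"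
    "\<And>X Y. \<bar>B X Y\<bar> \<le> b * norm X * norm Y" by (rule B_bounds) (rule that)
  obtain Z r0 where Z: "r0 > 0" "tame (V \<times> V) (\<lambda>p. fst p + snd p) Z"
    "\<And>S. S \<in> \<pp> \<Longrightarrow> norm S < r0 \<Longrightarrow> Z (S, S) = 2 *\<^sub>R S"
    "\<And>X Y. X \<in> \<pp> \<Longrightarrow> Y \<in> \<pp> \<Longrightarrow> norm X < r0 \<Longrightarrow> norm Y < r0 \<Longrightarrow> Z (X, Y) \<in> \<pp> \<and>
      (\<exists>k\<in>K. Exp X \<otimes> Exp Y = Exp (Z (X, Y)) \<otimes> k) \<and> B (Z (Y, X)) (Z (Y, X)) = B (Z (X, Y)) (Z (X, Y))"
    by (rule corner_coordinates) (rule that)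
  obtain C0 r1 where T: "tame_within (V \<times> V) (\<lambda>p. fst p + snd p) Z C0 r1" using Z(2) tame_def by metis
  define C where "C = C0 + 1"
  have T: "tame_within (V \<times> V) (\<lambda>p. fst p + snd p) Z C r1"
    by (rule tame_within_mono[OF T _ tame_withinD(1)[OF T] order_refl]) (simp add: C_def)
  note t = tame_withinD[OF T]
  have C: "C \<ge> 1" using tame_withinD(2)[OF \<open>tame_within (V \<times> V) (\<lambda>p. fst p + snd p) Z C0 r1\<close>] by (simp add: C_def)
  \<comment> \<open>The three error terms below add up to \<open>16 + 4 + 256 = 276\<close> times
    \<open>b C^2 r |W|^2\<close>. As \<open>276 \<le> 11 * 26\<close>, this is at most
    \<open>11 c |W|^2\<close>, less than the \<open>16 c |W|^2\<close> available. The bound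
    \<open>r \<le> 1\<close> absorbs a second factor \<open>r\<close>.\<close>
  define r where "r = min (min (r0) (r1 / 2)) (min 1 (c / (26 * b * C\<^sup>2)))"
  have bC: "26 * b * C\<^sup>2 > 0" using cb C by simp
  have r: "r > 0" "r \<le> r0" "r \<le> r1 / 2" "r \<le> 1" "r \<le> c / (26 * b * C\<^sup>2)"
    using Z(1) t(1) cb bC by (auto simp: r_def)
  have rc: "26 * b * C\<^sup>2 * r \<le> c" using r(5) bC by (simp add: field_simps)
  show ?thesis
  proof (rule that[OF r(1)])
    fix X Y assume XY: "X \<in> \<pp>" "Y \<in> \<pp>" "norm X < r" "norm Y < r" "X \<noteq> Y"
    define S W where "S = (1/2) *\<^sub>R (X + Y)" and "W = (1/2) *\<^sub>R (X - Y)"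
    have XYSW: "X = S + W" "Y = S - W"
      unfolding S_def W_def by (simp_all add: algebra_simps flip: scaleR_add_left)
    have SW: "S \<in> \<pp>" "W \<in> \<pp>" "W \<noteq> 0"
      using XY subspace_\<pp> by (auto simp: S_def W_def intro!: subspace_scale subspace_add subspace_diff)
    have nS: "norm S < r" using norm_triangle_ineq[of X Y] XY by (simp add: S_def)
    have nW: "norm W < r" using norm_triangle_ineq4[of X Y] XY by (simp add: W_def)
    let ?P = "Z (X, Y)" and ?Q = "Z (Y, X)"
    have zz: "?P \<in> \<pp>" "\<exists>k\<in>K. Exp X \<otimes> Exp Y = Exp ?P \<otimes> k" "B ?Q ?Q = B ?P ?P"
      using Z(4)[OF XY(1,2)] XY r(2) by auto
    have QV: "?Q \<in> \<pp>" using Z(4)[OF XY(2,1)] XY r(2) by auto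
    have pn: "norm (x, y) < r1" if "norm x < r" "norm y < r" for x y :: 'e
      using norm_Pair_le[of x y] that r(3) by simp
    have pV: "(x, y) \<in> V \<times> V" if "x \<in> \<pp>" "y \<in> \<pp>" for x y using that \<pp>_V by blast
    \<comment> \<open>\<open>D\<close> is the second difference of \<open>Z\<close> at
      \<open>(S, S)\<close> with step \<open>(W, - W)\<close>, because
      \<open>Z (S, S) = 2 S\<close>; it is of order \<open>|W|^2\<close>. The odd part
      \<open>N\<close> is of order \<open>r |W|\<close>.\<close>
    define D where "D = ?P + ?Q - 4 *\<^sub>R S"
    define N where "N = ?P - ?Q"
    have mW: "- W \<in> \<pp>" using SW subspace_\<pp> by (simp add: subspace_neg)
    have nWW: "(norm (W, - W))\<^sup>2 = 2 * (norm W)\<^sup>2" by (simp add: norm_prod_def)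
    have "norm (Z ((S, S) + (W, - W)) + Z ((S, S) - (W, - W)) - 2 *\<^sub>R Z (S, S)) \<le> C * (norm (W, - W))\<^sup>2"
      using pV SW mW pn nS XY by (intro t(5)) (auto simp: XYSW[symmetric])
    then have D: "norm D \<le> 2 * C * (norm W)\<^sup>2"
      using Z(3)[OF SW(1)] nS r(2) by (simp add: D_def XYSW[symmetric] nWW)
    \<comment> \<open>The linear part takes the same value at \<open>(X, Y)\<close> and
      \<open>(Y, X)\<close>, so the strict differentiability error alone bounds
      \<open>N\<close>.\<close>
    have "norm (?P - ?Q - (fst ((X, Y) - (Y, X)) + snd ((X, Y) - (Y, X)))) \<le> C * (norm (X, Y) + norm (Y, X)) * norm ((X, Y) - (Y, X))"
      using pV XY pn by (intro t(4)) auto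
    also have "fst ((X, Y) - (Y, X)) + snd ((X, Y) - (Y, X)) = 0" by simp
    also have "(X, Y) - (Y, X) = 2 *\<^sub>R (W, - W)" by (simp add: W_def algebra_simps)
    also have "norm (2 *\<^sub>R (W, - W)) = 2 * norm (W, - W)" by (simp only: norm_scaleR abs_numeral)
    also have "norm (W, - W) = sqrt 2 * norm W" by (simp add: norm_prod_def real_sqrt_mult)
    also have "C * (norm (X, Y) + norm (Y, X)) * (2 * (sqrt 2 * norm W)) \<le> C * (2 * r + 2 * r) * (2 * (2 * norm W))"
    proof (intro mult_mono mult_left_mono add_mono)
      show "norm (X, Y) \<le> 2 * r" "norm (Y, X) \<le> 2 * r" using norm_Pair_le[of X Y] norm_Pair_le[of Y X] XY by auto
      show "sqrt 2 \<le> 2" by (simp add: real_le_lsqrt)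
    qed (use C r in auto)
    finally have N: "norm N \<le> 16 * C * r * norm W" by (simp add: N_def algebra_simps)
    have PQ: "?P + ?Q = 4 *\<^sub>R S + D" by (simp add: D_def)
    \<comment> \<open>The parallelogram law, with \<open>B ?Q ?Q = B ?P ?P\<close>. It leaves no
      product of \<open>?P + ?Q\<close> with \<open>N\<close>, so \<open>N\<close> contributes only
      to second order.\<close>
    have par: "4 * B ?P ?P = B (?P + ?Q) (?P + ?Q) + B N N"
      using zz(3) by (simp add: N_def B_simps)
    have "B (?P + ?Q) (?P + ?Q) = 16 * B S S + 8 * B S D + B D D"
      unfolding PQ by (simp add: B_simps B_sym[of D S])
    moreover have "8 * B S D \<le> 16 * b * C\<^sup>2 * r * (norm W)\<^sup>2"
    proof -
      have "8 * B S D \<le> 8 * (b * norm S * norm D)" using cb(4)[of S D] by simp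
      also have "\<dots> \<le> 8 * (b * r * (2 * C * (norm W)\<^sup>2))"
        using D nS cb C r by (intro mult_left_mono mult_mono) auto
      also have "\<dots> \<le> 16 * b * C\<^sup>2 * r * (norm W)\<^sup>2"
      proof -
        have "C * (b * r * (norm W)\<^sup>2) \<le> C\<^sup>2 * (b * r * (norm W)\<^sup>2)"
          using C cb r by (intro mult_right_mono) (auto simp: power2_eq_square)
        then show ?thesis by (simp add: algebra_simps)
      qed
      finally show ?thesis .
    qed
    moreover have "B D D \<le> 4 * b * C\<^sup>2 * r * (norm W)\<^sup>2"
    proof -
      have "norm W * norm W \<le> 1 * r" using nW r by (intro mult_mono) auto
      then have W2: "(norm W)\<^sup>2 \<le> r" by (simp add: power2_eq_square)
      have "B D D \<le> b * norm D * norm D" using cb(4)[of D D] by simp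
      also have "\<dots> \<le> b * (2 * C * (norm W)\<^sup>2) * (2 * C * (norm W)\<^sup>2)"
        using D cb C by (intro mult_mono mult_left_mono) auto
      also have "\<dots> = (4 * b * C\<^sup>2 * (norm W)\<^sup>2) * (norm W)\<^sup>2" by (simp add: power2_eq_square)
      also have "\<dots> \<le> (4 * b * C\<^sup>2 * (norm W)\<^sup>2) * r" using W2 cb by (intro mult_left_mono) auto
      finally show ?thesis by (simp add: algebra_simps)
    qed
    moreover have "B N N \<le> 256 * b * C\<^sup>2 * r * (norm W)\<^sup>2"
    proof -
      have "B N N \<le> b * norm N * norm N" using cb(4)[of N N] by simp
      also have "\<dots> \<le> b * (16 * C * r * norm W) * (16 * C * r * norm W)"
        using N cb C r by (intro mult_mono mult_left_mono) auto
      also have "\<dots> = (256 * b * C\<^sup>2 * r * (norm W)\<^sup>2) * r" by (simp add: power2_eq_square)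
      also have "\<dots> \<le> (256 * b * C\<^sup>2 * r * (norm W)\<^sup>2) * 1" using r cb by (intro mult_left_mono) auto
      finally show ?thesis by simp
    qed
    ultimately have "4 * B ?P ?P \<le> 16 * B S S + 276 * b * C\<^sup>2 * r * (norm W)\<^sup>2"
      using par by (simp add: algebra_simps)
    also have "276 * b * C\<^sup>2 * r * (norm W)\<^sup>2 \<le> (11 * c) * (norm W)\<^sup>2"
    proof (intro mult_right_mono)
      have "0 \<le> b * C\<^sup>2 * r" using cb r(1) by simp
      then show "276 * b * C\<^sup>2 * r \<le> 11 * c" using rc by linarith
    qed simp
    also have "\<dots> < 16 * (c * (norm W)\<^sup>2)" using SW(3) cb(1) by simp
    also have "\<dots> \<le> 16 * B W W" using cb(3)[OF SW(2)] by simp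
    finally have "4 * B ?P ?P < 16 * B S S + 16 * B W W" by simp
    moreover have "B X X + B Y Y = 2 * B S S + 2 * B W W"
      unfolding XYSW by (simp add: B_simps)
    ultimately have "B ?P ?P < 2 * (B X X + B Y Y)" by simp
    then show "\<exists>Z\<in>\<pp>. \<exists>k\<in>K. Exp X \<otimes> Exp Y = Exp Z \<otimes> k \<and> B Z Z < 2 * (B X X + B Y Y)"
      using zz(1,2) by blast
  qed
qed

end

section \<open>Energy minimisation\<close>

lemma replicate_if_adjacent_eq:
  assumes "\<And>xs x y zs. Ys = xs @ x # y # zs \<Longrightarrow> x = y" "Ys \<noteq> []"
  shows "Ys = replicate (length Ys) (hd Ys)"
  using assms
proof (induction Ys)
  case (Cons a Ys)
  show ?case
  proof (cases Ys)
    case (Cons b zs)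
    have "x = y" if "Ys = xs @ x # y # us" for xs x y us
      using Cons.prems(1)[of "a # xs" x y us] that by simp
    then have "Ys = replicate (length Ys) (hd Ys)" using Cons.IH Cons by blast
    moreover have "a = b" using Cons.prems(1)[of "[]" a b zs] Cons by simp
    ultimately show ?thesis using Cons by simp
  qed simp
qed simp

section \<open>Products of exponentials generate the group modulo \<open>K\<close>\<close>

context sym_chart
begin

definition prodE :: "'e list \<Rightarrow> 'g" where "prodE Xs = foldr (\<lambda>X a. Exp X \<otimes> a) Xs \<one>"

lemma prodE_Nil [simp]: "prodE [] = \<one>" and prodE_Cons [simp]: "prodE (X # Xs) = Exp X \<otimes> prodE Xs"
  by (simp_all add: prodE_def)

lemma prodE_carrier [simp]: "set Xs \<subseteq> V \<Longrightarrow> prodE Xs \<in> carrier G"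
  by (induction Xs) auto

lemma prodE_append: "set Xs \<subseteq> V \<Longrightarrow> set Ys \<subseteq> V \<Longrightarrow> prodE (Xs @ Ys) = prodE Xs \<otimes> prodE Ys"
  by (induction Xs) (auto simp: m_assoc)

lemma prodE_replicate:
  assumes "X \<in> V"
  shows "prodE (replicate n X) = Exp (real n *\<^sub>R X)"
proof -
  have "prodE (replicate n X) = Exp X [^] n"
  proof (induction n)
    case (Suc n)
    then show ?case using nat_pow_Suc2[OF Exp_carrier[OF assms], of n] by simp
  qed simp
  then show ?thesis using Exp_nat[OF assms] by simp
qed

lemma prodE_Ad:
  assumes k: "k \<in> carrier G" and Xs: "set Xs \<subseteq> V"
  shows "prodE (map (Ad k) Xs) = k \<otimes> prodE Xs \<otimes> inv k"
  using Xs
proof (induction Xs)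
  case (Cons X Xs)
  have c: "prodE Xs \<in> carrier G" "Exp X \<in> carrier G" using Cons.prems by auto
  have "prodE (map (Ad k) (X # Xs)) = (k \<otimes> Exp X \<otimes> inv k) \<otimes> (k \<otimes> prodE Xs \<otimes> inv k)"
    using Cons Exp_Ad[OF k, of X] by simp
  also have "\<dots> = k \<otimes> (Exp X \<otimes> prodE Xs) \<otimes> inv k"
    using k c by (simp add: m_assoc inv_solve_left')
  finally show ?case by simp
qed (use k in simp)

definition generated :: "'g set" where
  "generated = {prodE Xs \<otimes> k | Xs k. set Xs \<subseteq> \<pp> \<and> k \<in> K}"

lemma set_\<pp>_V: "set Xs \<subseteq> \<pp> \<Longrightarrow> set Xs \<subseteq> V"
  using \<pp>_V by blast

text \<open>The factor \<open>k\<close> in \<open>h\<close> is moved past \<open>Exp Z\<close> at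
  the price of replacing \<open>Z\<close> by \<open>Ad k Z\<close>, which stays in
  \<open>\<pp>\<close>.\<close>

lemma generated_mult:
  assumes h: "h \<in> generated" and Z: "Z \<in> \<pp>" and k2: "k2 \<in> K"
  shows "h \<otimes> (Exp Z \<otimes> k2) \<in> generated"
proof -
  obtain Xs k where X: "h = prodE Xs \<otimes> k" "set Xs \<subseteq> \<pp>" "k \<in> K" using h by (auto simp: generated_def)
  have c: "prodE Xs \<in> carrier G" "k \<in> carrier G" "Exp Z \<in> carrier G" "k2 \<in> carrier G" "Z \<in> V"
    using X Z k2 set_\<pp>_V \<pp>_V K_carrier by auto
  have A: "Ad k Z \<in> \<pp>" using Ad_\<pp>[OF X(3) Z] .
  then have AV: "Ad k Z \<in> V" by (rule \<pp>_V)
  have "prodE (Xs @ [Ad k Z]) \<otimes> (k \<otimes> k2) = prodE Xs \<otimes> (k \<otimes> Exp Z \<otimes> inv k) \<otimes> (k \<otimes> k2)"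
    using prodE_append[of Xs "[Ad k Z]"] X(2) set_\<pp>_V AV Exp_Ad[OF c(2,5)] by simp
  also have "\<dots> = h \<otimes> (Exp Z \<otimes> k2)"
    unfolding X(1) using c by (simp add: m_assoc inv_solve_left')
  finally have "h \<otimes> (Exp Z \<otimes> k2) = prodE (Xs @ [Ad k Z]) \<otimes> (k \<otimes> k2)" by simp
  moreover have "k \<otimes> k2 \<in> K" using subgroup.m_closed[OF K_subgroup X(3) k2] .
  moreover have "set (Xs @ [Ad k Z]) \<subseteq> \<pp>" using X(2) A by simp
  ultimately show ?thesis unfolding generated_def by blast
qed

lemma generated_carrier: "generated \<subseteq> carrier G"
  using set_\<pp>_V K_carrier by (auto simp: generated_def)

text \<open>Right multiplication by a neighbourhood \<open>A\<close> of the identity keeps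
  \<open>generated\<close> inside itself. This makes both the set and its complement open, and
  connectedness concludes.\<close>

lemma generated_eq: "generated = carrier G"
proof -
  obtain A where A: "openin (mtop M) A" "\<one> \<in> A"
    "\<And>a. a \<in> A \<Longrightarrow> \<exists>Z\<in>\<pp>. \<exists>k\<in>K. norm Z < 1 \<and> a = Exp Z \<otimes> k"
    by (rule cartan_decomposition_near[OF zero_less_one]) (rule that)
  have step: "h \<otimes> a \<in> generated" if "h \<in> generated" "a \<in> A" for h a
    using A(3)[OF that(2)] generated_mult[OF that(1)] by blast
  have "openin (mtop M) generated"
  proof (subst openin_subopen, intro ballI)
    fix h assume h: "h \<in> generated"
    then have hc: "h \<in> carrier G" using generated_carrier by blast
    have "continuous_map (mtop M) (mtop M) (\<lambda>x. inv h \<otimes> x)"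
      using hc by (intro continuous_map_mult) (auto simp: points_eq)
    from openin_continuous_map_preimage[OF this A(1)]
    have "openin (mtop M) {x \<in> points M. inv h \<otimes> x \<in> A}" .
    moreover have "x \<in> generated" if "x \<in> {x \<in> points M. inv h \<otimes> x \<in> A}" for x
    proof -
      have "h \<otimes> (inv h \<otimes> x) \<in> generated" using step[OF h] that by blast
      then show ?thesis using that hc points_eq by (simp flip: m_assoc)
    qed
    ultimately show "\<exists>T. openin (mtop M) T \<and> h \<in> T \<and> T \<subseteq> generated"
      using hc A(2) points_eq by (intro exI[of _ "{x \<in> points M. inv h \<otimes> x \<in> A}"]) auto
  qed
  \<comment> \<open>If some \<open>x\<close> in \<open>generated\<close> had
    \<open>inv x \<otimes> g\<close> in \<open>A\<close>, then \<open>g\<close> itself would lie in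
    \<open>generated\<close>.\<close>
  moreover have "openin (mtop M) (points M - generated)"
  proof (subst openin_subopen, intro ballI)
    fix g assume g: "g \<in> points M - generated"
    then have gc: "g \<in> carrier G" using points_eq by blast
    have "continuous_map (mtop M) (mtop M) (\<lambda>x. inv x \<otimes> g)"
      using gc by (intro continuous_map_mult continuous_map_inv) (auto simp: points_eq)
    from openin_continuous_map_preimage[OF this A(1)]
    have "openin (mtop M) {x \<in> points M. inv x \<otimes> g \<in> A}" .
    moreover have "x \<notin> generated" if "x \<in> {x \<in> points M. inv x \<otimes> g \<in> A}" for x
    proof
      assume "x \<in> generated"
      then have "x \<otimes> (inv x \<otimes> g) \<in> generated" using step that by blast
      then show False using that gc g points_eq by (simp flip: m_assoc)
    qed
    ultimately show "\<exists>T. openin (mtop M) T \<and> g \<in> T \<and> T \<subseteq> points M - generated"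
      using gc A(2) points_eq by (intro exI[of _ "{x \<in> points M. inv x \<otimes> g \<in> A}"]) auto
  qed
  then have "closedin (mtop M) generated" using generated_carrier points_eq by (simp add: closedin_def)
  moreover have "\<one> \<in> generated"
    using subgroup.one_closed[OF K_subgroup] unfolding generated_def by (intro CollectI exI[of _ "[]"] exI[of _ \<one>]) simp
  ultimately show ?thesis using connected points_eq unfolding connected_space_clopen_in by blast
qed

lemma K_closed: "closedin (mtop M) K"
proof -
  have "closedin (mtop M) {x \<in> points M. \<sigma> x = x}"
    using smooth_automorphism by (intro closedin_continuous_maps_eq[OF Hausdorff]) (auto simp: smooth_map_def)
  then show ?thesis by (simp add: K_eq points_eq)
qed

lemma continuous_map_prodE:
  assumes "set is \<subseteq> I"
  shows "continuous_map (product_topology (\<lambda>_. top_of_set V) I) (mtop M) (\<lambda>X. prodE (map X is))"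
  using assms
proof (induction "is")
  case Nil
  then show ?case by (simp add: points_eq)
next
  case (Cons i "is")
  have "continuous_map (product_topology (\<lambda>_. top_of_set V) I) (top_of_set V) (\<lambda>X. X i)"
    using Cons.prems by (intro continuous_map_product_projection) auto
  from continuous_map_compose[OF this Exp_continuous]
  have "continuous_map (product_topology (\<lambda>_. top_of_set V) I) (mtop M) (\<lambda>X. Exp (X i))" by (simp add: o_def)
  then show ?case using Cons by (simp add: continuous_map_mult)
qed

end

section \<open>Existence and shape of energy minimisers\<close>

context sym_chart_inner
begin

definition energy :: "'e list \<Rightarrow> real" where "energy Xs = (\<Sum>X\<leftarrow>Xs. B X X)"

lemma energy_simps [simp]: "energy [] = 0" "energy (X # Xs) = B X X + energy Xs"
  "energy (Xs @ Ys) = energy Xs + energy Ys"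
  by (simp_all add: energy_def)

lemma energy_nonneg: "set Xs \<subseteq> \<pp> \<Longrightarrow> energy Xs \<ge> 0"
  by (induction Xs) (auto simp: B_nonneg)

lemma energy_member: "set Xs \<subseteq> \<pp> \<Longrightarrow> X \<in> set Xs \<Longrightarrow> B X X \<le> energy Xs"
  by (induction Xs) (auto simp: add_increasing add_increasing2 B_nonneg energy_nonneg)

lemma energy_Ad: "k \<in> K \<Longrightarrow> set Xs \<subseteq> \<pp> \<Longrightarrow> energy (map (Ad k) Xs) = energy Xs"
  by (induction Xs) (auto simp: B_Ad)

lemma B_continuous: "continuous_on T (\<lambda>X. B X X)"
  by (intro bounded_bilinear.continuous_on[OF B_bilinear] continuous_intros)

lemma continuous_map_energy:
  assumes "set is \<subseteq> I"
  shows "continuous_map (product_topology (\<lambda>_. top_of_set V) I) euclideanreal (\<lambda>X. energy (map X is))"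
  using assms
proof (induction "is")
  case (Cons i "is")
  have "continuous_map (product_topology (\<lambda>_. top_of_set V) I) (top_of_set V) (\<lambda>X. X i)"
    using Cons.prems by (intro continuous_map_product_projection) auto
  moreover have "continuous_map (top_of_set V) euclideanreal (\<lambda>X. B X X)" using B_continuous by simp
  ultimately have "continuous_map (product_topology (\<lambda>_. top_of_set V) I) euclideanreal ((\<lambda>X. B X X) \<circ> (\<lambda>X. X i))"
    by (rule continuous_map_compose)
  then show ?case using Cons by (simp add: o_def continuous_map_add)
qed simp

lemma compact_B_ball: "compact {X \<in> \<pp>. B X X \<le> \<epsilon>}"
proof -
  obtain c b where cb: "c > 0" "b > 0" "\<And>X. X \<in> \<pp> \<Longrightarrow> c * (norm X)\<^sup>2 \<le> B X X"
    "\<And>X Y. \<bar>B X Y\<bar> \<le> b * norm X * norm Y" by (rule B_bounds) (rule that)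
  have "norm X \<le> sqrt (\<epsilon> / c)" if "X \<in> \<pp>" "B X X \<le> \<epsilon>" for X
  proof -
    have "(norm X)\<^sup>2 \<le> \<epsilon> / c" using cb(3)[OF that(1)] that(2) cb(1) by (simp add: field_simps)
    then show ?thesis by (rule real_le_rsqrt)
  qed
  then have "bounded {X \<in> \<pp>. B X X \<le> \<epsilon>}" unfolding bounded_iff by blast
  moreover have "closed {X \<in> \<pp>. B X X \<le> \<epsilon>}"
  proof -
    have "closed {X. B X X \<le> \<epsilon>}" by (intro closed_Collect_le B_continuous continuous_on_const)
    then have "closed (\<pp> \<inter> {X. B X X \<le> \<epsilon>})" by (rule closed_Int[OF closed_subspace[OF subspace_\<pp>]])
    then show ?thesis by (simp add: Int_def)
  qed
  ultimately show ?thesis by (simp add: compact_eq_bounded_closed)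
qed

text \<open>Tuples are extensional functions on \<open>{..<n}\<close>, so that compactness of a
  product is available. A competitor of energy at most that of \<open>X0\<close> has every entry in
  the compact set \<open>S\<close>; the coset condition is closed because \<open>K\<close> is.
  Tuples of larger energy cannot beat the minimum.\<close>

lemma energy_minimizer:
  assumes g: "g \<in> carrier G" and X0: "set X0 \<subseteq> \<pp>" "inv g \<otimes> prodE X0 \<in> K"
  obtains Y where "length Y = length X0" "set Y \<subseteq> \<pp>" "inv g \<otimes> prodE Y \<in> K" "energy Y \<le> energy X0"
    "\<And>Z. length Z = length X0 \<Longrightarrow> set Z \<subseteq> \<pp> \<Longrightarrow> inv g \<otimes> prodE Z \<in> K \<Longrightarrow> energy Y \<le> energy Z"
proof -
  define n where "n = length X0"
  define \<epsilon> where "\<epsilon> = energy X0"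
  define S where "S = {X \<in> \<pp>. B X X \<le> \<epsilon>}"
  let ?I = "{..<n}" and ?is = "[0..<n]"
  let ?T = "product_topology (\<lambda>_. top_of_set V) ?I"
  have SV: "S \<subseteq> V" using \<pp>_V by (auto simp: S_def)
  have cS: "compact S" unfolding S_def by (rule compact_B_ball)
  have "compactin ?T (PiE ?I (\<lambda>_. S))"
    using cS SV by (simp add: compactin_PiE compactin_subtopology)
  moreover
  have "continuous_map ?T (mtop M) (\<lambda>X. inv g \<otimes> prodE (map X ?is))"
    using g by (intro continuous_map_mult continuous_map_prodE) (auto simp: points_eq)
  then have "closedin ?T {X \<in> topspace ?T. inv g \<otimes> prodE (map X ?is) \<in> K}"
    using K_closed by (rule closedin_continuous_map_preimage)
  ultimately have "compactin ?T (PiE ?I (\<lambda>_. S) \<inter> {X \<in> topspace ?T. inv g \<otimes> prodE (map X ?is) \<in> K})"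
    by (rule compact_Int_closedin)
  moreover have "PiE ?I (\<lambda>_. S) \<inter> {X \<in> topspace ?T. inv g \<otimes> prodE (map X ?is) \<in> K} =
      {X \<in> PiE ?I (\<lambda>_. S). inv g \<otimes> prodE (map X ?is) \<in> K}"
  proof -
    have "PiE ?I (\<lambda>_. S) \<subseteq> topspace ?T" using PiE_mono[of ?I "\<lambda>_. S" "\<lambda>_. V"] SV by simp
    then show ?thesis by blast
  qed
  ultimately have cA: "compactin ?T {X \<in> PiE ?I (\<lambda>_. S). inv g \<otimes> prodE (map X ?is) \<in> K}" by simp
  define A where "A = {X \<in> PiE ?I (\<lambda>_. S). inv g \<otimes> prodE (map X ?is) \<in> K}"
  have list_fun: "\<exists>X\<in>A. map X ?is = Z" if Z: "length Z = n" "set Z \<subseteq> S" "inv g \<otimes> prodE Z \<in> K" for Z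
  proof (intro bexI)
    show m: "map (restrict (\<lambda>i. Z ! i) ?I) ?is = Z"
      using Z(1) by (intro nth_equalityI) auto
    have "Z ! i \<in> S" if "i < n" for i using nth_mem[of i Z] Z(1,2) that by auto
    then show "restrict (\<lambda>i. Z ! i) ?I \<in> A" using m Z(3) by (auto simp: A_def)
  qed
  have small: "set Z \<subseteq> S" if "set Z \<subseteq> \<pp>" "energy Z \<le> \<epsilon>" for Z
    using energy_member[OF that(1)] that by (force simp: S_def)
  obtain f0 where f0: "f0 \<in> A" "map f0 ?is = X0"
    using list_fun[of X0] small[of X0] X0 by (auto simp: n_def \<epsilon>_def)
  have "compactin euclideanreal ((\<lambda>X. energy (map X ?is)) ` A)"
    using cA[folded A_def] continuous_map_energy[of ?is ?I] by (intro image_compactin) (auto simp: atLeast0LessThan)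
  then have "compact ((\<lambda>X. energy (map X ?is)) ` A)" by simp
  then obtain f where f: "f \<in> A" "\<And>h. h \<in> A \<Longrightarrow> energy (map f ?is) \<le> energy (map h ?is)"
    using compact_attains_inf[of "(\<lambda>X. energy (map X ?is)) ` A"] f0(1) by blast
  let ?Y = "map f ?is"
  have Y: "set ?Y \<subseteq> \<pp>" "inv g \<otimes> prodE ?Y \<in> K" using f(1) by (auto simp: A_def S_def PiE_iff)
  have le: "energy ?Y \<le> \<epsilon>" using f(2)[OF f0(1)] f0(2) by (simp add: \<epsilon>_def)
  show ?thesis
  proof (rule that[of ?Y])
    show "energy ?Y \<le> energy Z" if Z: "length Z = length X0" "set Z \<subseteq> \<pp>" "inv g \<otimes> prodE Z \<in> K" for Z
    proof (cases "energy Z \<le> \<epsilon>")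
      case True
      then obtain h where "h \<in> A" "map h ?is = Z" using list_fun[of Z] small[of Z] Z n_def by blast
      then show ?thesis using f(2) by blast
    qed (use le in simp)
  qed (use Y le in \<open>simp_all add: n_def \<epsilon>_def\<close>)
qed

lemma prodE_subdivide:
  assumes "set Xs \<subseteq> V" "m > 0"
  shows "prodE (concat (map (\<lambda>X. replicate m ((1 / real m) *\<^sub>R X)) Xs)) = prodE Xs"
  using assms(1)
proof (induction Xs)
  case (Cons X Xs)
  have X: "(1 / real m) *\<^sub>R X \<in> V" using Cons.prems V_scale by simp
  have "set (concat (map (\<lambda>X. replicate m ((1 / real m) *\<^sub>R X)) Xs)) \<subseteq> V"
    using Cons.prems V_scale by auto
  then show ?case using Cons prodE_append[of "replicate m ((1 / real m) *\<^sub>R X)"] X prodE_replicate[OF X, of m] assms(2)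
    by (simp add: set_replicate_conv_if)
qed simp

lemma energy_replicate: "energy (replicate m X) = real m * B X X"
  by (induction m) (auto simp: algebra_simps)

text \<open>Each vector becomes \<open>m\<close> pieces of energy \<open>1 / m^2\<close> times its
  own, so the total drops by the factor \<open>m\<close> while the product is unchanged.\<close>

lemma energy_subdivide:
  assumes "m > 0"
  shows "energy (concat (map (\<lambda>X. replicate m ((1 / real m) *\<^sub>R X)) Xs)) = energy Xs / real m"
  using assms by (induction Xs) (simp_all add: energy_replicate B_simps add_divide_distrib)

theorem Exp_\<pp>_meets_coset:
  assumes g: "g \<in> carrier G"
  obtains X where "X \<in> \<pp>" "inv g \<otimes> Exp X \<in> K"
proof -
  obtain c b where cb: "c > 0" "b > 0" "\<And>X. X \<in> \<pp> \<Longrightarrow> c * (norm X)\<^sup>2 \<le> B X X"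
    "\<And>X Y. \<bar>B X Y\<bar> \<le> b * norm X * norm Y" by (rule B_bounds) (rule that)
  obtain r where r: "r > 0" "\<And>X Y. X \<in> \<pp> \<Longrightarrow> Y \<in> \<pp> \<Longrightarrow> norm X < r \<Longrightarrow> norm Y < r \<Longrightarrow> X \<noteq> Y \<Longrightarrow>
    \<exists>Z\<in>\<pp>. \<exists>k\<in>K. Exp X \<otimes> Exp Y = Exp Z \<otimes> k \<and> B Z Z < 2 * (B X X + B Y Y)"
    by (rule corner) (rule that)
  obtain Xs k where Xs: "g = prodE Xs \<otimes> k" "set Xs \<subseteq> \<pp>" "k \<in> K"
    using g generated_eq unfolding generated_def by blast
  \<comment> \<open>A leading 0 leaves the product unchanged and ensures that the tuple is nonempty,
    so that its head exists at the end.\<close>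
  define Ws where "Ws = 0 # Xs"
  have Ws: "set Ws \<subseteq> \<pp>" "set Ws \<subseteq> V" using Xs(2) subspace_0[OF subspace_\<pp>] subspace_0[OF V] set_\<pp>_V[OF Xs(2)] by (auto simp: Ws_def)
  have kc: "k \<in> carrier G" using Xs(3) K_carrier by blast
  have pX: "prodE Xs \<in> carrier G" using Xs(2) set_\<pp>_V by simp
  have "inv g \<otimes> prodE Ws = inv k"
    using Xs(1) kc pX by (simp add: Ws_def inv_mult_group m_assoc)
  then have WK: "inv g \<otimes> prodE Ws \<in> K" using subgroup.m_inv_closed[OF K_subgroup Xs(3)] by simp
  obtain m :: nat where m: "m > 0" "energy Ws / real m < c * r\<^sup>2"
  proof -
    have p: "c * r\<^sup>2 > 0" using cb r by simp
    obtain m where "energy Ws / (c * r\<^sup>2) < real m" using reals_Archimedean2 by blast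
    then have "energy Ws / (c * r\<^sup>2) < real (Suc m)" by simp
    then have "energy Ws / real (Suc m) < c * r\<^sup>2" using p by (simp add: field_simps)
    then show ?thesis using that[of "Suc m"] by simp
  qed
  define X0 where "X0 = concat (map (\<lambda>X. replicate m ((1 / real m) *\<^sub>R X)) Ws)"
  have X0: "set X0 \<subseteq> \<pp>" using Ws(1) \<pp>_scale by (auto simp: X0_def)
  have X0K: "inv g \<otimes> prodE X0 \<in> K" using WK prodE_subdivide[OF Ws(2) m(1)] by (simp add: X0_def)
  have X0e: "energy X0 < c * r\<^sup>2" using m energy_subdivide[OF m(1)] by (simp add: X0_def)
  have X0ne: "X0 \<noteq> []" using m(1) by (simp add: X0_def Ws_def)
  obtain Y where Y: "length Y = length X0" "set Y \<subseteq> \<pp>" "inv g \<otimes> prodE Y \<in> K" "energy Y \<le> energy X0"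
    "\<And>Z. length Z = length X0 \<Longrightarrow> set Z \<subseteq> \<pp> \<Longrightarrow> inv g \<otimes> prodE Z \<in> K \<Longrightarrow> energy Y \<le> energy Z"
    by (rule energy_minimizer[OF g X0 X0K]) (rule that)
  have small: "norm X < r" if "X \<in> set Y" for X
  proof -
    have "c * (norm X)\<^sup>2 \<le> B X X" using cb(3) Y(2) that by blast
    also have "\<dots> \<le> energy Y" using energy_member[OF Y(2) that] .
    also have "\<dots> < c * r\<^sup>2" using Y(4) X0e by simp
    finally have "(norm X)\<^sup>2 < r\<^sup>2" using cb(1) by simp
    then show ?thesis using r(1) by (simp add: power2_less_imp_less)
  qed
  have "x = y" if split: "Y = xs @ x # y # zs" for xs x y zs
  proof (rule ccontr)
    assume "x \<noteq> y"
    have mem: "x \<in> \<pp>" "y \<in> \<pp>" "set xs \<subseteq> \<pp>" "set zs \<subseteq> \<pp>" "norm x < r" "norm y < r"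
      using Y(2) small split by auto
    obtain Z l where Z: "Z \<in> \<pp>" "l \<in> K" "Exp x \<otimes> Exp y = Exp Z \<otimes> l" "B Z Z < 2 * (B x x + B y y)"
      using r(2)[OF mem(1,2,5,6) \<open>x \<noteq> y\<close>] by blast
    have lc: "l \<in> carrier G" using Z(2) K_carrier by blast
    let ?h = "(1/2) *\<^sub>R Z"
    \<comment> \<open>Moving \<open>l\<close> to the right end conjugates the entries of
      \<open>zs\<close>, which preserves their energy, and changes the whole product only by the
      right factor \<open>inv l\<close> from \<open>K\<close>.\<close>
    let ?N = "xs @ ?h # ?h # map (Ad l) zs"
    have hp: "?h \<in> \<pp>" "?h \<in> V" using \<pp>_scale[OF Z(1)] \<pp>_V by auto
    have Vs: "set xs \<subseteq> V" "set zs \<subseteq> V" "x \<in> V" "y \<in> V" "Z \<in> V" using mem Z(1) set_\<pp>_V \<pp>_V by auto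
    have Np: "set ?N \<subseteq> \<pp>" using mem hp Ad_\<pp>[OF Z(2)] by auto
    have zc: "prodE zs \<in> carrier G" "prodE xs \<in> carrier G" using Vs by auto
    have mV: "set (map (Ad l) zs) \<subseteq> V" using Ad_V[OF lc] Vs(2) by auto
    have "prodE ?N = prodE xs \<otimes> (Exp ?h \<otimes> (Exp ?h \<otimes> prodE (map (Ad l) zs)))"
      using prodE_append[of xs "?h # ?h # map (Ad l) zs"] Vs hp mV by simp
    also have "Exp ?h \<otimes> (Exp ?h \<otimes> prodE (map (Ad l) zs)) = Exp Z \<otimes> prodE (map (Ad l) zs)"
      using Exp_half[OF Vs(5)] hp prodE_carrier[OF mV] by (simp add: m_assoc)
    also have "\<dots> = Exp Z \<otimes> l \<otimes> prodE zs \<otimes> inv l"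
      using prodE_Ad[OF lc Vs(2)] Vs lc zc by (simp add: m_assoc)
    also have "\<dots> = Exp x \<otimes> Exp y \<otimes> prodE zs \<otimes> inv l" using Z(3) by simp
    finally have "prodE ?N = prodE Y \<otimes> inv l"
      using prodE_append[of xs "x # y # zs"] Vs zc lc by (simp add: split m_assoc)
    then have "inv g \<otimes> prodE ?N = (inv g \<otimes> prodE Y) \<otimes> inv l"
      using g lc Y(2) set_\<pp>_V by (simp add: m_assoc)
    then have NK: "inv g \<otimes> prodE ?N \<in> K"
      using subgroup.m_closed[OF K_subgroup Y(3) subgroup.m_inv_closed[OF K_subgroup Z(2)]] by simp
    have "length ?N = length X0" using Y(1) split by simp
    from Y(5)[OF this Np NK] have "energy Y \<le> energy ?N" .
    \<comment> \<open>Two halves of \<open>Z\<close> together cost \<open>B Z Z / 2\<close>, and the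
      corner estimate says that this is less than \<open>B x x + B y y\<close>.\<close>
    moreover have "energy ?N = energy xs + B Z Z / 2 + energy zs"
      using energy_Ad[OF Z(2) mem(4)] by (simp add: B_simps)
    ultimately show False using Z(4) by (simp add: split)
  qed
  moreover have Yne: "Y \<noteq> []" using Y(1) X0ne by auto
  ultimately have rep: "Y = replicate (length Y) (hd Y)" by (rule replicate_if_adjacent_eq)
  have hp: "hd Y \<in> \<pp>" using Y(2) Yne by auto
  have "prodE Y = Exp (real (length Y) *\<^sub>R hd Y)"
    using prodE_replicate[OF \<pp>_V[OF hp], of "length Y"] rep by simp
  then show ?thesis using that[OF \<pp>_scale[OF hp]] Y(3) by simp
qed

end

section \<open>The invariant inner product\<close>

text \<open>
  The Riemannian structure is pulled back to \<open>\<pp>\<close> along the differential \<open>dpr\<close> of the projection.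
  Injectivity of \<open>dpr\<close> on \<open>\<pp>\<close> holds because \<open>Exp X K\<close> determines \<open>Exp (2 X)\<close>.
\<close>

locale sym_quotient = sym_chart G M \<sigma> K U \<phi> + N: riemannian_structure N h
  for G :: "('g, 'r) monoid_scheme" (structure)
    and M :: "('g, 'e::euclidean_space) manifold" and \<sigma> :: "'g \<Rightarrow> 'g" and K :: "'g set"
    and U :: "'g set" and \<phi> :: "'g \<Rightarrow> 'e"
    and N :: "('g set, 'e) manifold" and h :: "'g set \<Rightarrow> 'g set tvector \<Rightarrow> 'g set tvector \<Rightarrow> real" +
  fixes W :: "'g set set" and \<psi> :: "'g set \<Rightarrow> 'e"
  assumes structure_N: "homogeneous_space_structure G M K N"
    and invariant: "invariant_structure G N h"
    and chart_N: "(W, \<psi>) \<in> atlas N" and K_W: "K \<in> W"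
begin

section \<open>The projection onto the quotient and its differential\<close>

definition pr :: "'g \<Rightarrow> 'g set" where "pr x = x <# K"

lemma N_manifold: "smooth_manifold N" and pr_smooth: "smooth_map M N pr"
  and pr_submersion: "p \<in> points M \<Longrightarrow> differential N pr p ` tangent_space M p = tangent_space N (pr p)"
  using structure_N by (auto simp: homogeneous_space_structure_def submersion_def pr_def[abs_def])

lemma K_sub: "K \<subseteq> carrier G" using K_carrier by blast

lemma pr_one [simp]: "pr \<one> = K"
  unfolding pr_def by (rule lcos_mult_one[OF K_sub])

lemma pr_eqD:
  assumes "x \<in> carrier G" "y \<in> carrier G" "pr x = pr y"
  obtains k where "k \<in> K" "x = y \<otimes> k"
proof -
  have "x \<in> pr x" unfolding pr_def l_coset_def using subgroup.one_closed[OF K_subgroup] assms(1) by force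
  then have "x \<in> y <# K" using assms(3) by (simp add: pr_def)
  then show ?thesis using that by (auto simp: l_coset_def)
qed

lemma pr_K: "k \<in> K \<Longrightarrow> pr k = K"
  unfolding pr_def by (rule coset_join3[OF K_carrier K_subgroup])

lemma pr_left: "a \<in> carrier G \<Longrightarrow> x \<in> carrier G \<Longrightarrow> a <# pr x = pr (a \<otimes> x)"
  unfolding pr_def by (rule lcos_m_assoc[OF K_sub])

lemma pr_right: "x \<in> carrier G \<Longrightarrow> k \<in> K \<Longrightarrow> pr (x \<otimes> k) = pr x"
  using lcos_m_assoc[OF K_sub, of x k] coset_join3[OF K_carrier K_subgroup, of k] K_carrier by (simp add: pr_def)

definition qc :: "'g \<Rightarrow> 'e" where "qc x = \<psi> (pr x) - \<psi> K"

text \<open>The derivative of the projection in the charts centred at \<open>\<one>\<close> and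
  \<open>K\<close>. The tame form is used with exponentials, the smooth form for local sections, and
  the last conjunct for transporting tangent vectors.\<close>

definition dpr :: "'e \<Rightarrow> 'e" where
  "dpr = (SOME L. linear L \<and> (\<forall>v\<in>V. L v \<in> model N) \<and> tame V L (\<lambda>y. qc (ex y)) \<and>
     (\<exists>r>0. (\<forall>y\<in>V. norm y < r \<longrightarrow> pr (ex y) \<in> W) \<and> smooth_on V (V \<inter> ball 0 r) (\<lambda>y. qc (ex y)) \<and>
        ((\<lambda>y. qc (ex y)) has_derivative L) (at 0 within V \<inter> ball 0 r)) \<and>
     (\<forall>v\<in>V. differential N pr \<one> (coord_vector M (U, \<phi>) v \<one>) = coord_vector N (W, \<psi>) (L v) K))"

lemma dpr: "linear dpr" "v \<in> V \<Longrightarrow> dpr v \<in> model N" "tame V dpr (\<lambda>y. qc (ex y))"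
    "\<exists>r>0. (\<forall>y\<in>V. norm y < r \<longrightarrow> pr (ex y) \<in> W) \<and> smooth_on V (V \<inter> ball 0 r) (\<lambda>y. qc (ex y)) \<and>
        ((\<lambda>y. qc (ex y)) has_derivative dpr) (at 0 within V \<inter> ball 0 r)"
    "v \<in> V \<Longrightarrow> differential N pr \<one> (coord_vector M (U, \<phi>) v \<one>) = coord_vector N (W, \<psi>) (dpr v) K"
proof -
  let ?P = "\<lambda>L. linear L \<and> (\<forall>v\<in>V. L v \<in> model N) \<and> tame V L (\<lambda>y. qc (ex y)) \<and>
     (\<exists>r>0. (\<forall>y\<in>V. norm y < r \<longrightarrow> pr (ex y) \<in> W) \<and> smooth_on V (V \<inter> ball 0 r) (\<lambda>y. qc (ex y)) \<and>
        ((\<lambda>y. qc (ex y)) has_derivative L) (at 0 within V \<inter> ball 0 r)) \<and>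
     (\<forall>v\<in>V. differential N pr \<one> (coord_vector M (U, \<phi>) v \<one>) = coord_vector N (W, \<psi>) (L v) K)"
  have p1: "pr \<one> \<in> W" using K_W by simp
  obtain L r where L: "linear L" "\<And>v. v \<in> V \<Longrightarrow> L v \<in> model N" "r > 0"
    "\<And>y. y \<in> V \<Longrightarrow> norm y < r \<Longrightarrow> \<phi> \<one> + y \<in> \<phi> ` U \<and> pr (inv_into U \<phi> (\<phi> \<one> + y)) \<in> W"
    "smooth_on V (V \<inter> ball 0 r) (\<lambda>y. \<psi> (pr (inv_into U \<phi> (\<phi> \<one> + y))) - \<psi> (pr \<one>))"
    "((\<lambda>y. \<psi> (pr (inv_into U \<phi> (\<phi> \<one> + y))) - \<psi> (pr \<one>)) has_derivative L) (at 0 within V \<inter> ball 0 r)"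
    "tame V L (\<lambda>y. \<psi> (pr (inv_into U \<phi> (\<phi> \<one> + y))) - \<psi> (pr \<one>))"
    "\<And>v. v \<in> V \<Longrightarrow> differential N pr \<one> (coord_vector M (U, \<phi>) v \<one>) = coord_vector N (W, \<psi>) (L v) (pr \<one>)"
    by (rule centered_chart_map[OF smooth_manifold_M N_manifold pr_smooth chart one_U chart_N p1]) (rule that)
  have f: "(\<lambda>y. \<psi> (pr (inv_into U \<phi> (\<phi> \<one> + y))) - \<psi> (pr \<one>)) = (\<lambda>y. qc (ex y))"
    by (simp add: qc_def ex_def)
  have "?P L"
    using L(1,2,3,4,8) L(5-7)[unfolded f] by (auto simp: ex_def)
  then have "?P dpr" unfolding dpr_def by (rule someI[where P = ?P])
  then show "linear dpr" "v \<in> V \<Longrightarrow> dpr v \<in> model N" "tame V dpr (\<lambda>y. qc (ex y))"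
    "\<exists>r>0. (\<forall>y\<in>V. norm y < r \<longrightarrow> pr (ex y) \<in> W) \<and> smooth_on V (V \<inter> ball 0 r) (\<lambda>y. qc (ex y)) \<and>
        ((\<lambda>y. qc (ex y)) has_derivative dpr) (at 0 within V \<inter> ball 0 r)"
    "v \<in> V \<Longrightarrow> differential N pr \<one> (coord_vector M (U, \<phi>) v \<one>) = coord_vector N (W, \<psi>) (dpr v) K"
    by blast+
qed

lemma qc_N: "pr x \<in> W \<Longrightarrow> qc x \<in> model N"
  using N.chart_image_subset[OF chart_N] K_W N.subspace_model by (auto simp: qc_def intro!: subspace_diff)

lemma qc_inj: "pr x \<in> W \<Longrightarrow> pr y \<in> W \<Longrightarrow> qc x = qc y \<Longrightarrow> pr x = pr y"
  using N.chart_inj[OF chart_N] by (auto simp: qc_def dest: inj_onD)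

lemma gtame_qc:
  assumes a: "gtame V' A a"
  shows "tame V' (\<lambda>x. dpr (A x)) (\<lambda>x. qc (a x))" "\<exists>r>0. \<forall>x\<in>V'. norm x < r \<longrightarrow> pr (a x) \<in> W"
proof -
  note g = gtameD[OF a]
  obtain r1 where r1: "r1 > 0" "\<forall>x\<in>V'. norm x < r1 \<longrightarrow> a x \<in> U" using g(4) by blast
  have "tame V' (\<lambda>x. dpr (A x)) (\<lambda>x. qc (ex (lg (a x))))"
    by (rule tame_compose[OF g(1) V g(3) dpr(3) g(2) dpr(1) r1(1)]) (use r1(2) lg_V in blast)
  then show "tame V' (\<lambda>x. dpr (A x)) (\<lambda>x. qc (a x))"
    by (rule tame_cong[OF _ r1(1) g(1)]) (use r1(2) in simp_all)
  obtain r where r: "r > 0" "\<forall>y\<in>V. norm y < r \<longrightarrow> pr (ex y) \<in> W" using dpr(4) by blast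
  obtain r2 where r2: "r2 > 0" "\<And>x. x \<in> V' \<Longrightarrow> norm x < r2 \<Longrightarrow> a x \<in> U \<and> norm (lg (a x)) < r"
    by (rule gtame_small[OF a r(1)]) (rule that)
  have "pr (a x) \<in> W" if "x \<in> V'" "norm x < r2" for x
    using r2(2)[OF that] r(2) lg_V by (metis ex_lg)
  then show "\<exists>r>0. \<forall>x\<in>V'. norm x < r \<longrightarrow> pr (a x) \<in> W" using r2(1) by blast
qed

lemma dpr_surj:
  assumes w: "w \<in> model N"
  obtains v where "v \<in> V" "dpr v = w"
proof -
  have "coord_vector N (W, \<psi>) w K \<in> tangent_space N (pr \<one>)"
    using N.coord_vector_in_tangent_space[OF chart_N K_W w] by simp
  then obtain X where X: "X \<in> tangent_space M \<one>" "differential N pr \<one> X = coord_vector N (W, \<psi>) w K"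
    using pr_submersion[of \<one>] points_eq by (metis imageE one_closed)
  obtain v where v: "v \<in> V" "X = coord_vector M (U, \<phi>) v \<one>"
    using tangent_space_coord_vector[OF chart one_U X(1)] by blast
  have "coord_vector N (W, \<psi>) (dpr v) K = coord_vector N (W, \<psi>) w K" using X(2) dpr(5)[OF v(1)] v(2) by simp
  then have "dpr v = w" by (rule N.coord_vector_inj[OF chart_N K_W dpr(2)[OF v(1)] w])
  then show ?thesis using that v(1) by blast
qed

text \<open>The curve \<open>Exp (t X)\<close> stays in \<open>K\<close>, so its coset is constant
  and the derivative vanishes.\<close>

lemma dpr_fixed:
  assumes X: "X \<in> V" "ds X = X"
  shows "dpr X = 0"
proof -
  have "qc (Exp (t *\<^sub>R X)) = 0" for t
  proof -
    have "Exp (t *\<^sub>R X) \<in> K" using X V_scale[OF X(1)] by (intro K_I) (auto simp: \<sigma>_Exp ds_scale)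
    then show ?thesis by (simp add: qc_def pr_K)
  qed
  then have "tame UNIV (\<lambda>t. dpr (t *\<^sub>R X)) (\<lambda>t::real. 0)"
    using gtame_qc(1)[OF Exp_curve_gtame[OF X(1)]] by simp
  moreover have "tame UNIV (\<lambda>t. 0) (\<lambda>t::real. 0::'e)" by (rule tame_linear[OF linear_zero])
  moreover have "linear (\<lambda>t. dpr (t *\<^sub>R X))"
    using linear_compose[OF linear_scaleR_left dpr(1)] by (simp add: o_def)
  ultimately have "dpr (1 *\<^sub>R X) = 0"
    by (rule tame_derivative_unique[OF _ _ subspace_UNIV _ linear_zero UNIV_I])
  then show ?thesis by simp
qed

text \<open>Split a preimage into its antisymmetric and symmetric halves under \<open>ds\<close>;
  \<open>dpr\<close> kills the symmetric one.\<close>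

lemma dpr_\<pp>_surj:
  assumes w: "w \<in> model N"
  shows "w \<in> dpr ` \<pp>"
proof -
  obtain v where v: "v \<in> V" "dpr v = w" by (rule dpr_surj[OF w])
  let ?p = "(1/2) *\<^sub>R (v - ds v)" and ?k = "(1/2) *\<^sub>R (v + ds v)"
  have dv: "ds v \<in> V" using ds_V v(1) .
  have "?k \<in> V" using v(1) dv V by (intro V_scale subspace_add)
  moreover have "ds ?k = ?k" using v(1) by (simp add: ds_scale linear_add[OF linear_ds] ds_ds add.commute)
  ultimately have k0: "dpr ?k = 0" by (rule dpr_fixed)
  have "?p \<in> V" using v(1) dv V by (intro V_scale subspace_diff)
  moreover have "ds ?p = - ?p"
    using v(1) by (simp add: ds_scale linear_diff[OF linear_ds] ds_ds flip: scaleR_minus_right)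
  ultimately have "?p \<in> \<pp>" by (simp add: \<pp>_def)
  moreover have "v = ?p + ?k" by (simp add: algebra_simps flip: scaleR_add_left)
  then have "dpr v = dpr ?p + dpr ?k" using linear_add[OF dpr(1)] by metis
  ultimately show ?thesis using v(2) k0 by (intro image_eqI[of _ _ ?p]) simp_all
qed

definition sect :: "'e \<Rightarrow> 'e" where
  "sect = (SOME g. range g \<subseteq> \<pp> \<and> linear g \<and> (\<forall>w\<in>dpr ` \<pp>. dpr (g w) = w))"

lemma sect_\<pp>: "sect w \<in> \<pp>" and linear_sect: "linear sect" and dpr_sect: "w \<in> model N \<Longrightarrow> dpr (sect w) = w"
proof -
  have "\<exists>g. range g \<subseteq> \<pp> \<and> linear g \<and> (\<forall>w\<in>dpr ` \<pp>. dpr (g w) = w)"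
    by (rule real_vector.linear_exists_right_inverse_on[OF dpr(1) subspace_\<pp>])
  then have "range sect \<subseteq> \<pp> \<and> linear sect \<and> (\<forall>w\<in>dpr ` \<pp>. dpr (sect w) = w)"
    unfolding sect_def by (rule someI_ex)
  then show "sect w \<in> \<pp>" "linear sect" "w \<in> model N \<Longrightarrow> dpr (sect w) = w" using dpr_\<pp>_surj by auto
qed

text \<open>A vanishing derivative at 0 alone does not stop the coset of \<open>Exp (t X)\<close>
  from moving. But the exponentials of \<open>sect w\<close> reach all cosets near \<open>K\<close>,
  so this coset is also that of \<open>Exp (sect w)\<close> for some \<open>w\<close>. Comparing
  doubled exponents gives \<open>t X = sect w\<close>; applying \<open>dpr\<close> gives
  \<open>w = 0\<close>.\<close>

lemma dpr_\<pp>_inj: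
  assumes X: "X \<in> \<pp>" "dpr X = 0"
  shows "X = 0"
proof -
  obtain \<rho> gl where \<rho>: "\<rho> > 0" "tame V (\<lambda>x. x) gl"
    "\<And>X. X \<in> V \<Longrightarrow> norm X < \<rho> \<Longrightarrow> Exp X \<in> U \<and> norm (lg (Exp X)) \<le> 2 * norm X"
    "\<And>X Y. X \<in> V \<Longrightarrow> Y \<in> V \<Longrightarrow> norm X < \<rho> \<Longrightarrow> norm Y < \<rho> \<Longrightarrow> Exp X = Exp Y \<Longrightarrow> X = Y"
    "\<And>x. x \<in> U \<Longrightarrow> norm (lg x) < \<rho> / 4 \<Longrightarrow> gl (lg x) \<in> V \<and> norm (gl (lg x)) \<le> 2 * norm (lg x) \<and> Exp (gl (lg x)) = x"
    by (rule Exp_near) (rule that)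
  have XV: "X \<in> V" using X(1) \<pp>_V by blast
  have sV: "sect w \<in> V" for w using sect_\<pp> \<pp>_V by blast
  note VN = N.subspace_model
  have gs: "gtame (model N) sect (\<lambda>w. Exp (sect w))"
    using gtame_linear_compose[OF gtame_Exp VN linear_sect sV] .
  have tq: "tame (model N) (\<lambda>w. w) (\<lambda>w. qc (Exp (sect w)))"
    by (rule tame_cong[OF gtame_qc(1)[OF gs] zero_less_one VN refl]) (simp add: dpr_sect)
  obtain C r where T: "tame_within (model N) (\<lambda>w. w) (\<lambda>w. qc (Exp (sect w))) C r"
    "\<And>x y. x \<in> model N \<Longrightarrow> y \<in> model N \<Longrightarrow> norm x < r \<Longrightarrow> norm y < r \<Longrightarrow>
      norm (qc (Exp (sect x)) - qc (Exp (sect y)) - (x - y)) \<le> (1/2) * norm (x - y)"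
    by (rule tame_near_identity[OF tq]) (rule that)
  obtain r1 where r1: "r1 > 0" "\<forall>x\<in>model N. norm x < r1 \<longrightarrow> pr (Exp (sect x)) \<in> W" using gtame_qc(2)[OF gs] by blast
  obtain c where c: "c > 0" "\<And>x. norm (sect x) \<le> c * norm x" using linear_bounded_pos[OF linear_sect] by blast
  \<comment> \<open>For \<open>w\<close> of norm at most \<open>e\<close>, the inversion estimate
    applies, the coset stays in \<open>W\<close>, and twice \<open>sect w\<close> stays in the
    injectivity ball of \<open>Exp\<close>.\<close>
  define e where "e = min (min r r1) (\<rho> / (2 * c)) / 2"
  have e: "e > 0" "e < r" "e < r1" "2 * c * e < \<rho>"
  proof -
    have "min (min r r1) (\<rho> / (2 * c)) > 0" using tame_withinD(1)[OF T(1)] r1(1) \<rho>(1) c(1) by simp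
    then show "e > 0" "e < r" "e < r1" by (auto simp: e_def)
    have "e < \<rho> / (2 * c)" using \<open>min (min r r1) (\<rho> / (2 * c)) > 0\<close> by (auto simp: e_def)
    then show "2 * c * e < \<rho>" using c(1) by (simp add: field_simps)
  qed
  note gX = Exp_curve_gtame[OF XV]
  obtain r2 where r2: "r2 > 0" "\<forall>t\<in>UNIV. norm t < r2 \<longrightarrow> pr (Exp (t *\<^sub>R X)) \<in> W" using gtame_qc(2)[OF gX] by blast
  have lint: "linear (\<lambda>t. dpr (t *\<^sub>R X))"
    using linear_compose[OF linear_scaleR_left dpr(1)] by (simp add: o_def)
  obtain C3 r3 K3 where T3: "tame_within UNIV (\<lambda>t. dpr (t *\<^sub>R X)) (\<lambda>t. qc (Exp (t *\<^sub>R X))) C3 r3" "K3 > 0"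
    and K3: "\<And>x. x \<in> UNIV \<Longrightarrow> norm x < r3 \<Longrightarrow> norm (qc (Exp (x *\<^sub>R X))) \<le> K3 * norm x"
    by (rule tame_bounds[OF gtame_qc(1)[OF gX] subspace_UNIV lint]) (rule that)
  define q1 q2 where "q1 = e / (2 * K3)" and "q2 = \<rho> / (2 * (norm X + 1))"
  have q: "q1 > 0" "q2 > 0" using e(1) T3(2) \<rho>(1) by (auto simp: q1_def q2_def add_nonneg_pos)
  \<comment> \<open>Small enough that the coset lies in \<open>W\<close>, that its coordinate has
    norm below \<open>e / 2\<close>, and that \<open>2 t X\<close> lies in the injectivity
    ball.\<close>
  define t where "t = min (min r2 r3) (min q1 q2) / 2"
  have "t > 0" "t < r2" "t < r3" "t < q1" "t < q2"
    using r2(1) tame_withinD(1)[OF T3(1)] q by (auto simp: t_def)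
  then have t: "t > 0" "t < r2" "t < r3" "t < e / (2 * K3)" "t < \<rho> / (2 * (norm X + 1))"
    by (simp_all only: q1_def q2_def)
  have n1: "norm X + 1 > 0" by (simp add: add_nonneg_pos)
  have tX: "norm (2 *\<^sub>R (t *\<^sub>R X)) < \<rho>"
  proof -
    have "2 * (t * norm X) \<le> 2 * (t * (norm X + 1))" using t(1) by simp
    also have "\<dots> < \<rho>" using t(5) n1 by (simp add: field_simps)
    finally show ?thesis using t(1) by simp
  qed
  let ?y = "qc (Exp (t *\<^sub>R X))"
  have yW: "pr (Exp (t *\<^sub>R X)) \<in> W" using r2(2) t by simp
  have y: "?y \<in> model N" by (rule qc_N[OF yW])
  have "norm ?y \<le> K3 * t" using K3[of t] t by simp
  also have "\<dots> < e / 2" using t(4) T3(2) by (simp add: field_simps)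
  finally have yn: "norm ?y < e / 2" .
  obtain w where w: "w \<in> model N" "norm w \<le> 2 * norm ?y" "qc (Exp (sect w)) = ?y"
  proof (rule perturbed_identity_surj[OF VN e(1), where f = "\<lambda>w. qc (Exp (sect w))" and y = ?y])
    show "qc (Exp (sect x)) \<in> model N" if "x \<in> model N" "norm x \<le> e" for x
      using qc_N r1(2) that e(3) by simp
    show "norm (qc (Exp (sect x)) - qc (Exp (sect z)) - (x - z)) \<le> 1 / 2 * norm (x - z)"
      if "x \<in> model N" "z \<in> model N" "norm x \<le> e" "norm z \<le> e" for x z
      using that e(2) by (intro T(2)) auto
    show "qc (Exp (sect 0)) = 0" by (simp add: linear_0[OF linear_sect] qc_def)
    show "norm ?y \<le> e / 2" using yn by simp
  qed (use y in auto)
  have wn: "norm w < e" using w(2) yn by simp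
  then have wW: "pr (Exp (sect w)) \<in> W" using r1(2) w(1) e(3) by simp
  have "pr (Exp (t *\<^sub>R X)) = pr (Exp (sect w))" by (rule qc_inj[OF yW wW w(3)[symmetric]])
  then obtain k where k: "k \<in> K" "Exp (t *\<^sub>R X) = Exp (sect w) \<otimes> k"
    using pr_eqD[of "Exp (t *\<^sub>R X)" "Exp (sect w)"] V_scale[OF XV] sV by auto
  have one: "\<one> \<in> K" using subgroup.one_closed[OF K_subgroup] .
  have "Exp (t *\<^sub>R X) \<otimes> \<one> = Exp (sect w) \<otimes> k" using k(2) r_one[OF Exp_carrier[OF V_scale[OF XV]]] by (rule trans[rotated])
  then have "Exp (2 *\<^sub>R (t *\<^sub>R X)) = Exp (2 *\<^sub>R sect w)"
    by (rule Exp_coset_eq[OF \<pp>_scale[OF X(1)] sect_\<pp> one k(1)])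
  moreover have "norm (2 *\<^sub>R sect w) < \<rho>"
  proof -
    have "2 * norm (sect w) \<le> 2 * (c * norm w)" using c(2) by simp
    also have "\<dots> \<le> 2 * (c * e)" using wn c(1) by simp
    also have "\<dots> < \<rho>" using e(4) by simp
    finally show ?thesis by simp
  qed
  ultimately have "2 *\<^sub>R (t *\<^sub>R X) = 2 *\<^sub>R sect w" using tX V_scale XV sV by (intro \<rho>(4)) auto
  then have eq: "t *\<^sub>R X = sect w" by (simp only: scaleR_cancel_left) simp
  then have "w = dpr (t *\<^sub>R X)" using dpr_sect[OF w(1)] by simp
  also have "\<dots> = 0" using X(2) linear_cmul[OF dpr(1)] by simp
  finally have "t *\<^sub>R X = 0" using eq linear_0[OF linear_sect] by simp
  then show ?thesis using t(1) by simp
qed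

lemma sect_V: "sect w \<in> V"
  using sect_\<pp> \<pp>_V by blast

text \<open>Along \<open>sect\<close> the projection has derivative the identity at 0, so
  \<open>smooth_on_inverse\<close> yields a smooth local section. With it, smoothness of a function
  on the quotient can be verified on its pullback to the group.\<close>

lemma smooth_section:
  obtains g \<delta> where "\<delta> > 0" "smooth_on (model N) (model N \<inter> ball 0 \<delta>) g"
    "\<And>w. w \<in> model N \<Longrightarrow> norm w < \<delta> \<Longrightarrow> g w \<in> model N \<and> norm (g w) \<le> 2 * norm w \<and>
      pr (ex (sect (g w))) \<in> W \<and> qc (ex (sect (g w))) = w"
proof -
  note VN = N.subspace_model
  obtain r where r: "r > 0" "\<forall>y\<in>V. norm y < r \<longrightarrow> pr (ex y) \<in> W" "smooth_on V (V \<inter> ball 0 r) (\<lambda>y. qc (ex y))"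
    using dpr(4) by blast
  obtain c where c: "c > 0" "\<And>x. norm (sect x) \<le> c * norm x" using linear_bounded_pos[OF linear_sect] by blast
  have "tame (model N) (\<lambda>w. dpr (sect w)) (\<lambda>w. qc (ex (sect w)))"
    by (rule tame_compose[OF VN V tame_linear[OF linear_sect] dpr(3) linear_sect dpr(1) zero_less_one sect_V])
  then have tq: "tame (model N) (\<lambda>w. w) (\<lambda>w. qc (ex (sect w)))"
    by (rule tame_cong[OF _ zero_less_one VN refl]) (simp add: dpr_sect)
  obtain C r' where T: "tame_within (model N) (\<lambda>w. w) (\<lambda>w. qc (ex (sect w))) C r'"
    "\<And>x y. x \<in> model N \<Longrightarrow> y \<in> model N \<Longrightarrow> norm x < r' \<Longrightarrow> norm y < r' \<Longrightarrow>
      norm (qc (ex (sect x)) - qc (ex (sect y)) - (x - y)) \<le> (1/2) * norm (x - y)"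
    by (rule tame_near_identity[OF tq]) (rule that)
  define e where "e = min r' (r / c)"
  have e: "e > 0" "e \<le> r'" "e \<le> r / c" using tame_withinD(1)[OF T(1)] r(1) c(1) by (auto simp: e_def)
  define S where "S = model N \<inter> ball 0 e"
  define T' where "T' = model N \<inter> ball 0 (e / 4)"
  have So: "openin (top_of_set (model N)) S" and To: "openin (top_of_set (model N)) T'"
    by (auto simp: S_def T'_def openin_open)
  have sr: "norm (sect w) < r" if "norm w < e" for w
  proof -
    have "c * norm w < c * (r / c)" using that e(3) c(1) by (intro mult_strict_left_mono) auto
    then show ?thesis using c(2)[of w] c(1) by simp
  qed
  have im: "sect ` S \<subseteq> V \<inter> ball 0 r" using sr sect_V by (auto simp: S_def)
  have fs: "smooth_on (model N) S (\<lambda>w. qc (ex (sect w)))"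
    by (rule smooth_on_compose[OF V Int_lower1 im
          smooth_on_bounded_linear[OF linear_sect[unfolded linear_conv_bounded_linear]] r(3)])
  have fW: "pr (ex (sect w)) \<in> W" if "w \<in> S" for w using r(2) sr sect_V that by (simp add: S_def)
  have surj: "\<exists>x. x \<in> model N \<and> norm x \<le> 2 * norm y \<and> qc (ex (sect x)) = y" if y: "y \<in> T'" for y
  proof -
    have p: "0 < e / 2" using e(1) by simp
    obtain x where "x \<in> model N" "norm x \<le> 2 * norm y" "qc (ex (sect x)) = y"
    proof (rule perturbed_identity_surj[OF VN p, where f = "\<lambda>w. qc (ex (sect w))" and y = y])
      show "qc (ex (sect x)) \<in> model N" if "x \<in> model N" "norm x \<le> e / 2" for x
        using qc_N fW[of x] that e(1) by (simp add: S_def)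
      show "norm (qc (ex (sect x)) - qc (ex (sect z)) - (x - z)) \<le> 1 / 2 * norm (x - z)"
        if "x \<in> model N" "z \<in> model N" "norm x \<le> e / 2" "norm z \<le> e / 2" for x z
        using that e(1,2) by (intro T(2)) auto
      show "qc (ex (sect 0)) = 0" by (simp add: linear_0[OF linear_sect] qc_def)
    qed (use y in \<open>auto simp: T'_def\<close>)
    then show ?thesis by blast
  qed
  define g where "g = (\<lambda>y. SOME x. x \<in> model N \<and> norm x \<le> 2 * norm y \<and> qc (ex (sect x)) = y)"
  have g: "g y \<in> model N \<and> norm (g y) \<le> 2 * norm y \<and> qc (ex (sect (g y))) = y" if "y \<in> T'" for y
    unfolding g_def using surj[OF that] by (rule someI_ex)
  have gS: "g y \<in> S" if "y \<in> T'" for y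
  proof -
    have "norm y < e / 4" using that by (simp add: T'_def)
    then have "norm (g y) < e" using g[OF that] norm_ge_zero[of y] by linarith
    then show ?thesis using g[OF that] by (simp add: S_def)
  qed
  have sm: "smooth_on (model N) T' g"
  proof (rule smooth_on_inverse[OF VN So fs _ _ To])
    show "qc (ex (sect x)) \<in> model N" if "x \<in> S" for x using qc_N fW[OF that] by blast
    show "norm (qc (ex (sect x)) - qc (ex (sect y)) - (x - y)) \<le> 1 / 2 * norm (x - y)" if "x \<in> S" "y \<in> S" for x y
      using that e(2) by (intro T(2)) (auto simp: S_def)
    show "g y \<in> S \<and> qc (ex (sect (g y))) = y" if "y \<in> T'" for y using g gS that by blast
  qed
  show ?thesis
  proof (rule that[of "e / 4" g])
    show "e / 4 > 0" using e(1) by simp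
    show "smooth_on (model N) (model N \<inter> ball 0 (e / 4)) g" using sm by (simp add: T'_def)
    show "g w \<in> model N \<and> norm (g w) \<le> 2 * norm w \<and> pr (ex (sect (g w))) \<in> W \<and> qc (ex (sect (g w))) = w"
      if "w \<in> model N" "norm w < e / 4" for w
    proof -
      have "w \<in> T'" using that by (simp add: T'_def)
      then show ?thesis using g gS fW by blast
    qed
  qed
qed

section \<open>The action of \<open>K\<close> on the tangent space of the quotient\<close>

lemma pr_conj:
  assumes "k \<in> K" "x \<in> carrier G"
  shows "k <# pr x = pr (k \<otimes> x \<otimes> inv k)"
  using pr_left[OF K_carrier[OF assms(1)] assms(2)] assms K_carrier
    pr_right[of "k \<otimes> x" "inv k"] subgroup.m_inv_closed[OF K_subgroup assms(1)] by simp

text \<open>Translation by \<open>k\<close> on cosets is induced by conjugation by \<open>k\<close>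
  on the group, which is smooth and fixes \<open>\<one>\<close>. Pull \<open>f\<close> back along it
  and descend by the local section.\<close>

lemma left_translation_smooth_near:
  assumes k: "k \<in> K" and f: "smooth_near N K f"
  shows "smooth_near N K (\<lambda>q. f (k <# q))"
proof -
  note VN = N.subspace_model
  have kc: "k \<in> carrier G" using k K_carrier by blast
  let ?F = "\<lambda>x. pr (k \<otimes> x \<otimes> inv k)"
  have F: "smooth_map M N ?F"
    by (rule smooth_map_compose[OF smooth_manifold_M smooth_manifold_M N_manifold conj_smooth[OF kc] pr_smooth])
  have F1: "?F \<one> = K" using kc by simp
  have "smooth_near M \<one> (\<lambda>x. f (?F x))"
    by (rule smooth_near_compose[OF smooth_manifold_M N_manifold F]) (use F1 f points_eq in simp_all)
  then obtain S1 where S1: "openin (top_of_set V) S1" "\<phi> \<one> \<in> S1" "S1 \<subseteq> \<phi> ` U"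
    "smooth_on V S1 (\<lambda>y. f (?F (inv_into U \<phi> y)))"
    by (rule smooth_nearE[OF _ chart one_U])
  have oV: "\<phi> \<one> \<in> V" using S1 openin_imp_subset by blast
  have "openin (top_of_set V) {y \<in> V. \<phi> \<one> + y \<in> S1}" "0 \<in> {y \<in> V. \<phi> \<one> + y \<in> S1}"
    using openin_subspace_translate[OF V S1(1) oV] S1(2) subspace_0[OF V] by auto
  then obtain r1 where r1: "r1 > 0" "V \<inter> ball 0 r1 \<subseteq> {y \<in> V. \<phi> \<one> + y \<in> S1}"
    by (rule openin_subspace_ball)
  have im1: "(\<lambda>y. \<phi> \<one> + y) ` (V \<inter> ball 0 r1) \<subseteq> S1" using r1(2) by blast
  have S1V: "S1 \<subseteq> V" using S1(1) openin_imp_subset by blast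
  have sh: "smooth_on V (V \<inter> ball 0 r1) (\<lambda>y. \<phi> \<one> + y)"
    by (intro smooth_on_add smooth_on_const smooth_on_id)
  have f1: "smooth_on V (V \<inter> ball 0 r1) (\<lambda>y. f (?F (ex y)))"
    unfolding ex_def by (rule smooth_on_compose[OF V S1V im1 sh S1(4)])
  have exc: "ex y \<in> carrier G" if "y \<in> V" "norm y < r1" for y
  proof -
    have "y \<in> V \<inter> ball 0 r1" using that by simp
    then have "\<phi> \<one> + y \<in> \<phi> ` U" using im1 S1(3) by blast
    then have "inv_into U \<phi> (\<phi> \<one> + y) \<in> U" by (rule inv_into_into)
    then show ?thesis unfolding ex_def by (rule U_carrier)
  qed
  obtain g \<delta> where g: "\<delta> > 0" "smooth_on (model N) (model N \<inter> ball 0 \<delta>) g"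
    "\<And>w. w \<in> model N \<Longrightarrow> norm w < \<delta> \<Longrightarrow> g w \<in> model N \<and> norm (g w) \<le> 2 * norm w \<and>
      pr (ex (sect (g w))) \<in> W \<and> qc (ex (sect (g w))) = w"
    by (rule smooth_section) (rule that)
  obtain c where c: "c > 0" "\<And>x. norm (sect x) \<le> c * norm x" using linear_bounded_pos[OF linear_sect] by blast
  define d where "d = min \<delta> (r1 / (2 * c))"
  have d: "d > 0" "d \<le> \<delta>" "d \<le> r1 / (2 * c)" using g(1) r1(1) c(1) by (auto simp: d_def)
  have small: "norm (sect (g w)) < r1" if "w \<in> model N" "norm w < d" for w
  proof -
    have gw: "norm (g w) \<le> 2 * norm w" using g(3)[OF that(1)] that(2) d(2) by simp
    have "norm (sect (g w)) \<le> c * norm (g w)" by (rule c(2))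
    also have "\<dots> \<le> c * (2 * norm w)" using gw c(1) by (intro mult_left_mono) auto
    also have "\<dots> < c * (2 * (r1 / (2 * c)))" using that(2) d(3) c(1) by (intro mult_strict_left_mono) auto
    also have "\<dots> = r1" using c(1) by simp
    finally show ?thesis .
  qed
  define S where "S = model N \<inter> ball (\<psi> K) d"
  have pK: "\<psi> K \<in> model N" using N.chart_image_subset[OF chart_N] K_W by blast
  have So: "openin (top_of_set (model N)) S" "\<psi> K \<in> S" using d(1) pK by (auto simp: S_def openin_open)
  have w: "y - \<psi> K \<in> model N" "norm (y - \<psi> K) < d" if "y \<in> S" for y
    using that pK VN by (auto simp: S_def subspace_diff dist_norm norm_minus_commute)
  let ?s = "\<lambda>y. sect (g (y - \<psi> K))"
  have s1: "smooth_on (model N) S (\<lambda>y. y + - \<psi> K)" by (intro smooth_on_add smooth_on_const smooth_on_id)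
  have i1: "(\<lambda>y. y + - \<psi> K) ` S \<subseteq> model N \<inter> ball 0 \<delta>" using w d(2) by force
  have "smooth_on (model N) S (\<lambda>y. g (y + - \<psi> K))"
    by (rule smooth_on_compose[OF VN Int_lower1 i1 s1 g(2)])
  then have s2: "smooth_on (model N) S ?s"
    using smooth_on_bounded_linear_compose[OF linear_sect[unfolded linear_conv_bounded_linear]] by simp
  have i2: "?s ` S \<subseteq> V \<inter> ball 0 r1" using small w sect_V by auto
  have s3: "smooth_on (model N) S (\<lambda>y. f (?F (ex (?s y))))"
    by (rule smooth_on_compose[OF V Int_lower1 i2 s2 f1])
  show ?thesis
  proof (rule N.smooth_nearI[OF chart_N So K_W])
    show "smooth_on (model N) (S \<inter> \<psi> ` W) (\<lambda>y. f (k <# inv_into W \<psi> y))"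
    proof (rule smooth_on_transform[OF smooth_on_subset[OF s3 Int_lower1]])
      fix y assume y: "y \<in> S \<inter> \<psi> ` W"
      then have wy: "y - \<psi> K \<in> model N" "norm (y - \<psi> K) < d" using w by auto
      let ?x = "ex (?s y)"
      have gy: "pr ?x \<in> W" "qc ?x = y - \<psi> K" using g(3)[OF wy(1)] wy(2) d(2) by auto
      have xc: "?x \<in> carrier G" by (rule exc[OF sect_V small[OF wy]])
      have "\<psi> (pr ?x) = y" using gy(2) by (simp add: qc_def)
      then have "inv_into W \<psi> y = pr ?x" using N.chart_inv[OF chart_N gy(1)] by simp
      then show "f (k <# inv_into W \<psi> y) = f (?F ?x)" using pr_conj[OF k xc] by simp
    qed
  qed
qed

lemma pr_curve_derivative:
  assumes X: "X \<in> V" and f: "smooth_near N K f"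
  shows "((\<lambda>t. f (pr (Exp (t *\<^sub>R X)))) has_real_derivative coord_vector N (W, \<psi>) (dpr X) K f) (at 0)"
proof -
  note g = Exp_curve_gtame[OF X]
  obtain r where r: "r > 0" "\<forall>t\<in>UNIV. norm t < r \<longrightarrow> pr (Exp (t *\<^sub>R X)) \<in> W" using gtame_qc(2)[OF g] by blast
  have "tame UNIV (\<lambda>t. t *\<^sub>R dpr X) (\<lambda>t. qc (Exp (t *\<^sub>R X)))"
    using gtame_qc(1)[OF g] by (simp add: linear_cmul[OF dpr(1)])
  then have "((\<lambda>t. qc (Exp (t *\<^sub>R X))) has_vector_derivative dpr X) (at 0)"
    by (rule tame_has_vector_derivative)
  then have "((\<lambda>t. qc (Exp (t *\<^sub>R X)) + \<psi> K) has_vector_derivative dpr X + 0) (at 0)"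
    by (intro has_vector_derivative_add has_vector_derivative_const)
  then have d: "((\<lambda>t. \<psi> (pr (Exp (t *\<^sub>R X)))) has_vector_derivative dpr X) (at 0)" by (simp add: qc_def)
  have p0: "pr (Exp (0 *\<^sub>R X)) = K" by simp
  have "((\<lambda>t. f (pr (Exp (t *\<^sub>R X)))) has_real_derivative coord_vector N (W, \<psi>) (dpr X) (pr (Exp (0 *\<^sub>R X))) f) (at 0)"
    by (rule N.curve_derivative[OF chart_N _ open_ball[of 0 r] _ _ dpr(2)[OF X] d])
      (use f p0 r in auto)
  then show ?thesis by simp
qed

text \<open>Both sides are computed along the coset curve of \<open>Exp (t X)\<close>, which
  \<open>k\<close> carries to that of \<open>Exp (t Ad k X)\<close>. Smoothness of the translated
  test function is essential: otherwise \<open>coord_vector\<close> would return its default 0 on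
  it.\<close>

lemma differential_left_translation:
  assumes k: "k \<in> K" and X: "X \<in> V"
  shows "differential N (\<lambda>q. k <# q) K (coord_vector N (W, \<psi>) (dpr X) K) = coord_vector N (W, \<psi>) (dpr (Ad k X)) K"
proof
  fix f
  have kc: "k \<in> carrier G" using k K_carrier by blast
  have kK: "k <# K = K" by (rule coset_join3[OF kc K_subgroup k])
  show "differential N (\<lambda>q. k <# q) K (coord_vector N (W, \<psi>) (dpr X) K) f = coord_vector N (W, \<psi>) (dpr (Ad k X)) K f"
  proof (cases "smooth_near N K f")
    case True
    have "((\<lambda>t. f (k <# pr (Exp (t *\<^sub>R X)))) has_real_derivative coord_vector N (W, \<psi>) (dpr X) K (\<lambda>q. f (k <# q))) (at 0)"
      by (rule pr_curve_derivative[OF X left_translation_smooth_near[OF k True]])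
    moreover have "k <# pr (Exp (t *\<^sub>R X)) = pr (Exp (t *\<^sub>R Ad k X))" for t
      using pr_conj[OF k Exp_carrier[OF V_scale[OF X]], of t] Exp_Ad[OF kc V_scale[OF X], of t]
      by (simp add: linear_cmul[OF linear_Ad[OF kc]])
    moreover have "((\<lambda>t. f (pr (Exp (t *\<^sub>R Ad k X)))) has_real_derivative coord_vector N (W, \<psi>) (dpr (Ad k X)) K f) (at 0)"
      by (rule pr_curve_derivative[OF Ad_V[OF kc X] True])
    ultimately have "coord_vector N (W, \<psi>) (dpr X) K (\<lambda>q. f (k <# q)) = coord_vector N (W, \<psi>) (dpr (Ad k X)) K f"
      using DERIV_unique by simp
    then show ?thesis using True kK by (simp add: differential_def)
  qed (simp add: differential_def kK N.coord_vector_not_smooth)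
qed

definition ip :: "'e \<Rightarrow> 'e \<Rightarrow> real" where
  "ip X Y = h K (coord_vector N (W, \<psi>) (dpr X) K) (coord_vector N (W, \<psi>) (dpr Y) K)"

lemma K_point: "K \<in> points N"
  using N.chart_subset_points[OF chart_N] K_W by blast

lemma coord_dpr: "X \<in> V \<Longrightarrow> coord_vector N (W, \<psi>) (dpr X) K \<in> tangent_space N K"
  by (rule N.coord_vector_in_tangent_space[OF chart_N K_W dpr(2)])

lemma ip_sym: "X \<in> V \<Longrightarrow> Y \<in> V \<Longrightarrow> ip X Y = ip Y X"
  unfolding ip_def by (rule N.sym[OF K_point coord_dpr coord_dpr])

lemma ip_linear:
  assumes "X \<in> V" "Y \<in> V" "Z \<in> V"
  shows "ip (a *\<^sub>R X + b *\<^sub>R Y) Z = a * ip X Z + b * ip Y Z"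
proof -
  have "dpr (a *\<^sub>R X + b *\<^sub>R Y) = a *\<^sub>R dpr X + b *\<^sub>R dpr Y"
    by (simp add: linear_add[OF dpr(1)] linear_cmul[OF dpr(1)])
  then have "coord_vector N (W, \<psi>) (dpr (a *\<^sub>R X + b *\<^sub>R Y)) K = (\<lambda>f. a * coord_vector N (W, \<psi>) (dpr X) K f + b * coord_vector N (W, \<psi>) (dpr Y) K f)"
    using N.coord_vector_linear[OF chart_N K_W dpr(2)[OF assms(1)] dpr(2)[OF assms(2)]] by simp
  then show ?thesis unfolding ip_def using N.linear[OF K_point coord_dpr coord_dpr coord_dpr, OF assms] by simp
qed

lemma ip_pos: assumes X: "X \<in> \<pp>" "X \<noteq> 0" shows "ip X X > 0"
proof -
  have XV: "X \<in> V" using X(1) \<pp>_V by blast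
  have "dpr X \<noteq> 0" using dpr_\<pp>_inj X by blast
  then have "coord_vector N (W, \<psi>) (dpr X) K \<noteq> (\<lambda>f. 0)"
    using N.coord_vector_inj[OF chart_N K_W dpr(2)[OF XV] subspace_0[OF N.subspace_model]]
      N.coord_vector_zero[OF chart_N K_W] by metis
  then show ?thesis unfolding ip_def by (rule N.pos_def[OF K_point coord_dpr[OF XV]])
qed

lemma ip_Ad: assumes k: "k \<in> K" and X: "X \<in> V" shows "ip (Ad k X) (Ad k X) = ip X X"
proof -
  have kc: "k \<in> carrier G" using k K_carrier by blast
  have kK: "k <# K = K" by (rule coset_join3[OF kc K_subgroup k])
  have "h (k <# K) (differential N (\<lambda>q. k <# q) K (coord_vector N (W, \<psi>) (dpr X) K))
      (differential N (\<lambda>q. k <# q) K (coord_vector N (W, \<psi>) (dpr X) K)) = ip X X"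
    using invariant kc K_point coord_dpr[OF X] unfolding invariant_structure_def ip_def by blast
  then show ?thesis by (simp add: differential_left_translation[OF k X] kK ip_def)
qed

text \<open>\<open>ip\<close> is known to be bilinear only on \<open>V\<close>. Composing with the
  orthogonal projection \<open>P\<close> onto \<open>\<pp>\<close> gives a form that is bilinear on
  the whole type and equals \<open>ip\<close> on \<open>\<pp>\<close>.\<close>

lemma ex_inner_product:
  obtains B where "sym_chart_inner G M \<sigma> K U \<phi> B"
proof -
  obtain Q where Q: "finite Q" "Q \<subseteq> \<pp>" "\<And>x. x \<in> \<pp> \<Longrightarrow> (\<Sum>b\<in>Q. (x \<bullet> b) *\<^sub>R b) = x"
    using subspace_orthonormal_expansion[OF subspace_\<pp>] by metis
  define P where "P = (\<lambda>x. \<Sum>b\<in>Q. (x \<bullet> b) *\<^sub>R b)"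
  have P: "P x \<in> \<pp>" for x unfolding P_def using Q(2) subspace_\<pp> by (intro subspace_sum subspace_scale) auto
  then have PV: "P x \<in> V" for x using \<pp>_V by blast
  have Pl: "P (a *\<^sub>R x + b *\<^sub>R y) = a *\<^sub>R P x + b *\<^sub>R P y" for a b x y
    by (simp add: P_def inner_add_left scaleR_add_left sum.distrib scaleR_sum_right)
  define B where "B = (\<lambda>X Y. ip (P X) (P Y))"
  have sy: "B X Y = B Y X" for X Y unfolding B_def by (rule ip_sym[OF PV PV])
  have li: "B (a *\<^sub>R X + b *\<^sub>R Y) Z = a * B X Z + b * B Y Z" for a b X Y Z
    unfolding B_def Pl by (rule ip_linear[OF PV PV PV])
  have linl: "linear (\<lambda>X. B X Z)" for Z
  proof (rule linearI)
    show "B (X + Y) Z = B X Z + B Y Z" for X Y using li[of 1 X 1 Y Z] by simp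
    show "B (r *\<^sub>R X) Z = r *\<^sub>R B X Z" for r X using li[of r X 0 X Z] by simp
  qed
  have "bilinear B" unfolding bilinear_def
  proof (intro conjI allI)
    show "linear (\<lambda>X. B X Z)" for Z by (rule linl)
    show "linear (B Z)" for Z using linl[of Z] sy[of Z] by (metis (no_types, lifting) ext)
  qed
  then have bb: "bounded_bilinear B" by (simp add: bilinear_conv_bounded_bilinear)
  have PX: "P X = X" if "X \<in> \<pp>" for X using Q(3)[OF that] by (simp add: P_def)
  have "sym_chart_inner G M \<sigma> K U \<phi> B"
  proof (rule sym_chart_inner.intro[OF sym_chart_axioms], rule sym_chart_inner_axioms.intro)
    show "bounded_bilinear B" by (rule bb)
    show "B X Y = B Y X" for X Y by (rule sy)
    show "0 < B X X" if "X \<in> \<pp>" "X \<noteq> 0" for X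
      unfolding B_def PX[OF that(1)] by (rule ip_pos[OF that])
    show "B (Ad k X) (Ad k X) = B X X" if "k \<in> K" "X \<in> \<pp>" for k X
      unfolding B_def PX[OF that(2)] PX[OF Ad_\<pp>[OF that]] by (rule ip_Ad[OF that(1) \<pp>_V[OF that(2)]])
  qed
  then show ?thesis by (rule that)
qed

end

section \<open>From charts at \<open>\<one>\<close> and \<open>K\<close> to arbitrary cosets\<close>

theorem corollary3p2:
  fixes G :: "('g, 'r) monoid_scheme"
    and M :: "('g, 'e::euclidean_space) manifold"
    and \<sigma> :: "'g \<Rightarrow> 'g" and K P :: "'g set" and g :: 'g
  assumes "riemannian_symmetric_triple G M \<sigma> K"
    and "P = lie_exp G M ` minus_eigenspace G M \<sigma>"
    and "g \<in> carrier G"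
  shows "(g <#\<^bsub>G\<^esub> K) \<inter> P \<noteq> {}"
proof -
  interpret riemannian_symmetric_triple G M \<sigma> K by (rule assms(1))
  obtain U \<phi> where c: "(U, \<phi>) \<in> atlas M" "\<one>\<^bsub>G\<^esub> \<in> U"
    using chart_at[of "\<one>\<^bsub>G\<^esub>"] points_eq by auto
  interpret sym_chart G M \<sigma> K U \<phi> by unfold_locales (rule c)+
  obtain N h where N: "homogeneous_space_structure G M K N" "riemannian_structure N h" "invariant_structure G N h"
    using invariant_riemannian by blast
  interpret N: riemannian_structure N h by (rule N(2))
  have "K \<subseteq> carrier G" using K_carrier by blast
  then have "\<one>\<^bsub>G\<^esub> <#\<^bsub>G\<^esub> K = K" by (rule lcos_mult_one)
  moreover have "\<one>\<^bsub>G\<^esub> <#\<^bsub>G\<^esub> K \<in> lcosets\<^bsub>G\<^esub> K"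
    unfolding LCOSETS_def by (rule UN_I[OF one_closed]) simp
  ultimately have "K \<in> points N" using N(1) by (simp add: homogeneous_space_structure_def)
  then obtain W \<psi> where d: "(W, \<psi>) \<in> atlas N" "K \<in> W" by (rule N.chart_at)
  interpret sym_quotient G M \<sigma> K U \<phi> N h W \<psi> by unfold_locales (rule N d)+
  obtain B where B: "sym_chart_inner G M \<sigma> K U \<phi> B" by (rule ex_inner_product)
  interpret sym_chart_inner G M \<sigma> K U \<phi> B by (rule B)
  obtain X where X: "X \<in> \<pp>" "inv\<^bsub>G\<^esub> g \<otimes>\<^bsub>G\<^esub> Exp X \<in> K" by (rule Exp_\<pp>_meets_coset[OF assms(3)])
  have "Exp X = g \<otimes>\<^bsub>G\<^esub> (inv\<^bsub>G\<^esub> g \<otimes>\<^bsub>G\<^esub> Exp X)"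
    using assms(3) \<pp>_V[OF X(1)] by (simp flip: m_assoc)
  then have "Exp X \<in> g <#\<^bsub>G\<^esub> K" using X(2) unfolding l_coset_def by blast
  moreover have "Exp X \<in> P" using Exp_\<pp>_in_image[OF X(1)] assms(2) by simp
  ultimately show ?thesis by blast
qed

end
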